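(* Let $G$ be a finite factorizable group. Then the factorization graph $\mathfrak{F}(G)$ is $K_{1,4}$-free if and only if $G$ is isomorphic to one of the following groups, where $p,q,r$ are distinct primes: (1) $C_{pqr}$, $C_p\times C_p$, $Q_8$, $C_4\times C_2$, $C_4\times C_4$; (2) $C_{p^mq^n}$ for $1\leqslant m,n\leqslant 3$; (3) $C_p\times Q_8$ or $C_p\times C_2\times C_2$ for $p>2$; or (4) $\langle x,y : x^{2^n}=y^3=1,\ y^x=y^{-1},\ (x^2)^y=x^2\rangle$ for $1\leqslant n\leqslant 3$.
   Context: A group $G$ is factorizable if $G=AB$ for some proper subgroups $A,B$ of $G$. $\Phi(G)$ denotes the Frattini subgroup of $G$. The factorization graph $\mathfrak{F}(G)$ of a finite group $G$ is the simple undirected graph whose vertices are the proper subgroups $H$ of $G$ with $H\nsubseteq\Phi(G)$, two vertices $U,V$ being adjacent if $G=UV$. A graph is $\Gamma$-free if it has no induced subgraph isomorphic to $\Gamma$. $K_{1,4}$ is the star with one central vertex joined to four pairwise non-adjacent vertices. $C_k$ is the cyclic group of order $k$, $Q_8$ the quaternion group of order $8$, and $a^b=b^{-1}ab$. *)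

theory Defs
  imports
    "HOL-Algebra.Algebra"
    "Graph_Theory.Graph_Theory"
begin

section \<open>Factorizations and the Frattini subgroup\<close>

definition proper_subgroup :: "'a set \<Rightarrow> ('a, 'b) monoid_scheme \<Rightarrow> bool" where
  "proper_subgroup H G \<longleftrightarrow> subgroup H G \<and> H \<noteq> carrier G"

definition factorizable :: "('a, 'b) monoid_scheme \<Rightarrow> bool" where
  "factorizable G \<longleftrightarrow>
     (\<exists>A B. proper_subgroup A G \<and> proper_subgroup B G \<and> carrier G = A <#>\<^bsub>G\<^esub> B)"

definition maximal_subgroup :: "'a set \<Rightarrow> ('a, 'b) monoid_scheme \<Rightarrow> bool" where
  "maximal_subgroup M G \<longleftrightarrow> proper_subgroup M G \<and>
     (\<forall>H. proper_subgroup H G \<and> M \<subseteq> H \<longrightarrow> H = M)"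

text \<open>Intersecting with the carrier gives the usual convention that a group without maximal
  subgroups is its own Frattini subgroup.\<close>

definition frattini :: "('a, 'b) monoid_scheme \<Rightarrow> 'a set" where
  "frattini G = carrier G \<inter> \<Inter>{M. maximal_subgroup M G}"

section \<open>The factorization graph\<close>

text \<open>As usual in \<^theory>\<open>Graph_Theory.Digraph\<close>, an undirected graph is a symmetric digraph.
  Lemma \<open>pair_graph_factorization_graph\<close> below shows that the following is indeed a finite
  simple undirected graph when \<open>G\<close> is a finite group.\<close>

definition factorization_graph :: "('a, 'b) monoid_scheme \<Rightarrow> 'a set pair_pre_digraph" where
  "factorization_graph G =
     (let V = {H. proper_subgroup H G \<and> \<not> H \<subseteq> frattini G}
      in \<lparr>pverts = V, parcs = {(A, B) \<in> V \<times> V. carrier G = A <#>\<^bsub>G\<^esub> B}\<rparr>)"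

definition induced_free :: "('c, 'd) pre_digraph \<Rightarrow> ('a, 'b) pre_digraph \<Rightarrow> bool" where
  "induced_free \<Gamma> G \<longleftrightarrow> \<not> (\<exists>H. induced_subgraph H G \<and> digraph_iso H \<Gamma>)"

text \<open>The star with centre \<open>0\<close> and leaves \<open>1, \<dots>, n\<close>.\<close>

definition star_graph :: "nat \<Rightarrow> nat pair_pre_digraph" where
  "star_graph n = \<lparr>pverts = {0..n}, parcs = {0} \<times> {1..n} \<union> {1..n} \<times> {0}\<rparr>"

lemma complete_bipartite_star_graph: "K\<^bsub>1,n\<^esub> (with_proj (star_graph n))"
  unfolding complete_bipartite_digraph_pair_def
  by (intro conjI exI[of _ "{0}"] exI[of _ "{1..n}"]) (auto simp: star_graph_def)

lemma pair_graph_factorization_graph: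
  assumes "group G" and "finite (carrier G)"
  shows "pair_graph (factorization_graph G)"
proof -
  interpret group G by fact
  let ?V = "{H. proper_subgroup H G \<and> \<not> H \<subseteq> frattini G}"
  have fin: "finite ?V"
    by (rule finite_subset[of _ "Pow (carrier G)"])
      (use assms(2) in \<open>auto simp: proper_subgroup_def dest: subgroup.subset\<close>)
  have swap: "carrier G = B <#>\<^bsub>G\<^esub> A"
    if A: "subgroup A G" and B: "subgroup B G" and eq: "carrier G = A <#>\<^bsub>G\<^esub> B" for A B
  proof -
    have "x \<in> B <#>\<^bsub>G\<^esub> A" if x: "x \<in> carrier G" for x
    proof -
      from x have "inv\<^bsub>G\<^esub> x \<in> A <#>\<^bsub>G\<^esub> B" unfolding eq[symmetric] by (rule inv_closed)
      then obtain a b where ab: "a \<in> A" "b \<in> B" "inv\<^bsub>G\<^esub> x = a \<otimes>\<^bsub>G\<^esub> b"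
        by (auto simp: set_mult_def)
      then have c: "a \<in> carrier G" "b \<in> carrier G"
        using A B by (auto dest: subgroup.mem_carrier)
      have "x = inv\<^bsub>G\<^esub> (a \<otimes>\<^bsub>G\<^esub> b)" using ab(3) x inv_inv by metis
      also have "\<dots> = inv\<^bsub>G\<^esub> b \<otimes>\<^bsub>G\<^esub> inv\<^bsub>G\<^esub> a" using c by (simp add: inv_mult_group)
      finally show ?thesis unfolding set_mult_def
        using subgroup.m_inv_closed[OF A ab(1)] subgroup.m_inv_closed[OF B ab(2)] by blast
    qed
    moreover have "B <#>\<^bsub>G\<^esub> A \<subseteq> carrier G"
      using A B by (intro set_mult_closed) (simp_all add: subgroup.subset)
    ultimately show ?thesis by blast
  qed
  have irr: "carrier G \<noteq> A <#>\<^bsub>G\<^esub> A" if "proper_subgroup A G" for A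
  proof -
    have "A <#>\<^bsub>G\<^esub> A \<subseteq> A" and "A \<subseteq> carrier G"
      using that unfolding proper_subgroup_def set_mult_def
      by (auto intro: subgroup.m_closed dest: subgroup.subset)
    then show ?thesis using that unfolding proper_subgroup_def by blast
  qed
  have parcs: "(A, B) \<in> parcs (factorization_graph G) \<longleftrightarrow>
      A \<in> ?V \<and> B \<in> ?V \<and> carrier G = A <#>\<^bsub>G\<^esub> B" for A B
    unfolding factorization_graph_def Let_def by simp
  have pverts: "pverts (factorization_graph G) = ?V"
    unfolding factorization_graph_def Let_def by simp
  have sub: "parcs (factorization_graph G) \<subseteq> ?V \<times> ?V"
    by (rule subrelI) (simp only: parcs mem_Times_iff fst_conv snd_conv)
  show ?thesis
  proof
    show "finite (pverts (factorization_graph G))" using fin by (simp only: pverts)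
    show "finite (parcs (factorization_graph G))"
      by (rule finite_subset[OF sub]) (use fin in blast)
    show "symmetric (with_proj (factorization_graph G))"
      unfolding symmetric_def with_proj_simps
    proof (rule symI)
      fix A B assume "(A, B) \<in> parcs (factorization_graph G)"
      then have AB: "A \<in> ?V" "B \<in> ?V" "carrier G = A <#>\<^bsub>G\<^esub> B"
        unfolding parcs by iprover+
      have "carrier G = B <#>\<^bsub>G\<^esub> A"
        by (rule swap[OF _ _ AB(3)]) (use AB(1,2) in \<open>simp_all add: proper_subgroup_def\<close>)
      with AB show "(B, A) \<in> parcs (factorization_graph G)"
        unfolding parcs by iprover
    qed
    fix e assume e: "e \<in> parcs (factorization_graph G)"
    show "fst e \<in> pverts (factorization_graph G)" "snd e \<in> pverts (factorization_graph G)"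
      unfolding pverts using subsetD[OF sub e] by (simp_all add: mem_Times_iff)
    show "fst e \<noteq> snd e"
    proof
      assume "fst e = snd e"
      with e have "(fst e, fst e) \<in> parcs (factorization_graph G)" by (metis prod.collapse)
      then show False unfolding parcs using irr[of "fst e"] by simp
    qed
  qed
qed

section \<open>The quaternion group\<close>

text \<open>The integer quadruple \<open>(a, b, c, d)\<close> stands for the quaternion \<open>a + bi + cj + dk\<close>.\<close>

fun quat_mult :: "int \<times> int \<times> int \<times> int \<Rightarrow> int \<times> int \<times> int \<times> int \<Rightarrow> int \<times> int \<times> int \<times> int" where
  "quat_mult (a, b, c, d) (a', b', c', d') =
     (a * a' - b * b' - c * c' - d * d',
      a * b' + b * a' + c * d' - d * c',
      a * c' - b * d' + c * a' + d * b',
      a * d' + b * c' - c * b' + d * a')"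

definition quaternion_group :: "(int \<times> int \<times> int \<times> int) monoid" where
  "quaternion_group =
     \<lparr>carrier = {(1, 0, 0, 0), (-1, 0, 0, 0), (0, 1, 0, 0), (0, -1, 0, 0),
                 (0, 0, 1, 0), (0, 0, -1, 0), (0, 0, 0, 1), (0, 0, 0, -1)},
      monoid.mult = quat_mult, one = (1, 0, 0, 0)\<rparr>"

lemma quat_mult_assoc: "quat_mult (quat_mult u v) w = quat_mult u (quat_mult v w)"
  by (cases u; cases v; cases w) (simp add: algebra_simps)

lemma group_quaternion_group: "group quaternion_group"
proof (rule groupI)
  fix u v assume "u \<in> carrier quaternion_group" "v \<in> carrier quaternion_group"
  then show "u \<otimes>\<^bsub>quaternion_group\<^esub> v \<in> carrier quaternion_group"
    unfolding quaternion_group_def partial_object.simps monoid.simps insert_iff empty_iff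
    by (elim disjE FalseE; hypsubst; simp)
qed (auto simp: quaternion_group_def quat_mult_assoc)

section \<open>Group presentations\<close>

text \<open>A letter \<open>(g, True)\<close> is the generator \<open>g\<close>, and \<open>(g, False)\<close> is its formal inverse.\<close>

type_synonym 'g word = "('g \<times> bool) list"

definition gen_word :: "'g \<Rightarrow> 'g word" where
  "gen_word g = [(g, True)]"

definition inv_word :: "'g word \<Rightarrow> 'g word" where
  "inv_word w = rev (map (\<lambda>(g, b). (g, \<not> b)) w)"

definition pow_word :: "'g word \<Rightarrow> nat \<Rightarrow> 'g word" where
  "pow_word w n = concat (replicate n w)"

definition conj_word :: "'g word \<Rightarrow> 'g word \<Rightarrow> 'g word" where
  "conj_word a b = inv_word b @ a @ b"

text \<open>A pair \<open>(l, r)\<close> in \<open>R\<close> is the defining relation \<open>l = r\<close>.  The generators are all the elements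
  of the type \<open>'g\<close>.\<close>

inductive word_cong :: "('g word \<times> 'g word) set \<Rightarrow> 'g word \<Rightarrow> 'g word \<Rightarrow> bool"
  for R where
  refl: "word_cong R w w"
| sym: "word_cong R u v \<Longrightarrow> word_cong R v u"
| trans: "word_cong R u v \<Longrightarrow> word_cong R v w \<Longrightarrow> word_cong R u w"
| cancel: "word_cong R (u @ [(g, b), (g, \<not> b)] @ v) (u @ v)"
| rel: "(l, r) \<in> R \<Longrightarrow> word_cong R (u @ l @ v) (u @ r @ v)"

definition word_class :: "('g word \<times> 'g word) set \<Rightarrow> 'g word \<Rightarrow> 'g word set" where
  "word_class R w = {v. word_cong R w v}"

definition presented_group :: "('g word \<times> 'g word) set \<Rightarrow> 'g word set monoid" where
  "presented_group R =
     \<lparr>carrier = range (word_class R),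
      monoid.mult = (\<lambda>A B. \<Union>u\<in>A. \<Union>v\<in>B. word_class R (u @ v)),
      one = word_class R []\<rparr>"

lemma word_class_eq_iff: "word_class R u = word_class R v \<longleftrightarrow> word_cong R u v"
  by (auto simp: word_class_def intro: word_cong.intros)

lemma word_cong_append_left: "word_cong R u v \<Longrightarrow> word_cong R (w @ u) (w @ v)"
proof (induction rule: word_cong.induct)
  case (cancel u g b v)
  then show ?case using word_cong.cancel[of R "w @ u" g b v] by simp
next
  case (rel l r u v)
  then show ?case using word_cong.rel[of l r R "w @ u" v] by simp
qed (auto intro: word_cong.intros)

lemma word_cong_append_right: "word_cong R u v \<Longrightarrow> word_cong R (u @ w) (v @ w)"
proof (induction rule: word_cong.induct)
  case (cancel u g b v)
  then show ?case using word_cong.cancel[of R u g b "v @ w"] by simp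
next
  case (rel l r u v)
  then show ?case using word_cong.rel[of l r R u "v @ w"] by simp
qed (auto intro: word_cong.intros)

lemma mult_presented_group:
  "word_class R u \<otimes>\<^bsub>presented_group R\<^esub> word_class R v = word_class R (u @ v)"
proof -
  have "word_class R (u' @ v') = word_class R (u @ v)"
    if "u' \<in> word_class R u" "v' \<in> word_class R v" for u' v'
  proof -
    have "word_cong R (u @ v) (u' @ v)"
      using that by (simp add: word_class_def word_cong_append_right)
    moreover have "word_cong R (u' @ v) (u' @ v')"
      using that by (simp add: word_class_def word_cong_append_left)
    ultimately show ?thesis
      unfolding word_class_eq_iff by (rule word_cong.sym[OF word_cong.trans])
  qed
  moreover have "u \<in> word_class R u" "v \<in> word_class R v"
    by (auto simp: word_class_def intro: word_cong.refl)
  ultimately show ?thesis unfolding presented_group_def monoid.simps by blast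
qed

lemma word_cong_inv_word_left: "word_cong R (inv_word w @ w) []"
proof (induction w)
  case (Cons p w)
  obtain g b where p: "p = (g, b)" by force
  have "word_cong R (inv_word w @ [(g, \<not> b), (g, \<not> \<not> b)] @ w) (inv_word w @ w)"
    by (rule word_cong.cancel)
  then show ?case using Cons.IH by (auto simp: p inv_word_def intro: word_cong.trans)
qed (simp add: inv_word_def word_cong.refl)

lemma group_presented_group: "group (presented_group R)"
proof (rule groupI)
  fix A assume "A \<in> carrier (presented_group R)"
  then obtain w where w: "A = word_class R w" by (auto simp: presented_group_def)
  have "word_class R (inv_word w) \<otimes>\<^bsub>presented_group R\<^esub> A = \<one>\<^bsub>presented_group R\<^esub>"
    by (simp add: w mult_presented_group)
      (simp add: presented_group_def word_class_eq_iff word_cong_inv_word_left)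
  then show "\<exists>B\<in>carrier (presented_group R). B \<otimes>\<^bsub>presented_group R\<^esub> A = \<one>\<^bsub>presented_group R\<^esub>"
    by (auto simp: presented_group_def)
  show "\<one>\<^bsub>presented_group R\<^esub> \<otimes>\<^bsub>presented_group R\<^esub> A = A"
    using mult_presented_group[of R "[]" w] by (simp add: w) (simp add: presented_group_def)
next
  fix A B assume "A \<in> carrier (presented_group R)" "B \<in> carrier (presented_group R)"
  then obtain u v where w: "A = word_class R u" "B = word_class R v"
    by (auto simp: presented_group_def)
  show "A \<otimes>\<^bsub>presented_group R\<^esub> B \<in> carrier (presented_group R)"
    by (simp add: w mult_presented_group) (simp add: presented_group_def)
next
  fix A B C
  assume "A \<in> carrier (presented_group R)" "B \<in> carrier (presented_group R)"
    "C \<in> carrier (presented_group R)"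
  then obtain u v w where w: "A = word_class R u" "B = word_class R v" "C = word_class R w"
    by (auto simp: presented_group_def)
  show "A \<otimes>\<^bsub>presented_group R\<^esub> B \<otimes>\<^bsub>presented_group R\<^esub> C =
      A \<otimes>\<^bsub>presented_group R\<^esub> (B \<otimes>\<^bsub>presented_group R\<^esub> C)"
    by (simp add: w mult_presented_group)
qed (simp add: presented_group_def)

datatype gen_xy = Gen_x | Gen_y

text \<open>The group with generators \<open>x, y\<close> and relations
  \<open>x\<^bsup>2^n\<^esup> = y\<^bsup>3\<^esup> = 1\<close>, \<open>x\<^bsup>-1\<^esup> y x = y\<^bsup>-1\<^esup>\<close>, \<open>y\<^bsup>-1\<^esup> x\<^bsup>2\<^esup> y = x\<^bsup>2\<^esup>\<close>.\<close>

definition group_C3_C2pow :: "nat \<Rightarrow> gen_xy word set monoid" where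
  "group_C3_C2pow n =
     (let x = gen_word Gen_x; y = gen_word Gen_y
      in presented_group
           {(pow_word x (2 ^ n), []),
            (pow_word y 3, []),
            (conj_word y x, inv_word y),
            (conj_word (pow_word x 2) y, pow_word x 2)})"

end

theory Submission imports Defs begin

text \<open>A star \<open>K\<^sub>1\<^sub>,\<^sub>4\<close> in the factorization graph is a proper subgroup \<open>U\<close> with four proper supplements, no
  two of which have product \<open>G\<close>.  So the graph condition says that every independent family of
  supplements of one proper subgroup has at most three members; this is \<open>star_free\<close>, and it is
  inherited by quotients.

  Independent families come from two sources.  The conjugates of a supplement of \<open>U\<close> are supplements
  of \<open>U\<close> and pairwise non-adjacent, so a maximal subgroup that is a factor of \<open>G\<close> is normal or has
  index \<open>3\<close> (\<open>maximal_factor_normal_or_index_le_3\<close>).  The subgroups of one proper subgroup are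
  pairwise non-adjacent, so at most three of them lie outside a normal subgroup of prime index
  (\<open>card_supplements_le\<close>).  By the counting lemma \<open>few_subgroups_outside\<close>, a p-group with so few
  subgroups outside a subgroup of index \<open>p\<close> is cyclic, or \<open>p = 2\<close> and besides the whole group there
  are exactly two, both cyclic of index \<open>2\<close>.

  Let \<open>G\<close> be a p-group.  It has two maximal subgroups \<open>M \<noteq> N\<close>, and the lemma applies to every maximal
  subgroup over \<open>D = M \<inter> N\<close>.  If two of them are cyclic, commutator calculations in a group with two
  cyclic subgroups of index \<open>p\<close> leave \<open>C\<^sub>p \<times> C\<^sub>p\<close>, \<open>Q\<^sub>8\<close> and \<open>C\<^sub>4 \<times> C\<^sub>2\<close>
  (\<open>two_cyclic_maximal\<close>).  Otherwise \<open>p = 2\<close>, none of them is cyclic, \<open>G\<close> is the product of two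
  cyclic subgroups of index \<open>4\<close>, and again commutators show that \<open>G\<close> is \<open>C\<^sub>4 \<times> C\<^sub>4\<close>
  (\<open>noncyclic_factorization\<close>).

  Let \<open>G\<close> have at least two prime divisors.  There is a normal subgroup \<open>N\<close> of some prime index \<open>p\<close>
  (\<open>factorizable_normal_prime_index\<close>).  Products of p-subgroups are too small to be \<open>G\<close>, so at most
  three p-subgroups lie outside \<open>N\<close>.  If a Sylow p-subgroup is not normal, these are its conjugates
  and \<open>G\<close> is the extension of \<open>C\<^sub>3\<close> by a cyclic 2-group (\<open>nonnormal_sylow\<close>).  If a Sylow p-subgroup
  \<open>P\<close> is normal, then all proper subgroups of \<open>G/P\<close> yield supplements of \<open>N\<close>, which forces \<open>G/P\<close> to
  have order \<open>r\<^sup>k\<close> with \<open>k \<le> 3\<close> or \<open>rs\<close>, and provides normal subgroups of the other prime indices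
  (\<open>sylow_data\<close>).  So all Sylow subgroups are normal; they are cyclic, except that the Sylow
  2-subgroup may be \<open>C\<^sub>2 \<times> C\<^sub>2\<close> or \<open>Q\<^sub>8\<close>, and then the other one has prime order
  (\<open>noncyclic_sylow_two\<close>).

  Isomorphisms with the groups of the list, the presented one included, are obtained from one
  normal form for metacyclic groups (\<open>metacyclic_iso\<close>).  For the converse the supplements of each
  proper subgroup are counted, in cyclic groups and the extensions of \<open>C\<^sub>3\<close> by their orders, and in
  the others by their position relative to the Frattini subgroup of the 2-part.\<close>

section \<open>Group-theoretic form of the condition\<close>

text \<open>Taking \<open>V = W\<close> is harmless: a proper subgroup satisfies \<open>VV = V\<close>.\<close>

definition independent_family :: "('a, 'b) monoid_scheme \<Rightarrow> 'a set set \<Rightarrow> bool" where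
  "independent_family G \<S> \<longleftrightarrow> (\<forall>V\<in>\<S>. proper_subgroup V G) \<and>
     (\<forall>V\<in>\<S>. \<forall>W\<in>\<S>. V <#>\<^bsub>G\<^esub> W \<noteq> carrier G)"

definition star_free :: "('a, 'b) monoid_scheme \<Rightarrow> bool" where
  "star_free G \<longleftrightarrow> (\<forall>U \<S>. proper_subgroup U G \<and> independent_family G \<S> \<and>
     (\<forall>V\<in>\<S>. U <#>\<^bsub>G\<^esub> V = carrier G) \<longrightarrow> card \<S> \<le> 3)"

locale fin_group = group G for G (structure) +
  assumes fin [simp]: "finite (carrier G)"

context fin_group begin

lemma inv_mult_cancel: "x \<in> carrier G \<Longrightarrow> y \<in> carrier G \<Longrightarrow> inv x \<otimes> (x \<otimes> y) = y"
  by (simp flip: m_assoc)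

lemma mult_inv_cancel: "x \<in> carrier G \<Longrightarrow> y \<in> carrier G \<Longrightarrow> x \<otimes> (inv x \<otimes> y) = y"
  by (simp flip: m_assoc)

text \<open>Rewriting with these rules brings every group word to its freely reduced form.\<close>

lemmas word_simps = m_assoc inv_mult_group inv_mult_cancel mult_inv_cancel

lemma finite_subgroup: "subgroup H G \<Longrightarrow> finite H"
  using fin finite_subset subgroup.subset by metis

lemma finite_subgroups: "finite {H. subgroup H G \<and> P H}"
  by (rule finite_subset[of _ "Pow (carrier G)"]) (auto dest: subgroup.subset)

lemma card_subgroup_pos: "subgroup H G \<Longrightarrow> card H > 0"
  using finite_subgroup subgroup.one_closed by (metis card_gt_0_iff empty_iff)

lemma order_pos: "order G > 0"
  by (simp add: order_gt_0_iff_finite)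

lemma card_subgroup_dvd: "subgroup H G \<Longrightarrow> card H dvd order G"
  by (metis dvd_triv_right lagrange)

lemma card_subgroup_dvd_subgroup:
  assumes "subgroup H G" "subgroup K G" "H \<subseteq> K"
  shows "card H dvd card K"
proof -
  interpret K: group "G\<lparr>carrier := K\<rparr>" using assms(2) by (rule subgroup_imp_group)
  have "subgroup H (G\<lparr>carrier := K\<rparr>)" using assms by (simp add: subgroup_incl)
  from K.lagrange[OF this] show ?thesis by (simp add: order_def) (metis dvd_triv_right)
qed

lemma set_mult_eq_carrier_iff:
  assumes "subgroup H G" "subgroup K G"
  shows "H <#> K = carrier G \<longleftrightarrow> card (H <#> K) = order G"
  using assms setmult_subset_G[of H K] by (metis card_subset_eq fin order_def subgroup.subset)

lemma set_multI: "u \<in> U \<Longrightarrow> v \<in> V \<Longrightarrow> u \<otimes> v \<in> U <#> V"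
  unfolding set_mult_def by blast

lemma set_multE:
  assumes "x \<in> U <#> V" obtains u v where "u \<in> U" "v \<in> V" "x = u \<otimes> v"
  using assms unfolding set_mult_def by blast

text \<open>Count the pairs in \<open>H \<times> K\<close> by their product: the fibre over \<open>hk\<close> is a copy of \<open>H \<inter> K\<close>.\<close>

lemma card_set_mult:
  assumes H: "subgroup H G" and K: "subgroup K G"
  shows "card (H <#> K) * card (H \<inter> K) = card H * card K"
proof -
  let ?f = "\<lambda>(h, k). h \<otimes> k"
  have fH: "finite H" "finite K" using assms finite_subgroup by auto
  have img: "?f ` (H \<times> K) = H <#> K" by (auto simp: set_mult_def)
  have fibre: "card {p \<in> H \<times> K. ?f p = z} = card (H \<inter> K)" if "z \<in> H <#> K" for z
  proof -
    obtain h k where hk: "h \<in> H" "k \<in> K" "z = h \<otimes> k" using \<open>z \<in> H <#> K\<close> by (auto simp: set_mult_def)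
    have c: "h \<in> carrier G" "k \<in> carrier G" using hk H K by (auto dest: subgroup.mem_carrier)
    have "bij_betw (\<lambda>d. (h \<otimes> d, inv d \<otimes> k)) (H \<inter> K) {p \<in> H \<times> K. ?f p = z}"
    proof (rule bij_betw_imageI)
      show "inj_on (\<lambda>d. (h \<otimes> d, inv d \<otimes> k)) (H \<inter> K)"
      proof (rule inj_onI)
        fix x y assume "x \<in> H \<inter> K" "y \<in> H \<inter> K" "(h \<otimes> x, inv x \<otimes> k) = (h \<otimes> y, inv y \<otimes> k)"
        moreover from this have "x \<in> carrier G" "y \<in> carrier G" using H by (auto dest: subgroup.mem_carrier)
        ultimately show "x = y" using c by simp
      qed
      show "(\<lambda>d. (h \<otimes> d, inv d \<otimes> k)) ` (H \<inter> K) = {p \<in> H \<times> K. ?f p = z}"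
      proof (intro equalityI subsetI)
        fix p assume "p \<in> (\<lambda>d. (h \<otimes> d, inv d \<otimes> k)) ` (H \<inter> K)"
        then obtain d where d: "d \<in> H" "d \<in> K" "p = (h \<otimes> d, inv d \<otimes> k)" by auto
        then have dc: "d \<in> carrier G" using H by (auto dest: subgroup.mem_carrier)
        have "h \<otimes> d \<otimes> (inv d \<otimes> k) = h \<otimes> k"
          using c dc by (simp add: word_simps)
        then show "p \<in> {p \<in> H \<times> K. ?f p = z}"
          using d hk H K by (auto simp: subgroup.m_closed subgroup.m_inv_closed)
      next
        fix p assume "p \<in> {p \<in> H \<times> K. ?f p = z}"
        then obtain h' k' where p: "p = (h', k')" "h' \<in> H" "k' \<in> K" "h' \<otimes> k' = h \<otimes> k" using hk by auto
        then have c': "h' \<in> carrier G" "k' \<in> carrier G" using H K by (auto dest: subgroup.mem_carrier)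
        define d where "d = inv h \<otimes> h'"
        have "d = inv h \<otimes> (h' \<otimes> k') \<otimes> inv k'" using c c' by (simp add: d_def word_simps)
        then have "d = k \<otimes> inv k'" using c c' unfolding p(4) by (simp add: word_simps)
        have "d \<in> H" using p hk H by (simp add: d_def subgroup.m_closed subgroup.m_inv_closed)
        moreover have "d \<in> K" using p hk K \<open>d = k \<otimes> inv k'\<close>
          by (simp add: subgroup.m_closed subgroup.m_inv_closed)
        moreover have "h \<otimes> d = h'" using c c' by (simp add: d_def word_simps)
        moreover have "inv d \<otimes> k = k'" using c c' \<open>d = k \<otimes> inv k'\<close> by (simp add: word_simps)
        ultimately show "p \<in> (\<lambda>d. (h \<otimes> d, inv d \<otimes> k)) ` (H \<inter> K)"
          using p(1) by (intro image_eqI[of _ _ d]) simp_all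
      qed
    qed
    then show ?thesis by (rule bij_betw_same_card[symmetric])
  qed
  have "card H * card K = card (H \<times> K)" by (simp add: card_cartesian_product)
  also have "\<dots> = (\<Sum>z\<in>?f ` (H \<times> K). card {p \<in> H \<times> K. ?f p = z})"
    unfolding card_eq_sum by (rule sum.image_gen) (use fH in simp)
  also have "\<dots> = (\<Sum>z\<in>H <#> K. card (H \<inter> K))" unfolding img by (rule sum.cong) (use fibre in auto)
  finally show ?thesis by simp
qed


text \<open>Inversion maps \<open>UV\<close> onto \<open>VU\<close>.\<close>

lemma set_mult_swap:
  assumes "subgroup U G" "subgroup V G" "U <#> V = carrier G"
  shows "V <#> U = carrier G"
proof
  show "V <#> U \<subseteq> carrier G" using assms by (intro set_mult_closed) (auto dest: subgroup.subset)
  show "carrier G \<subseteq> V <#> U"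
  proof
    fix x assume x: "x \<in> carrier G"
    then have "inv x \<in> U <#> V" using assms by simp
    then obtain u v where uv: "u \<in> U" "v \<in> V" "inv x = u \<otimes> v" by (auto simp: set_mult_def)
    then have "inv (inv x) = inv v \<otimes> inv u"
      using assms by (simp add: inv_mult_group subgroup.mem_carrier)
    then have "x = inv v \<otimes> inv u" using x by simp
    moreover have "inv v \<in> V" "inv u \<in> U" using uv assms by (auto simp: subgroup.m_inv_closed)
    ultimately show "x \<in> V <#> U" unfolding set_mult_def by blast
  qed
qed

lemma set_mult_mono_carrier:
  assumes "U <#> V = carrier G" "U \<subseteq> U'" "V \<subseteq> V'" "U' \<subseteq> carrier G" "V' \<subseteq> carrier G"
  shows "U' <#> V' = carrier G"
  using assms mono_set_mult[of U U' V V' G] set_mult_closed[of U' V'] by blast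

lemma set_mult_subset_subgroup:
  assumes "subgroup W G" "U \<subseteq> W" "V \<subseteq> W" shows "U <#> V \<subseteq> W"
  using assms by (auto simp: set_mult_def intro: subgroup.m_closed)

lemma proper_subgroupD:
  assumes "proper_subgroup H G"
  shows "subgroup H G" "H \<subseteq> carrier G" "card H < order G"
proof -
  show "subgroup H G" "H \<subseteq> carrier G" using assms by (auto simp: proper_subgroup_def dest: subgroup.subset)
  then show "card H < order G" using assms unfolding proper_subgroup_def order_def by (metis fin psubsetI psubset_card_mono)
qed

lemma proper_subgroupI: "subgroup H G \<Longrightarrow> card H \<noteq> order G \<Longrightarrow> proper_subgroup H G"
  by (auto simp: proper_subgroup_def order_def)

lemma not_carrier_if_in_proper:
  assumes "proper_subgroup W G" "U \<subseteq> W" "V \<subseteq> W" shows "U <#> V \<noteq> carrier G"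
proof
  assume "U <#> V = carrier G"
  then have "carrier G \<subseteq> W"
    using assms set_mult_subset_subgroup[of W U V] proper_subgroupD(1)[OF assms(1)] by simp
  then show False using assms(1) proper_subgroupD(2)[OF assms(1)] by (simp add: proper_subgroup_def)
qed

lemma star_freeD:
  assumes "star_free G" "proper_subgroup U G" "independent_family G \<S>"
    "\<And>V. V \<in> \<S> \<Longrightarrow> U <#> V = carrier G"
  shows "card \<S> \<le> 3"
  using assms(1)[unfolded star_free_def, THEN spec, THEN spec, of U \<S>] assms(2-4) by simp

text \<open>All products of members stay inside \<open>W\<close>.\<close>

lemma independent_family_in_proper:
  assumes "proper_subgroup W G" "\<And>V. V \<in> \<S> \<Longrightarrow> subgroup V G" "\<And>V. V \<in> \<S> \<Longrightarrow> V \<subseteq> W"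
  shows "independent_family G \<S>"
  unfolding independent_family_def
proof (intro conjI ballI)
  fix V assume V: "V \<in> \<S>"
  have "V \<noteq> carrier G"
    using assms(1) assms(3)[OF V] proper_subgroupD(2)[OF assms(1)] by (auto simp: proper_subgroup_def)
  then show "proper_subgroup V G" using assms(2)[OF V] by (simp add: proper_subgroup_def)
  fix W assume "W \<in> \<S>"
  then show "V <#> W \<noteq> carrier G"
    using V by (intro not_carrier_if_in_proper[OF assms(1)] assms(3))
qed

lemma prime_power_order_if_product:
  assumes p: "Factorial_Ring.prime (p::nat)" and A: "subgroup A G" "card A = p ^ i" and B: "subgroup B G" "card B = p ^ j"
    and "A <#> B = carrier G"
  shows "\<exists>k. order G = p ^ k"
proof -
  have "order G * card (A \<inter> B) = p ^ (i + j)"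
    using card_set_mult[OF A(1) B(1)] assms by (simp add: order_def power_add)
  then have "order G dvd p ^ (i + j)" by (metis dvd_triv_left)
  then show ?thesis using p divides_primepow_nat by blast
qed

subsection \<open>Conjugate subgroups\<close>

definition conjugate :: "'a \<Rightarrow> 'a set \<Rightarrow> 'a set" where
  "conjugate g H = (\<lambda>h. g \<otimes> h \<otimes> inv g) ` H"

lemma conjugate_subset: "H \<subseteq> carrier G \<Longrightarrow> g \<in> carrier G \<Longrightarrow> conjugate g H \<subseteq> carrier G"
  by (auto simp: conjugate_def)

lemma conjugate_mono: "H \<subseteq> K \<Longrightarrow> conjugate g H \<subseteq> conjugate g K"
  by (auto simp: conjugate_def)

lemma conjugate_conjugate:
  assumes "H \<subseteq> carrier G" "g \<in> carrier G" "h \<in> carrier G"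
  shows "conjugate g (conjugate h H) = conjugate (g \<otimes> h) H"
  unfolding conjugate_def image_image
  by (rule image_cong) (use assms in \<open>auto simp: word_simps subset_iff\<close>)

lemma conjugate_one: "H \<subseteq> carrier G \<Longrightarrow> conjugate \<one> H = H"
  unfolding conjugate_def by (auto simp: subset_iff image_iff)

lemma conjugate_inv:
  assumes "H \<subseteq> carrier G" "g \<in> carrier G"
  shows "conjugate (inv g) (conjugate g H) = H"
  using assms by (simp add: conjugate_conjugate conjugate_one)

lemma conjugate_subgroup:
  assumes H: "subgroup H G" and g: "g \<in> carrier G"
  shows "subgroup (conjugate g H) G"
proof (rule subgroupI)
  have s: "H \<subseteq> carrier G" using H by (rule subgroup.subset)
  show "conjugate g H \<subseteq> carrier G" using s g by (rule conjugate_subset)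
  show "conjugate g H \<noteq> {}" using subgroup.one_closed[OF H] by (auto simp: conjugate_def)
  fix a assume "a \<in> conjugate g H"
  then obtain h where h: "h \<in> H" "a = g \<otimes> h \<otimes> inv g" by (auto simp: conjugate_def)
  then have "inv a = g \<otimes> inv h \<otimes> inv g" using g s by (auto simp: word_simps subset_iff)
  then show "inv a \<in> conjugate g H" using h subgroup.m_inv_closed[OF H] by (auto simp: conjugate_def)
  fix b assume "b \<in> conjugate g H"
  then obtain k where k: "k \<in> H" "b = g \<otimes> k \<otimes> inv g" by (auto simp: conjugate_def)
  then have "a \<otimes> b = g \<otimes> (h \<otimes> k) \<otimes> inv g" using h g s by (auto simp: word_simps subset_iff)
  then show "a \<otimes> b \<in> conjugate g H" using h k subgroup.m_closed[OF H] by (auto simp: conjugate_def)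
qed

lemma card_conjugate:
  assumes "H \<subseteq> carrier G" "g \<in> carrier G"
  shows "card (conjugate g H) = card H"
  unfolding conjugate_def by (rule card_image) (use assms in \<open>auto simp: inj_on_def subset_iff\<close>)

lemma conjugate_by_member:
  assumes "subgroup H G" "h \<in> H"
  shows "conjugate h H = H"
proof -
  have h: "h \<in> carrier G" using assms by (auto dest: subgroup.mem_carrier)
  have "conjugate h H \<subseteq> H"
    using assms by (auto simp: conjugate_def intro!: subgroup.m_closed subgroup.m_inv_closed)
  then show ?thesis
    using assms h by (metis card_conjugate card_subset_eq finite_subgroup subgroup.subset)
qed

lemma normal_iff_conjugate:
  "N \<lhd> G \<longleftrightarrow> subgroup N G \<and> (\<forall>g\<in>carrier G. conjugate g N \<subseteq> N)"
  by (auto simp: normal_inv_iff conjugate_def)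

lemma normal_conjugate: "N \<lhd> G \<Longrightarrow> g \<in> carrier G \<Longrightarrow> conjugate g N = N"
  by (metis card_conjugate card_subset_eq finite_subgroup normal_iff_conjugate subgroup.subset)

text \<open>If \<open>G = UV\<close> and \<open>g = uv\<close>, then conjugating \<open>V\<close> by \<open>g\<close> is conjugating by \<open>u\<close>, and
  \<open>U (u V u\<^sup>-\<^sup>1) = UVu\<^sup>-\<^sup>1 = G\<close>.\<close>

lemma set_mult_conjugate:
  assumes U: "subgroup U G" and V: "subgroup V G" and UV: "U <#> V = carrier G" and g: "g \<in> carrier G"
  shows "U <#> conjugate g V = carrier G"
proof
  have s: "U \<subseteq> carrier G" "V \<subseteq> carrier G" using U V by (auto dest: subgroup.subset)
  show "U <#> conjugate g V \<subseteq> carrier G" using s g by (intro set_mult_closed conjugate_subset)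
  obtain u v where uv: "u \<in> U" "v \<in> V" "g = u \<otimes> v" using g unfolding UV[symmetric] by (rule set_multE)
  then have c: "u \<in> carrier G" "v \<in> carrier G" using s by auto
  have cg: "conjugate g V = conjugate u V"
    using conjugate_conjugate[OF s(2) c] conjugate_by_member[OF V uv(2)] uv by simp
  show "carrier G \<subseteq> U <#> conjugate g V"
  proof
    fix x assume x: "x \<in> carrier G"
    then have "x \<otimes> u \<in> U <#> V" using UV c by simp
    then obtain u1 v1 where w: "u1 \<in> U" "v1 \<in> V" "x \<otimes> u = u1 \<otimes> v1" by (auto simp: set_mult_def)
    then have c1: "u1 \<in> carrier G" "v1 \<in> carrier G" using s by auto
    have "x = (x \<otimes> u) \<otimes> inv u" using x c by (simp add: word_simps)
    also have "\<dots> = (u1 \<otimes> inv u) \<otimes> (u \<otimes> v1 \<otimes> inv u)" unfolding w(3) using c c1 by (simp add: word_simps)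
    finally show "x \<in> U <#> conjugate g V" unfolding cg
      using w uv U by (auto simp: set_mult_def conjugate_def subgroup.m_closed subgroup.m_inv_closed)
  qed
qed

text \<open>Otherwise the conjugation could be undone by the previous lemma, giving \<open>VV = G\<close>.\<close>

lemma conjugates_not_carrier:
  assumes V: "proper_subgroup V G" and g: "g \<in> carrier G" and h: "h \<in> carrier G"
  shows "conjugate g V <#> conjugate h V \<noteq> carrier G"
proof
  assume *: "conjugate g V <#> conjugate h V = carrier G"
  have s: "subgroup V G" "V \<subseteq> carrier G" using V proper_subgroupD by auto
  have "conjugate g V <#> conjugate (g \<otimes> inv h) (conjugate h V) = carrier G"
    by (rule set_mult_conjugate) (use * g h s in \<open>auto simp: conjugate_subgroup\<close>)
  moreover have "conjugate (g \<otimes> inv h) (conjugate h V) = conjugate g V"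
    using g h s by (simp add: conjugate_conjugate word_simps)
  moreover have "conjugate g V <#> conjugate g V \<subseteq> conjugate g V"
    using conjugate_subgroup[OF s(1) g] by (intro set_mult_subset_subgroup) auto
  ultimately have "order G \<le> card (conjugate g V)"
    using conjugate_subgroup[OF s(1) g] by (metis card_mono finite_subgroup order_def)
  then show False using proper_subgroupD(3)[OF V] g s by (simp add: card_conjugate)
qed

lemma proper_conjugate:
  assumes "proper_subgroup V G" "g \<in> carrier G" shows "proper_subgroup (conjugate g V) G"
  using assms proper_subgroupD[OF assms(1)] by (intro proper_subgroupI) (auto simp: conjugate_subgroup card_conjugate)

text \<open>If \<open>H\<close> had a conjugate \<open>H' \<noteq> H\<close>, then \<open>|H : H \<inter> H'| \<ge> |G : H|\<close>, so
  \<open>HH' = G\<close>, which is impossible for conjugates.\<close>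

lemma normal_if_index_le_divisors:
  assumes H: "subgroup H G" and idx: "order G = n * card H" and n: "n > 1"
    and dv: "\<And>d. d dvd card H \<Longrightarrow> d > 1 \<Longrightarrow> n \<le> d"
  shows "H \<lhd> G"
proof -
  have sH: "H \<subseteq> carrier G" using H by (rule subgroup.subset)
  have ppr: "proper_subgroup H G" using H idx n card_subgroup_pos[OF H] by (intro proper_subgroupI) auto
  have "conjugate g H \<subseteq> H" if g: "g \<in> carrier G" for g
  proof (rule ccontr)
    assume ns: "\<not> conjugate g H \<subseteq> H"
    let ?H' = "conjugate g H"
    have H': "subgroup ?H' G" using H g by (rule conjugate_subgroup)
    have c: "card ?H' = card H" using sH g by (rule card_conjugate)
    have I: "subgroup (H \<inter> ?H') G" using H H' by (rule subgroups_Inter_pair)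
    obtain d where d: "card H = d * card (H \<inter> ?H')"
      using card_subgroup_dvd_subgroup[OF I H] by (metis Int_lower1 dvd_def mult.commute)
    have "H \<inter> ?H' \<noteq> ?H'" using ns by blast
    then have "card (H \<inter> ?H') < card ?H'"
      using finite_subgroup[OF H'] by (metis Int_lower2 psubsetI psubset_card_mono)
    then have "d \<noteq> 0" "d \<noteq> 1" using c d card_subgroup_pos[OF H] by auto
    then have "n \<le> d" using d by (intro dv) auto
    have "card (H <#> ?H') * card (H \<inter> ?H') = card H * (d * card (H \<inter> ?H'))"
      using card_set_mult[OF H H'] c d by simp
    then have "card (H <#> ?H') = card H * d" using card_subgroup_pos[OF I] by simp
    then have "order G \<le> card (H <#> ?H')" using idx \<open>n \<le> d\<close> by simp
    then have "H <#> ?H' = carrier G"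
      using set_mult_closed[OF sH subgroup.subset[OF H']] by (metis card_seteq fin order_def)
    moreover have "H <#> ?H' \<noteq> carrier G"
      using conjugates_not_carrier[OF ppr one_closed g] unfolding conjugate_one[OF sH] .
    ultimately show False by simp
  qed
  then show ?thesis using H by (simp add: normal_iff_conjugate)
qed

subsection \<open>Subgroups of prime index\<close>

text \<open>Lagrange: the index of \<open>K\<close> divides the prime index of \<open>H\<close>.\<close>

lemma prime_index_maximal:
  assumes p: "Factorial_Ring.prime (p::nat)" and H: "subgroup H G" "order G = p * card H"
    and K: "subgroup K G" "H \<subseteq> K"
  shows "K = H \<or> K = carrier G"
proof -
  obtain m where m: "card K = card H * m" using card_subgroup_dvd_subgroup[OF H(1) K] by (auto simp: dvd_def)
  obtain l where l: "order G = card K * l" using card_subgroup_dvd[OF K(1)] by (auto simp: dvd_def)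
  have "p = m * l" using m l H card_subgroup_pos[OF H(1)] by simp
  then have "m = 1 \<or> l = 1" using p by (metis prime_product)
  then show ?thesis
  proof
    assume "m = 1"
    then show ?thesis using m K finite_subgroup[OF K(1)] by (metis card_subset_eq mult.right_neutral)
  next
    assume "l = 1"
    then show ?thesis using l subgroup.subset[OF K(1)] by (metis card_subset_eq fin mult.right_neutral order_def)
  qed
qed

lemma normal_set_mult_subgroup: "N \<lhd> G \<Longrightarrow> subgroup V G \<Longrightarrow> subgroup (N <#> V) G"
  by (metis mult_norm_subgroup)

lemma set_mult_upper:
  assumes "subgroup U G" "subgroup V G" shows "U \<subseteq> U <#> V" "V \<subseteq> U <#> V"
  using assms subgroup.one_closed by (force simp: set_mult_def dest: subgroup.mem_carrier)+

lemma prime_index_supplement: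
  assumes p: "Factorial_Ring.prime (p::nat)" and N: "N \<lhd> G" "order G = p * card N"
    and V: "subgroup V G" "\<not> V \<subseteq> N"
  shows "N <#> V = carrier G" "card V = p * card (N \<inter> V)"
proof -
  have sN: "subgroup N G" using N(1) by (rule normal_imp_subgroup)
  show eq: "N <#> V = carrier G"
    using prime_index_maximal[OF p sN N(2) normal_set_mult_subgroup[OF N(1) V(1)]]
      set_mult_upper[OF sN V(1)] V by auto
  show "card V = p * card (N \<inter> V)"
    using card_set_mult[OF sN V(1)] N(2) card_subgroup_pos[OF sN] unfolding eq order_def[symmetric] by simp
qed

text \<open>The main consequence of star-freeness: subgroups of one proper subgroup \<open>W\<close> that are not
  contained in \<open>N\<close> are pairwise non-adjacent supplements of \<open>N\<close>.\<close>

lemma card_supplements_le: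
  assumes sf: "star_free G" and p: "Factorial_Ring.prime (p::nat)" and N: "N \<lhd> G" "order G = p * card N"
    and W: "proper_subgroup W G"
  shows "card {V. subgroup V G \<and> V \<subseteq> W \<and> \<not> V \<subseteq> N} \<le> 3"
proof (rule star_freeD[OF sf])
  show "proper_subgroup N G"
    using N normal_imp_subgroup[OF N(1)] prime_gt_1_nat[OF p] card_subgroup_pos[of N]
    by (intro proper_subgroupI) auto
  show "independent_family G {V. subgroup V G \<and> V \<subseteq> W \<and> \<not> V \<subseteq> N}"
    by (rule independent_family_in_proper[OF W]) auto
qed (use prime_index_supplement[OF p N] in auto)

end

section \<open>Translation between the graph and subgroups\<close>

context fin_group begin

lemma proper_subset_maximal:
  assumes "proper_subgroup H G"
  obtains M where "maximal_subgroup M G" "H \<subseteq> M"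
proof -
  let ?F = "{K. proper_subgroup K G \<and> H \<subseteq> K}"
  have fin: "finite ?F"
    by (rule finite_subset[of _ "Pow (carrier G)"]) (auto dest: proper_subgroupD(2))
  have ne: "?F \<noteq> {}" using assms by blast
  from finite_has_maximal[OF fin ne] obtain M
    where M: "M \<in> ?F" "\<forall>K\<in>?F. M \<subseteq> K \<longrightarrow> M = K" by (rule bexE)
  have "maximal_subgroup M G" unfolding maximal_subgroup_def
  proof (intro conjI allI impI)
    show "proper_subgroup M G" using M(1) by simp
    fix K assume "proper_subgroup K G \<and> M \<subseteq> K"
    then show "K = M" using M by auto
  qed
  with M(1) that show thesis by simp
qed

text \<open>If \<open>U\<close> were contained in the Frattini subgroup, \<open>UV\<close> would be contained in every maximal
  subgroup over \<open>V\<close>.\<close>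

lemma supplement_not_in_frattini:
  assumes "proper_subgroup U G" "proper_subgroup V G" "U <#> V = carrier G"
  shows "\<not> U \<subseteq> frattini G"
proof
  assume *: "U \<subseteq> frattini G"
  obtain M where M: "maximal_subgroup M G" "V \<subseteq> M" using assms(2) by (rule proper_subset_maximal)
  then have "U \<subseteq> M" using * by (auto simp: frattini_def)
  then show False
    using not_carrier_if_in_proper[of M U V] M assms by (auto simp: maximal_subgroup_def)
qed

lemma pverts_factorization_graph:
  "pverts (factorization_graph G) = {H. proper_subgroup H G \<and> \<not> H \<subseteq> frattini G}"
  by (simp add: factorization_graph_def Let_def)

text \<open>Both ends of an edge avoid the Frattini subgroup anyway.\<close>

lemma parcs_factorization_graph:
  "(A, B) \<in> parcs (factorization_graph G) \<longleftrightarrow>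
     proper_subgroup A G \<and> proper_subgroup B G \<and> A <#> B = carrier G"
proof -
  have "(A, B) \<in> parcs (factorization_graph G) \<longleftrightarrow>
      A \<in> pverts (factorization_graph G) \<and> B \<in> pverts (factorization_graph G) \<and> carrier G = A <#> B"
    unfolding factorization_graph_def Let_def by simp
  also have "\<dots> \<longleftrightarrow> proper_subgroup A G \<and> proper_subgroup B G \<and> A <#> B = carrier G"
  proof
    assume *: "proper_subgroup A G \<and> proper_subgroup B G \<and> A <#> B = carrier G"
    then have "B <#> A = carrier G" using set_mult_swap[of A B] by (simp add: proper_subgroup_def)
    then have "\<not> A \<subseteq> frattini G" "\<not> B \<subseteq> frattini G"
      using * supplement_not_in_frattini[of A B] supplement_not_in_frattini[of B A] by iprover+
    with * show "A \<in> pverts (factorization_graph G) \<and> B \<in> pverts (factorization_graph G) \<and> carrier G = A <#> B"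
      by (simp add: pverts_factorization_graph)
  qed (simp add: pverts_factorization_graph)
  finally show ?thesis .
qed

lemma ends_factorization_graph:
  assumes "e \<in> parcs (factorization_graph G)"
  shows "fst e \<in> pverts (factorization_graph G)" "snd e \<in> pverts (factorization_graph G)"
  using assms unfolding factorization_graph_def Let_def by auto

lemma wf_factorization_graph: "wf_digraph (with_proj (factorization_graph G))"
  by (rule wf_digraph.intro) (simp_all add: ends_factorization_graph)

text \<open>Four members of an independent family of supplements of \<open>U\<close>, together with \<open>U\<close>, induce a star.\<close>

lemma star_free_if_induced_free:
  assumes free: "induced_free (with_proj (star_graph 4)) (with_proj (factorization_graph G))"
  shows "star_free G"
proof (rule ccontr)
  assume "\<not> star_free G"
  then obtain U \<S> where U: "proper_subgroup U G" and S: "independent_family G \<S>"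
    and US: "\<forall>V\<in>\<S>. U <#> V = carrier G" and "\<not> card \<S> \<le> 3"
    unfolding star_free_def not_all not_imp by (elim exE conjE)
  then have c: "4 \<le> card \<S>" by simp
  obtain T where T: "T \<subseteq> \<S>" "card T = 4" by (rule obtain_subset_with_card_n[OF c])
  then have "finite T" by (intro card_ge_0_finite) simp
  then obtain h where h: "bij_betw h T {1..4::nat}"
    using T(2) finite_same_card_bij[of T "{1..4::nat}"] by auto
  have UT: "U \<notin> T"
  proof
    assume "U \<in> T"
    then have "U \<in> \<S>" using T(1) by blast
    then show False using S US unfolding independent_family_def by simp
  qed
  define \<phi> where "\<phi> V = (if V = U then 0 else h V)" for V
  have \<phi>T: "\<phi> V = h V" if "V \<in> T" for V using UT that by (auto simp: \<phi>_def)
  have \<phi>U: "\<phi> U = 0" by (simp add: \<phi>_def)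
  have im: "\<phi> ` T = {1..4}" using h \<phi>T by (simp add: bij_betw_def)
  have "inj_on \<phi> T" using h \<phi>T by (simp add: bij_betw_def inj_on_def)
  moreover have "\<phi> U \<notin> \<phi> ` (T - {U})" using im \<phi>U by fastforce
  ultimately have inj: "inj_on \<phi> (insert U T)" by (simp add: inj_on_insert)
  let ?A = "{U} \<times> T \<union> T \<times> {U}"
  let ?H = "\<lparr>verts = insert U T, arcs = ?A, tail = fst, head = snd\<rparr>"
  have pr: "proper_subgroup V G" if "V \<in> insert U T" for V
    using that U S T(1) unfolding independent_family_def by auto
  have UU: "U <#> U \<noteq> carrier G" by (rule not_carrier_if_in_proper[OF U]) simp_all
  have UT2: "U <#> V = carrier G" if "V \<in> T" for V using that US T by blast
  have TU: "V <#> U = carrier G" if "V \<in> T" for V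
    by (rule set_mult_swap[OF _ _ UT2[OF that]]) (use pr that in \<open>simp_all add: proper_subgroup_def\<close>)
  have TT: "V <#> W \<noteq> carrier G" if "V \<in> T" "W \<in> T" for V W
    using that S T(1) unfolding independent_family_def by (simp add: subset_iff)
  have adj: "(V, W) \<in> parcs (factorization_graph G) \<longleftrightarrow> (V, W) \<in> ?A"
    if VW: "V \<in> insert U T" "W \<in> insert U T" for V W
  proof -
    consider "V = U" "W = U" | "V = U" "W \<in> T" | "V \<in> T" "W = U" | "V \<in> T" "W \<in> T"
      using VW by blast
    then show ?thesis
    proof cases
      case 1 then show ?thesis using UU UT by (simp add: parcs_factorization_graph)
    next
      case 2 then show ?thesis using UT2 UT VW pr by (simp add: parcs_factorization_graph)
    next
      case 3 then show ?thesis using TU UT VW pr by (simp add: parcs_factorization_graph)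
    next
      case 4 then show ?thesis using TT[OF 4] UT by (auto simp: parcs_factorization_graph)
    qed
  qed
  have vsub: "insert U T \<subseteq> pverts (factorization_graph G)"
  proof
    fix V assume V: "V \<in> insert U T"
    have "\<exists>W. (V, W) \<in> parcs (factorization_graph G)"
    proof (cases "V = U")
      case True
      obtain W where "W \<in> T" using T(2) by fastforce
      then show ?thesis using True adj[of U W] by blast
    next
      case False
      then show ?thesis using V adj[of V U] by blast
    qed
    then show "V \<in> pverts (factorization_graph G)" using ends_factorization_graph(1) by fastforce
  qed
  have wfH: "wf_digraph ?H" by (rule wf_digraph.intro) auto
  have arcs: "?A = {e \<in> parcs (factorization_graph G). fst e \<in> insert U T \<and> snd e \<in> insert U T}" (is "_ = ?B")
  proof (rule Set.set_eqI)
    fix e show "e \<in> ?A \<longleftrightarrow> e \<in> ?B" using adj[of "fst e" "snd e"] by (cases e) auto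
  qed
  then have "?A \<subseteq> parcs (factorization_graph G)" by blast
  with arcs have ind: "induced_subgraph ?H (with_proj (factorization_graph G))"
    unfolding induced_subgraph_def subgraph_def compatible_def using vsub wf_factorization_graph wfH by simp
  let ?f = "\<lparr>iso_verts = \<phi>, iso_arcs = map_prod \<phi> \<phi>, iso_head = snd, iso_tail = fst\<rparr>"
  have "inj_on (map_prod \<phi> \<phi>) (insert U T \<times> insert U T)"
    by (rule map_prod_inj_on[OF inj inj])
  then have "inj_on (map_prod \<phi> \<phi>) ?A" by (rule inj_on_subset) auto
  then have "pre_digraph.digraph_isomorphism ?H ?f"
    using wfH inj unfolding pre_digraph.digraph_isomorphism_def by simp
  moreover have "with_proj (star_graph 4) = app_iso ?f ?H"
  proof -
    have "map_prod \<phi> \<phi> ` ?A = {0} \<times> {1..4} \<union> {1..4} \<times> {0}"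
      unfolding image_Un map_prod_surj_on[OF HOL.refl HOL.refl] im using \<phi>U by simp
    moreover have "\<phi> ` insert U T = {0..4}" unfolding image_insert im \<phi>U by auto
    ultimately show ?thesis by (simp add: app_iso_def with_proj_def star_graph_def)
  qed
  ultimately have "digraph_iso ?H (with_proj (star_graph 4))"
    unfolding digraph_iso_def by blast
  with ind free show False unfolding induced_free_def by blast
qed

text \<open>The images of the leaves of an induced star form an independent family of supplements of the
  centre.\<close>

lemma induced_free_if_star_free:
  assumes sf: "star_free G"
  shows "induced_free (with_proj (star_graph 4)) (with_proj (factorization_graph G))"
  unfolding induced_free_def
proof (rule notI, elim exE conjE)
  fix H assume ind: "induced_subgraph H (with_proj (factorization_graph G))"
    and "digraph_iso H (with_proj (star_graph 4))"
  then obtain f where f: "pre_digraph.digraph_isomorphism H f" and eq: "with_proj (star_graph 4) = app_iso f H"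
    unfolding digraph_iso_def by blast
  define \<phi> where "\<phi> = iso_verts f"
  have th: "tail H = fst" "head H = snd" and vs: "verts H \<subseteq> pverts (factorization_graph G)"
    and arcs: "arcs H = {e \<in> parcs (factorization_graph G). fst e \<in> verts H \<and> snd e \<in> verts H}"
    using ind by (auto simp: induced_subgraph_def subgraph_def compatible_def)
  have inj: "inj_on \<phi> (verts H)" using f by (simp add: pre_digraph.digraph_isomorphism_def \<phi>_def)
  have vim: "{0..4} = \<phi> ` verts H" using arg_cong[OF eq, of verts] by (simp add: star_graph_def \<phi>_def)
  have tl: "fst = iso_tail f" "snd = iso_head f"
    using arg_cong[OF eq, of tail] arg_cong[OF eq, of head] by simp_all
  have "iso_arcs f e = (\<phi> (fst e), \<phi> (snd e))" if "e \<in> arcs H" for e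
    using f that unfolding pre_digraph.digraph_isomorphism_def \<phi>_def th tl[symmetric]
    by (simp add: prod_eq_iff)
  moreover have "parcs (star_graph 4) = iso_arcs f ` arcs H"
    using arg_cong[OF eq, of arcs] by simp
  ultimately have aim: "parcs (star_graph 4) = (\<lambda>e. (\<phi> (fst e), \<phi> (snd e))) ` arcs H" by simp
  have adj: "V <#> W = carrier G \<longleftrightarrow> (\<phi> V, \<phi> W) \<in> parcs (star_graph 4)" if VW: "V \<in> verts H" "W \<in> verts H" for V W
  proof -
    have "(\<phi> V, \<phi> W) \<in> parcs (star_graph 4) \<longleftrightarrow> (V, W) \<in> arcs H"
    proof
      assume "(\<phi> V, \<phi> W) \<in> parcs (star_graph 4)"
      then obtain e where e: "e \<in> arcs H" "\<phi> V = \<phi> (fst e)" "\<phi> W = \<phi> (snd e)" unfolding aim by auto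
      then have "V = fst e" "W = snd e" using inj VW arcs by (auto dest: inj_onD)
      then show "(V, W) \<in> arcs H" using e by simp
    next
      assume "(V, W) \<in> arcs H"
      then show "(\<phi> V, \<phi> W) \<in> parcs (star_graph 4)" unfolding aim by force
    qed
    moreover have "(V, W) \<in> arcs H \<longleftrightarrow> V <#> W = carrier G"
      using VW vs unfolding arcs by (auto simp: parcs_factorization_graph pverts_factorization_graph)
    ultimately show ?thesis by simp
  qed
  have "0 \<in> \<phi> ` verts H" unfolding vim[symmetric] by simp
  then obtain U where U: "U \<in> verts H" "\<phi> U = 0" by (metis imageE)
  define \<S> where "\<S> = {V \<in> verts H. \<phi> V \<in> {1..4}}"
  have "\<phi> ` \<S> = \<phi> ` verts H \<inter> {1..4}" unfolding \<S>_def by auto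
  then have "\<phi> ` \<S> = {1..4}" unfolding vim[symmetric] by auto
  moreover have "inj_on \<phi> \<S>" using inj by (rule inj_on_subset) (auto simp: \<S>_def)
  ultimately have "card \<S> = 4" using card_image[of \<phi> \<S>] by simp
  moreover have "card \<S> \<le> 3"
  proof (rule star_freeD[OF sf])
    show "proper_subgroup U G" using U vs by (auto simp: pverts_factorization_graph)
    show "independent_family G \<S>"
      unfolding independent_family_def
    proof (intro conjI ballI)
      fix V assume V: "V \<in> \<S>"
      then show "proper_subgroup V G" using vs by (auto simp: pverts_factorization_graph \<S>_def)
      fix W assume "W \<in> \<S>"
      then show "V <#> W \<noteq> carrier G" using V adj[of V W] by (auto simp: \<S>_def star_graph_def)
    qed
    fix V assume "V \<in> \<S>"
    then show "U <#> V = carrier G" using adj[of U V] U by (auto simp: \<S>_def star_graph_def)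
  qed
  ultimately show False by simp
qed

end

section \<open>Quotients\<close>

lemma (in group_hom) preimage_subgroup:
  assumes W: "subgroup W H" shows "subgroup {x \<in> carrier G. h x \<in> W} G"
proof (rule G.subgroupI)
  have "\<one>\<^bsub>G\<^esub> \<in> {x \<in> carrier G. h x \<in> W}" using subgroup.one_closed[OF W] by simp
  then show "{x \<in> carrier G. h x \<in> W} \<noteq> {}" by blast
qed (use subgroup.m_closed[OF W] subgroup.m_inv_closed[OF W] in auto)

lemma (in group_hom) preimage_proper:
  assumes W: "proper_subgroup W H" and surj: "h ` carrier G = carrier H"
  shows "proper_subgroup {x \<in> carrier G. h x \<in> W} G"
proof -
  have sW: "subgroup W H" "W \<noteq> carrier H" using W by (simp_all add: proper_subgroup_def)
  then obtain y where "y \<in> carrier H" "y \<notin> W" using subgroup.subset[OF sW(1)] by blast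
  then obtain x where "x \<in> carrier G" "h x \<notin> W" unfolding surj[symmetric] by blast
  then have "{x \<in> carrier G. h x \<in> W} \<noteq> carrier G" by blast
  then show ?thesis using preimage_subgroup[OF sW(1)] by (simp add: proper_subgroup_def)
qed

lemma mem_set_mult_iff: "x \<in> U <#>\<^bsub>G\<^esub> V \<longleftrightarrow> (\<exists>u\<in>U. \<exists>v\<in>V. x = u \<otimes>\<^bsub>G\<^esub> v)"
  unfolding set_mult_def by blast

lemma (in group_hom) preimage_set_mult:
  assumes V: "subgroup V H" and W: "subgroup W H" and surj: "h ` carrier G = carrier H"
  shows "{x \<in> carrier G. h x \<in> V} <#>\<^bsub>G\<^esub> {x \<in> carrier G. h x \<in> W} = carrier G \<longleftrightarrow> V <#>\<^bsub>H\<^esub> W = carrier H"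
    (is "?V <#>\<^bsub>G\<^esub> ?W = _ \<longleftrightarrow> _")
proof (rule iffI; rule equalityI)
  show "V <#>\<^bsub>H\<^esub> W \<subseteq> carrier H"
    by (rule H.set_mult_closed[OF subgroup.subset[OF V] subgroup.subset[OF W]])
  show "?V <#>\<^bsub>G\<^esub> ?W \<subseteq> carrier G" by (rule G.set_mult_closed) blast+
next
  assume eq: "?V <#>\<^bsub>G\<^esub> ?W = carrier G"
  show "carrier H \<subseteq> V <#>\<^bsub>H\<^esub> W"
  proof
    fix y assume "y \<in> carrier H"
    then obtain x where x: "x \<in> carrier G" "y = h x" unfolding surj[symmetric] by (rule imageE)
    have "x \<in> ?V <#>\<^bsub>G\<^esub> ?W" by (subst eq) (rule x(1))
    then obtain u v where uv: "u \<in> ?V" "v \<in> ?W" "x = u \<otimes>\<^bsub>G\<^esub> v"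
      unfolding mem_set_mult_iff by (elim bexE)
    then have "y = h u \<otimes>\<^bsub>H\<^esub> h v" using x by simp
    then show "y \<in> V <#>\<^bsub>H\<^esub> W" using uv unfolding mem_set_mult_iff by blast
  qed
next
  assume eq: "V <#>\<^bsub>H\<^esub> W = carrier H"
  show "carrier G \<subseteq> ?V <#>\<^bsub>G\<^esub> ?W"
  proof
    fix x assume x: "x \<in> carrier G"
    then have "h x \<in> V <#>\<^bsub>H\<^esub> W" unfolding eq by simp
    then obtain v w where vw: "v \<in> V" "w \<in> W" "h x = v \<otimes>\<^bsub>H\<^esub> w" unfolding mem_set_mult_iff by (elim bexE)
    then have c: "v \<in> carrier H" "w \<in> carrier H" using subgroup.mem_carrier[OF V] subgroup.mem_carrier[OF W] by simp_all
    obtain u where u: "u \<in> carrier G" "v = h u" using c(1) unfolding surj[symmetric] by (rule imageE)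
    have "h (inv\<^bsub>G\<^esub> u \<otimes>\<^bsub>G\<^esub> x) = inv\<^bsub>H\<^esub> v \<otimes>\<^bsub>H\<^esub> (v \<otimes>\<^bsub>H\<^esub> w)" using u x vw by simp
    also have "\<dots> = w" using c by (simp flip: H.m_assoc)
    finally have "inv\<^bsub>G\<^esub> u \<otimes>\<^bsub>G\<^esub> x \<in> ?W" using u x vw by simp
    moreover have "u \<in> ?V" using u vw by simp
    moreover have "x = u \<otimes>\<^bsub>G\<^esub> (inv\<^bsub>G\<^esub> u \<otimes>\<^bsub>G\<^esub> x)" using u x by (simp flip: G.m_assoc)
    ultimately show "x \<in> ?V <#>\<^bsub>G\<^esub> ?W" unfolding mem_set_mult_iff by blast
  qed
qed

lemma (in group_hom) preimage_inj:
  assumes "V \<subseteq> carrier H" "W \<subseteq> carrier H" "h ` carrier G = carrier H"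
    "{x \<in> carrier G. h x \<in> V} = {x \<in> carrier G. h x \<in> W}"
  shows "V = W"
proof -
  have "y \<in> V \<longleftrightarrow> y \<in> W" if "y \<in> carrier H" for y
  proof -
    obtain x where x: "x \<in> carrier G" "y = h x" using \<open>y \<in> carrier H\<close> unfolding assms(3)[symmetric] by (rule imageE)
    have "x \<in> {x \<in> carrier G. h x \<in> V} \<longleftrightarrow> x \<in> {x \<in> carrier G. h x \<in> W}"
      unfolding assms(4) ..
    then show ?thesis using x by simp
  qed
  then show ?thesis using assms(1,2) by (intro Set.set_eqI) (simp add: subset_iff, metis)
qed

text \<open>Taking preimages embeds the factorization graph of a quotient into that of the group.\<close>

lemma (in group_hom) independent_family_preimage:
  assumes surj: "h ` carrier G = carrier H" and S: "independent_family H \<S>"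
  shows "independent_family G ((\<lambda>W. {x \<in> carrier G. h x \<in> W}) ` \<S>)"
    "inj_on (\<lambda>W. {x \<in> carrier G. h x \<in> W}) \<S>"
proof -
  let ?p = "\<lambda>W. {x \<in> carrier G. h x \<in> W}"
  have pr: "proper_subgroup V H" if "V \<in> \<S>" for V using that S by (simp add: independent_family_def)
  have sub: "subgroup V H" "V \<subseteq> carrier H" if "V \<in> \<S>" for V
    using pr[OF that] by (simp_all add: proper_subgroup_def subgroup.subset)
  have indep: "V <#>\<^bsub>H\<^esub> W \<noteq> carrier H" if "V \<in> \<S>" "W \<in> \<S>" for V W
    using S that by (simp add: independent_family_def)
  show "independent_family G (?p ` \<S>)"
    unfolding independent_family_def
  proof (intro conjI ballI)
    fix V' assume "V' \<in> ?p ` \<S>"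
    then obtain V where V: "V \<in> \<S>" "V' = ?p V" by blast
    then show "proper_subgroup V' G" using preimage_proper[OF pr surj] by simp
    fix W' assume "W' \<in> ?p ` \<S>"
    then obtain W where W: "W \<in> \<S>" "W' = ?p W" by blast
    show "V' <#>\<^bsub>G\<^esub> W' \<noteq> carrier G"
      unfolding V(2) W(2) preimage_set_mult[OF sub(1)[OF V(1)] sub(1)[OF W(1)] surj]
      by (rule indep[OF V(1) W(1)])
  qed
  show "inj_on ?p \<S>" by (rule inj_onI) (rule preimage_inj[OF sub(2) sub(2) surj])
qed

lemma (in group_hom) star_free_epi:
  assumes surj: "h ` carrier G = carrier H" and sf: "star_free G"
  shows "star_free H"
  unfolding star_free_def
proof (intro allI impI, elim conjE)
  fix U \<S> assume U: "proper_subgroup U H" and S: "independent_family H \<S>" and US: "\<forall>V\<in>\<S>. U <#>\<^bsub>H\<^esub> V = carrier H"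
  let ?p = "\<lambda>W. {x \<in> carrier G. h x \<in> W}"
  note I = independent_family_preimage[OF surj S]
  have subU: "subgroup U H" using U by (simp add: proper_subgroup_def)
  have "\<forall>V\<in>?p ` \<S>. ?p U <#>\<^bsub>G\<^esub> V = carrier G"
  proof
    fix V' assume "V' \<in> ?p ` \<S>"
    then obtain V where V: "V \<in> \<S>" "V' = ?p V" by blast
    have "subgroup V H" using S V(1) by (simp add: independent_family_def proper_subgroup_def)
    then show "?p U <#>\<^bsub>G\<^esub> V' = carrier G"
      unfolding V(2) using preimage_set_mult[OF subU _ surj] US V(1) by simp
  qed
  then have "card (?p ` \<S>) \<le> 3"
    using sf[unfolded star_free_def, THEN spec, THEN spec, of "?p U" "?p ` \<S>"] I(1)
      preimage_proper[OF U surj] by simp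
  then show "card \<S> \<le> 3" using card_image[OF I(2)] by simp
qed

lemma star_free_iso:
  assumes "group G" "group H" "G \<cong> H" "star_free G"
  shows "star_free H"
proof -
  obtain h where h: "h \<in> iso G H" using assms(3) by (auto simp: is_iso_def)
  then interpret group_hom G H h
    using assms by (simp add: group_hom_def group_hom_axioms_def iso_def)
  show ?thesis using h assms(4) by (intro star_free_epi) (auto simp: iso_iff)
qed

section \<open>Cyclic subgroups and p-groups\<close>

abbreviation (in group) cyc :: "'a \<Rightarrow> 'a set" where
  "cyc x \<equiv> generate G {x}"

context fin_group begin

lemma cyc_subgroup: "x \<in> carrier G \<Longrightarrow> subgroup (cyc x) G"
  by (simp add: generate_is_subgroup)

lemma card_cyc: "x \<in> carrier G \<Longrightarrow> card (cyc x) = ord x"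
  by (rule generate_pow_card[symmetric])

lemma mem_cyc: "x \<in> cyc x"
  by (simp add: generate.incl)

lemma cyc_eq: "x \<in> carrier G \<Longrightarrow> cyc x = range (\<lambda>k::nat. x [^] k)"
  using generate_pow_on_finite_carrier[OF fin] by blast

lemma pow_mem_cyc: "x \<in> carrier G \<Longrightarrow> x [^] (k::nat) \<in> cyc x"
  by (simp add: cyc_eq)

lemma cyc_subset: "subgroup H G \<Longrightarrow> x \<in> H \<Longrightarrow> cyc x \<subseteq> H"
  using generate_subgroup_incl[of "{x}" H] by simp

lemma pow_mem_subgroup: "subgroup H G \<Longrightarrow> x \<in> H \<Longrightarrow> x [^] (k::nat) \<in> H"
  by (induction k) (auto simp: subgroup.one_closed subgroup.m_closed)

lemma ord_gt_0: "x \<in> carrier G \<Longrightarrow> ord x > 0"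
  using ord_ge_1[OF fin, of x] by simp

lemma cyc_eqI:
  assumes "subgroup H G" "x \<in> H" "card H \<le> ord x"
  shows "cyc x = H"
proof (rule card_seteq)
  show "finite H" using assms(1) by (rule finite_subgroup)
  show "cyc x \<subseteq> H" using assms by (intro cyc_subset)
  show "card H \<le> card (cyc x)" using assms by (simp add: card_cyc subgroup.mem_carrier)
qed

lemma ord_dvd_card: "subgroup H G \<Longrightarrow> x \<in> H \<Longrightarrow> ord x dvd card H"
  using card_subgroup_dvd_subgroup[OF cyc_subgroup _ cyc_subset, of x H]
  by (simp add: card_cyc subgroup.mem_carrier)

lemma proper_subgroup_of_pgroup:
  assumes p: "Factorial_Ring.prime (p::nat)" and P: "subgroup P G" "card P = p ^ k"
    and V: "subgroup V G" "V \<subseteq> P" "V \<noteq> P"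
  shows "p * card V dvd card P"
proof -
  obtain i where i: "card V = p ^ i" "i \<le> k"
    using card_subgroup_dvd_subgroup[OF V(1) P(1) V(2)] p P(2) divides_primepow_nat by metis
  have "card V \<noteq> card P" using V finite_subgroup[OF P(1)] by (metis card_subset_eq)
  then have "Suc i \<le> k" using i P by (metis le_antisym not_less_eq_eq)
  then show ?thesis unfolding i P(2) by (metis le_imp_power_dvd power_Suc)
qed

text \<open>A power \<open>x\<^sup>i\<close> outside \<open>\<langle>x\<^sup>p\<rangle>\<close> has \<open>i\<close> prime to \<open>p\<close>, so it generates.\<close>

lemma cyclic_pgroup_generator:
  assumes p: "Factorial_Ring.prime (p::nat)" and x: "x \<in> carrier G" "ord x = p ^ k"
    and y: "y \<in> cyc x" "y \<notin> cyc (x [^] p)"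
  shows "cyc y = cyc x"
proof -
  obtain i :: nat where i: "y = x [^] i" using y(1) x(1) by (auto simp: cyc_eq)
  have "\<not> p dvd i"
  proof
    assume "p dvd i"
    then obtain j where "i = p * j" by (elim dvdE)
    then have "y = (x [^] p) [^] j" using i x(1) by (simp add: nat_pow_pow)
    then have "y \<in> cyc (x [^] p)" using x(1) pow_mem_cyc[of "x [^] p" j] by simp
    then show False using y(2) by simp
  qed
  then have "coprime i (ord x)" using p x(2) by (metis coprime_commute coprime_power_left_iff prime_imp_coprime)
  then have "ord y = ord x" using pow_ord_eq_ord_iff[OF fin x(1)] i by simp
  then show ?thesis using y(1) x(1) cyc_subgroup[OF x(1)] by (intro cyc_eqI) (simp_all add: card_cyc)
qed

text \<open>A proper subgroup contains no generator and is therefore inside \<open>\<langle>x\<^sup>p\<rangle>\<close>, which has the same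
  order as \<open>H\<close>.\<close>

lemma cyclic_pgroup_maximal:
  assumes p: "Factorial_Ring.prime (p::nat)" and x: "x \<in> carrier G" "ord x = p ^ k"
    and H: "subgroup H G" "H \<subseteq> cyc x" "ord x = p * card H"
  shows "H = cyc (x [^] p)"
proof -
  have "H \<subseteq> cyc (x [^] p)"
  proof (rule ccontr)
    assume "\<not> H \<subseteq> cyc (x [^] p)"
    then obtain y where y: "y \<in> H" "y \<notin> cyc (x [^] p)" by blast
    then have "cyc y = cyc x" using cyclic_pgroup_generator[OF p x] H by blast
    then have "cyc x \<subseteq> H" using cyc_subset[OF H(1) y(1)] by simp
    then have "card H = ord x" using H x by (metis card_cyc subset_antisym)
    then show False using H(3) p card_subgroup_pos[OF H(1)] prime_gt_1_nat[OF p] by simp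
  qed
  moreover have "ord (x [^] p) = card H"
    using ord_pow[of x p] x(1) H(3) prime_gt_0_nat[OF p] by simp
  ultimately show ?thesis using x by (intro card_subset_eq) (simp_all add: finite_subgroup cyc_subgroup card_cyc)
qed

lemma cyclic_pgroup_outside:
  assumes p: "Factorial_Ring.prime (p::nat)" and x: "x \<in> carrier G" "ord x = p ^ k"
    and H: "subgroup H G" "H \<subseteq> cyc x" "ord x = p * card H" and y: "y \<in> cyc x" "y \<notin> H"
  shows "cyc y = cyc x"
  using cyclic_pgroup_generator[OF p x y(1)] cyclic_pgroup_maximal[OF p x H] y(2) by simp

text \<open>Every element of \<open>P\<close> outside \<open>Q\<close> generates one of the few subgroups not inside \<open>Q\<close>.  If
  none of these elements generates \<open>P\<close>, at most two proper subgroups, each of index at least \<open>p\<close>,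
  must cover \<open>P - Q\<close>; comparing sizes leaves only \<open>p = 2\<close> and two subgroups of index \<open>2\<close>.\<close>

lemma few_subgroups_outside:
  assumes p: "Factorial_Ring.prime (p::nat)" and P: "subgroup P G" "card P = p ^ k"
    and Q: "subgroup Q G" "Q \<subseteq> P" "card P = p * card Q"
    and few: "card {V. subgroup V G \<and> V \<subseteq> P \<and> \<not> V \<subseteq> Q} \<le> 3"
  shows "(\<forall>x\<in>P - Q. cyc x = P) \<or>
    (p = 2 \<and> (\<exists>A B. A \<noteq> B \<and> A \<noteq> P \<and> B \<noteq> P \<and> {V. subgroup V G \<and> V \<subseteq> P \<and> \<not> V \<subseteq> Q} = {P, A, B} \<and>
      2 * card A = card P \<and> 2 * card B = card P \<and> A \<in> cyc ` (P - Q) \<and> B \<in> cyc ` (P - Q) \<and>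
      (\<forall>x\<in>P - Q. cyc x = A \<or> cyc x = B)))"
proof (cases "\<exists>x\<in>P. cyc x = P")
  case True
  then obtain x where x: "x \<in> P" "cyc x = P" by blast
  then have xc: "x \<in> carrier G" using P by (simp add: subgroup.mem_carrier)
  then have o: "ord x = card P" using card_cyc x by metis
  have "cyc y = cyc x" if "y \<in> P - Q" for y
    by (rule cyclic_pgroup_outside[OF p xc]) (use that x o P Q in auto)
  then show ?thesis using x by blast
next
  case False
  let ?F = "{V. subgroup V G \<and> V \<subseteq> P \<and> \<not> V \<subseteq> Q}"
  let ?S = "cyc ` (P - Q)"
  have p1: "p > 1" using p by (rule prime_gt_1_nat)
  have posQ: "card Q > 0" using Q(1) by (rule card_subgroup_pos)
  have finP: "finite P" using P(1) by (rule finite_subgroup)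
  have finF: "finite ?F" using finite_subgroups by simp
  have "card P \<noteq> card Q" using Q(3) posQ p1 by simp
  then have PQ: "\<not> P \<subseteq> Q" using Q(2) by auto
  then have PF: "P \<in> ?F" using P by simp
  have SF: "?S \<subseteq> ?F - {P}"
  proof
    fix V assume "V \<in> ?S"
    then obtain x where x: "x \<in> P" "x \<notin> Q" "V = cyc x" by blast
    then have "subgroup V G" "V \<subseteq> P" using P(1) cyc_subset cyc_subgroup by (simp_all add: subgroup.mem_carrier)
    moreover have "\<not> V \<subseteq> Q" using x mem_cyc[of x] by blast
    moreover have "V \<noteq> P" using x False by blast
    ultimately show "V \<in> ?F - {P}" by blast
  qed
  then have finS: "finite ?S" using finF finite_subset by blast
  have "card ?S \<le> card (?F - {P})" using SF finF by (intro card_mono) simp_all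
  also have "\<dots> \<le> 2" using PF finF few by simp
  finally have S2: "card ?S \<le> 2" .
  \<comment> \<open>Only a fraction \<open>(p - 1)/p\<close> of a subgroup can avoid \<open>Q\<close>, as \<open>VQ\<close> stays inside \<open>P\<close>.\<close>
  have VQ: "card V \<le> card Q" "p * card (V - Q) \<le> (p - 1) * card V" if V: "V \<in> ?S" for V
  proof -
    have V': "subgroup V G" "V \<subseteq> P" "V \<noteq> P" using SF V by auto
    have "p * card V dvd card P" using proper_subgroup_of_pgroup[OF p P V'] .
    then have "p * card V \<le> card P" using card_subgroup_pos[OF P(1)] by (rule dvd_imp_le)
    then show "card V \<le> card Q" using Q(3) p1 by simp
    have "card (V <#> Q) \<le> card P" using set_mult_subset_subgroup[OF P(1) V'(2) Q(2)] finP by (rule card_mono[rotated])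
    then have "card (V <#> Q) * card (V \<inter> Q) \<le> p * card Q * card (V \<inter> Q)" unfolding Q(3) by (rule mult_right_mono) simp
    then have "card V * card Q \<le> p * card (V \<inter> Q) * card Q" unfolding card_set_mult[OF V'(1) Q(1)] by (simp add: ac_simps)
    then have "card V \<le> p * card (V \<inter> Q)" using posQ by simp
    moreover have "card (V - Q) = card V - card (V \<inter> Q)" using V'(1) finite_subgroup by (intro card_Diff_subset_Int) simp
    ultimately show "p * card (V - Q) \<le> (p - 1) * card V"
      by (simp add: diff_mult_distrib diff_mult_distrib2)
  qed
  have "P - Q \<subseteq> (\<Union>V\<in>?S. V - Q)" using mem_cyc by blast
  then have "card (P - Q) \<le> card (\<Union>V\<in>?S. V - Q)"
    by (rule card_mono[rotated]) (use finS SF finite_subgroup in blast)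
  also have "\<dots> \<le> (\<Sum>V\<in>?S. card (V - Q))" using finS by (rule card_UN_le)
  finally have "p * card (P - Q) \<le> (\<Sum>V\<in>?S. p * card (V - Q))" by (simp flip: sum_distrib_left)
  also have "\<dots> \<le> (\<Sum>V\<in>?S. (p - 1) * card V)" by (rule sum_mono) (rule VQ(2))
  also have "\<dots> = (p - 1) * (\<Sum>V\<in>?S. card V)" by (simp add: sum_distrib_left)
  finally have "p * card (P - Q) \<le> (p - 1) * (\<Sum>V\<in>?S. card V)" .
  moreover have "card (P - Q) = (p - 1) * card Q"
    using Q finite_subgroup[OF Q(1)] by (simp add: card_Diff_subset diff_mult_distrib)
  ultimately have "(p - 1) * (p * card Q) \<le> (p - 1) * (\<Sum>V\<in>?S. card V)" by (simp add: ac_simps)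
  then have big: "p * card Q \<le> (\<Sum>V\<in>?S. card V)" using p1 by simp
  also have "\<dots> \<le> card ?S * card Q" using sum_bounded_above[of ?S card "card Q"] VQ(1) by simp
  finally have "p \<le> card ?S" using posQ by simp
  with S2 p1 have p2: "p = 2" "card ?S = 2" by simp_all
  from p2(2) obtain A B where AB: "?S = {A, B}" "A \<noteq> B" unfolding card_2_iff by blast
  have "2 * card Q \<le> card A + card B" using big AB p2 by simp
  moreover have "card A \<le> card Q" "card B \<le> card Q" using VQ(1) AB by auto
  ultimately have cAB: "card A = card Q" "card B = card Q" by simp_all
  have ABF: "A \<in> ?F - {P}" "B \<in> ?F - {P}" using SF AB by auto
  then have neP: "A \<noteq> P" "B \<noteq> P" using DiffD2[OF ABF(1)] DiffD2[OF ABF(2)] by simp_all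
  have "{P, A, B} = ?F"
  proof (rule card_seteq[OF finF])
    show "{P, A, B} \<subseteq> ?F"
      unfolding insert_subset using PF DiffD1[OF ABF(1)] DiffD1[OF ABF(2)] by (intro conjI empty_subsetI)
    have "card {P, A, B} = 3" using AB(2) neP by (simp add: card_insert_if not_sym)
    then show "card ?F \<le> card {P, A, B}" using few by simp
  qed
  moreover have "\<forall>x\<in>P - Q. cyc x = A \<or> cyc x = B" using AB(1) by blast
  moreover have "A \<in> ?S" "B \<in> ?S" using AB(1) by auto
  moreover have "2 * card A = card P" "2 * card B = card P" using cAB Q(3) p2(1) by simp_all
  ultimately show ?thesis using AB(2) neP p2(1) by (intro disjI2 conjI exI[of _ A] exI[of _ B]) (assumption | simp only:)+
qed

end

section \<open>Recognizing split and non-split metacyclic groups\<close>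

text \<open>The group with generators \<open>a\<close>, \<open>b\<close> and relations \<open>a\<^sup>m = 1\<close>, \<open>b\<^sup>n = a\<^sup>k\<close>, \<open>b\<^sup>-\<^sup>1ab = a\<^sup>e\<close>, under the condition
  that no further collapse occurs.\<close>

definition metacyclic :: "('a, 'b) monoid_scheme \<Rightarrow> nat \<Rightarrow> nat \<Rightarrow> nat \<Rightarrow> nat \<Rightarrow> 'a \<Rightarrow> 'a \<Rightarrow> bool" where
  "metacyclic G m n k e a b \<longleftrightarrow> a \<in> carrier G \<and> b \<in> carrier G \<and> 0 < m \<and> 0 < n \<and> order G = m * n \<and>
     a [^]\<^bsub>G\<^esub> m = \<one>\<^bsub>G\<^esub> \<and> b [^]\<^bsub>G\<^esub> n = a [^]\<^bsub>G\<^esub> k \<and> a \<otimes>\<^bsub>G\<^esub> b = b \<otimes>\<^bsub>G\<^esub> a [^]\<^bsub>G\<^esub> e \<and>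
     (\<forall>x\<in>carrier G. \<exists>(j::nat) (i::nat). x = b [^]\<^bsub>G\<^esub> j \<otimes>\<^bsub>G\<^esub> a [^]\<^bsub>G\<^esub> i)"

context group begin

lemma pow_twist:
  assumes a: "a \<in> carrier G" and b: "b \<in> carrier G" and tw: "a \<otimes> b = b \<otimes> a [^] (e::nat)"
  shows "a [^] (i::nat) \<otimes> b [^] (j::nat) = b [^] j \<otimes> a [^] (i * e ^ j)"
proof -
  have 1: "a [^] i \<otimes> b = b \<otimes> a [^] (i * e)" for i :: nat
  proof (induction i)
    case (Suc i)
    have "a [^] Suc i \<otimes> b = a [^] i \<otimes> (a \<otimes> b)" using a b by (simp add: m_assoc)
    also have "\<dots> = a [^] i \<otimes> b \<otimes> a [^] e" using a b tw by (simp add: m_assoc)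
    also have "\<dots> = b \<otimes> (a [^] (i * e) \<otimes> a [^] e)" using a b Suc by (simp add: m_assoc)
    finally show ?case using a by (simp add: nat_pow_mult add.commute)
  qed (use a b in simp)
  show ?thesis
  proof (induction j)
    case (Suc j)
    have "a [^] i \<otimes> b [^] Suc j = (a [^] i \<otimes> b [^] j) \<otimes> b" using a b by (simp add: m_assoc)
    also have "\<dots> = b [^] j \<otimes> (a [^] (i * e ^ j) \<otimes> b)" using a b Suc by (simp add: m_assoc)
    also have "\<dots> = b [^] Suc j \<otimes> a [^] (i * e ^ j * e)" using a b 1 by (simp add: m_assoc)
    finally show ?case by (simp add: ac_simps)
  qed (use a b in simp)
qed

lemma metacyclic_mult:
  assumes "metacyclic G m n k e a b"
  shows "(b [^] (j::nat) \<otimes> a [^] (i::nat)) \<otimes> (b [^] (l::nat) \<otimes> a [^] (h::nat)) = b [^] (j + l) \<otimes> a [^] (i * e ^ l + h)"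
proof -
  have ab: "a \<in> carrier G" "b \<in> carrier G" "a \<otimes> b = b \<otimes> a [^] e" using assms by (auto simp: metacyclic_def)
  have "(b [^] j \<otimes> a [^] i) \<otimes> (b [^] l \<otimes> a [^] h) = b [^] j \<otimes> (a [^] i \<otimes> b [^] l) \<otimes> a [^] h"
    using ab by (simp add: m_assoc)
  also have "\<dots> = (b [^] j \<otimes> b [^] l) \<otimes> (a [^] (i * e ^ l) \<otimes> a [^] h)"
    using ab pow_twist[OF ab] by (simp add: m_assoc)
  finally show ?thesis using ab by (simp add: nat_pow_mult)
qed

lemma metacyclic_reduce:
  assumes "metacyclic G m n k e a b"
  shows "b [^] (j::nat) \<otimes> a [^] (i::nat) = b [^] (j mod n) \<otimes> a [^] ((k * (j div n) + i) mod m)"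
proof -
  have ab: "a \<in> carrier G" "b \<in> carrier G" "a [^] m = \<one>" "b [^] n = a [^] k" using assms by (auto simp: metacyclic_def)
  have "b [^] j = b [^] (j mod n) \<otimes> (b [^] n) [^] (j div n)" using ab(2) by (simp add: nat_pow_pow nat_pow_mult)
  also have "\<dots> = b [^] (j mod n) \<otimes> a [^] (k * (j div n))" using ab by (simp add: nat_pow_pow)
  finally have 1: "b [^] j \<otimes> a [^] i = b [^] (j mod n) \<otimes> a [^] (k * (j div n) + i)"
    using ab by (simp add: m_assoc nat_pow_mult)
  have 2: "a [^] s = a [^] (s mod m)" for s :: nat
  proof -
    have "a [^] s = (a [^] m) [^] (s div m) \<otimes> a [^] (s mod m)" using ab(1) by (simp only: nat_pow_pow nat_pow_mult mult_div_mod_eq)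
    then show ?thesis using ab by simp
  qed
  show ?thesis unfolding 1 by (subst 2) simp
qed

text \<open>There are at most \<open>mn\<close> reduced products, so by counting they are pairwise distinct.\<close>

lemma metacyclic_eq_iff:
  assumes M: "metacyclic G m n k e a b"
  shows "b [^] (j::nat) \<otimes> a [^] (i::nat) = b [^] (l::nat) \<otimes> a [^] (h::nat) \<longleftrightarrow>
    j mod n = l mod n \<and> (k * (j div n) + i) mod m = (k * (l div n) + h) mod m"
proof -
  let ?f = "\<lambda>(j::nat, i::nat). b [^] j \<otimes> a [^] i"
  have m: "0 < m" "0 < n" "order G = m * n" and ab: "a \<in> carrier G" "b \<in> carrier G" using M by (auto simp: metacyclic_def)
  have "?f ` ({..<n} \<times> {..<m}) = carrier G"
  proof
    show "?f ` ({..<n} \<times> {..<m}) \<subseteq> carrier G" using ab by auto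
    show "carrier G \<subseteq> ?f ` ({..<n} \<times> {..<m})"
    proof
      fix x assume "x \<in> carrier G"
      then obtain j i :: nat where "x = b [^] j \<otimes> a [^] i" using M unfolding metacyclic_def by blast
      then have "x = ?f (j mod n, (k * (j div n) + i) mod m)" using metacyclic_reduce[OF M] by simp
      then show "x \<in> ?f ` ({..<n} \<times> {..<m})" by (rule image_eqI) (use m in simp)
    qed
  qed
  then have "card (?f ` ({..<n} \<times> {..<m})) = card ({..<n} \<times> {..<m})"
    using m by (simp add: order_def card_cartesian_product)
  then have inj: "inj_on ?f ({..<n} \<times> {..<m})" by (intro eq_card_imp_inj_on) simp_all
  have "b [^] j \<otimes> a [^] i = b [^] l \<otimes> a [^] h \<longleftrightarrow>
      ?f (j mod n, (k * (j div n) + i) mod m) = ?f (l mod n, (k * (l div n) + h) mod m)"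
    using metacyclic_reduce[OF M, of j i] metacyclic_reduce[OF M, of l h] by simp
  also have "\<dots> \<longleftrightarrow> (j mod n, (k * (j div n) + i) mod m) = (l mod n, (k * (l div n) + h) mod m)"
    using m by (intro inj_on_eq_iff[OF inj]) simp_all
  finally show ?thesis by simp
qed

end

text \<open>The parameters determine the multiplication table.\<close>

theorem metacyclic_iso:
  assumes "group G" "group H" and M: "metacyclic G m n k e a b" and M': "metacyclic H m n k e a' b'"
  shows "G \<cong> H"
proof -
  interpret G: group G by fact
  interpret H: group H by fact
  have ab: "a \<in> carrier G" "b \<in> carrier G" and ab': "a' \<in> carrier H" "b' \<in> carrier H"
    using M M' by (auto simp: metacyclic_def)
  define w where "w j i = b [^]\<^bsub>G\<^esub> j \<otimes>\<^bsub>G\<^esub> a [^]\<^bsub>G\<^esub> i" for j i :: nat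
  define w' where "w' j i = b' [^]\<^bsub>H\<^esub> j \<otimes>\<^bsub>H\<^esub> a' [^]\<^bsub>H\<^esub> i" for j i :: nat
  have eq: "w j i = w l h \<longleftrightarrow> w' j i = w' l h" for j i l h
    unfolding w_def w'_def G.metacyclic_eq_iff[OF M] H.metacyclic_eq_iff[OF M'] ..
  have ex: "\<exists>j i. x = w j i" if "x \<in> carrier G" for x using that M unfolding metacyclic_def w_def by blast
  have ex': "\<exists>j i. x = w' j i" if "x \<in> carrier H" for x using that M' unfolding metacyclic_def w'_def by blast
  have wc: "w j i \<in> carrier G" "w' j i \<in> carrier H" for j i using ab ab' by (simp_all add: w_def w'_def)
  define f where "f x = (let ji = (SOME ji. x = w (fst ji) (snd ji)) in w' (fst ji) (snd ji))" for x
  have f: "f (w j i) = w' j i" for j i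
  proof -
    let ?P = "\<lambda>ji. w j i = w (fst ji) (snd ji)"
    have "?P (SOME ji. ?P ji)" by (rule someI[of ?P "(j, i)"]) simp
    then show ?thesis unfolding f_def Let_def by (subst eq[symmetric]) simp
  qed
  have "f \<in> hom G H"
  proof (rule homI)
    fix x assume "x \<in> carrier G"
    then obtain j i where x: "x = w j i" using ex by blast
    then show "f x \<in> carrier H" using f wc by simp
    fix y assume "y \<in> carrier G"
    then obtain l h where y: "y = w l h" using ex by blast
    have "x \<otimes>\<^bsub>G\<^esub> y = w (j + l) (i * e ^ l + h)"
      unfolding x y w_def by (rule G.metacyclic_mult[OF M])
    moreover have "w' j i \<otimes>\<^bsub>H\<^esub> w' l h = w' (j + l) (i * e ^ l + h)"
      unfolding w'_def by (rule H.metacyclic_mult[OF M'])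
    ultimately show "f (x \<otimes>\<^bsub>G\<^esub> y) = f x \<otimes>\<^bsub>H\<^esub> f y" using x y f by simp
  qed
  moreover have "inj_on f (carrier G)"
  proof (rule inj_onI)
    fix x y assume "x \<in> carrier G" "y \<in> carrier G" and fxy: "f x = f y"
    then obtain j i l h where "x = w j i" "y = w l h" using ex by blast
    then show "x = y" using fxy f eq by simp
  qed
  moreover have "f ` carrier G = carrier H"
  proof (intro equalityI subsetI)
    fix z assume "z \<in> f ` carrier G"
    then show "z \<in> carrier H" using \<open>f \<in> hom G H\<close> by (auto simp: hom_def)
  next
    fix z assume "z \<in> carrier H"
    then obtain j i where "z = w' j i" using ex' by blast
    then show "z \<in> f ` carrier G" by (intro image_eqI[of _ _ "w j i"]) (simp_all add: f wc)
  qed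
  ultimately have "f \<in> iso G H" by (simp add: iso_def bij_betw_def)
  then show ?thesis by (rule is_isoI)
qed

section \<open>Models of the target groups\<close>

lemma DirProd_nat_pow: "(x, y) [^]\<^bsub>G \<times>\<times> H\<^esub> (n::nat) = (x [^]\<^bsub>G\<^esub> n, y [^]\<^bsub>H\<^esub> n)"
  by (induction n) simp_all

lemma metacyclic_DirProd:
  assumes "0 < m" "0 < n"
  shows "metacyclic (integer_mod_group m \<times>\<times> integer_mod_group n) m n 0 1 (1 mod int m, 0) (0, 1 mod int n)"
  unfolding metacyclic_def
proof (intro conjI ballI)
  show "order (integer_mod_group m \<times>\<times> integer_mod_group n) = m * n"
    using assms by (simp add: order_def carrier_integer_mod_group card_cartesian_product)
  fix x assume "x \<in> carrier (integer_mod_group m \<times>\<times> integer_mod_group n)"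
  then obtain u v where x: "x = (u, v)" "0 \<le> u" "u < int m" "0 \<le> v" "v < int n"
    using assms by (auto simp: carrier_integer_mod_group)
  then show "\<exists>(j::nat) (i::nat). x = (0, 1 mod int n) [^]\<^bsub>integer_mod_group m \<times>\<times> integer_mod_group n\<^esub> j \<otimes>\<^bsub>integer_mod_group m \<times>\<times> integer_mod_group n\<^esub>
      (1 mod int m, 0) [^]\<^bsub>integer_mod_group m \<times>\<times> integer_mod_group n\<^esub> i"
    by (intro exI[of _ "nat v"] exI[of _ "nat u"]) (simp add: DirProd_nat_pow mod_mult_right_eq)
qed (use assms in \<open>simp_all add: carrier_integer_mod_group DirProd_nat_pow mod_mult_right_eq\<close>)

lemma metacyclic_quaternion: "metacyclic quaternion_group 4 2 2 3 (0, 1, 0, 0) (0, 0, 1, 0)"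
proof -
  let ?Q = quaternion_group and ?i = "(0, 1, 0, 0) :: int \<times> int \<times> int \<times> int" and ?j = "(0, 0, 1, 0) :: int \<times> int \<times> int \<times> int"
  have m: "monoid.mult ?Q = quat_mult" "\<one>\<^bsub>?Q\<^esub> = (1, 0, 0, 0)" by (simp_all add: quaternion_group_def)
  have i: "?i [^]\<^bsub>?Q\<^esub> (0::nat) = (1, 0, 0, 0)" "?i [^]\<^bsub>?Q\<^esub> (1::nat) = ?i" "?i [^]\<^bsub>?Q\<^esub> (2::nat) = (-1, 0, 0, 0)"
      "?i [^]\<^bsub>?Q\<^esub> (3::nat) = (0, -1, 0, 0)" "?i [^]\<^bsub>?Q\<^esub> (4::nat) = (1, 0, 0, 0)"
    by (simp_all add: numeral_eq_Suc m)
  have j: "?j [^]\<^bsub>?Q\<^esub> (0::nat) = (1, 0, 0, 0)" "?j [^]\<^bsub>?Q\<^esub> (1::nat) = ?j" "?j [^]\<^bsub>?Q\<^esub> (2::nat) = (-1, 0, 0, 0)"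
    by (simp_all add: numeral_eq_Suc m)
  have all: "\<exists>(l::nat) (h::nat). x = ?j [^]\<^bsub>?Q\<^esub> l \<otimes>\<^bsub>?Q\<^esub> ?i [^]\<^bsub>?Q\<^esub> h" if "x \<in> carrier ?Q" for x
  proof -
    have w: "x = ?j [^]\<^bsub>?Q\<^esub> l \<otimes>\<^bsub>?Q\<^esub> ?i [^]\<^bsub>?Q\<^esub> h \<Longrightarrow> ?thesis" for l h :: nat by blast
    have "x \<in> {(1, 0, 0, 0), (-1, 0, 0, 0), (0, 1, 0, 0), (0, -1, 0, 0), (0, 0, 1, 0), (0, 0, -1, 0), (0, 0, 0, 1), (0, 0, 0, -1)}"
      using that by (simp add: quaternion_group_def)
    then consider "x = (1, 0, 0, 0)" | "x = (-1, 0, 0, 0)" | "x = (0, 1, 0, 0)" | "x = (0, -1, 0, 0)"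
      | "x = (0, 0, 1, 0)" | "x = (0, 0, -1, 0)" | "x = (0, 0, 0, 1)" | "x = (0, 0, 0, -1)" by blast
    then show ?thesis
    proof cases
      case 1 show ?thesis by (rule w[of 0 0]) (simp only: i j m 1, simp)
    next
      case 2 show ?thesis by (rule w[of 0 2]) (simp only: i j m 2, simp)
    next
      case 3 show ?thesis by (rule w[of 0 1]) (simp only: i j m 3, simp)
    next
      case 4 show ?thesis by (rule w[of 0 3]) (simp only: i j m 4, simp)
    next
      case 5 show ?thesis by (rule w[of 1 0]) (simp only: i j m 5, simp)
    next
      case 6 show ?thesis by (rule w[of 1 2]) (simp only: i j m 6, simp)
    next
      case 7 show ?thesis by (rule w[of 1 3]) (simp only: i j m 7, simp)
    next
      case 8 show ?thesis by (rule w[of 1 1]) (simp only: i j m 8, simp)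
    qed
  qed
  have "order ?Q = 4 * 2" by (simp add: order_def quaternion_group_def)
  moreover have "?i \<otimes>\<^bsub>?Q\<^esub> ?j = ?j \<otimes>\<^bsub>?Q\<^esub> ?i [^]\<^bsub>?Q\<^esub> (3::nat)" by (simp only: i m) simp
  moreover have "?i \<in> carrier ?Q" "?j \<in> carrier ?Q" by (simp_all add: quaternion_group_def)
  ultimately show ?thesis unfolding metacyclic_def using all i(5) i(3) j(3) m(2) by simp
qed

context fin_group begin

lemma metacyclicI:
  assumes "a \<in> carrier G" "b \<in> carrier G" "0 < m" "0 < n" "order G = m * n" "a [^] m = \<one>" "b [^] n = a [^] k"
    "a \<otimes> b = b \<otimes> a [^] e" "cyc b <#> cyc a = carrier G"
  shows "metacyclic G m n k e a b"
  unfolding metacyclic_def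
proof (intro conjI ballI)
  fix x assume "x \<in> carrier G"
  then have "x \<in> cyc b <#> cyc a" using assms(9) by simp
  then obtain u v where "u \<in> cyc b" "v \<in> cyc a" "x = u \<otimes> v" by (rule set_multE)
  then show "\<exists>(j::nat) (i::nat). x = b [^] j \<otimes> a [^] i" using assms(1,2) by (auto simp: cyc_eq)
qed (use assms in simp_all)

section \<open>Groups of prime power order\<close>

text \<open>In a p-group the orders have no divisors between \<open>1\<close> and the index \<open>p\<close>.\<close>

lemma pgroup_prime_index_normal:
  assumes p: "Factorial_Ring.prime (p::nat)" and G: "order G = p ^ k" and H: "subgroup H G" "order G = p * card H"
  shows "H \<lhd> G"
proof (rule normal_if_index_le_divisors[OF H prime_gt_1_nat[OF p]])
  fix d assume d: "d dvd card H" "d > 1"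
  have "d dvd p ^ k" using d(1) H(2) G by (metis dvd_mult)
  then obtain i where i: "d = p ^ i" using p divides_primepow_nat by blast
  then have "i \<noteq> 0" using d(2) by (metis power_0 less_irrefl)
  then show "p \<le> d" unfolding i using prime_ge_1_nat[OF p] by (simp add: self_le_power)
qed

text \<open>Collecting powers of \<open>bc\<close> when \<open>cb = bcf\<close> with \<open>f\<close> central costs one \<open>f\<close> per transposition.\<close>

lemma pow_mult_central:
  assumes "b \<in> carrier G" "c \<in> carrier G" "f \<in> carrier G"
    and cb: "c \<otimes> b = b \<otimes> c \<otimes> f" and fb: "f \<otimes> b = b \<otimes> f" and fc: "f \<otimes> c = c \<otimes> f"
  shows "(b \<otimes> c) [^] (n::nat) = b [^] n \<otimes> c [^] n \<otimes> f [^] (\<Sum>i<n. i)"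
proof -
  have cn: "c [^] n \<otimes> b = b \<otimes> c [^] n \<otimes> f [^] n" for n :: nat
  proof (induction n)
    case (Suc n)
    have "c [^] Suc n \<otimes> b = c [^] n \<otimes> (c \<otimes> b)" using assms by (simp add: m_assoc)
    also have "\<dots> = (c [^] n \<otimes> b) \<otimes> (c \<otimes> f)" using assms(1-3) cb by (simp add: m_assoc)
    also have "\<dots> = b \<otimes> c [^] n \<otimes> (f [^] n \<otimes> c) \<otimes> f" using assms(1-3) Suc by (simp add: m_assoc)
    also have "f [^] n \<otimes> c = c \<otimes> f [^] n" using fc assms by (intro group_commutes_pow)
    finally show ?case using assms(1-3) by (simp add: m_assoc)
  qed (use assms in simp)
  show ?thesis
  proof (induction n)
    case (Suc n)
    let ?T = "\<Sum>i<n. i"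
    have "(b \<otimes> c) [^] Suc n = b [^] n \<otimes> c [^] n \<otimes> (f [^] ?T \<otimes> b) \<otimes> c" using assms(1-3) Suc by (simp add: m_assoc)
    also have "f [^] ?T \<otimes> b = b \<otimes> f [^] ?T" using fb assms by (intro group_commutes_pow)
    also have "b [^] n \<otimes> c [^] n \<otimes> (b \<otimes> f [^] ?T) \<otimes> c = b [^] n \<otimes> (c [^] n \<otimes> b) \<otimes> (f [^] ?T \<otimes> c)"
      using assms(1-3) by (simp add: m_assoc)
    also have "f [^] ?T \<otimes> c = c \<otimes> f [^] ?T" using fc assms by (intro group_commutes_pow)
    also have "b [^] n \<otimes> (c [^] n \<otimes> b) \<otimes> (c \<otimes> f [^] ?T) = b [^] Suc n \<otimes> c [^] n \<otimes> (f [^] n \<otimes> c) \<otimes> f [^] ?T"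
      using assms(1-3) cn by (simp add: m_assoc)
    also have "f [^] n \<otimes> c = c \<otimes> f [^] n" using fc assms by (intro group_commutes_pow)
    also have "b [^] Suc n \<otimes> c [^] n \<otimes> (c \<otimes> f [^] n) \<otimes> f [^] ?T = b [^] Suc n \<otimes> c [^] Suc n \<otimes> (f [^] n \<otimes> f [^] ?T)"
      using assms(1-3) by (simp add: m_assoc)
    finally show ?case using assms(1-3) by (simp add: nat_pow_mult add.commute)
  qed (use assms in simp)
qed

lemma cyc_commute: "x \<in> carrier G \<Longrightarrow> u \<in> cyc x \<Longrightarrow> v \<in> cyc x \<Longrightarrow> u \<otimes> v = v \<otimes> u"
  by (auto simp: cyc_eq nat_pow_mult add.commute)

text \<open>Two cyclic subgroups \<open>\<langle>a\<rangle>, \<langle>b\<rangle>\<close> of index \<open>p\<close> meet in a central subgroup \<open>D = \<langle>a\<^sup>p\<rangle> = \<langle>b\<^sup>p\<rangle>\<close>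
  containing all commutators.  Correcting \<open>b\<close> by a power of \<open>a\<close> gives an element \<open>t\<close> outside
  \<open>\<langle>a\<rangle>\<close> with \<open>t\<^sup>p\<close> a power of the commutator, so \<open>t\<close> has small order; the assumption that
  elements outside \<open>\<langle>a\<rangle>\<close> have large order then bounds \<open>|G|\<close> by \<open>p\<^sup>2\<close> for odd \<open>p\<close> and by \<open>16\<close> for
  \<open>p = 2\<close>.  A further correction of \<open>t\<close> gives an involution outside \<open>\<langle>a\<rangle>\<close> and excludes order \<open>16\<close>.\<close>

lemma two_cyclic_maximal:
  assumes p: "Factorial_Ring.prime (p::nat)" and G: "order G = p ^ k"
    and ab: "a \<in> carrier G" "b \<in> carrier G" "order G = p * ord a" "order G = p * ord b" "b \<notin> cyc a"
    and large: "\<And>x. x \<in> carrier G \<Longrightarrow> x \<notin> cyc a \<Longrightarrow> order G \<le> p * ord x \<or> p = 2 \<and> order G \<le> 4 * ord x"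
  shows "G \<cong> integer_mod_group p \<times>\<times> integer_mod_group p \<or>
    p = 2 \<and> (G \<cong> quaternion_group \<or>
      G \<cong> integer_mod_group 4 \<times>\<times> integer_mod_group 2 \<and> (\<exists>x\<in>carrier G - cyc a. 2 * ord x < order G))"
proof -
  let ?A = "cyc a" and ?B = "cyc b"
  define D where "D = ?A \<inter> ?B"
  have p1: "p > 1" using p by (rule prime_gt_1_nat)
  have sA: "subgroup ?A G" "subgroup ?B G" using ab cyc_subgroup by simp_all
  have nA: "?A \<lhd> G" "?B \<lhd> G"
    using pgroup_prime_index_normal[OF p G sA(1)] pgroup_prime_index_normal[OF p G sA(2)] ab(3,4)
    by (simp_all only: card_cyc[OF ab(1)] card_cyc[OF ab(2)])
  have BA: "\<not> ?B \<subseteq> ?A" using ab(5) mem_cyc[of b] by blast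
  have AB: "?A <#> ?B = carrier G" and cB: "ord b = p * card D"
    using prime_index_supplement[OF p nA(1) _ sA(2) BA] ab by (simp_all add: card_cyc D_def)
  have sD: "subgroup D G" unfolding D_def using sA by (rule subgroups_Inter_pair)
  have oab: "ord a = ord b" using ab p1 by simp
  obtain l where l: "ord a = p ^ l" "ord b = p ^ l"
    using ab(3) G oab p divides_primepow_nat[OF p, of "ord a" k] by auto
  have Da: "D = cyc (a [^] p)" by (rule cyclic_pgroup_maximal[OF p ab(1) l(1) sD]) (use cB oab in \<open>auto simp: D_def\<close>)
  have Db: "D = cyc (b [^] p)" by (rule cyclic_pgroup_maximal[OF p ab(2) l(2) sD]) (use cB in \<open>auto simp: D_def\<close>)
  have Dcomm: "x \<otimes> a = a \<otimes> x" "x \<otimes> b = b \<otimes> x" if "x \<in> D" for x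
    using that cyc_commute[OF ab(1) _ mem_cyc] cyc_commute[OF ab(2) _ mem_cyc] by (simp_all add: D_def)
  define d where "d = inv a \<otimes> inv b \<otimes> a \<otimes> b"
  have dc: "d \<in> carrier G" using ab by (simp add: d_def)
  have abd: "a \<otimes> b = b \<otimes> a \<otimes> d" using ab(1,2) by (simp add: d_def word_simps)
  have dD: "d \<in> D"
  proof -
    have "inv b \<otimes> a \<otimes> b \<in> ?A" using normal.inv_op_closed1[OF nA(1) ab(2) mem_cyc] .
    then have "inv a \<otimes> (inv b \<otimes> a \<otimes> b) \<in> ?A" using sA(1) mem_cyc[of a] by (simp add: subgroup.m_closed subgroup.m_inv_closed)
    moreover have "inv a \<otimes> inv b \<otimes> a \<in> ?B"
      using normal.inv_op_closed1[OF nA(2) ab(1), of "inv b"] sA(2) mem_cyc[of b] by (simp add: subgroup.m_inv_closed)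
    then have "inv a \<otimes> inv b \<otimes> a \<otimes> b \<in> ?B" using sA(2) mem_cyc[of b] by (simp add: subgroup.m_closed)
    ultimately show ?thesis using ab by (simp add: D_def d_def m_assoc)
  qed
  have dcom: "d \<otimes> a = a \<otimes> d" "d \<otimes> b = b \<otimes> d" using Dcomm dD by simp_all
  have twist: "a [^] i \<otimes> b = b \<otimes> a [^] i \<otimes> d [^] i" for i :: nat
  proof (induction i)
    case (Suc i)
    have "a [^] Suc i \<otimes> b = a [^] i \<otimes> (a \<otimes> b)" using ab by (simp add: m_assoc)
    also have "\<dots> = (a [^] i \<otimes> b) \<otimes> (a \<otimes> d)" using ab(1,2) dc abd by (simp add: m_assoc)
    also have "\<dots> = b \<otimes> a [^] i \<otimes> (d [^] i \<otimes> a) \<otimes> d" using ab(1,2) dc Suc by (simp add: m_assoc)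
    also have "d [^] i \<otimes> a = a \<otimes> d [^] i" using dcom ab dc by (intro group_commutes_pow)
    finally show ?case using ab(1,2) dc by (simp add: m_assoc)
  qed (use ab in simp)
  \<comment> \<open>The commutator \<open>d\<close> is central, and \<open>a\<^sup>p\<close> is central too, so \<open>d\<^sup>p = [a\<^sup>p, b] = 1\<close>.\<close>
  have dp: "d [^] p = \<one>"
  proof -
    have "b \<otimes> a [^] p \<otimes> d [^] p = b \<otimes> a [^] p" using twist[of p] Dcomm(2)[of "a [^] p"] Da mem_cyc[of "a [^] p"] by simp
    then show ?thesis using ab dc by simp
  qed
  obtain j :: nat where j: "b [^] p = a [^] (p * j)"
    using mem_cyc[of "b [^] p"] ab unfolding Db[symmetric] Da by (auto simp: cyc_eq nat_pow_pow)
  \<comment> \<open>The exponent \<open>i\<close> stands for \<open>-j\<close>: it makes \<open>a\<^sup>i\<^sup>p\<close> the inverse of \<open>b\<^sup>p\<close>.\<close>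
  define i where "i = (ord a - 1) * j"
  define t where "t = b \<otimes> a [^] i"
  have tc: "t \<in> carrier G" using ab by (simp add: t_def)
  have tA: "t \<notin> ?A"
  proof
    assume "t \<in> ?A"
    moreover have "b = t \<otimes> inv (a [^] i)" using ab by (simp add: t_def word_simps)
    ultimately have "b \<in> ?A" using sA(1) pow_mem_cyc[OF ab(1), of i] by (simp add: subgroup.m_closed subgroup.m_inv_closed)
    then show False using ab by simp
  qed
  have "(t [^] n) = b [^] n \<otimes> (a [^] i) [^] n \<otimes> (d [^] i) [^] (\<Sum>i<n. i)" for n :: nat
    unfolding t_def
  proof (rule pow_mult_central)
    show "d [^] i \<otimes> b = b \<otimes> d [^] i" using dcom ab dc by (intro group_commutes_pow)
    have "d \<otimes> a [^] i = a [^] i \<otimes> d" using dcom ab dc group_commutes_pow[of a d i] by simp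
    then show "d [^] i \<otimes> a [^] i = a [^] i \<otimes> d [^] i" using ab dc by (intro group_commutes_pow) simp_all
  qed (use ab dc twist in simp_all)
  then have "t [^] p = a [^] (p * j) \<otimes> (a [^] i) [^] p \<otimes> (d [^] i) [^] (\<Sum>i<p. i)" using j by simp
  also have "a [^] (p * j) \<otimes> (a [^] i) [^] p = (a [^] ord a) [^] (j * p)"
  proof -
    have "p * j + i * p = ord a * (j * p)" using ord_gt_0[OF ab(1)] by (cases "ord a") (simp_all add: i_def algebra_simps)
    then show ?thesis using ab(1) by (simp only: nat_pow_pow nat_pow_mult)
  qed
  finally have tp: "t [^] p = (d [^] i) [^] (\<Sum>i<p. i)" using ab dc by simp
  have ordt: "ord t > 0" using tc by (rule ord_gt_0)
  have cD: "order G = p * p * card D" using ab(4) cB by simp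
  have cDpos: "card D > 0" using sD by (rule card_subgroup_pos)
  have elem: "G \<cong> integer_mod_group p \<times>\<times> integer_mod_group p" if "card D = 1"
  proof -
    have "D = {\<one>}" using that subgroup.one_closed[OF sD] by (metis card_1_singletonE singletonD)
    then have "d = \<one>" using dD by simp
    moreover have "ord a = p" "ord b = p" using that cB oab by simp_all
    ultimately have "metacyclic G p p 0 1 a b"
      using ab abd p1 set_mult_swap[OF sA AB] pow_ord_eq_1[OF ab(1)] pow_ord_eq_1[OF ab(2)] by (intro metacyclicI) simp_all
    then show ?thesis using metacyclic_iso[OF is_group _ _ metacyclic_DirProd] p1
      by (metis DirProd_group One_nat_def Suc_lessD group_integer_mod_group)
  qed
  show ?thesis
  proof (cases "p = 2")
    case False
    then have "odd p" using prime_odd_nat[OF p] p1 by simp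
    have "2 * (\<Sum>i<n. i) = n * (n - 1)" for n :: nat
    proof (induction n)
      case (Suc n) then show ?case by (cases n) simp_all
    qed simp
    \<comment> \<open>For odd \<open>p\<close> the triangular number collected in \<open>t\<^sup>p\<close> is a multiple of \<open>p\<close>.\<close>
    from this[of p] obtain s where "(\<Sum>i<p. i) = p * s" using \<open>odd p\<close> by (metis dvd_def dvd_triv_left coprime_dvd_mult_right_iff coprime_right_2_iff_odd)
    then have "t [^] p = (d [^] p) [^] (i * s)" using tp dc by (simp add: nat_pow_pow ac_simps)
    then have "t [^] p = \<one>" using dp by simp
    then have "ord t \<le> p" using tc p1 by (intro dvd_imp_le) (simp_all add: pow_eq_id)
    then have "p * p * card D \<le> p * p" using large[OF tc tA] False cD
      by (metis le_trans mult_le_mono2)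
    then have "card D = 1" using cDpos p1 by simp
    then show ?thesis using elem by blast
  next
    case True
    have "t [^] (2::nat) = d [^] i" using tp True dc by (simp add: numeral_2_eq_2)
    moreover have d2: "d [^] (2::nat) = \<one>" using dp True by simp
    ultimately have "t [^] (2::nat) = \<one> \<or> t [^] (2::nat) = d"
    proof -
      have "d [^] i = (d [^] (2::nat)) [^] (i div 2) \<otimes> d [^] (i mod 2)" using dc by (simp add: nat_pow_pow nat_pow_mult)
      then have "d [^] i = d [^] (i mod 2)" using d2 dc by simp
      then show ?thesis using \<open>t [^] (2::nat) = d [^] i\<close> dc by (cases "even i") (simp_all add: odd_iff_mod_2_eq_one)
    qed
    note t2 = this
    have tsmall: "order G \<le> 4 * ord x" if "x \<in> carrier G" "x \<notin> ?A" for x using large[OF that] True by auto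
    have t4: "t [^] (4::nat) = \<one>"
    proof -
      have "t [^] (4::nat) = (t [^] (2::nat)) [^] (2::nat)" using tc by (simp add: nat_pow_pow)
      then show ?thesis using t2 d2 by auto
    qed
    then have "ord t \<le> 4" using tc by (intro dvd_imp_le) (simp_all add: pow_eq_id)
    then have D4: "card D \<le> 4" using tsmall[OF tc tA] cD True by simp
    have "card D dvd 2 ^ k" using card_subgroup_dvd[OF sD] G True by simp
    then obtain r where r: "card D = 2 ^ r" using divides_primepow_nat two_is_prime_nat by blast
    then have "r \<le> 2" using D4 power_increasing[of 3 r "2::nat"] by (cases "r \<le> 2") simp_all
    then consider "card D = 1" | "card D = 2" | "card D = 4" using r by (cases "r = 0"; cases "r = 1"; cases "r = 2") simp_all
    then show ?thesis
    proof cases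
      case 1 then show ?thesis using elem by blast
    next
      case 2
      then have oG: "order G = 8" and oa: "ord a = 4" "ord b = 4" using cD cB oab True by simp_all
      show ?thesis
      proof (cases "d = \<one>")
        case dn: True
        then have t2': "t [^] (2::nat) = \<one>" using t2 by auto
        have "\<not> cyc t \<subseteq> ?A" using tA mem_cyc[of t] by blast
        then have "?A <#> cyc t = carrier G"
          using prime_index_supplement(1)[OF p nA(1) _ cyc_subgroup[OF tc]] ab by (simp add: card_cyc)
        then have "cyc t <#> ?A = carrier G" using set_mult_swap[OF sA(1) cyc_subgroup[OF tc]] by simp
        moreover have "a \<otimes> t = t \<otimes> a"
        proof -
          have "a \<otimes> t = a \<otimes> b \<otimes> a [^] i" using ab by (simp add: t_def m_assoc)
          also have "\<dots> = b \<otimes> (a \<otimes> a [^] i)" using ab dn abd by (simp add: m_assoc)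
          also have "a \<otimes> a [^] i = a [^] i \<otimes> a" using ab by (metis nat_pow_Suc nat_pow_Suc2)
          finally show ?thesis using ab by (simp add: t_def m_assoc)
        qed
        ultimately have "metacyclic G 4 2 0 1 a t"
          using ab tc oG t2' pow_ord_eq_1[OF ab(1)] oa by (intro metacyclicI) simp_all
        moreover have "metacyclic (integer_mod_group 4 \<times>\<times> integer_mod_group 2) 4 2 0 1 (1 mod int 4, 0) (0, 1 mod int 2)"
          by (rule metacyclic_DirProd) simp_all
        ultimately have "G \<cong> integer_mod_group 4 \<times>\<times> integer_mod_group 2"
          by (rule metacyclic_iso[OF is_group DirProd_group[OF group_integer_mod_group group_integer_mod_group]])
        moreover have "ord t \<le> 2" using t2' tc by (intro dvd_imp_le) (simp_all add: pow_eq_id)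
        then have "2 * ord t < order G" using oG by simp
        ultimately show ?thesis using True tc tA by blast
      next
        case False
        have "D - {\<one>} = {d}"
        proof (rule card_seteq[symmetric])
          show "finite (D - {\<one>})" using finite_subgroup[OF sD] by simp
          show "{d} \<subseteq> D - {\<one>}" using dD False by simp
          show "card (D - {\<one>}) \<le> card {d}" using 2 subgroup.one_closed[OF sD] finite_subgroup[OF sD] by simp
        qed
        moreover have "a [^] (2::nat) \<in> D" using mem_cyc[of "a [^] (2::nat)"] Da True by simp
        moreover have "b [^] (2::nat) \<in> D" using mem_cyc[of "b [^] (2::nat)"] Db True by simp
        moreover have "a [^] (2::nat) \<noteq> \<one>" "b [^] (2::nat) \<noteq> \<one>" using oa ab by (simp_all add: pow_eq_id)
        ultimately have sq: "a [^] (2::nat) = d" "b [^] (2::nat) = d" by blast+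
        have "a \<otimes> b = b \<otimes> a [^] (3::nat)"
        proof -
          have "a [^] (3::nat) = a \<otimes> a [^] (2::nat)" using ab(1) by (simp add: numeral_eq_Suc m_assoc)
          then show ?thesis using abd sq ab dc by (simp add: m_assoc)
        qed
        then have "metacyclic G 4 2 2 3 a b"
          using ab sq oG set_mult_swap[OF sA AB] pow_ord_eq_1[OF ab(1)] oa by (intro metacyclicI) simp_all
        then have "G \<cong> quaternion_group"
          by (rule metacyclic_iso[OF is_group group_quaternion_group _ metacyclic_quaternion])
        then show ?thesis using True by blast
      qed
    next
      case 3
      then have oG: "order G = 16" and oa: "ord a = 8" using cD cB oab True by simp_all
      have no2: "x [^] (2::nat) \<noteq> \<one>" if "x \<in> carrier G" "x \<notin> ?A" for x
      proof
        assume "x [^] (2::nat) = \<one>"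
        then have "ord x \<le> 2" using that by (intro dvd_imp_le) (simp_all add: pow_eq_id)
        then show False using tsmall[OF that] oG by simp
      qed
      \<comment> \<open>Here \<open>\<langle>a\<rangle>\<close> has order \<open>8\<close>, so \<open>d\<close> is a fourth power \<open>a\<^sup>4\<^sup>s'\<close> and \<open>ta\<^sup>2\<^sup>s'\<close> is an involution.\<close>
      then have td: "t [^] (2::nat) = d" "d \<noteq> \<one>" using t2 tc tA by auto
      obtain s :: nat where s: "d = a [^] (2 * s)" using dD ab True unfolding Da by (auto simp: cyc_eq nat_pow_pow)
      then have "a [^] (4 * s) = \<one>" using d2 ab by (simp add: nat_pow_pow)
      then have "even s" using oa ab by (auto simp: pow_eq_id)
      then obtain s' where "s = 2 * s'" by (elim evenE)
      then have d4: "d = (a [^] (4::nat)) [^] s'" using s ab by (simp add: nat_pow_pow)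
      let ?u = "t \<otimes> a [^] (2 * s')"
      have inD: "a [^] (2 * s') \<in> D" using pow_mem_cyc[of "a [^] (2::nat)" s'] ab True Da by (simp add: nat_pow_pow)
      have com: "a [^] (2 * s') \<otimes> t = t \<otimes> a [^] (2 * s')"
      proof -
        have "a [^] (2 * s') \<otimes> t = b \<otimes> (a [^] (2 * s') \<otimes> a [^] i)"
          using Dcomm(2)[OF inD] ab unfolding t_def by (simp flip: m_assoc)
        also have "a [^] (2 * s') \<otimes> a [^] i = a [^] i \<otimes> a [^] (2 * s')" using ab by (simp add: nat_pow_mult add.commute)
        finally show ?thesis using ab by (simp add: t_def m_assoc)
      qed
      have "?u [^] (2::nat) = t [^] (2::nat) \<otimes> (a [^] (2 * s')) [^] (2::nat)"
        using com tc ab by (intro pow_mult_distrib) simp_all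
      also have "(a [^] (2 * s')) [^] (2::nat) = d" using d4 ab by (simp add: nat_pow_pow)
      also have "t [^] (2::nat) \<otimes> d = \<one>" using td d2 dc by (simp add: numeral_2_eq_2)
      finally have "?u [^] (2::nat) = \<one>" .
      moreover have "?u \<notin> ?A"
      proof
        assume "?u \<in> ?A"
        moreover have "t = ?u \<otimes> inv (a [^] (2 * s'))" using ab tc by (simp add: word_simps)
        ultimately have "t \<in> ?A" using sA(1) pow_mem_cyc[OF ab(1), of "2 * s'"] by (metis subgroup.m_closed subgroup.m_inv_closed)
        then show False using tA by simp
      qed
      ultimately show ?thesis using no2[of ?u] tc ab by simp
    qed
  qed
qed

end

context fin_group begin

subsection \<open>Quotients and maximal subgroups\<close>

lemma quotient_hom:
  assumes N: "N \<lhd> G"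
  shows "group_hom G (G Mod N) (\<lambda>x. N #> x)" "(\<lambda>x. N #> x) ` carrier G = carrier (G Mod N)"
    "fin_group (G Mod N)" "order (G Mod N) * card N = order G"
proof -
  interpret N: normal N G by fact
  interpret Q: group "G Mod N" by (rule N.factorgroup_is_group)
  show im: "(\<lambda>x. N #> x) ` carrier G = carrier (G Mod N)" by (simp add: carrier_FactGroup)
  show "group_hom G (G Mod N) (\<lambda>x. N #> x)"
    by (simp add: group_hom_def group_hom_axioms_def N.factorgroup_is_group N.r_coset_hom_Mod)
  show "fin_group (G Mod N)"
    unfolding fin_group_def fin_group_axioms_def using im Q.is_group by (metis fin finite_imageI)
  show "order (G Mod N) * card N = order G"
    using lagrange[OF N.subgroup_axioms] by (simp add: order_def FactGroup_def)
qed

lemma in_preimage_unit: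
  assumes N: "N \<lhd> G" and W: "subgroup W (G Mod N)"
  shows "N \<subseteq> {x \<in> carrier G. N #> x \<in> W}"
proof
  fix x assume x: "x \<in> N"
  have sN: "subgroup N G" using N by (rule normal_imp_subgroup)
  have "N #> x = N" using x sN subgroup.mem_carrier[OF sN x] by (intro coset_join2)
  moreover have "N \<in> W" using subgroup.one_closed[OF W] by simp
  ultimately show "x \<in> {x \<in> carrier G. N #> x \<in> W}" using subgroup.mem_carrier[OF sN x] by simp
qed

text \<open>The quotient by a normal maximal subgroup has no subgroups besides the trivial ones, so a
  subgroup of prime order of it is everything.\<close>

lemma maximal_normal_prime_index:
  assumes M: "maximal_subgroup M G" and N: "M \<lhd> G"
  obtains q where "Factorial_Ring.prime (q::nat)" "order G = q * card M"
proof -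
  interpret Q: fin_group "G Mod M" using quotient_hom(3)[OF N] .
  interpret h: group_hom G "G Mod M" "\<lambda>x. M #> x" using quotient_hom(1)[OF N] .
  have M': "subgroup M G" "M \<noteq> carrier G" "card M < order G"
    using M proper_subgroupD unfolding maximal_subgroup_def by (simp_all add: proper_subgroup_def)
  have o: "order (G Mod M) * card M = order G" using quotient_hom(4)[OF N] .
  then have "order (G Mod M) \<noteq> 1" using M'(3) by auto
  then obtain q where q: "Factorial_Ring.prime q" "q dvd order (G Mod M)" using prime_factor_nat by blast
  then obtain m where m: "order (G Mod M) = q ^ 1 * m" by (auto elim: dvdE)
  obtain W where W: "subgroup W (G Mod M)" "card W = q" using sylow_thm[OF q(1) Q.is_group m Q.fin] by auto
  let ?K = "{x \<in> carrier G. M #> x \<in> W}"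
  have K: "subgroup ?K G" "M \<subseteq> ?K" using h.preimage_subgroup[OF W(1)] in_preimage_unit[OF N W(1)] by simp_all
  have surj: "(\<lambda>x. M #> x) ` carrier G = carrier (G Mod M)" using quotient_hom(2)[OF N] .
  have KW: "(\<lambda>x. M #> x) ` ?K = W"
  proof -
    have "W \<subseteq> (\<lambda>x. M #> x) ` carrier G" using subgroup.subset[OF W(1)] surj by simp
    then show ?thesis by blast
  qed
  have "?K \<noteq> M"
  proof
    assume "?K = M"
    then have "W = (\<lambda>x. M #> x) ` M" using KW by simp
    also have "\<dots> \<subseteq> {M}"
    proof
      fix V assume "V \<in> (\<lambda>x. M #> x) ` M"
      then obtain x where x: "x \<in> M" "V = M #> x" by (rule imageE)
      then show "V \<in> {M}" using coset_join2[OF subgroup.mem_carrier[OF M'(1) x(1)] M'(1) x(1)] by simp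
    qed
    finally have "card W \<le> 1" using card_mono[of "{M}" W] by simp
    then show False using W(2) prime_gt_1_nat[OF q(1)] by simp
  qed
  then have "?K = carrier G" using M K unfolding maximal_subgroup_def proper_subgroup_def by blast
  then have "W = carrier (G Mod M)" using KW surj by simp
  then have "order (G Mod M) = q" using W(2) by (simp add: order_def)
  then show thesis using o q(1) that by simp
qed

definition normaliser :: "'a set \<Rightarrow> 'a set" where
  "normaliser H = {g \<in> carrier G. conjugate g H = H}"

lemma normaliser_subgroup:
  assumes "H \<subseteq> carrier G" shows "subgroup (normaliser H) G"
proof (rule subgroupI)
  show "normaliser H \<noteq> {}" unfolding normaliser_def using conjugate_one[OF assms] by blast
  fix g assume g: "g \<in> normaliser H"
  then have "conjugate (inv g) (conjugate g H) = H" using assms by (intro conjugate_inv) (simp_all add: normaliser_def)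
  then show "inv g \<in> normaliser H" using g by (simp add: normaliser_def)
  fix h assume "h \<in> normaliser H"
  then show "g \<otimes> h \<in> normaliser H" using g conjugate_conjugate[OF assms, of g h] by (simp add: normaliser_def)
qed (simp add: normaliser_def)

lemma subset_normaliser: "subgroup H G \<Longrightarrow> H \<subseteq> normaliser H"
  unfolding normaliser_def using conjugate_by_member subgroup.subset by blast

text \<open>The elements conjugating \<open>H\<close> to a given conjugate form a coset of the normalizer.\<close>

lemma order_eq_conjugates_mult_normaliser:
  assumes H: "H \<subseteq> carrier G"
  shows "order G = card ((\<lambda>g. conjugate g H) ` carrier G) * card (normaliser H)"
proof -
  let ?C = "(\<lambda>g. conjugate g H) ` carrier G"
  have sub: "normaliser H \<subseteq> carrier G" by (auto simp: normaliser_def)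
  have fibre: "card {g \<in> carrier G. conjugate g H = V} = card (normaliser H)" if V: "V \<in> ?C" for V
  proof -
    obtain g where g: "g \<in> carrier G" "V = conjugate g H" using V by blast
    have "{x \<in> carrier G. conjugate x H = V} = (\<lambda>m. g \<otimes> m) ` normaliser H"
    proof (intro equalityI subsetI)
      fix x assume "x \<in> {x \<in> carrier G. conjugate x H = V}"
      then have x: "x \<in> carrier G" "conjugate x H = conjugate g H" using g by simp_all
      have "conjugate (inv g \<otimes> x) H = conjugate (inv g) (conjugate g H)"
        using conjugate_conjugate[OF H, of "inv g" x] g x by simp
      then have "inv g \<otimes> x \<in> normaliser H" using g x conjugate_inv[OF H g(1)] by (simp add: normaliser_def)
      moreover have "x = g \<otimes> (inv g \<otimes> x)" using g x by (simp add: word_simps)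
      ultimately show "x \<in> (\<lambda>m. g \<otimes> m) ` normaliser H" by (rule rev_image_eqI)
    next
      fix x assume "x \<in> (\<lambda>m. g \<otimes> m) ` normaliser H"
      then obtain m where m: "m \<in> carrier G" "conjugate m H = H" "x = g \<otimes> m" by (auto simp: normaliser_def)
      then show "x \<in> {x \<in> carrier G. conjugate x H = V}"
        using g conjugate_conjugate[OF H g(1) m(1)] by simp
    qed
    moreover have "inj_on (\<lambda>m. g \<otimes> m) (normaliser H)" using g sub by (auto simp: inj_on_def subset_iff)
    ultimately show ?thesis by (simp add: card_image)
  qed
  have "order G = (\<Sum>V\<in>?C. card {g \<in> carrier G. conjugate g H = V})"
    unfolding order_def card_eq_sum by (rule sum.image_gen) simp
  also have "\<dots> = (\<Sum>V\<in>?C. card (normaliser H))" by (rule sum.cong) (use fibre in auto)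
  finally show ?thesis by simp
qed

lemma maximal_not_normal_conjugates:
  assumes M: "maximal_subgroup M G" and nn: "\<not> M \<lhd> G"
  shows "order G = card ((\<lambda>g. conjugate g M) ` carrier G) * card M"
proof -
  have M': "subgroup M G" "M \<subseteq> carrier G" using M proper_subgroupD unfolding maximal_subgroup_def by simp_all
  have "normaliser M \<noteq> carrier G"
  proof
    assume *: "normaliser M = carrier G"
    have "conjugate g M \<subseteq> M" if "g \<in> carrier G" for g
      using that unfolding *[symmetric] by (simp add: normaliser_def)
    then show False using nn M'(1) unfolding normal_iff_conjugate by simp
  qed
  then have "proper_subgroup (normaliser M) G" using normaliser_subgroup[OF M'(2)] by (simp add: proper_subgroup_def)
  then have "normaliser M = M" using M subset_normaliser[OF M'(1)] unfolding maximal_subgroup_def by blast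
  then show ?thesis using order_eq_conjugates_mult_normaliser[OF M'(2)] by simp
qed

text \<open>A maximal subgroup that is not normal is its own normalizer, so its index is the number
  of its conjugates; if it is a factor of \<open>G\<close>, these are pairwise non-adjacent neighbours.\<close>

lemma maximal_factor_normal_or_index_le_3:
  assumes sf: "star_free G" and M: "maximal_subgroup M G" and U: "proper_subgroup U G" "U <#> M = carrier G"
  shows "M \<lhd> G \<or> order G \<le> 3 * card M"
proof (cases "M \<lhd> G")
  case nn: False
  have pM: "proper_subgroup M G" using M by (simp add: maximal_subgroup_def)
  let ?C = "(\<lambda>g. conjugate g M) ` carrier G"
  have "card ?C \<le> 3"
  proof (rule star_freeD[OF sf U(1)])
    show "independent_family G ?C"
      unfolding independent_family_def
      using proper_conjugate[OF pM] conjugates_not_carrier[OF pM] by (intro conjI ballI) blast+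
    show "U <#> V = carrier G" if "V \<in> ?C" for V
      using that set_mult_conjugate[OF proper_subgroupD(1)[OF U(1)] proper_subgroupD(1)[OF pM] U(2)] by blast
  qed
  then have "order G \<le> 3 * card M"
    unfolding maximal_not_normal_conjugates[OF M nn] by (rule mult_right_mono) simp
  then show ?thesis ..
qed simp

subsection \<open>Two maximal subgroups of a p-group\<close>

lemma pgroup_card_power:
  assumes "Factorial_Ring.prime (p::nat)" "order G = p ^ k" "subgroup H G"
  obtains l where "card H = p ^ l" "l \<le> k"
  using card_subgroup_dvd[OF assms(3)] assms(1,2) divides_primepow_nat that by metis

text \<open>A point outside the subgroup \<open>N\<close> of index \<open>p\<close> generates a proper subgroup; a maximal subgroup
  over it is a supplement of \<open>N\<close>, so star-freeness makes it normal or of index at most \<open>3\<close>, and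
  in both cases the index is \<open>p\<close>.\<close>

lemma pgroup_two_maximal:
  assumes sf: "star_free G" and p: "Factorial_Ring.prime (p::nat)" and G: "order G = p ^ k"
    and nc: "\<And>x. x \<in> carrier G \<Longrightarrow> cyc x \<noteq> carrier G"
  obtains M N where "M \<lhd> G" "order G = p * card M" "N \<lhd> G" "order G = p * card N" "M \<noteq> N"
proof -
  have "k \<noteq> 0"
  proof
    assume "k = 0"
    then have "card (carrier G) = 1" using G by (simp add: order_def)
    then show False using nc[OF one_closed] cyc_eqI[OF subgroup_self one_closed] by simp
  qed
  then have k: "order G = p ^ (k - 1) * p" using G by (cases k) simp_all
  obtain N where N: "subgroup N G" "card N = p ^ (k - 1)" using sylow_thm[OF p is_group k fin] by blast
  have oN: "order G = p * card N" using k N by simp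
  have nN: "N \<lhd> G" using pgroup_prime_index_normal[OF p G N(1) oN] .
  have pN: "proper_subgroup N G"
    using N(1) oN prime_gt_1_nat[OF p] card_subgroup_pos[OF N(1)] by (intro proper_subgroupI) auto
  then obtain x where x: "x \<in> carrier G" "x \<notin> N" using proper_subgroupD(2)[OF pN] unfolding proper_subgroup_def by blast
  have "proper_subgroup (cyc x) G" using nc[OF x(1)] cyc_subgroup[OF x(1)] by (simp add: proper_subgroup_def)
  then obtain M where M: "maximal_subgroup M G" "cyc x \<subseteq> M" by (rule proper_subset_maximal)
  then have xM: "x \<in> M" using mem_cyc by blast
  have sM: "subgroup M G" "card M < order G" using M(1) proper_subgroupD unfolding maximal_subgroup_def by simp_all
  have "\<not> M \<subseteq> N" using xM x by blast
  then have NM: "N <#> M = carrier G" using prime_index_supplement[OF p nN oN sM(1)] by simp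
  have "order G = p * card M"
  proof (cases "M \<lhd> G")
    case True
    obtain q where q: "Factorial_Ring.prime (q::nat)" "order G = q * card M"
      using maximal_normal_prime_index[OF M(1) True] .
    then have "q dvd p ^ k" using G by (metis dvd_triv_left)
    then have "q = p" using q(1) p by (metis prime_dvd_power primes_dvd_imp_eq)
    then show ?thesis using q by simp
  next
    case False
    then have le: "order G \<le> 3 * card M" using maximal_factor_normal_or_index_le_3[OF sf M(1) pN NM] by simp
    have d: "p * card M dvd order G"
      using proper_subgroup_of_pgroup[OF p subgroup_self G[unfolded order_def] sM(1) subgroup.subset[OF sM(1)]] sM(2)
      by (auto simp: order_def)
    then obtain r where r: "order G = p * card M * r" by (elim dvdE)
    have "p * r \<le> 3" using le r card_subgroup_pos[OF sM(1)] by simp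
    moreover have "r \<noteq> 0" using r order_pos by auto
    moreover have "r = 1" if "r \<noteq> 0"
    proof (rule ccontr)
      assume "r \<noteq> 1"
      then have "2 \<le> r" using that by simp
      then have "2 * 2 \<le> p * r" using prime_ge_2_nat[OF p] mult_le_mono by blast
      then show False using \<open>p * r \<le> 3\<close> by simp
    qed
    ultimately show ?thesis using r by simp
  qed
  moreover have "M \<lhd> G" using pgroup_prime_index_normal[OF p G sM(1)] calculation .
  moreover have "M \<noteq> N" using xM x by blast
  ultimately show thesis using that nN oN by blast
qed

text \<open>The quotient has order \<open>p\<close>.\<close>

lemma pgroup_power_in_prime_index:
  assumes p: "Factorial_Ring.prime (p::nat)" and G: "order G = p ^ k" and H: "H \<lhd> G" "order G = p * card H"
    and y: "y \<in> carrier G"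
  shows "y [^] p \<in> H"
proof (cases "y \<in> H")
  case True then show ?thesis using H normal_imp_subgroup pow_mem_subgroup by blast
next
  case False
  have sH: "subgroup H G" using H(1) by (rule normal_imp_subgroup)
  have c: "subgroup (cyc y) G" using y by (rule cyc_subgroup)
  obtain l where l: "ord y = p ^ l" using pgroup_card_power[OF p G c] card_cyc[OF y] by metis
  have "\<not> cyc y \<subseteq> H" using False mem_cyc[of y] by blast
  then have "ord y = p * card (H \<inter> cyc y)" using prime_index_supplement(2)[OF p H c] card_cyc[OF y] by simp
  then have "H \<inter> cyc y = cyc (y [^] p)"
    by (intro cyclic_pgroup_maximal[OF p y l]) (simp_all add: subgroups_Inter_pair[OF sH c])
  then show ?thesis using mem_cyc[of "y [^] p"] by blast
qed

lemma cyclic_pgroup_proper: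
  assumes p: "Factorial_Ring.prime (p::nat)" and x: "x \<in> carrier G" "ord x = p ^ k"
    and H: "subgroup H G" "H \<subseteq> cyc x" "H \<noteq> cyc x"
  shows "H \<subseteq> cyc (x [^] p)"
proof
  fix y assume y: "y \<in> H"
  show "y \<in> cyc (x [^] p)"
  proof (rule ccontr)
    assume "y \<notin> cyc (x [^] p)"
    then have "cyc y = cyc x" using cyclic_pgroup_generator[OF p x] H y by blast
    then show False using cyc_subset[OF H(1) y] H by simp
  qed
qed

end

locale two_maximal_pgroup = fin_group +
  fixes p k :: nat and M N :: "'a set"
  assumes sf: "star_free G" and p: "Factorial_Ring.prime p" and G: "order G = p ^ k"
    and M: "M \<lhd> G" "order G = p * card M" and N: "N \<lhd> G" "order G = p * card N" and MN: "M \<noteq> N"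
begin

definition D :: "'a set" where "D = M \<inter> N"

text \<open>The maximal subgroup through \<open>D\<close> and a point \<open>y\<close> outside \<open>D\<close>.\<close>

definition cover :: "'a \<Rightarrow> 'a set" where "cover y = D <#> cyc y"

text \<open>Equivalent to \<open>cover y\<close> being cyclic for \<open>y\<close> outside \<open>D\<close>, in the form in which it is used.\<close>

definition cyclic_cover :: "'a \<Rightarrow> bool" where
  "cyclic_cover y \<longleftrightarrow> (\<forall>x\<in>cover y - D. cyc x = cover y)"

lemma p1: "p > 1" using p by (rule prime_gt_1_nat)

lemma sM: "subgroup M G" "subgroup N G" using M N by (simp_all add: normal_imp_subgroup)

lemma sD: "subgroup D G" unfolding D_def using sM by (rule subgroups_Inter_pair)

lemma nD: "D \<lhd> G" unfolding D_def using M(1) N(1) by (rule normal_subgroup_intersect)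

lemma card_D: "order G = p * p * card D"
proof -
  have "\<not> M \<subseteq> N"
  proof
    assume "M \<subseteq> N"
    moreover have "card M = card N" using M N p1 by simp
    ultimately show False using MN finite_subgroup[OF sM(2)] by (metis card_subset_eq)
  qed
  then have "card M = p * card (N \<inter> M)" using prime_index_supplement(2)[OF p N sM(1)] by simp
  then show ?thesis using M(2) by (simp add: D_def Int_commute)
qed

lemma pow_p_in_D: "y \<in> carrier G \<Longrightarrow> y [^] p \<in> D"
  unfolding D_def using pgroup_power_in_prime_index[OF p G M] pgroup_power_in_prime_index[OF p G N] by blast

lemma ord_power: "y \<in> carrier G \<Longrightarrow> \<exists>l. ord y = p ^ l"
  using pgroup_card_power[OF p G cyc_subgroup] card_cyc by metis

lemma cover_subgroup: "y \<in> carrier G \<Longrightarrow> subgroup (cover y) G"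
  unfolding cover_def using normal_set_mult_subgroup[OF nD cyc_subgroup] .

lemma cover_upper: "y \<in> carrier G \<Longrightarrow> D \<subseteq> cover y" "y \<in> carrier G \<Longrightarrow> cyc y \<subseteq> cover y" "y \<in> carrier G \<Longrightarrow> y \<in> cover y"
  using set_mult_upper[OF sD cyc_subgroup] mem_cyc[of y] unfolding cover_def by blast+

lemma card_cover:
  assumes y: "y \<in> carrier G" "y \<notin> D"
  shows "card (cover y) = p * card D"
proof -
  have c: "subgroup (cyc y) G" using y(1) by (rule cyc_subgroup)
  obtain l where l: "ord y = p ^ l" using ord_power[OF y(1)] by blast
  have I: "subgroup (D \<inter> cyc y) G" using sD c by (rule subgroups_Inter_pair)
  have "D \<inter> cyc y \<noteq> cyc y" using y(2) mem_cyc[of y] by blast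
  then have d: "p * card (D \<inter> cyc y) dvd ord y"
    using proper_subgroup_of_pgroup[OF p c _ I Int_lower2] l y(1) by (simp add: card_cyc)
  have yp: "cyc (y [^] p) \<subseteq> D \<inter> cyc y"
    using cyc_subset[OF I] pow_p_in_D[OF y(1)] pow_mem_cyc[OF y(1)] by simp
  have "p dvd ord y" using d by (metis dvd_mult_left)
  then have "ord (y [^] p) = ord y div p" using ord_pow[OF y(1)] p1 by simp
  moreover have "ord (y [^] p) \<le> card (D \<inter> cyc y)"
    using card_mono[OF finite_subgroup[OF I] yp] y(1) by (simp add: card_cyc)
  ultimately have "ord y \<le> p * card (D \<inter> cyc y)" using \<open>p dvd ord y\<close>
    by (metis dvd_mult_div_cancel mult_le_mono2)
  then have "ord y = p * card (D \<inter> cyc y)" using d ord_gt_0[OF y(1)] by (simp add: dvd_imp_le le_antisym)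
  then show ?thesis
    using card_set_mult[OF sD c] card_subgroup_pos[OF I] y(1) unfolding cover_def by (simp add: card_cyc)
qed

lemma cover_index: "y \<in> carrier G \<Longrightarrow> y \<notin> D \<Longrightarrow> order G = p * card (cover y)"
  using card_cover card_D by simp

lemma cover_normal: "y \<in> carrier G \<Longrightarrow> y \<notin> D \<Longrightarrow> cover y \<lhd> G"
  using pgroup_prime_index_normal[OF p G cover_subgroup cover_index] .

lemma cover_proper: "y \<in> carrier G \<Longrightarrow> y \<notin> D \<Longrightarrow> proper_subgroup (cover y) G"
  using cover_subgroup[of y] cover_index[of y] p1 card_subgroup_pos[of "cover y"] by (intro proper_subgroupI) auto

lemma cover_subset:
  assumes "subgroup L G" "D \<subseteq> L" "y \<in> L" shows "cover y \<subseteq> L"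
  unfolding cover_def using set_mult_subset_subgroup[OF assms(1,2) cyc_subset[OF assms(1,3)]] .

lemma cover_eq:
  assumes "y \<in> carrier G" "y \<notin> D" "z \<in> cover y" "z \<notin> D"
  shows "cover z = cover y"
proof -
  have z: "z \<in> carrier G" using assms cover_subgroup by (metis subgroup.mem_carrier)
  have "cover z \<subseteq> cover y" using assms cover_subgroup cover_upper by (intro cover_subset) simp_all
  then show ?thesis using assms z cover_subgroup by (intro card_subset_eq) (simp_all add: card_cover finite_subgroup)
qed

lemma cover_eqD:
  assumes "y \<in> carrier G" "y \<notin> D" "z \<in> carrier G" "z \<notin> D" "cover z \<noteq> cover y"
  shows "z \<notin> cover y" "cover y \<inter> cover z = D"
proof -
  show "z \<notin> cover y" using assms cover_eq by blast
  show "cover y \<inter> cover z = D"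
  proof
    show "D \<subseteq> cover y \<inter> cover z" using assms cover_upper by simp
    show "cover y \<inter> cover z \<subseteq> D" using assms cover_eq by blast
  qed
qed

text \<open>One of \<open>M\<close>, \<open>N\<close> does not contain \<open>y\<close> and therefore meets \<open>cover y\<close> in \<open>D\<close>; the subgroups in
  question are supplements of it.\<close>

lemma few_outside_D:
  assumes y: "y \<in> carrier G" "y \<notin> D"
  shows "card {V. subgroup V G \<and> V \<subseteq> cover y \<and> \<not> V \<subseteq> D} \<le> 3"
proof -
  have *: "card {V. subgroup V G \<and> V \<subseteq> cover y \<and> \<not> V \<subseteq> D} \<le> 3"
    if L: "L \<lhd> G" "order G = p * card L" "D \<subseteq> L" "y \<notin> L" for L
  proof -
    have sL: "subgroup L G" using L(1) by (rule normal_imp_subgroup)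
    have "cover y \<inter> L \<subseteq> D"
    proof (rule ccontr)
      assume "\<not> cover y \<inter> L \<subseteq> D"
      then obtain w where w: "w \<in> cover y" "w \<in> L" "w \<notin> D" by blast
      then have "cover y \<subseteq> L" using cover_eq[OF y w(1,3)] cover_subset[OF sL L(3) w(2)] by simp
      then show False using cover_upper(3)[OF y(1)] L(4) by blast
    qed
    then have "{V. subgroup V G \<and> V \<subseteq> cover y \<and> \<not> V \<subseteq> D} = {V. subgroup V G \<and> V \<subseteq> cover y \<and> \<not> V \<subseteq> L}"
      using L(3) by blast
    then show ?thesis using card_supplements_le[OF sf p L(1,2) cover_proper[OF y]] by simp
  qed
  have "y \<notin> M \<or> y \<notin> N" using y by (simp add: D_def)
  then show ?thesis
  proof
    assume "y \<notin> M" then show ?thesis by (intro *[of M] M) (auto simp: D_def)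
  next
    assume "y \<notin> N" then show ?thesis by (intro *[of N] N) (auto simp: D_def)
  qed
qed

lemma cover_alternative:
  assumes y: "y \<in> carrier G" "y \<notin> D" and nc: "\<not> cyclic_cover y"
  obtains A B where "p = 2" "A \<noteq> B" "2 * card A = card (cover y)" "2 * card B = card (cover y)"
    "A \<in> cyc ` (cover y - D)" "B \<in> cyc ` (cover y - D)" "\<forall>x\<in>cover y - D. cyc x = A \<or> cyc x = B"
proof -
  obtain l where l: "card (cover y) = p ^ l" using pgroup_card_power[OF p G cover_subgroup[OF y(1)]] by blast
  have "\<not> (\<forall>x\<in>cover y - D. cyc x = cover y)" using nc by (simp add: cyclic_cover_def)
  with few_subgroups_outside[OF p cover_subgroup[OF y(1)] l sD cover_upper(1)[OF y(1)] card_cover[OF y] few_outside_D[OF y]]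
  show thesis using that by (elim disjE conjE exE) simp_all
qed

lemma ord_outside_D:
  assumes y: "y \<in> carrier G" "y \<notin> D"
  shows "order G \<le> p * ord y \<or> p = 2 \<and> order G \<le> 4 * ord y"
proof (cases "cyclic_cover y")
  case True
  then have "cyc y = cover y" using cover_upper(3)[OF y(1)] y(2) by (simp add: cyclic_cover_def)
  then show ?thesis using cover_index[OF y] card_cyc[OF y(1)] by simp
next
  case False
  obtain A B where p2: "p = 2" and AB: "A \<noteq> B" "2 * card A = card (cover y)" "2 * card B = card (cover y)"
    "A \<in> cyc ` (cover y - D)" "B \<in> cyc ` (cover y - D)" and "\<forall>x\<in>cover y - D. cyc x = A \<or> cyc x = B"
    by (rule cover_alternative[OF y False])
  then have all: "\<And>x. x \<in> cover y \<Longrightarrow> x \<notin> D \<Longrightarrow> cyc x = A \<or> cyc x = B" by simp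
  have "2 * ord y = card (cover y)"
    using all[OF cover_upper(3)[OF y(1)] y(2)]
  proof
    assume "cyc y = A" then show ?thesis using AB(2) card_cyc[OF y(1)] by simp
  next
    assume "cyc y = B" then show ?thesis using AB(3) card_cyc[OF y(1)] by simp
  qed
  then show ?thesis using cover_index[OF y] p2 by simp
qed

text \<open>Elements outside \<open>cover a\<close> are outside \<open>D\<close> and thus have the large order asked for by
  \<open>two_cyclic_maximal\<close>.\<close>

lemma two_cyclic_covers:
  assumes a: "a \<in> carrier G" "a \<notin> D" "cyclic_cover a" and b: "b \<in> carrier G" "b \<notin> D" "cyclic_cover b"
    and ne: "cover a \<noteq> cover b"
  shows "G \<cong> integer_mod_group p \<times>\<times> integer_mod_group p \<or>
    G \<cong> quaternion_group \<or> G \<cong> integer_mod_group 4 \<times>\<times> integer_mod_group 2"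
proof -
  have c: "cyc a = cover a" "cyc b = cover b"
    using a b cover_upper(3)[OF a(1)] cover_upper(3)[OF b(1)] by (simp_all add: cyclic_cover_def)
  have o: "order G = p * ord a" "order G = p * ord b"
    using cover_index[OF a(1,2)] cover_index[OF b(1,2)] c card_cyc[OF a(1)] card_cyc[OF b(1)] by simp_all
  have "b \<notin> cyc a" unfolding c using cover_eqD(1)[OF a(1,2) b(1,2)] ne by simp
  moreover have "order G \<le> p * ord x \<or> p = 2 \<and> order G \<le> 4 * ord x" if "x \<in> carrier G" "x \<notin> cyc a" for x
    using ord_outside_D[OF that(1)] that(2) cover_upper(1)[OF a(1)] c by blast
  ultimately show ?thesis using two_cyclic_maximal[OF p G a(1) b(1) o] by blast
qed

end

context two_maximal_pgroup begin

text \<open>A maximal subgroup \<open>H \<supseteq> D\<close> that is not cyclic is the product of two cyclic subgroups of index \<open>2\<close>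
  which between them contain \<open>H - D\<close>.  They meet in \<open>\<langle>y\<^sup>2\<rangle>\<close>, which is therefore the same for
  all \<open>y \<in> H - D\<close> and central in \<open>H\<close>.\<close>

lemma noncyclic_cover:
  assumes y: "y \<in> carrier G" "y \<notin> D" and nc: "\<not> cyclic_cover y"
  shows "p = 2" "order G = 4 * ord y" "order G = 8 * ord (y [^] (2::nat))"
    "\<And>z. z \<in> cover y \<Longrightarrow> z \<notin> D \<Longrightarrow> cyc (z [^] (2::nat)) = cyc (y [^] (2::nat))"
    "\<And>u. u \<in> cover y \<Longrightarrow> u \<otimes> y [^] (2::nat) = y [^] (2::nat) \<otimes> u"
    "\<exists>z1\<in>cover y - D. \<exists>z2\<in>cover y - D. cyc z1 \<noteq> cyc z2"
proof -
  obtain A B where p2: "p = 2" and AB: "A \<noteq> B" "2 * card A = card (cover y)" "2 * card B = card (cover y)"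
    "A \<in> cyc ` (cover y - D)" "B \<in> cyc ` (cover y - D)" and "\<forall>x\<in>cover y - D. cyc x = A \<or> cyc x = B"
    by (rule cover_alternative[OF y nc])
  then have all: "\<And>x. x \<in> cover y \<Longrightarrow> x \<notin> D \<Longrightarrow> cyc x = A \<or> cyc x = B" by simp
  show "p = 2" by (rule p2)
  show "\<exists>z1\<in>cover y - D. \<exists>z2\<in>cover y - D. cyc z1 \<noteq> cyc z2" using AB(1,4,5) by (elim imageE) (simp, blast)
  obtain x1 where x1: "x1 \<in> cover y - D" "A = cyc x1" using AB(4) by (elim imageE)
  obtain x2 where x2: "x2 \<in> cover y - D" "B = cyc x2" using AB(5) by (elim imageE)
  have x: "x1 \<in> cover y" "A = cyc x1" "x2 \<in> cover y" "B = cyc x2" using x1 x2 by simp_all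
  have H: "subgroup (cover y) G" using y(1) by (rule cover_subgroup)
  have xc: "x1 \<in> carrier G" "x2 \<in> carrier G" using x H by (simp_all add: subgroup.mem_carrier)
  have sAB: "subgroup A G" "subgroup B G" "A \<subseteq> cover y" "B \<subseteq> cover y" using x xc H cyc_subgroup cyc_subset by simp_all
  have oG: "order G = 2 * card (cover y)" using cover_index[OF y] p2 by simp
  have yH: "y \<in> cover y" using y(1) by (rule cover_upper)
  have oz: "order G = 4 * ord z" if "z \<in> cover y" "z \<notin> D" for z
    using all[OF that]
  proof
    have zc: "z \<in> carrier G" using that H by (simp add: subgroup.mem_carrier)
    { assume "cyc z = A" then show ?thesis using AB(2) oG card_cyc[OF zc] by simp }
    { assume "cyc z = B" then show ?thesis using AB(3) oG card_cyc[OF zc] by simp }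
  qed
  show oy: "order G = 4 * ord y" using oz[OF yH y(2)] .
  have I: "subgroup (A \<inter> B) G" using sAB by (intro subgroups_Inter_pair)
  have cAB: "card A = card B" using AB by simp
  have "A \<inter> B \<noteq> A" using AB(1) cAB finite_subgroup[OF sAB(2)] by (metis Int_lower2 card_subset_eq)
  obtain l1 where l1: "card A = 2 ^ l1" using pgroup_card_power[OF p G sAB(1)] p2 by metis
  have d: "2 * card (A \<inter> B) dvd card A"
    using proper_subgroup_of_pgroup[OF p sAB(1) _ I Int_lower1 \<open>A \<inter> B \<noteq> A\<close>] l1 p2 by simp
  have "card (A <#> B) \<le> card (cover y)"
    using set_mult_subset_subgroup[OF H sAB(3,4)] finite_subgroup[OF H] by (rule card_mono[rotated])
  then have "card (A <#> B) * card (A \<inter> B) \<le> 2 * card A * card (A \<inter> B)"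
    unfolding AB(2) by (rule mult_right_mono) simp
  then have "card A * card B \<le> 2 * card A * card (A \<inter> B)" unfolding card_set_mult[OF sAB(1,2)] .
  then have "card A * card A \<le> card A * (2 * card (A \<inter> B))" unfolding cAB[symmetric] by (simp only: mult.assoc mult.left_commute)
  then have "card A \<le> 2 * card (A \<inter> B)" using card_subgroup_pos[OF sAB(1)] by simp
  then have cI: "card A = 2 * card (A \<inter> B)"
    by (rule le_antisym) (rule dvd_imp_le[OF d card_subgroup_pos[OF sAB(1)]])
  have E: "cyc (z [^] (2::nat)) = A \<inter> B" if z: "z \<in> cover y" "z \<notin> D" for z
  proof -
    have zc: "z \<in> carrier G" using z H by (simp add: subgroup.mem_carrier)
    obtain l where l: "ord z = p ^ l" using ord_power[OF zc] by blast
    have "A \<inter> B \<subseteq> cyc z" using all[OF z] by (elim disjE) simp_all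
    moreover have "ord z = p * card (A \<inter> B)" using oz[OF z] oG AB(2) cI p2 by simp
    ultimately show ?thesis using cyclic_pgroup_maximal[OF p zc l I] p2 by simp
  qed
  show "cyc (z [^] (2::nat)) = cyc (y [^] (2::nat))" if "z \<in> cover y" "z \<notin> D" for z
    using E[OF that] E[OF yH y(2)] by simp
  show "order G = 8 * ord (y [^] (2::nat))"
    using E[OF yH y(2)] card_cyc[of "y [^] (2::nat)"] y(1) cI AB(2) oG by simp
  have "card (A <#> B) = card (cover y)"
    using card_set_mult[OF sAB(1,2)] cI cAB AB(2) card_subgroup_pos[OF I] by simp
  then have ABH: "A <#> B = cover y"
    using set_mult_subset_subgroup[OF H sAB(3,4)] finite_subgroup[OF H] by (intro card_subset_eq)
  show "u \<otimes> y [^] (2::nat) = y [^] (2::nat) \<otimes> u" if u: "u \<in> cover y" for u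
  proof -
    let ?y = "y [^] (2::nat)"
    have yI: "?y \<in> A" "?y \<in> B" using E[OF yH y(2)] mem_cyc[of ?y] by blast+
    obtain v w where vw: "v \<in> A" "w \<in> B" "u = v \<otimes> w" using u unfolding ABH[symmetric] by (rule set_multE)
    have c: "v \<in> carrier G" "w \<in> carrier G" using vw sAB by (simp_all add: subgroup.mem_carrier)
    have 1: "v \<otimes> ?y = ?y \<otimes> v" using vw yI x xc cyc_commute by simp
    have 2: "w \<otimes> ?y = ?y \<otimes> w" using vw yI x xc cyc_commute by simp
    have "u \<otimes> ?y = v \<otimes> (w \<otimes> ?y)" using vw c y by (simp add: m_assoc)
    also have "\<dots> = (v \<otimes> ?y) \<otimes> w" unfolding 2 using c y by (simp add: m_assoc)
    also have "\<dots> = ?y \<otimes> u" unfolding 1 using vw c y by (simp add: m_assoc)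
    finally show ?thesis .
  qed
qed

text \<open>Two such maximal subgroups have together four cyclic subgroups of index \<open>2\<close> outside \<open>D\<close>, and
  all of them supplement the third maximal subgroup \<open>cover w\<close>.  So two of the four are adjacent, and
  these cannot be in the same maximal subgroup.\<close>

lemma noncyclic_pair:
  assumes x: "x \<in> carrier G" "x \<notin> D" "\<not> cyclic_cover x" and y: "y \<in> carrier G" "y \<notin> D" "\<not> cyclic_cover y"
    and w: "w \<in> carrier G" "w \<notin> D" and ne: "cover x \<noteq> cover y" "cover w \<noteq> cover x" "cover w \<noteq> cover y"
  obtains a b where "a \<in> cover x" "a \<notin> D" "b \<in> cover y" "b \<notin> D" "cyc a <#> cyc b = carrier G"
proof (rule ccontr)
  note main = that
  assume not: "\<not> thesis"
  obtain x1 x2 where x12: "x1 \<in> cover x - D" "x2 \<in> cover x - D" "cyc x1 \<noteq> cyc x2" using noncyclic_cover(6)[OF x] by blast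
  obtain y1 y2 where y12: "y1 \<in> cover y - D" "y2 \<in> cover y - D" "cyc y1 \<noteq> cyc y2" using noncyclic_cover(6)[OF y] by blast
  let ?X = "{cyc x1, cyc x2}" and ?Y = "{cyc y1, cyc y2}"
  have sH: "subgroup (cover x) G" "subgroup (cover y) G" using x y cover_subgroup by simp_all
  have X: "subgroup V G" "V \<subseteq> cover x" "\<not> V \<subseteq> D" "\<exists>a\<in>cover x - D. V = cyc a" if V: "V \<in> ?X" for V
  proof -
    have "\<exists>a\<in>cover x - D. V = cyc a" using V x12(1,2) by (elim insertE emptyE) blast+
    then obtain a where a: "a \<in> cover x - D" "V = cyc a" by (rule bexE)
    have ac: "a \<in> carrier G" using a(1) sH(1) by (simp add: subgroup.mem_carrier)
    show "subgroup V G" unfolding a(2) using ac by (rule cyc_subgroup)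
    show "V \<subseteq> cover x" unfolding a(2) using cyc_subset[OF sH(1)] a(1) by simp
    show "\<not> V \<subseteq> D" using a mem_cyc[of a] by blast
    show "\<exists>a\<in>cover x - D. V = cyc a" using a by (rule rev_bexI)
  qed
  have Y: "subgroup V G" "V \<subseteq> cover y" "\<not> V \<subseteq> D" "\<exists>a\<in>cover y - D. V = cyc a" if V: "V \<in> ?Y" for V
  proof -
    have "\<exists>a\<in>cover y - D. V = cyc a" using V y12(1,2) by (elim insertE emptyE) blast+
    then obtain a where a: "a \<in> cover y - D" "V = cyc a" by (rule bexE)
    have ac: "a \<in> carrier G" using a(1) sH(2) by (simp add: subgroup.mem_carrier)
    show "subgroup V G" unfolding a(2) using ac by (rule cyc_subgroup)
    show "V \<subseteq> cover y" unfolding a(2) using cyc_subset[OF sH(2)] a(1) by simp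
    show "\<not> V \<subseteq> D" using a mem_cyc[of a] by blast
    show "\<exists>a\<in>cover y - D. V = cyc a" using a by (rule rev_bexI)
  qed
  have xyD: "cover x \<inter> cover y = D" using cover_eqD(2)[OF x(1,2) y(1,2)] ne(1) by simp
  have disj: "?X \<inter> ?Y = {}"
  proof (rule ccontr)
    assume "?X \<inter> ?Y \<noteq> {}"
    then obtain V where V: "V \<in> ?X" "V \<in> ?Y" by blast
    have "V \<subseteq> cover x \<inter> cover y" using X(2)[OF V(1)] Y(2)[OF V(2)] by simp
    then show False using X(3)[OF V(1)] xyD by simp
  qed
  have XY: "V <#> W \<noteq> carrier G" if V: "V \<in> ?X" and W: "W \<in> ?Y" for V W
  proof
    assume VW: "V <#> W = carrier G"
    obtain a where a: "a \<in> cover x - D" "V = cyc a" using X(4)[OF V] by (rule bexE)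
    obtain b where b: "b \<in> cover y - D" "W = cyc b" using Y(4)[OF W] by (rule bexE)
    have "cyc a <#> cyc b = carrier G" using VW unfolding a(2) b(2) .
    then have thesis using main[of a b] a(1) b(1) by simp
    then show False using not by simp
  qed
  have "card (?X \<union> ?Y) = 4" using x12(3) y12(3) disj by (simp add: card_Un_disjoint)
  moreover have "card (?X \<union> ?Y) \<le> 3"
  proof (rule star_freeD[OF sf cover_proper[OF w]])
    have prX: "proper_subgroup V G" if "V \<in> ?X" for V
    proof -
      have "card V \<le> card (cover x)" by (rule card_mono[OF finite_subgroup[OF sH(1)] X(2)[OF that]])
      then show ?thesis using X(1)[OF that] proper_subgroupD(3)[OF cover_proper[OF x(1,2)]] by (intro proper_subgroupI) simp_all
    qed
    have prY: "proper_subgroup V G" if "V \<in> ?Y" for V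
    proof -
      have "card V \<le> card (cover y)" by (rule card_mono[OF finite_subgroup[OF sH(2)] Y(2)[OF that]])
      then show ?thesis using Y(1)[OF that] proper_subgroupD(3)[OF cover_proper[OF y(1,2)]] by (intro proper_subgroupI) simp_all
    qed
    show "independent_family G (?X \<union> ?Y)"
      unfolding independent_family_def
    proof (intro conjI ballI)
      fix V assume V: "V \<in> ?X \<union> ?Y"
      show "proper_subgroup V G" using V prX[of V] prY[of V] by (elim UnE)
      fix W assume W: "W \<in> ?X \<union> ?Y"
      consider "V \<in> ?X" "W \<in> ?X" | "V \<in> ?Y" "W \<in> ?Y" | "V \<in> ?X" "W \<in> ?Y" | "V \<in> ?Y" "W \<in> ?X"
        using V W unfolding Un_iff by iprover
      then show "V <#> W \<noteq> carrier G"
      proof cases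
        case 1 show ?thesis
          by (rule not_carrier_if_in_proper[OF cover_proper[OF x(1,2)]]) (rule X(2)[OF 1(1)], rule X(2)[OF 1(2)])
      next
        case 2 show ?thesis
          by (rule not_carrier_if_in_proper[OF cover_proper[OF y(1,2)]]) (rule Y(2)[OF 2(1)], rule Y(2)[OF 2(2)])
      next
        case 3 then show ?thesis by (rule XY)
      next
        case 4
        show ?thesis
        proof
          assume "V <#> W = carrier G"
          then have "W <#> V = carrier G" using set_mult_swap[OF Y(1)[OF 4(1)] X(1)[OF 4(2)]] by simp
          then show False using XY[OF 4(2) 4(1)] by simp
        qed
      qed
    qed
    fix V assume V: "V \<in> ?X \<union> ?Y"
    have wx: "cover x \<inter> cover w = D" "cover y \<inter> cover w = D"
      using cover_eqD(2)[OF x(1,2) w] cover_eqD(2)[OF y(1,2) w] ne by simp_all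
    have sV: "subgroup V G" using V X(1)[of V] Y(1)[of V] by (elim UnE)
    have "\<not> V \<subseteq> cover w"
    proof
      assume Vw: "V \<subseteq> cover w"
      from V show False
      proof
        assume "V \<in> ?X" then show False using X(2,3)[of V] wx(1) Vw by blast
      next
        assume "V \<in> ?Y" then show False using Y(2,3)[of V] wx(2) Vw by blast
      qed
    qed
    with sV show "cover w <#> V = carrier G"
      using prime_index_supplement(1)[OF p cover_normal[OF w] cover_index[OF w]] by simp
  qed
  ultimately show False by simp
qed

lemma noncyclic_pair_order:
  assumes x: "x \<in> carrier G" "x \<notin> D" "\<not> cyclic_cover x" and y: "y \<in> carrier G" "y \<notin> D" "\<not> cyclic_cover y"
    and xy: "cyc x <#> cyc y = carrier G"
  shows "order G = 16 * card (cyc x \<inter> cyc y)"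
proof -
  have "order G * card (cyc x \<inter> cyc y) = ord x * ord y"
    using card_set_mult[OF cyc_subgroup[OF x(1)] cyc_subgroup[OF y(1)]] xy card_cyc[OF x(1)] card_cyc[OF y(1)]
    by (simp add: order_def)
  then have "order G * (16 * card (cyc x \<inter> cyc y)) = (4 * ord x) * (4 * ord y)" by simp
  also have "\<dots> = order G * order G" using noncyclic_cover(2)[OF x] noncyclic_cover(2)[OF y] by simp
  finally show ?thesis using order_pos by simp
qed

lemma noncyclic_cover_transfer:
  assumes "y \<in> carrier G" "y \<notin> D" "\<not> cyclic_cover y" "z \<in> cover y" "z \<notin> D"
  shows "z \<in> carrier G" "\<not> cyclic_cover z" "cover z = cover y"
proof -
  show "z \<in> carrier G" using assms cover_subgroup by (metis subgroup.mem_carrier)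
  show "cover z = cover y" using cover_eq[OF assms(1,2,4,5)] .
  then show "\<not> cyclic_cover z" using assms(3) by (simp add: cyclic_cover_def)
qed

text \<open>If the two squares generated the same subgroup, the factors \<open>\<langle>a\<rangle>\<close>, \<open>\<langle>b\<rangle>\<close> of \<open>G\<close> found in the two
  maximal subgroups would meet in at least \<open>|G|/8\<close> elements, but \<open>|G| = 16|\<langle>a\<rangle> \<inter> \<langle>b\<rangle>|\<close>.\<close>

lemma noncyclic_pair_squares:
  assumes x: "x \<in> carrier G" "x \<notin> D" "\<not> cyclic_cover x" and y: "y \<in> carrier G" "y \<notin> D" "\<not> cyclic_cover y"
    and w: "w \<in> carrier G" "w \<notin> D" and ne: "cover x \<noteq> cover y" "cover w \<noteq> cover x" "cover w \<noteq> cover y"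
  shows "cyc (x [^] (2::nat)) \<noteq> cyc (y [^] (2::nat))"
proof
  assume eq: "cyc (x [^] (2::nat)) = cyc (y [^] (2::nat))"
  obtain a b where ab: "a \<in> cover x" "a \<notin> D" "b \<in> cover y" "b \<notin> D" "cyc a <#> cyc b = carrier G"
    using noncyclic_pair[OF x y w ne] by blast
  have a: "a \<in> carrier G" "\<not> cyclic_cover a" using noncyclic_cover_transfer[OF x ab(1,2)] by simp_all
  have b: "b \<in> carrier G" "\<not> cyclic_cover b" using noncyclic_cover_transfer[OF y ab(3,4)] by simp_all
  have E: "cyc (a [^] (2::nat)) = cyc (b [^] (2::nat))"
    using noncyclic_cover(4)[OF x ab(1,2)] noncyclic_cover(4)[OF y ab(3,4)] eq by simp
  have s: "subgroup (cyc a) G" "subgroup (cyc b) G" using a b cyc_subgroup by simp_all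
  have "cyc (a [^] (2::nat)) \<subseteq> cyc a" using cyc_subset[OF s(1) pow_mem_cyc[OF a(1)]] .
  moreover have "cyc (b [^] (2::nat)) \<subseteq> cyc b" using cyc_subset[OF s(2) pow_mem_cyc[OF b(1)]] .
  ultimately have "cyc (a [^] (2::nat)) \<subseteq> cyc a \<inter> cyc b" using E by simp
  then have "ord (a [^] (2::nat)) \<le> card (cyc a \<inter> cyc b)"
    using card_mono[OF finite_Int[OF disjI1[OF finite_subgroup[OF s(1)]]]] card_cyc[of "a [^] (2::nat)"] a(1) by (metis nat_pow_closed)
  then show False
    using noncyclic_cover(3)[OF a(1) ab(2) a(2)] noncyclic_pair_order[OF a(1) ab(2) a(2) b(1) ab(4) b(2) ab(5)] order_pos by simp
qed

lemma mult_not_in_cover: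
  assumes x: "x \<in> carrier G" "x \<notin> D" and y: "y \<in> carrier G" "y \<notin> D" and ne: "cover x \<noteq> cover y"
    and u: "u \<in> cover x"
  shows "u \<otimes> y \<notin> cover x"
proof
  assume "u \<otimes> y \<in> cover x"
  have sH: "subgroup (cover x) G" using x(1) by (rule cover_subgroup)
  have uc: "u \<in> carrier G" using u sH by (simp add: subgroup.mem_carrier)
  have "inv u \<otimes> (u \<otimes> y) \<in> cover x" using sH u \<open>u \<otimes> y \<in> cover x\<close> by (simp add: subgroup.m_closed subgroup.m_inv_closed)
  then have "y \<in> cover x" using uc y by (simp add: word_simps)
  then show False using cover_eqD(1)[OF x y] ne by simp
qed

text \<open>The product provides a third maximal subgroup over \<open>D\<close>.\<close>

lemma mult_outside:
  assumes x: "x \<in> carrier G" "x \<notin> D" and y: "y \<in> carrier G" "y \<notin> D" and ne: "cover x \<noteq> cover y"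
  shows "x \<otimes> y \<in> carrier G" "x \<otimes> y \<notin> D" "cover (x \<otimes> y) \<noteq> cover x" "cover (x \<otimes> y) \<noteq> cover y"
proof -
  show c: "x \<otimes> y \<in> carrier G" using x y by simp
  have 1: "x \<otimes> y \<notin> cover x" using mult_not_in_cover[OF x y ne cover_upper(3)[OF x(1)]] .
  have 2: "x \<otimes> y \<notin> cover y"
  proof
    assume *: "x \<otimes> y \<in> cover y"
    have sH: "subgroup (cover y) G" using y(1) by (rule cover_subgroup)
    have "x \<otimes> y \<otimes> inv y \<in> cover y" using sH * cover_upper(3)[OF y(1)] by (simp add: subgroup.m_closed subgroup.m_inv_closed)
    then have "x \<in> cover y" using x y by (simp add: m_assoc)
    then show False using cover_eqD(1)[OF y x] ne by simp
  qed
  show "x \<otimes> y \<notin> D" using 1 cover_upper(1)[OF x(1)] by blast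
  show "cover (x \<otimes> y) \<noteq> cover x" "cover (x \<otimes> y) \<noteq> cover y" using 1 2 cover_upper(3)[OF c] by auto
qed

text \<open>If some maximal subgroup over \<open>D\<close> were cyclic, \<open>D\<close> would be cyclic as well and have only one
  subgroup of index \<open>2\<close>; but \<open>\<langle>x\<^sup>2\<rangle>\<close> and \<open>\<langle>y\<^sup>2\<rangle>\<close> are two of them.\<close>

lemma all_noncyclic:
  assumes x: "x \<in> carrier G" "x \<notin> D" "\<not> cyclic_cover x" and y: "y \<in> carrier G" "y \<notin> D" "\<not> cyclic_cover y"
    and ne: "cover x \<noteq> cover y" and v: "v \<in> carrier G" "v \<notin> D"
  shows "\<not> cyclic_cover v"
proof
  assume "cyclic_cover v"
  then have cv: "cyc v = cover v" using cover_upper(3)[OF v(1)] v(2) by (simp add: cyclic_cover_def)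
  have p2: "p = 2" using noncyclic_cover(1)[OF x] .
  obtain l where l: "ord v = p ^ l" using ord_power[OF v(1)] by blast
  have "ord v = p * card D" using card_cover[OF v] card_cyc[OF v(1)] cv by simp
  then have D: "D = cyc (v [^] (2::nat))"
    using cyclic_pgroup_maximal[OF p v(1) l sD] cover_upper(1)[OF v(1)] cv p2 by simp
  have vc: "v [^] (2::nat) \<in> carrier G" using v by simp
  obtain l' where l': "ord (v [^] (2::nat)) = p ^ l'" using ord_power[OF vc] by blast
  have E: "cyc (z [^] (2::nat)) = cyc ((v [^] (2::nat)) [^] p)" if z: "z \<in> carrier G" "z \<notin> D" "\<not> cyclic_cover z" for z
  proof (rule cyclic_pgroup_maximal[OF p vc l'])
    show "subgroup (cyc (z [^] (2::nat))) G" using z by (intro cyc_subgroup) simp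
    show "cyc (z [^] (2::nat)) \<subseteq> cyc (v [^] (2::nat))"
      unfolding D[symmetric] using cyc_subset[OF sD] pow_p_in_D[OF z(1)] p2 by simp
    have "ord (v [^] (2::nat)) = card D" using D card_cyc[OF vc] by simp
    then show "ord (v [^] (2::nat)) = p * card (cyc (z [^] (2::nat)))"
      using noncyclic_cover(3)[OF z] card_D p2 card_cyc[of "z [^] (2::nat)"] z(1) by simp
  qed
  show False using E[OF x] E[OF y] noncyclic_pair_squares[OF x y mult_outside(1,2)[OF x(1,2) y(1,2) ne] ne
      mult_outside(3,4)[OF x(1,2) y(1,2) ne]] by simp
qed

end

context two_maximal_pgroup begin

text \<open>With \<open>G = \<langle>a\<rangle>\<langle>b\<rangle>\<close>, the square of \<open>ab\<close> lies in neither \<open>\<langle>a\<^sup>2\<rangle>\<close> nor \<open>\<langle>b\<^sup>2\<rangle>\<close>, which forces the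
  commutator of \<open>a\<close> and \<open>b\<close> into the central subgroup \<open>Z = \<langle>a\<rangle> \<inter> \<langle>b\<rangle>\<close>.  Then a suitable
  \<open>a\<^sup>jb\<close> has order at most \<open>8\<close>, and in a second round at most \<open>4\<close>.\<close>

lemma noncyclic_factorization:
  assumes a: "a \<in> carrier G" "a \<notin> D" and b: "b \<in> carrier G" "b \<notin> D" and ne: "cover a \<noteq> cover b"
    and nc: "\<And>v. v \<in> carrier G \<Longrightarrow> v \<notin> D \<Longrightarrow> \<not> cyclic_cover v" and ab: "cyc a <#> cyc b = carrier G"
  shows "G \<cong> integer_mod_group 4 \<times>\<times> integer_mod_group 4"
proof -
  have nca: "\<not> cyclic_cover a" and ncb: "\<not> cyclic_cover b" using nc a b by simp_all
  note na = noncyclic_cover[OF a nca] and nb = noncyclic_cover[OF b ncb]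
  have p2: "p = 2" by (rule na(1))
  let ?A = "a [^] (2::nat)" and ?B = "b [^] (2::nat)"
  have cc: "?A \<in> carrier G" "?B \<in> carrier G" using a b by simp_all
  define Z where "Z = cyc a \<inter> cyc b"
  have sc: "subgroup (cyc a) G" "subgroup (cyc b) G" "subgroup (cyc ?A) G" "subgroup (cyc ?B) G"
    using a b cc by (simp_all add: cyc_subgroup)
  have sZ: "subgroup Z G" unfolding Z_def using sc(1,2) by (rule subgroups_Inter_pair)
  have oZ: "order G = 16 * card Z" unfolding Z_def by (rule noncyclic_pair_order[OF a nca b ncb ab])
  have oa: "ord a = 4 * card Z" "ord b = 4 * card Z" "ord ?A = 2 * card Z" "ord ?B = 2 * card Z"
    using oZ na(2,3) nb(2,3) by simp_all
  have Zpos: "card Z > 0" using sZ by (rule card_subgroup_pos)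
  obtain l where l: "ord a = p ^ l" using ord_power[OF a(1)] by blast
  obtain m where m: "ord b = p ^ m" using ord_power[OF b(1)] by blast
  obtain l' where l': "ord ?A = p ^ l'" using ord_power[OF cc(1)] by blast
  obtain m' where m': "ord ?B = p ^ m'" using ord_power[OF cc(2)] by blast
  have "card Z \<noteq> ord a" "card Z \<noteq> ord b" using oa Zpos by simp_all
  then have neZ: "Z \<noteq> cyc a" "Z \<noteq> cyc b" using card_cyc[OF a(1)] card_cyc[OF b(1)] by auto
  have ZA: "Z \<subseteq> cyc ?A"
    using cyclic_pgroup_proper[OF p a(1) l sZ _ neZ(1)] p2 by (simp add: Z_def)
  have ZB: "Z \<subseteq> cyc ?B"
    using cyclic_pgroup_proper[OF p b(1) m sZ _ neZ(2)] p2 by (simp add: Z_def)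
  have Za4: "Z = cyc (a [^] (4::nat))"
    using cyclic_pgroup_maximal[OF p cc(1) l' sZ ZA] oa(3) p2 a(1) by (simp add: nat_pow_pow)
  have Zb4: "Z = cyc (b [^] (4::nat))"
    using cyclic_pgroup_maximal[OF p cc(2) m' sZ ZB] oa(4) p2 b(1) by (simp add: nat_pow_pow)
  have Zc: "z \<in> carrier G" if "z \<in> Z" for z using that sZ by (simp add: subgroup.mem_carrier)
  have Zcentral: "z \<otimes> g = g \<otimes> z" if z: "z \<in> Z" and g: "g \<in> carrier G" for z g
  proof -
    have "g \<in> cyc a <#> cyc b" using g ab by simp
    then obtain u v where uv: "u \<in> cyc a" "v \<in> cyc b" "g = u \<otimes> v" by (rule set_multE)
    have c: "u \<in> carrier G" "v \<in> carrier G" "z \<in> carrier G" using uv sc Zc z by (simp_all add: subgroup.mem_carrier)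
    have 1: "z \<otimes> u = u \<otimes> z" "z \<otimes> v = v \<otimes> z" using z uv a b cyc_commute by (simp_all add: Z_def)
    have "z \<otimes> g = (z \<otimes> u) \<otimes> v" using uv(3) c by (simp add: m_assoc)
    also have "\<dots> = u \<otimes> (z \<otimes> v)" unfolding 1(1) using c by (simp add: m_assoc)
    also have "\<dots> = g \<otimes> z" unfolding 1(2) uv(3) using c by (simp add: m_assoc)
    finally show ?thesis .
  qed
  have AD: "?A \<in> D" "?B \<in> D" using pow_p_in_D[OF a(1)] pow_p_in_D[OF b(1)] p2 by simp_all
  have AB: "?B \<otimes> ?A = ?A \<otimes> ?B" using na(5)[of ?B] AD(2) cover_upper(1)[OF a(1)] by blast
  have Dprod: "cyc ?A <#> cyc ?B = D"
  proof (rule card_subset_eq)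
    show "finite D" using sD by (rule finite_subgroup)
    show "cyc ?A <#> cyc ?B \<subseteq> D"
      by (rule set_mult_subset_subgroup[OF sD cyc_subset[OF sD AD(1)] cyc_subset[OF sD AD(2)]])
    have "cyc ?A \<inter> cyc ?B = Z"
    proof
      show "Z \<subseteq> cyc ?A \<inter> cyc ?B" using ZA ZB by simp
      show "cyc ?A \<inter> cyc ?B \<subseteq> Z" unfolding Z_def
        using cyc_subset[OF sc(1) pow_mem_cyc[OF a(1)], of 2] cyc_subset[OF sc(2) pow_mem_cyc[OF b(1)], of 2] by blast
    qed
    then have "card (cyc ?A <#> cyc ?B) * card Z = (2 * card Z) * (2 * card Z)"
      using card_set_mult[OF sc(3,4)] oa(3,4) card_cyc[OF cc(1)] card_cyc[OF cc(2)] by simp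
    then have "card (cyc ?A <#> cyc ?B) = 4 * card Z" using Zpos by simp
    then show "card (cyc ?A <#> cyc ?B) = card D" using card_D p2 oZ by simp
  qed
  let ?t = "a \<otimes> b"
  note t = mult_outside[OF a b ne]
  have tn: "\<not> cyclic_cover ?t" using nc[OF t(1,2)] .
  have nEA: "cyc (?t [^] (2::nat)) \<noteq> cyc ?A"
    by (rule noncyclic_pair_squares[OF t(1,2) tn a nca b]) (use t ne in auto)
  have nEB: "cyc (?t [^] (2::nat)) \<noteq> cyc ?B"
    by (rule noncyclic_pair_squares[OF t(1,2) tn b ncb a]) (use t ne in auto)
  have ot: "ord (?t [^] (2::nat)) = 2 * card Z" using noncyclic_cover(3)[OF t(1,2) tn] oZ by simp
  have tc: "?t [^] (2::nat) \<in> carrier G" using t(1) by simp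
  have tA: "?t [^] (2::nat) \<notin> cyc ?A"
    using cyc_eqI[OF sc(3), of "?t [^] (2::nat)"] nEA ot oa(3) card_cyc[OF cc(1)] by auto
  have tB: "?t [^] (2::nat) \<notin> cyc ?B"
    using cyc_eqI[OF sc(4), of "?t [^] (2::nat)"] nEB ot oa(4) card_cyc[OF cc(2)] by auto
  have "?t [^] (2::nat) \<in> cyc ?A <#> cyc ?B" unfolding Dprod using pow_p_in_D[OF t(1)] p2 by simp
  then obtain e1 e2 where e: "e1 \<in> cyc ?A" "e2 \<in> cyc ?B" "?t [^] (2::nat) = e1 \<otimes> e2" by (rule set_multE)
  obtain i :: nat where i: "e1 = ?A [^] i" using e(1) cyc_eq[OF cc(1)] by auto
  obtain r :: nat where r: "e2 = ?B [^] r" using e(2) cyc_eq[OF cc(2)] by auto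
  have a4Z: "(a [^] (4::nat)) [^] s \<in> Z" "(b [^] (4::nat)) [^] s \<in> Z" for s :: nat
    using pow_mem_cyc[of "a [^] (4::nat)" s] pow_mem_cyc[of "b [^] (4::nat)" s] a b Za4 Zb4 by simp_all
  \<comment> \<open>An even exponent would put one factor of \<open>(ab)\<^sup>2\<close> into \<open>Z\<close>, which is inside both cyclic groups.\<close>
  have "odd r"
  proof
    assume "even r"
    then obtain s where "r = 2 * s" by (elim evenE)
    then have "e2 = (b [^] (4::nat)) [^] s" using r b by (simp add: nat_pow_pow)
    then have "e2 \<in> cyc ?A" using a4Z(2) ZA by blast
    then show False using tA e sc(3) by (simp add: subgroup.m_closed)
  qed
  then obtain r' where r': "r = 2 * r' + 1" by (elim oddE)
  have "odd i"
  proof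
    assume "even i"
    then obtain s where "i = 2 * s" by (elim evenE)
    then have "e1 = (a [^] (4::nat)) [^] s" using i a by (simp add: nat_pow_pow)
    then have "e1 \<in> cyc ?B" using a4Z(1) ZB by blast
    then show False using tB e sc(4) by (simp add: subgroup.m_closed)
  qed
  then obtain i' where i': "i = 2 * i' + 1" by (elim oddE)
  \<comment> \<open>Comparing \<open>(ab)\<^sup>2 = a\<^sup>2b\<^sup>2c\<^sup>b\<close> with \<open>(ab)\<^sup>2 \<in> a\<^sup>2Z \<sdot> b\<^sup>2Z\<close> puts the commutator \<open>c\<close> into \<open>Z\<close>.\<close>
  define c where "c = inv b \<otimes> inv a \<otimes> b \<otimes> a"
  have c: "c \<in> carrier G" and ba: "b \<otimes> a = a \<otimes> b \<otimes> c" using a b by (simp_all add: c_def word_simps)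
  define c2 where "c2 = inv b \<otimes> c \<otimes> b"
  have c2: "c2 \<in> carrier G" "c \<otimes> b = b \<otimes> c2" using b c by (simp_all add: c2_def word_simps)
  have "?t [^] (2::nat) = ?A \<otimes> ?B \<otimes> c2"
  proof -
    have "?t [^] (2::nat) = a \<otimes> (b \<otimes> a) \<otimes> b" using a b by (simp add: numeral_2_eq_2 m_assoc)
    also have "\<dots> = a \<otimes> a \<otimes> b \<otimes> (c \<otimes> b)" unfolding ba using a b c by (simp add: m_assoc)
    also have "\<dots> = ?A \<otimes> ?B \<otimes> c2" unfolding c2(2) using a b c2(1) by (simp add: numeral_2_eq_2 m_assoc)
    finally show ?thesis .
  qed
  moreover have "e1 = (a [^] (4::nat)) [^] i' \<otimes> ?A"
    unfolding i i' using a by (simp add: nat_pow_pow nat_pow_mult)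
  moreover have "e2 = ?B \<otimes> (b [^] (4::nat)) [^] r'"
    unfolding r r' using b by (simp add: nat_pow_pow nat_pow_mult)
  ultimately have "?A \<otimes> ?B \<otimes> c2 = (a [^] (4::nat)) [^] i' \<otimes> (?A \<otimes> ?B) \<otimes> (b [^] (4::nat)) [^] r'"
    using e(3) a b by (simp add: m_assoc)
  also have "(a [^] (4::nat)) [^] i' \<otimes> (?A \<otimes> ?B) = (?A \<otimes> ?B) \<otimes> (a [^] (4::nat)) [^] i'"
    by (rule Zcentral[OF a4Z(1)]) (use a b in simp)
  also have "(?A \<otimes> ?B) \<otimes> (a [^] (4::nat)) [^] i' \<otimes> (b [^] (4::nat)) [^] r' =
      ?A \<otimes> ?B \<otimes> ((a [^] (4::nat)) [^] i' \<otimes> (b [^] (4::nat)) [^] r')" using a b by (simp add: m_assoc)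
  finally have "c2 = (a [^] (4::nat)) [^] i' \<otimes> (b [^] (4::nat)) [^] r'"
    using l_cancel[of "?A \<otimes> ?B" c2 "(a [^] (4::nat)) [^] i' \<otimes> (b [^] (4::nat)) [^] r'"] a b c2(1) by simp
  then have c2Z: "c2 \<in> Z" using a4Z sZ by (simp add: subgroup.m_closed)
  have "c \<otimes> b = c2 \<otimes> b" using c2(2) Zcentral[OF c2Z b(1)] by simp
  then have "c = c2" using c c2(1) b by simp
  then have cZ: "c \<in> Z" using c2Z by simp
  have ba_pow: "b \<otimes> a [^] n = a [^] n \<otimes> b \<otimes> c [^] n" for n :: nat
  proof (induction n)
    case (Suc n)
    have cn: "c [^] n \<otimes> a = a \<otimes> c [^] n"
      using Zcentral[OF cZ a(1)] a c by (intro group_commutes_pow)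
    have "b \<otimes> a [^] Suc n = (b \<otimes> a [^] n) \<otimes> a" using a b by (simp add: m_assoc)
    also have "\<dots> = a [^] n \<otimes> b \<otimes> (c [^] n \<otimes> a)" unfolding Suc using a b c by (simp add: m_assoc)
    also have "\<dots> = a [^] n \<otimes> (b \<otimes> a) \<otimes> c [^] n" unfolding cn using a b c by (simp add: m_assoc)
    also have "\<dots> = a [^] Suc n \<otimes> b \<otimes> (c \<otimes> c [^] n)" unfolding ba using a b c by (simp add: m_assoc)
    also have "c \<otimes> c [^] n = c [^] Suc n" using c by (metis nat_pow_Suc2)
    finally show ?case .
  qed (use a b in simp)
  have c4: "c [^] (4::nat) = \<one>"
  proof -
    have "a [^] (4::nat) \<otimes> b = b \<otimes> a [^] (4::nat)" using Zcentral[OF a4Z(1)[of 1] b(1)] a by simp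
    then have "(a [^] (4::nat) \<otimes> b) \<otimes> c [^] (4::nat) = a [^] (4::nat) \<otimes> b" using ba_pow[of 4] by simp
    then show ?thesis using a b c by simp
  qed
  \<comment> \<open>As \<open>\<langle>a\<^sup>4\<rangle> = Z = \<langle>b\<^sup>4\<rangle>\<close>, a power of \<open>a\<close> cancels \<open>b\<^sup>4\<close> in the fourth power of \<open>a\<^sup>jb\<close>.\<close>
  have "inv (b [^] (4::nat)) \<in> Z" using a4Z(2)[of 1] sZ b by (simp add: subgroup.m_inv_closed)
  then obtain j :: nat where j: "inv (b [^] (4::nat)) = (a [^] (4::nat)) [^] j"
    using cyc_eq[of "a [^] (4::nat)"] a unfolding Za4 by auto
  let ?u = "a [^] j \<otimes> b" and ?C = "c [^] j"
  have u: "?u \<in> carrier G" using a b by simp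
  have uD: "?u \<notin> D"
  proof -
    have "a [^] j \<in> cover a"
      using pow_mem_subgroup[OF cover_subgroup[OF a(1)] cover_upper(3)[OF a(1)]] .
    then have "?u \<notin> cover a" by (rule mult_not_in_cover[OF a b ne])
    then show ?thesis using cover_upper(1)[OF a(1)] by blast
  qed
  have Cc: "?C \<in> carrier G" using c by simp
  have CZ: "?C \<in> Z" using pow_mem_subgroup[OF sZ cZ] .
  have ou: "order G = 4 * ord ?u" using noncyclic_cover(2)[OF u uD nc[OF u uD]] .
  have u2: "?u [^] (2::nat) = ?A [^] j \<otimes> ?B \<otimes> ?C"
  proof -
    have "?u [^] (2::nat) = a [^] j \<otimes> (b \<otimes> a [^] j) \<otimes> b" using a b by (simp add: numeral_2_eq_2 m_assoc)
    also have "\<dots> = (a [^] j \<otimes> a [^] j) \<otimes> b \<otimes> (?C \<otimes> b)" unfolding ba_pow using a b c by (simp add: m_assoc)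
    also have "?C \<otimes> b = b \<otimes> ?C" using Zcentral[OF CZ b(1)] .
    also have "a [^] j \<otimes> a [^] j = ?A [^] j" using a by (simp add: nat_pow_pow nat_pow_mult mult_2)
    finally show ?thesis using a b Cc by (simp add: numeral_2_eq_2 m_assoc)
  qed
  have u4: "?u [^] (4::nat) = ?C [^] (2::nat)"
  proof -
    have "?B \<otimes> ?A [^] j = ?A [^] j \<otimes> ?B"
      using group_commutes_pow[of ?A ?B j] AB cc by simp
    then have "(?A [^] j \<otimes> ?B) [^] (2::nat) = (?A [^] j) [^] (2::nat) \<otimes> ?B [^] (2::nat)"
      using cc by (intro pow_mult_distrib) simp_all
    also have "(?A [^] j) [^] (2::nat) = inv (b [^] (4::nat))" unfolding j using a by (simp add: nat_pow_pow mult.commute)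
    also have "?B [^] (2::nat) = b [^] (4::nat)" using b by (simp add: nat_pow_pow)
    also have "inv (b [^] (4::nat)) \<otimes> b [^] (4::nat) = \<one>" using b by simp
    finally have 1: "(?A [^] j \<otimes> ?B) [^] (2::nat) = \<one>" .
    have "?u [^] (4::nat) = (?u [^] (2::nat)) [^] (2::nat)" using u by (simp add: nat_pow_pow)
    also have "\<dots> = (?A [^] j \<otimes> ?B) [^] (2::nat) \<otimes> ?C [^] (2::nat)"
      unfolding u2 using Zcentral[OF CZ, of "?A [^] j \<otimes> ?B"] cc Cc by (intro pow_mult_distrib) simp_all
    finally show ?thesis using 1 Cc by simp
  qed
  have "?u [^] (8::nat) = (?u [^] (4::nat)) [^] (2::nat)" using u by (simp add: nat_pow_pow)
  also have "\<dots> = (c [^] (4::nat)) [^] j" unfolding u4 using c by (simp add: nat_pow_pow mult.commute)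
  also have "\<dots> = \<one>" using c4 by simp
  finally have "ord ?u \<le> 8" using u by (intro dvd_imp_le) (simp_all add: pow_eq_id)
  \<comment> \<open>An element outside \<open>D\<close> has order \<open>4|Z|\<close>.  With \<open>|Z| \<le> 2\<close> the square of \<open>c\<^sup>j\<close> vanishes, and the order
  of \<open>a\<^sup>jb\<close> drops to \<open>4\<close>.\<close>
  then have "card Z \<le> 2" using ou oZ by simp
  then have "card Z = 1 \<or> card Z = 2" using Zpos by linarith
  then have "card Z dvd 2" by auto
  moreover have "ord ?C dvd card Z" using ord_dvd_card[OF sZ CZ] .
  ultimately have "?C [^] (2::nat) = \<one>" using Cc pow_eq_id by (metis dvd_trans)
  then have "ord ?u \<le> 4" using u u4 by (intro dvd_imp_le) (simp_all add: pow_eq_id)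
  then have Z1: "card Z = 1" using ou oZ Zpos by simp
  then have "Z = {\<one>}" using subgroup.one_closed[OF sZ] by (metis card_1_singletonE singletonD)
  then have "c = \<one>" using cZ by simp
  then have "a \<otimes> b = b \<otimes> a" using ba a b by simp
  moreover have o4: "ord a = 4" "ord b = 4" using oa Z1 by simp_all
  moreover have "order G = 4 * 4" using oZ Z1 by simp
  ultimately have "metacyclic G 4 4 0 1 a b"
    using a(1) b(1) set_mult_swap[OF sc(1,2) ab] pow_ord_eq_1[OF a(1)] pow_ord_eq_1[OF b(1)]
    by (intro metacyclicI) simp_all
  moreover have "metacyclic (integer_mod_group 4 \<times>\<times> integer_mod_group 4) 4 4 0 1 (1 mod int 4, 0) (0, 1 mod int 4)"
    by (rule metacyclic_DirProd) simp_all
  ultimately show ?thesis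
    by (rule metacyclic_iso[OF is_group DirProd_group[OF group_integer_mod_group group_integer_mod_group]])
qed

text \<open>Among the three maximal subgroups over \<open>D\<close> through \<open>a\<close>, \<open>b\<close> and \<open>ab\<close>, two are cyclic or two are
  not.\<close>

lemma classification:
  "G \<cong> integer_mod_group p \<times>\<times> integer_mod_group p \<or> G \<cong> quaternion_group \<or>
   G \<cong> integer_mod_group 4 \<times>\<times> integer_mod_group 2 \<or> G \<cong> integer_mod_group 4 \<times>\<times> integer_mod_group 4"
proof -
  have cMN: "card M = card N" using M N p1 by simp
  have "\<not> M \<subseteq> N" using cMN MN finite_subgroup[OF sM(2)] by (metis card_subset_eq)
  then obtain a where a: "a \<in> M" "a \<notin> N" by blast
  have "\<not> N \<subseteq> M" using cMN MN finite_subgroup[OF sM(1)] by (metis card_subset_eq)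
  then obtain b where b: "b \<in> N" "b \<notin> M" by blast
  have ac: "a \<in> carrier G" "a \<notin> D" using a sM by (simp_all add: D_def subgroup.mem_carrier)
  have bc: "b \<in> carrier G" "b \<notin> D" using b sM by (simp_all add: D_def subgroup.mem_carrier)
  have "cover a \<subseteq> M" using cover_subset[OF sM(1) _ a(1)] by (simp add: D_def)
  then have ne: "cover a \<noteq> cover b" using b(2) cover_upper(3)[OF bc(1)] by blast
  note d = mult_outside[OF ac bc ne]
  let ?d = "a \<otimes> b"
  have fin: ?thesis if x: "x \<in> carrier G" "x \<notin> D" "\<not> cyclic_cover x"
    and y: "y \<in> carrier G" "y \<notin> D" "\<not> cyclic_cover y" and xy: "cover x \<noteq> cover y" for x y
  proof -
    note w = mult_outside[OF x(1,2) y(1,2) xy]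
    obtain u v where uv: "u \<in> cover x" "u \<notin> D" "v \<in> cover y" "v \<notin> D" "cyc u <#> cyc v = carrier G"
      by (rule noncyclic_pair[OF x y w(1,2) xy w(3,4)])
    note u = noncyclic_cover_transfer[OF x uv(1,2)] and v = noncyclic_cover_transfer[OF y uv(3,4)]
    have "G \<cong> integer_mod_group 4 \<times>\<times> integer_mod_group 4"
      by (rule noncyclic_factorization[OF u(1) uv(2) v(1) uv(4) _ all_noncyclic[OF x y xy] uv(5)]) (use u(3) v(3) xy in simp_all)
    then show ?thesis by blast
  qed
  consider "cyclic_cover a" "cyclic_cover b" | "cyclic_cover a" "cyclic_cover ?d" | "cyclic_cover b" "cyclic_cover ?d"
    | "\<not> cyclic_cover a" "\<not> cyclic_cover b" | "\<not> cyclic_cover a" "\<not> cyclic_cover ?d" | "\<not> cyclic_cover b" "\<not> cyclic_cover ?d"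
    by blast
  then show ?thesis
  proof cases
    case 1 show ?thesis using two_cyclic_covers[OF ac 1(1) bc 1(2) ne] by blast
  next
    case 2 show ?thesis using two_cyclic_covers[OF ac 2(1) d(1,2) 2(2)] d(3) by metis
  next
    case 3 show ?thesis using two_cyclic_covers[OF bc 3(1) d(1,2) 3(2)] d(4) by metis
  next
    case 4 show ?thesis by (rule fin[OF ac 4(1) bc 4(2) ne])
  next
    case 5 show ?thesis by (rule fin[OF ac 5(1) d(1,2) 5(2)]) (use d(3) in simp)
  next
    case 6 show ?thesis by (rule fin[OF bc 6(1) d(1,2) 6(2)]) (use d(4) in simp)
  qed
qed

end

theorem (in fin_group) star_free_pgroup_cases:
  assumes "star_free G" and "Factorial_Ring.prime (p::nat)" and "order G = p ^ k"
    and "\<And>x. x \<in> carrier G \<Longrightarrow> cyc x \<noteq> carrier G"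
  shows "G \<cong> integer_mod_group p \<times>\<times> integer_mod_group p \<or> G \<cong> quaternion_group \<or>
   G \<cong> integer_mod_group 4 \<times>\<times> integer_mod_group 2 \<or> G \<cong> integer_mod_group 4 \<times>\<times> integer_mod_group 4"
proof -
  obtain M N where MN: "M \<lhd> G" "order G = p * card M" "N \<lhd> G" "order G = p * card N" "M \<noteq> N"
    using pgroup_two_maximal[OF assms] by blast
  interpret two_maximal_pgroup G p k M N
    by (intro two_maximal_pgroup.intro two_maximal_pgroup_axioms.intro fin_group_axioms assms(1-3) MN)
  show ?thesis by (rule classification)
qed

section \<open>Groups that are not of prime power order\<close>

text \<open>If \<open>P\<close> is a normal supplement of a vertex \<open>N\<close> of the graph of \<open>G\<close>, all proper subgroups of \<open>G/P\<close>
  become neighbours of \<open>N\<close>, and star-freeness of \<open>G\<close> turns into this condition on \<open>G/P\<close>.\<close>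

definition strongly_star_free :: "('a, 'b) monoid_scheme \<Rightarrow> bool" where
  "strongly_star_free G \<longleftrightarrow> (\<forall>\<S>. independent_family G \<S> \<longrightarrow> card \<S> \<le> 3)"

context fin_group begin

lemma card_preimage:
  assumes N: "N \<lhd> G" and W: "subgroup W (G Mod N)"
  shows "card {x \<in> carrier G. N #> x \<in> W} = card W * card N"
proof -
  have sN: "subgroup N G" using N by (rule normal_imp_subgroup)
  let ?P = "{x \<in> carrier G. N #> x \<in> W}"
  have WC: "W \<subseteq> (\<lambda>x. N #> x) ` carrier G" using subgroup.subset[OF W] quotient_hom(2)[OF N] by simp
  then have im: "(\<lambda>x. N #> x) ` ?P = W" by blast
  have fibre: "card {x \<in> ?P. N #> x = V} = card N" if V: "V \<in> W" for V
  proof -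
    obtain g where g: "g \<in> carrier G" "V = N #> g" using V WC by blast
    have "{x \<in> ?P. N #> x = V} = V"
    proof (intro equalityI subsetI)
      fix x assume "x \<in> {x \<in> ?P. N #> x = V}"
      then show "x \<in> V" using rcos_self[OF _ sN, of x] by auto
    next
      fix x assume x: "x \<in> V"
      have xc: "x \<in> carrier G" using x g r_coset_subset_G[OF subgroup.subset[OF sN] g(1)] by blast
      have "N #> x = V" using repr_independence[OF _ g(1) sN] x g by simp
      then show "x \<in> {x \<in> ?P. N #> x = V}" using xc V by simp
    qed
    moreover have "V \<in> rcosets N" using g by (auto simp: RCOSETS_def)
    then have "card V = card N" using card_rcosets_equal[OF _ subgroup.subset[OF sN]] by simp
    ultimately show ?thesis by simp
  qed
  have "card ?P = (\<Sum>V\<in>(\<lambda>x. N #> x) ` ?P. card {x \<in> ?P. N #> x = V})"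
    unfolding card_eq_sum by (rule sum.image_gen) simp
  also have "\<dots> = (\<Sum>V\<in>W. card N)" unfolding im by (rule sum.cong) (use fibre in auto)
  finally show ?thesis by simp
qed

lemma preimage_normal_prime_index:
  assumes N: "N \<lhd> G" and W: "W \<lhd> (G Mod N)" "order (G Mod N) = r * card W"
  shows "{x \<in> carrier G. N #> x \<in> W} \<lhd> G" "order G = r * card {x \<in> carrier G. N #> x \<in> W}"
proof -
  interpret h: group_hom G "G Mod N" "\<lambda>x. N #> x" using quotient_hom(1)[OF N] .
  have sW: "subgroup W (G Mod N)" using W(1) by (rule normal_imp_subgroup)
  show "order G = r * card {x \<in> carrier G. N #> x \<in> W}"
    using card_preimage[OF N sW] quotient_hom(4)[OF N] W(2) by (simp add: mult.assoc)
  show "{x \<in> carrier G. N #> x \<in> W} \<lhd> G"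
    unfolding normal_inv_iff
  proof (intro conjI ballI)
    show "subgroup {x \<in> carrier G. N #> x \<in> W} G" using h.preimage_subgroup[OF sW] .
    fix g u assume g: "g \<in> carrier G" and "u \<in> {x \<in> carrier G. N #> x \<in> W}"
    then have u: "u \<in> carrier G" "N #> u \<in> W" by simp_all
    have gQ: "N #> g \<in> carrier (G Mod N)" using g by (rule h.hom_closed)
    have "N #> (g \<otimes> u \<otimes> inv g) = (N #> g) \<otimes>\<^bsub>G Mod N\<^esub> (N #> u) \<otimes>\<^bsub>G Mod N\<^esub> inv\<^bsub>G Mod N\<^esub> (N #> g)"
      using h.hom_mult[of "g \<otimes> u" "inv g"] h.hom_mult[of g u] h.hom_inv[of g] g u by simp
    moreover have "\<dots> \<in> W" using normal.inv_op_closed2[OF W(1) gQ u(2)] .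
    ultimately show "g \<otimes> u \<otimes> inv g \<in> {x \<in> carrier G. N #> x \<in> W}" using g u by simp
  qed
qed

text \<open>If \<open>NP = G\<close>, then the preimages of all proper subgroups of \<open>G/P\<close> are neighbours of \<open>N\<close>.\<close>

lemma quotient_strongly_star_free:
  assumes sf: "star_free G" and N: "proper_subgroup N G" and P: "P \<lhd> G" "N <#> P = carrier G"
  shows "strongly_star_free (G Mod P)"
  unfolding strongly_star_free_def
proof (intro allI impI)
  fix \<S> assume S: "independent_family (G Mod P) \<S>"
  interpret h: group_hom G "G Mod P" "\<lambda>x. P #> x" using quotient_hom(1)[OF P(1)] .
  let ?p = "\<lambda>W. {x \<in> carrier G. P #> x \<in> W}"
  have "card (?p ` \<S>) \<le> 3"
  proof (rule star_freeD[OF sf N])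
    show "independent_family G (?p ` \<S>)" by (rule h.independent_family_preimage(1)[OF quotient_hom(2)[OF P(1)] S])
    fix V assume "V \<in> ?p ` \<S>"
    then obtain W where W: "W \<in> \<S>" "V = ?p W" by blast
    then have sW: "subgroup W (G Mod P)" using S by (simp add: independent_family_def proper_subgroup_def)
    have "P \<subseteq> V" unfolding W(2) using in_preimage_unit[OF P(1) sW] .
    moreover have "V \<subseteq> carrier G" unfolding W(2) by blast
    ultimately show "N <#> V = carrier G"
      by (rule set_mult_mono_carrier[OF P(2) subset_refl _ proper_subgroupD(2)[OF N]])
  qed
  then show "card \<S> \<le> 3" using h.independent_family_preimage(2)[OF quotient_hom(2)[OF P(1)] S] by (simp add: card_image)
qed

lemma product_order_dvd:
  assumes "subgroup A G" "subgroup B G" "A <#> B = carrier G" shows "order G dvd card A * card B"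
  using card_set_mult[OF assms(1,2)] assms(3) by (metis dvd_triv_left order_def)

lemma independent_family_by_order:
  assumes "\<And>V. V \<in> \<S> \<Longrightarrow> subgroup V G" and nd: "\<And>V W. V \<in> \<S> \<Longrightarrow> W \<in> \<S> \<Longrightarrow> \<not> order G dvd card V * card W"
  shows "independent_family G \<S>"
  unfolding independent_family_def
proof (intro conjI ballI)
  fix V assume V: "V \<in> \<S>"
  show "proper_subgroup V G" using assms(1)[OF V] nd[OF V V] by (intro proper_subgroupI) auto
  fix W assume W: "W \<in> \<S>"
  show "V <#> W \<noteq> carrier G" using product_order_dvd[OF assms(1)[OF V] assms(1)[OF W]] nd[OF V W] by blast
qed

lemma sylow_exists:
  assumes "Factorial_Ring.prime (p::nat)" "p ^ i dvd order G"
  obtains H where "subgroup H G" "card H = p ^ i"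
proof -
  obtain m where "order G = p ^ i * m" using assms(2) by (elim dvdE)
  then show thesis using sylow_thm[OF assms(1) is_group _ fin] that by blast
qed

lemma sylow_within:
  assumes "Factorial_Ring.prime (p::nat)" and M: "subgroup M G" "p ^ i dvd card M"
  obtains H where "subgroup H G" "H \<subseteq> M" "card H = p ^ i"
proof -
  interpret S: group "G\<lparr>carrier := M\<rparr>" using M(1) by (rule subgroup_imp_group)
  interpret S: fin_group "G\<lparr>carrier := M\<rparr>" by unfold_locales (use finite_subgroup[OF M(1)] in simp)
  obtain H where H: "subgroup H (G\<lparr>carrier := M\<rparr>)" "card H = p ^ i"
    using S.sylow_exists[OF assms(1), of i] M(2) by (auto simp: order_def)
  then show thesis using that incl_subgroup[OF M(1) H(1)] subgroup.subset[OF H(1)] by simp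
qed

lemma four_distinct_cards:
  assumes "distinct [card A, card B, card C, card D]"
  shows "card {A, B, C, D} = 4"
  using assms by (auto simp: card_insert_if)

lemma set_mult_subgroup_if_normalises:
  assumes A: "subgroup A G" and B: "subgroup B G" and AB: "\<And>b. b \<in> B \<Longrightarrow> conjugate b A = A"
  shows "subgroup (A <#> B) G"
proof (rule subgroupI)
  have s: "A \<subseteq> carrier G" "B \<subseteq> carrier G" using A B by (simp_all add: subgroup.subset)
  show "A <#> B \<subseteq> carrier G" using s by (rule set_mult_closed)
  show "A <#> B \<noteq> {}" using set_multI[OF subgroup.one_closed[OF A] subgroup.one_closed[OF B]] by blast
  have cj: "b \<otimes> a \<otimes> inv b \<in> A" if "b \<in> B" "a \<in> A" for a b
  proof -
    have "b \<otimes> a \<otimes> inv b \<in> conjugate b A" using that(2) by (simp add: conjugate_def)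
    then show ?thesis using AB[OF that(1)] by simp
  qed
  fix x assume "x \<in> A <#> B"
  then obtain a b where x: "a \<in> A" "b \<in> B" "x = a \<otimes> b" by (rule set_multE)
  then have c: "a \<in> carrier G" "b \<in> carrier G" using s by blast+
  have "inv x = (inv b \<otimes> inv a \<otimes> inv (inv b)) \<otimes> inv b" using x(3) c by (simp add: word_simps)
  moreover have "inv b \<otimes> inv a \<otimes> inv (inv b) \<in> A" using x A B by (intro cj) (simp_all add: subgroup.m_inv_closed)
  moreover have "inv b \<in> B" using x B by (simp add: subgroup.m_inv_closed)
  ultimately show "inv x \<in> A <#> B" using set_multI by metis
  fix y assume "y \<in> A <#> B"
  then obtain a' b' where y: "a' \<in> A" "b' \<in> B" "y = a' \<otimes> b'" by (rule set_multE)
  then have c': "a' \<in> carrier G" "b' \<in> carrier G" using s by blast+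
  have "x \<otimes> y = (a \<otimes> (b \<otimes> a' \<otimes> inv b)) \<otimes> (b \<otimes> b')" using x(3) y(3) c c' by (simp add: word_simps)
  moreover have "a \<otimes> (b \<otimes> a' \<otimes> inv b) \<in> A" using x y A cj by (simp add: subgroup.m_closed)
  moreover have "b \<otimes> b' \<in> B" using x y B by (simp add: subgroup.m_closed)
  ultimately show "x \<otimes> y \<in> A <#> B" using set_multI by metis
qed

lemma prime_index_is_maximal:
  assumes p: "Factorial_Ring.prime (p::nat)" and H: "subgroup H G" "order G = p * card H"
  shows "maximal_subgroup H G"
  unfolding maximal_subgroup_def
proof (intro conjI allI impI)
  show "proper_subgroup H G" using H prime_gt_1_nat[OF p] card_subgroup_pos[OF H(1)] by (intro proper_subgroupI) auto
  fix K assume "proper_subgroup K G \<and> H \<subseteq> K"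
  then show "K = H" using prime_index_maximal[OF p H, of K] by (simp add: proper_subgroup_def)
qed

end

locale strongly_free_group = fin_group +
  assumes strong: "strongly_star_free G"
begin

lemma strongD: "independent_family G \<S> \<Longrightarrow> card \<S> \<le> 3"
  using strong by (simp add: strongly_star_free_def)

text \<open>The trivial subgroup and subgroups of three different prime orders are pairwise non-adjacent.\<close>

lemma not_three_primes:
  assumes "Factorial_Ring.prime (p::nat)" "Factorial_Ring.prime (q::nat)" "Factorial_Ring.prime (r::nat)"
    "p \<noteq> q" "p \<noteq> r" "q \<noteq> r" "p dvd order G" "q dvd order G" "r dvd order G"
  shows False
proof -
  obtain P where P: "subgroup P G" "card P = p" using sylow_exists[of p 1] assms by auto
  obtain Q where Q: "subgroup Q G" "card Q = q" using sylow_exists[of q 1] assms by auto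
  obtain R where R: "subgroup R G" "card R = r" using sylow_exists[of r 1] assms by auto
  let ?S = "{{\<one>}, P, Q, R}"
  have ne: "p \<noteq> 1" "q \<noteq> 1" "r \<noteq> 1" using assms(1-3) by (metis not_prime_1)+
  have "card ?S = 4" by (rule four_distinct_cards) (use P Q R ne assms in auto)
  moreover have "independent_family G ?S"
  proof (rule independent_family_by_order)
    fix V assume "V \<in> ?S" then show "subgroup V G" using P Q R triv_subgroup by auto
  next
    fix V W assume VW: "V \<in> ?S" "W \<in> ?S"
    have c: "card V \<in> {1, p, q, r}" "card W \<in> {1, p, q, r}" using VW P Q R by auto
    have eq: "t = x" if "t \<in> {p, q, r}" "x \<in> {1, p, q, r}" "t dvd x" for t x
    proof -
      have "Factorial_Ring.prime t" using that(1) assms(1-3) by auto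
      moreover have "x \<noteq> 1" using that(3) calculation by (metis dvd_1_iff_1 One_nat_def not_prime_1)
      then have "Factorial_Ring.prime x" using that(2) assms(1-3) by auto
      ultimately show ?thesis using that(3) by (rule primes_dvd_imp_eq)
    qed
    show "\<not> order G dvd card V * card W"
    proof
      assume d: "order G dvd card V * card W"
      have "card V = t \<or> card W = t" if "t \<in> {p, q, r}" for t
      proof -
        have t: "Factorial_Ring.prime t" "t dvd order G" using that assms by auto
        then have "t dvd card V * card W" using d dvd_trans by blast
        then show ?thesis using t(1) eq[OF that c(1)] eq[OF that c(2)] by (auto simp: prime_dvd_mult_iff)
      qed
      from this[of p] this[of q] this[of r] show False using assms(4-6) by auto
    qed
  qed
  ultimately show False using strongD by fastforce
qed

text \<open>Subgroups of r-power order are pairwise non-adjacent, and the trivial one, one of order \<open>r\<close> and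
  one of order \<open>r\<^sup>2\<close> already use up the bound.  So there is neither one of order \<open>r\<^sup>3\<close> nor a second
  one of order \<open>r\<close>; the latter makes the first one normal, and then the subgroups of its product
  with a subgroup of order \<open>s\<close> are too many.  If \<open>s\<^sup>2\<close> divides the order too, a subgroup of order
  \<open>s\<close> is the fourth member at once.\<close>

lemma two_primes_squarefree:
  assumes r: "Factorial_Ring.prime (r::nat)" and s: "Factorial_Ring.prime (s::nat)" and rs: "r \<noteq> s"
    and G: "order G = r ^ a * s ^ b" "1 \<le> b"
  shows "a \<le> 1"
proof (rule ccontr)
  assume "\<not> a \<le> 1"
  then have a2: "2 \<le> a" by simp
  have r1: "r > 1" and s1: "s > 1" using prime_gt_1_nat[OF r] prime_gt_1_nat[OF s] by simp_all
  have cop: "\<not> s dvd r ^ i" "\<not> r dvd s ^ i" for i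
    using r s rs by (metis prime_dvd_power primes_dvd_imp_eq)+
  have sdv: "s dvd order G" using G by (simp add: dvd_power)
  have "r ^ 1 dvd order G" using G(1) a2 by (intro dvd_trans[OF le_imp_power_dvd[of 1 a r]]) simp_all
  then obtain R1 where R1: "subgroup R1 G" "card R1 = r" using sylow_exists[OF r] by (metis power_one_right)
  have "r ^ 2 dvd order G" using G(1) a2 by (intro dvd_trans[OF le_imp_power_dvd[of 2 a r]]) simp_all
  then obtain R2 where R2: "subgroup R2 G" "card R2 = r ^ 2" using sylow_exists[OF r] by metis
  obtain S1 where S1: "subgroup S1 G" "card S1 = s" using sylow_exists[OF s, of 1] sdv by auto
  have rr: "r < r ^ 2" using r1 by (simp add: power2_eq_square)
  have rpow: "card \<S> \<le> 3" if T: "\<And>V. V \<in> \<S> \<Longrightarrow> subgroup V G \<and> (\<exists>i. card V = r ^ i)" for \<S>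
  proof (rule strongD, rule independent_family_by_order)
    fix V assume "V \<in> \<S>" then show "subgroup V G" using T by blast
  next
    fix V W assume "V \<in> \<S>" "W \<in> \<S>"
    then obtain i j where "card V = r ^ i" "card W = r ^ j" using T by blast
    then have "card V * card W = r ^ (i + j)" by (simp add: power_add)
    then show "\<not> order G dvd card V * card W" using sdv cop(1)[of "i + j"] dvd_trans by metis
  qed
  have one: "subgroup {\<one>} G" "card {\<one>} = r ^ 0" using triv_subgroup by simp_all
  have R1': "card R1 = r ^ 1" using R1(2) by simp
  have inj: "r ^ i = r ^ j \<longleftrightarrow> i = j" for i j using r1 by (rule power_inject_exp)
  have rsub: "subgroup {\<one>} G \<and> (\<exists>i. card {\<one>} = r ^ i)" "subgroup R1 G \<and> (\<exists>i. card R1 = r ^ i)" "subgroup R2 G \<and> (\<exists>i. card R2 = r ^ i)"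
    using one R1(1) R1' R2 by blast+
  show False
  proof (cases "b = 1")
    case False
    then have b2: "2 \<le> b" using G(2) by simp
    let ?S = "{{\<one>}, R1, R2, S1}"
    have "s \<noteq> r ^ 2" using cop(1)[of 2] by auto
    then have "card ?S = 4" by (intro four_distinct_cards) (use R1 R2 S1 r1 s1 rr rs in auto)
    moreover have "independent_family G ?S"
    proof (rule independent_family_by_order)
      fix V assume "V \<in> ?S" then show "subgroup V G" using R1 R2 S1 one by auto
    next
      fix V W assume VW: "V \<in> ?S" "W \<in> ?S"
      have c: "card V \<in> {1, r, r ^ 2, s}" "card W \<in> {1, r, r ^ 2, s}" using VW R1 R2 S1 by auto
      have "r ^ 1 * s ^ 2 dvd order G" unfolding G(1) using a2 b2 by (intro mult_dvd_mono le_imp_power_dvd) simp_all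
      then have d: "r * s * s dvd order G" by (simp add: power2_eq_square ac_simps)
      show "\<not> order G dvd card V * card W"
      proof
        assume "order G dvd card V * card W"
        then have d': "r * s * s dvd card V * card W" using d dvd_trans by blast
        have sV: "s dvd card V \<and> s dvd card W"
        proof (rule ccontr)
          assume "\<not> (s dvd card V \<and> s dvd card W)"
          then have "\<not> s * s dvd card V * card W"
          proof -
            assume n: "\<not> (s dvd card V \<and> s dvd card W)"
            have ns: "\<not> s dvd 1" "\<not> s dvd r" "\<not> s dvd r ^ 2" using cop(1)[of 0] cop(1)[of 1] cop(1)[of 2] by simp_all
            have nss: "\<not> s * s dvd s" using s1 by simp
            show ?thesis
            proof
              assume ss: "s * s dvd card V * card W"
              then have "s dvd card V * card W" by (metis dvd_mult_left)
              then consider "s dvd card V" | "s dvd card W" using s by (auto simp: prime_dvd_mult_iff)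
              then show False
              proof cases
                case 1
                then have "card V = s" "\<not> s dvd card W" using c(1) ns n by auto
                then show False using ss s1 by simp
              next
                case 2
                then have "card W = s" "\<not> s dvd card V" using c(2) ns n by auto
                then show False using ss s1 by simp
              qed
            qed
          qed
          then show False using d' by (metis dvd_mult_right mult.assoc)
        qed
        then have "card V = s" "card W = s"
          using c cop(1)[of 0] cop(1)[of 1] cop(1)[of 2] by auto
        then have "r dvd s ^ 2" using d' by (metis dvd_mult_left power2_eq_square)
        then show False using cop(2) by blast
      qed
    qed
    ultimately show False using strongD by fastforce
  next
    case b: True
    show False
    proof (cases "a = 2")
      case False
      then have "3 \<le> a" using a2 by simp
      then have "r ^ 3 dvd order G" using G(1) by (intro dvd_trans[OF le_imp_power_dvd[of 3 a r]]) simp_all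
      then obtain R3 where R3: "subgroup R3 G" "card R3 = r ^ 3" using sylow_exists[OF r] by metis
      have "card {{\<one>}, R1, R2, R3} = 4"
        by (rule four_distinct_cards) (unfold one(2) R1' R2(2) R3(2), simp add: inj del: power_0 power_one_right One_nat_def)
      moreover have "card {{\<one>}, R1, R2, R3} \<le> 3"
      proof (rule rpow)
        fix V assume "V \<in> {{\<one>}, R1, R2, R3}"
        moreover have "subgroup R3 G \<and> (\<exists>i. card R3 = r ^ i)" using R3 by blast
        ultimately show "subgroup V G \<and> (\<exists>i. card V = r ^ i)"
          using rsub by (elim insertE emptyE) simp_all
      qed
      ultimately show False by simp
    next
      case a: True
      have uniq: "V = R1" if V: "subgroup V G" "card V = r" for V
      proof (rule ccontr)
        assume ne: "V \<noteq> R1"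
        have "card V \<noteq> card R2" "card R1 \<noteq> card R2" using V(2) R1(2) R2(2) rr by simp_all
        then have "V \<noteq> R2" "R1 \<noteq> R2" by auto
        moreover have "{\<one>} \<noteq> V" "{\<one>} \<noteq> R1" "{\<one>} \<noteq> R2" using V(2) R1(2) R2(2) r1 rr by auto
        ultimately have "card {{\<one>}, R1, R2, V} = 4" using ne by (simp add: card_insert_if)
        moreover have "card {{\<one>}, R1, R2, V} \<le> 3"
        proof (rule rpow)
          fix U assume "U \<in> {{\<one>}, R1, R2, V}"
          moreover have "subgroup V G \<and> (\<exists>i. card V = r ^ i)" using V(1) R1' R1(2) V(2) by metis
          ultimately show "subgroup U G \<and> (\<exists>i. card U = r ^ i)"
            using rsub by (elim insertE emptyE) (simp_all only:)
        qed
        ultimately show False by simp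
      qed
      have "R1 \<lhd> G"
        unfolding normal_iff_conjugate
        using R1 uniq[OF conjugate_subgroup[OF R1(1)]] card_conjugate[OF subgroup.subset[OF R1(1)]] by simp
      then have W: "subgroup (R1 <#> S1) G" using S1(1) by (rule normal_set_mult_subgroup)
      have "card (R1 \<inter> S1) dvd r" "card (R1 \<inter> S1) dvd s"
        using card_subgroup_dvd_subgroup[OF subgroups_Inter_pair[OF R1(1) S1(1)]] R1 S1 by (metis Int_lower1, metis Int_lower2)
      then have "card (R1 \<inter> S1) = 1" using r s rs by (metis prime_nat_iff primes_dvd_imp_eq)
      then have cW: "card (R1 <#> S1) = r * s" using card_set_mult[OF R1(1) S1(1)] R1 S1 by simp
      have pW: "proper_subgroup (R1 <#> S1) G"
        using W cW G(1) a b rr s1 by (intro proper_subgroupI) simp_all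
      have "card {{\<one>}, R1, S1, R1 <#> S1} = 4"
        by (rule four_distinct_cards) (use R1 S1 cW r1 s1 rs in auto)
      moreover have "independent_family G {{\<one>}, R1, S1, R1 <#> S1}"
        by (rule independent_family_in_proper[OF pW])
          (use R1 S1 W one set_mult_upper[OF R1(1) S1(1)] subgroup.one_closed[OF W] in auto)
      ultimately show False using strongD by fastforce
    qed
  qed
qed

text \<open>The subgroup of order \<open>r\<close> is normal because its index \<open>s\<close> is smaller than \<open>r\<close>.  The one of order
  \<open>s\<close> would otherwise have \<open>r \<ge> 3\<close> conjugates, an independent family to which the trivial subgroup
  can be added.\<close>

lemma pq_normal:
  assumes r: "Factorial_Ring.prime (r::nat)" and s: "Factorial_Ring.prime (s::nat)" and lt: "s < r" and G: "order G = r * s"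
  shows "\<exists>N. N \<lhd> G \<and> order G = r * card N" "\<exists>N. N \<lhd> G \<and> order G = s * card N"
proof -
  obtain R where R: "subgroup R G" "card R = r" using sylow_exists[OF r, of 1] G by auto
  obtain S where S: "subgroup S G" "card S = s" using sylow_exists[OF s, of 1] G by auto
  have "R \<lhd> G"
  proof (rule normal_if_index_le_divisors[OF R(1)])
    show "order G = s * card R" using G R by simp
    show "s > 1" using s by (rule prime_gt_1_nat)
    fix d assume "d dvd card R" "d > 1"
    then have "d = r" using R r by (metis less_irrefl prime_nat_iff)
    then show "s \<le> d" using lt by simp
  qed
  then show "\<exists>N. N \<lhd> G \<and> order G = s * card N" using R G by (intro exI[of _ R]) simp
  have oS: "order G = r * card S" using G S by simp
  have mS: "maximal_subgroup S G" using prime_index_is_maximal[OF r S(1) oS] .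
  have "S \<lhd> G"
  proof (rule ccontr)
    assume nn: "\<not> S \<lhd> G"
    let ?C = "(\<lambda>g. conjugate g S) ` carrier G"
    have cC: "card ?C = r" using maximal_not_normal_conjugates[OF mS nn] oS card_subgroup_pos[OF S(1)] by simp
    have sC: "subgroup V G \<and> card V = s" if "V \<in> ?C" for V
      using that S conjugate_subgroup[OF S(1)] card_conjugate[OF subgroup.subset[OF S(1)]] by auto
    have "{\<one>} \<notin> ?C" using sC[of "{\<one>}"] prime_gt_1_nat[OF s] by auto
    then have "card (insert {\<one>} ?C) = Suc r" using cC by simp
    moreover have "card (insert {\<one>} ?C) \<le> 3"
    proof (rule strongD, rule independent_family_by_order)
      fix V assume "V \<in> insert {\<one>} ?C" then show "subgroup V G" using sC triv_subgroup by blast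
    next
      fix V W assume VW: "V \<in> insert {\<one>} ?C" "W \<in> insert {\<one>} ?C"
      have "card V \<in> {1, s}" "card W \<in> {1, s}" using VW sC by auto
      then have "\<not> r dvd card V * card W"
        using r s lt prime_gt_1_nat[OF r] by (auto simp: prime_dvd_mult_iff dest: primes_dvd_imp_eq)
      then show "\<not> order G dvd card V * card W" using G by (metis dvd_mult_left)
    qed
    ultimately have "r \<le> 2" by simp
    then show False using lt prime_gt_1_nat[OF s] by simp
  qed
  then show "\<exists>N. N \<lhd> G \<and> order G = r * card N" using oS by blast
qed

text \<open>A maximal subgroup has subgroups of all orders \<open>1, r, r\<^sup>2, \<dots>\<close> up to its own.\<close>

lemma pgroup_order_le:
  assumes r: "Factorial_Ring.prime (r::nat)" and G: "order G = r ^ a" "a \<noteq> 0"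
  shows "a \<le> 3" "\<exists>N. N \<lhd> G \<and> order G = r * card N"
proof -
  have d: "r ^ (a - 1) dvd order G" using G by (simp add: le_imp_power_dvd)
  obtain M where M: "subgroup M G" "card M = r ^ (a - 1)" by (rule sylow_exists[OF r d])
  have oM: "order G = r * card M" unfolding G(1) M(2) using G(2) by (cases a) simp_all
  show "\<exists>N. N \<lhd> G \<and> order G = r * card N"
    by (intro exI[of _ M] conjI pgroup_prime_index_normal[OF r G(1) M(1) oM] oM)
  show "a \<le> 3"
  proof (rule ccontr)
    assume "\<not> a \<le> 3"
    then have dv: "r ^ i dvd card M" if "i \<le> 3" for i unfolding M(2) using that by (intro le_imp_power_dvd) simp
    obtain A where A: "subgroup A G" "A \<subseteq> M" "card A = r ^ 0" by (rule sylow_within[OF r M(1) dv[of 0]]) simp_all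
    obtain B where B: "subgroup B G" "B \<subseteq> M" "card B = r ^ 1" by (rule sylow_within[OF r M(1) dv[of 1]]) simp_all
    obtain C where C: "subgroup C G" "C \<subseteq> M" "card C = r ^ 2" by (rule sylow_within[OF r M(1) dv[of 2]]) simp_all
    obtain D where D: "subgroup D G" "D \<subseteq> M" "card D = r ^ 3" by (rule sylow_within[OF r M(1) dv[of 3]]) simp_all
    have inj: "r ^ i = r ^ j \<longleftrightarrow> i = j" for i j using prime_gt_1_nat[OF r] by (rule power_inject_exp)
    have "card {A, B, C, D} = 4" by (rule four_distinct_cards) (simp add: A(3) B(3) C(3) D(3) inj del: power_0 power_one_right One_nat_def)
    moreover have "independent_family G {A, B, C, D}"
    proof (rule independent_family_in_proper)
      show "proper_subgroup M G" using prime_index_is_maximal[OF r M(1) oM] by (simp add: maximal_subgroup_def)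
    qed (use A B C D in auto)
    ultimately show False using strongD by fastforce
  qed
qed

lemma order_cases:
  assumes "order G \<noteq> 1"
  shows "(\<exists>(r::nat) a. Factorial_Ring.prime r \<and> 1 \<le> a \<and> a \<le> 3 \<and> order G = r ^ a) \<or>
    (\<exists>(r::nat) (s::nat). Factorial_Ring.prime r \<and> Factorial_Ring.prime s \<and> r \<noteq> s \<and> order G = r * s)"
    and "\<And>q::nat. Factorial_Ring.prime q \<Longrightarrow> q dvd order G \<Longrightarrow> \<exists>N. N \<lhd> G \<and> order G = q * card N"
proof -
  obtain r :: nat where r: "Factorial_Ring.prime r" "r dvd order G" using assms prime_factor_nat by blast
  have o0: "order G \<noteq> 0" using order_pos by simp
  have nu: "\<not> is_unit r" using prime_gt_1_nat[OF r(1)] by simp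
  obtain m where m: "order G = r ^ multiplicity r (order G) * m" "\<not> r dvd m"
    using multiplicity_decompose'[OF o0 nu] by blast
  define a where "a = multiplicity r (order G)"
  have a0: "a \<noteq> 0"
  proof
    assume "a = 0" then show False using m r(2) by (simp add: a_def)
  qed
  have "((\<exists>(r::nat) a. Factorial_Ring.prime r \<and> 1 \<le> a \<and> a \<le> 3 \<and> order G = r ^ a) \<or>
    (\<exists>(r::nat) (s::nat). Factorial_Ring.prime r \<and> Factorial_Ring.prime s \<and> r \<noteq> s \<and> order G = r * s)) \<and>
    (\<forall>q::nat. Factorial_Ring.prime q \<longrightarrow> q dvd order G \<longrightarrow> (\<exists>N. N \<lhd> G \<and> order G = q * card N))"
  proof (cases "m = 1")
    case True
    then have G: "order G = r ^ a" using m by (simp add: a_def)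
    note pg = pgroup_order_le[OF r(1) G a0]
    have "q = r" if "Factorial_Ring.prime q" "q dvd order G" for q :: nat
      using that r(1) unfolding G by (metis prime_dvd_power primes_dvd_imp_eq)
    moreover have "1 \<le> a" using a0 by simp
    ultimately show ?thesis using r(1) pg G by metis
  next
    case False
    obtain s :: nat where s: "Factorial_Ring.prime s" "s dvd m" using False prime_factor_nat by blast
    have rs: "r \<noteq> s" using s m by blast
    have m0: "m \<noteq> 0" using m(1) o0 by (metis mult_0_right)
    have nus: "\<not> is_unit s" using prime_gt_1_nat[OF s(1)] by simp
    obtain l where l: "m = s ^ multiplicity s m * l" "\<not> s dvd l" using multiplicity_decompose'[OF m0 nus] by blast
    define b where "b = multiplicity s m"
    have b0: "b \<noteq> 0"
    proof
      assume "b = 0" then show False using l s(2) by (simp add: b_def)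
    qed
    have sG: "s dvd order G" using s(2) m(1) by (metis dvd_mult)
    have "l = 1"
    proof (rule ccontr)
      assume "l \<noteq> 1"
      then obtain t :: nat where t: "Factorial_Ring.prime t" "t dvd l" using prime_factor_nat by blast
      have tm: "t dvd m" using t(2) l(1) by (metis dvd_mult)
      have "t dvd order G" using tm m(1) by (metis dvd_mult)
      moreover have "r \<noteq> t" "s \<noteq> t" using tm m t l by blast+
      ultimately show False using not_three_primes[OF r(1) s(1) t(1) rs _ _ r(2) sG] by blast
    qed
    then have G: "order G = r ^ a * s ^ b" using m l by (simp add: a_def b_def)
    then have G': "order G = s ^ b * r ^ a" by (simp add: mult.commute)
    have "a \<le> 1" using two_primes_squarefree[OF r(1) s(1) rs G] b0 by simp
    moreover have "b \<le> 1" using two_primes_squarefree[OF s(1) r(1) rs[symmetric] G'] a0 by simp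
    ultimately have "a = 1" "b = 1" using a0 b0 by simp_all
    then have G1: "order G = r * s" using G by simp
    then have G2: "order G = s * r" by simp
    have N: "(\<exists>N. N \<lhd> G \<and> order G = r * card N) \<and> (\<exists>N. N \<lhd> G \<and> order G = s * card N)"
    proof (cases "s < r")
      case True then show ?thesis using pq_normal[OF r(1) s(1) _ G1] by blast
    next
      case False then show ?thesis using pq_normal[OF s(1) r(1) _ G2] rs by (meson linorder_neqE_nat)
    qed
    have "q = r \<or> q = s" if "Factorial_Ring.prime q" "q dvd order G" for q :: nat
      using that r(1) s(1) unfolding G1 by (metis prime_dvd_mult_iff primes_dvd_imp_eq)
    then show ?thesis using N G1 r(1) s(1) rs by metis
  qed
  then show "(\<exists>(r::nat) a. Factorial_Ring.prime r \<and> 1 \<le> a \<and> a \<le> 3 \<and> order G = r ^ a) \<or>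
    (\<exists>(r::nat) (s::nat). Factorial_Ring.prime r \<and> Factorial_Ring.prime s \<and> r \<noteq> s \<and> order G = r * s)"
    and "\<And>q::nat. Factorial_Ring.prime q \<Longrightarrow> q dvd order G \<Longrightarrow> \<exists>N. N \<lhd> G \<and> order G = q * card N"
    by blast+
qed

end

context fin_group begin

lemma quotient_strongly_free_group:
  assumes "star_free G" "proper_subgroup N G" "P \<lhd> G" "N <#> P = carrier G"
  shows "strongly_free_group (G Mod P)"
  using quotient_hom(3)[OF assms(3)] quotient_strongly_star_free[OF assms]
  by (simp add: strongly_free_group_def strongly_free_group_axioms_def)

lemma index_two_normal:
  assumes H: "subgroup H G" "order G = 2 * card H"
  shows "H \<lhd> G"
  by (rule normal_if_index_le_divisors[OF H]) simp_all

lemma index_two_conjugate: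
  assumes M: "subgroup M G" and K: "subgroup K G" "K \<subseteq> M" "card M = 2 * card K" and m: "m \<in> M"
  shows "conjugate m K = K"
proof -
  interpret S: group "G\<lparr>carrier := M\<rparr>" using M by (rule subgroup_imp_group)
  interpret S: fin_group "G\<lparr>carrier := M\<rparr>" by unfold_locales (use finite_subgroup[OF M] in simp)
  have "K \<lhd> G\<lparr>carrier := M\<rparr>"
    by (rule S.index_two_normal) (use K M in \<open>simp_all add: order_def subgroup_incl\<close>)
  then have "m \<otimes> x \<otimes> inv m \<in> K" if "x \<in> K" for x
    using normal.inv_op_closed2[of K "G\<lparr>carrier := M\<rparr>" m x] m that M by simp
  then have "conjugate m K \<subseteq> K" by (auto simp: conjugate_def)
  moreover have "m \<in> carrier G" using m M by (simp add: subgroup.mem_carrier)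
  ultimately show ?thesis
    using card_conjugate[OF subgroup.subset[OF K(1)]] finite_subgroup[OF K(1)] by (intro card_subset_eq) simp_all
qed

text \<open>The product of two conjugates is not \<open>G\<close>, so it has less than \<open>3|M|\<close> elements, and the index of
  the intersection in \<open>M\<close> is less than \<open>3\<close>.\<close>

lemma index_three_core:
  assumes M: "subgroup M G" "order G = 3 * card M" and g: "g \<in> carrier G" "conjugate g M \<noteq> M"
  shows "card M = 2 * card (M \<inter> conjugate g M)"
proof -
  have pM: "proper_subgroup M G" using M card_subgroup_pos[OF M(1)] by (intro proper_subgroupI) auto
  let ?K = "M \<inter> conjugate g M"
  have sM: "subgroup (conjugate g M) G" "card (conjugate g M) = card M"
    using M(1) g(1) conjugate_subgroup card_conjugate[OF subgroup.subset] by simp_all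
  have K: "subgroup ?K G" using M(1) sM(1) by (rule subgroups_Inter_pair)
  have "M <#> conjugate g M \<noteq> carrier G"
    using conjugates_not_carrier[OF pM one_closed g(1)] unfolding conjugate_one[OF subgroup.subset[OF M(1)]] .
  then have "M <#> conjugate g M \<subset> carrier G"
    using set_mult_closed[OF subgroup.subset[OF M(1)] subgroup.subset[OF sM(1)]] by blast
  then have "card (M <#> conjugate g M) < 3 * card M" using M(2) psubset_card_mono[OF fin] by (simp add: order_def)
  then have "card (M <#> conjugate g M) * card ?K < 3 * card M * card ?K" using card_subgroup_pos[OF K] by simp
  then have "card M * card M < 3 * card M * card ?K" unfolding card_set_mult[OF M(1) sM(1)] sM(2) .
  then have "card M * card M < card M * (3 * card ?K)" by (simp only: mult.assoc mult.left_commute)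
  then have lt: "card M < 3 * card ?K" by simp
  obtain d where d: "card M = card ?K * d" using card_subgroup_dvd_subgroup[OF K M(1)] by (auto elim: dvdE)
  have "?K \<noteq> M"
  proof
    assume "?K = M"
    then have "M \<subseteq> conjugate g M" by blast
    then show False using g(2) sM(2) finite_subgroup[OF sM(1)] by (metis card_subset_eq)
  qed
  then have "card ?K \<noteq> card M" using finite_subgroup[OF M(1)] by (metis Int_lower1 card_subset_eq)
  then have "d \<noteq> 1" using d by auto
  moreover have "d < 3" using lt d by (simp add: mult.commute)
  moreover have "d \<noteq> 0" using d card_subgroup_pos[OF M(1)] by auto
  ultimately have "d = 2" by simp
  then show ?thesis using d by simp
qed

text \<open>A maximal subgroup \<open>M\<close> over a factor is a factor.  If it is not normal, it has index \<open>3\<close> and meets a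
  conjugate in a subgroup of index \<open>2\<close> of both, which is normalized by both and hence normal.  The
  quotient has order \<open>6\<close>, and its subgroup of order \<open>3\<close> pulls back to a normal subgroup of
  index \<open>2\<close>.\<close>

lemma factorizable_normal_prime_index:
  assumes sf: "star_free G" and fac: "factorizable G"
  obtains N p where "N \<lhd> G" "Factorial_Ring.prime (p::nat)" "order G = p * card N"
proof -
  obtain A B where AB: "proper_subgroup A G" "proper_subgroup B G" "A <#> B = carrier G"
    using fac unfolding factorizable_def by metis
  obtain M where M: "maximal_subgroup M G" "A \<subseteq> M" using AB(1) by (rule proper_subset_maximal)
  have pM: "proper_subgroup M G" using M(1) by (simp add: maximal_subgroup_def)
  note sM = proper_subgroupD[OF pM]
  have "M <#> B = carrier G"
    by (rule set_mult_mono_carrier[OF AB(3) M(2) subset_refl sM(2) proper_subgroupD(2)[OF AB(2)]])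
  then have BM: "B <#> M = carrier G" using set_mult_swap[OF sM(1) proper_subgroupD(1)[OF AB(2)]] by simp
  show thesis
  proof (cases "M \<lhd> G")
    case True
    then show thesis using maximal_normal_prime_index[OF M(1) True] that by blast
  next
    case False
    have le: "order G \<le> 3 * card M" using maximal_factor_normal_or_index_le_3[OF sf M(1) AB(2) BM] False by simp
    obtain n where n: "order G = card M * n" using card_subgroup_dvd[OF sM(1)] by (elim dvdE)
    have "n \<le> 3" using le n card_subgroup_pos[OF sM(1)] by simp
    moreover have "n \<noteq> 0" "n \<noteq> 1" using n sM(3) by auto
    moreover have "n \<noteq> 2" using index_two_normal[OF sM(1)] n False by (auto simp: mult.commute)
    ultimately have n3: "order G = 3 * card M" using n by simp
    obtain g where g: "g \<in> carrier G" "\<not> conjugate g M \<subseteq> M" using False sM(1) unfolding normal_iff_conjugate by blast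
    let ?K = "M \<inter> conjugate g M"
    have sC: "subgroup (conjugate g M) G" "card (conjugate g M) = card M"
      using sM g conjugate_subgroup card_conjugate by simp_all
    have c2: "card M = 2 * card ?K" by (rule index_three_core[OF sM(1) n3 g(1)]) (use g in blast)
    have K: "subgroup ?K G" using sM(1) sC(1) by (rule subgroups_Inter_pair)
    have "M \<subseteq> normaliser ?K"
      unfolding normaliser_def using index_two_conjugate[OF sM(1) K Int_lower1 c2] sM(2) by blast
    moreover have "conjugate g M \<subseteq> normaliser ?K"
      unfolding normaliser_def using index_two_conjugate[OF sC(1) K Int_lower2] c2 sC subgroup.subset[OF sC(1)] by auto
    ultimately have "normaliser ?K = carrier G"
      using M(1) g(2) normaliser_subgroup[OF subgroup.subset[OF K]]
      unfolding maximal_subgroup_def proper_subgroup_def by metis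
    then have nK: "?K \<lhd> G" unfolding normal_iff_conjugate using K by (auto simp: normaliser_def)
    have "order (G Mod ?K) * card ?K = 6 * card ?K" using quotient_hom(4)[OF nK] n3 c2 by simp
    then have o6: "order (G Mod ?K) = 6" using card_subgroup_pos[OF K] by simp
    interpret Q: fin_group "G Mod ?K" using quotient_hom(3)[OF nK] .
    obtain W where W: "subgroup W (G Mod ?K)" "card W = 3 ^ 1"
      by (rule Q.sylow_exists[of 3 1]) (simp_all add: o6)
    have oW: "order (G Mod ?K) = 2 * card W" using W(2) o6 by simp
    have "W \<lhd> (G Mod ?K)" using Q.index_two_normal[OF W(1) oW] .
    from preimage_normal_prime_index[OF nK this oW] show thesis using that[of _ 2] by simp
  qed
qed

end

context fin_group begin

lemma conjugate_inj:
  assumes "A \<subseteq> carrier G" "B \<subseteq> carrier G" "g \<in> carrier G" "conjugate g A = conjugate g B"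
  shows "A = B"
  using conjugate_inv[OF assms(1,3)] unfolding assms(4) conjugate_inv[OF assms(2,3)] by simp

lemma conjugate_not_subset:
  assumes N: "N \<lhd> G" and V: "V \<subseteq> carrier G" "\<not> V \<subseteq> N" and g: "g \<in> carrier G"
  shows "\<not> conjugate g V \<subseteq> N"
proof
  assume "conjugate g V \<subseteq> N"
  then have "conjugate (inv g) (conjugate g V) \<subseteq> conjugate (inv g) N" by (rule conjugate_mono)
  then show False using conjugate_inv[OF V(1) g] normal_conjugate[OF N, of "inv g"] g V(2) by simp
qed

lemma conjugate_central:
  assumes "\<And>z g. z \<in> A \<Longrightarrow> g \<in> carrier G \<Longrightarrow> z \<otimes> g = g \<otimes> z" "A \<subseteq> carrier G" "g \<in> carrier G"
  shows "conjugate g A = A"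
proof -
  have "g \<otimes> z \<otimes> inv g = z" if "z \<in> A" for z
  proof -
    have "z \<in> carrier G" using that assms(2) by blast
    then show ?thesis using assms(1)[OF that assms(3)] assms(3) by (metis inv_solve_right m_closed)
  qed
  then show ?thesis by (simp add: conjugate_def)
qed

end

locale prime_index_normal = fin_group +
  fixes p :: nat and N :: "'a set"
  assumes sf: "star_free G" and p: "Factorial_Ring.prime p" and N: "N \<lhd> G" "order G = p * card N"
    and not_power: "\<And>k. order G \<noteq> p ^ k"
begin

text \<open>Products of two p-subgroups have p-power size, so these are pairwise non-adjacent.\<close>

lemma few_psubgroups: "card {V. subgroup V G \<and> (\<exists>i. card V = p ^ i) \<and> \<not> V \<subseteq> N} \<le> 3"
proof (rule star_freeD[OF sf])
  show "proper_subgroup N G"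
    using prime_index_is_maximal[OF p normal_imp_subgroup[OF N(1)] N(2)] by (simp add: maximal_subgroup_def)
  show "independent_family G {V. subgroup V G \<and> (\<exists>i. card V = p ^ i) \<and> \<not> V \<subseteq> N}"
    unfolding independent_family_def
  proof (intro conjI ballI)
    fix V assume "V \<in> {V. subgroup V G \<and> (\<exists>i. card V = p ^ i) \<and> \<not> V \<subseteq> N}"
    then obtain i where V: "subgroup V G" "card V = p ^ i" by blast
    show "proper_subgroup V G" using V not_power[of i] by (intro proper_subgroupI) simp_all
    fix W assume "W \<in> {V. subgroup V G \<and> (\<exists>i. card V = p ^ i) \<and> \<not> V \<subseteq> N}"
    then obtain j where W: "subgroup W G" "card W = p ^ j" by blast
    show "V <#> W \<noteq> carrier G" using prime_power_order_if_product[OF p V W] not_power by blast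
  qed
qed (use prime_index_supplement(1)[OF p N] in blast)

text \<open>A Sylow p-subgroup cannot be contained in a subgroup of index \<open>p\<close>.\<close>

lemma sylow_outside:
  obtains P a m where "subgroup P G" "card P = p ^ a" "order G = p ^ a * m" "\<not> p dvd m" "1 \<le> a" "\<not> P \<subseteq> N" "m \<noteq> 1"
proof -
  have o0: "order G \<noteq> 0" using order_pos by simp
  have nu: "\<not> is_unit p" using prime_gt_1_nat[OF p] by simp
  obtain m where m: "order G = p ^ multiplicity p (order G) * m" "\<not> p dvd m"
    using multiplicity_decompose'[OF o0 nu] by blast
  define a where "a = multiplicity p (order G)"
  have G: "order G = p ^ a * m" using m(1) by (simp add: a_def)
  obtain P where P: "subgroup P G" "card P = p ^ a" by (rule sylow_exists[OF p, of a]) (simp_all add: G)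
  have "a \<noteq> 0"
  proof
    assume "a = 0"
    then have "m = p * card N" using G N(2) by simp
    then show False using m(2) by simp
  qed
  moreover have "\<not> P \<subseteq> N"
  proof
    assume "P \<subseteq> N"
    then have "p ^ a dvd card N" using card_subgroup_dvd_subgroup[OF P(1) normal_imp_subgroup[OF N(1)]] P(2) by simp
    then obtain l where l: "card N = p ^ a * l" by (elim dvdE)
    have "p ^ a * m = p * (p ^ a * l)" unfolding G[symmetric] N(2) l by (rule HOL.refl)
    also have "\<dots> = p ^ a * (p * l)" by (rule mult.left_commute)
    finally have "p ^ a * m = p ^ a * (p * l)" .
    moreover have "0 < p ^ a" using prime_gt_0_nat[OF p] by simp
    ultimately have "m = p * l" using nat_mult_eq_cancel1 by blast
    then show False using m(2) by simp
  qed
  moreover have "m \<noteq> 1" using not_power[of a] G by auto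
  ultimately show thesis using that[OF P G m(2)] by simp
qed

text \<open>The lemma on few subgroups outside a subgroup of index \<open>p\<close>, applied to \<open>N \<inter> P\<close> in \<open>P\<close>.\<close>

lemma psubgroup_alternative:
  assumes P: "subgroup P G" "card P = p ^ a" "\<not> P \<subseteq> N"
  shows "(\<exists>x\<in>P. cyc x = P) \<or> (p = 2 \<and> (\<exists>A B. A \<noteq> B \<and> 2 * card A = card P \<and> 2 * card B = card P \<and>
    A \<in> cyc ` (P - N) \<and> B \<in> cyc ` (P - N) \<and> (\<forall>x\<in>P - N. 2 * ord x = card P)))"
proof -
  have sN: "subgroup N G" using N(1) by (rule normal_imp_subgroup)
  have Q: "subgroup (N \<inter> P) G" "N \<inter> P \<subseteq> P" "card P = p * card (N \<inter> P)"
    using subgroups_Inter_pair[OF sN P(1)] prime_index_supplement(2)[OF p N P(1,3)] by simp_all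
  have sub: "{V. subgroup V G \<and> V \<subseteq> P \<and> \<not> V \<subseteq> N \<inter> P} \<subseteq> {V. subgroup V G \<and> (\<exists>i. card V = p ^ i) \<and> \<not> V \<subseteq> N}"
  proof
    fix V assume "V \<in> {V. subgroup V G \<and> V \<subseteq> P \<and> \<not> V \<subseteq> N \<inter> P}"
    then have V: "subgroup V G" "V \<subseteq> P" "\<not> V \<subseteq> N" by auto
    have "\<exists>i. card V = p ^ i" using card_subgroup_dvd_subgroup[OF V(1) P(1) V(2)] divides_primepow_nat[OF p] P(2) by auto
    then show "V \<in> {V. subgroup V G \<and> (\<exists>i. card V = p ^ i) \<and> \<not> V \<subseteq> N}" using V by simp
  qed
  have "card {V. subgroup V G \<and> V \<subseteq> P \<and> \<not> V \<subseteq> N \<inter> P} \<le> 3"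
    using card_mono[OF finite_subgroups sub] few_psubgroups by simp
  from few_subgroups_outside[OF p P(1,2) Q this] show ?thesis
  proof
    assume *: "\<forall>x\<in>P - N \<inter> P. cyc x = P"
    obtain x where "x \<in> P" "x \<notin> N" using P(3) by blast
    then show ?thesis using * by blast
  next
    assume "p = 2 \<and> (\<exists>A B. A \<noteq> B \<and> A \<noteq> P \<and> B \<noteq> P \<and> {V. subgroup V G \<and> V \<subseteq> P \<and> \<not> V \<subseteq> N \<inter> P} = {P, A, B} \<and>
      2 * card A = card P \<and> 2 * card B = card P \<and> A \<in> cyc ` (P - N \<inter> P) \<and> B \<in> cyc ` (P - N \<inter> P) \<and>
      (\<forall>x\<in>P - N \<inter> P. cyc x = A \<or> cyc x = B))"
    then obtain A B where p2: "p = 2" and AB: "A \<noteq> B" "2 * card A = card P" "2 * card B = card P"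
      "A \<in> cyc ` (P - N \<inter> P)" "B \<in> cyc ` (P - N \<inter> P)" and all: "\<forall>x\<in>P - N \<inter> P. cyc x = A \<or> cyc x = B"
      by (elim conjE exE)
    have PN: "P - N \<inter> P = P - N" by blast
    have "2 * ord x = card P" if "x \<in> P - N" for x
    proof -
      have "card (cyc x) = ord x" using that P(1) by (intro card_cyc) (simp add: subgroup.mem_carrier)
      moreover have "cyc x = A \<or> cyc x = B" using all that unfolding PN by blast
      ultimately show ?thesis using AB(2,3) by auto
    qed
    then show ?thesis using p2 AB unfolding PN by blast
  qed
qed

text \<open>A non-normal Sylow p-subgroup \<open>P\<close> permutes its other conjugates without a fixed one, so there are
  at least three conjugates, and these are all the p-subgroups outside \<open>N\<close>.  Hence \<open>P\<close> is cyclic,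
  generated by any of its elements outside \<open>N\<close>.  The normalizer of \<open>P\<close> also supplements \<open>N\<close> and is
  not adjacent to the conjugates of \<open>P\<close>, so it is one of them: \<open>P\<close> is self-normalizing of index \<open>3\<close>.
  Two conjugates meet in a subgroup of index \<open>2\<close> of both, which is central because both are abelian
  and generate \<open>G\<close>.  Modulo this subgroup \<open>G\<close> has order \<open>6\<close>, so \<open>P\<close> normalizes a subgroup of order
  \<open>3\<close>, on which it acts by inversion.\<close>

lemma nonnormal_sylow:
  assumes P: "subgroup P G" "card P = p ^ a" and G: "order G = p ^ a * m" "\<not> p dvd m" and PN: "\<not> P \<subseteq> N"
    and nn: "\<not> P \<lhd> G"
  shows "\<exists>x y. p = 2 \<and> order G = 3 * 2 ^ a \<and> x \<in> carrier G \<and> y \<in> carrier G \<and> ord x = 2 ^ a \<and> ord y = 3 \<and>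
    y \<otimes> x = x \<otimes> y [^] (2::nat) \<and> cyc x <#> cyc y = carrier G \<and>
    (\<forall>g\<in>carrier G. x [^] (2::nat) \<otimes> g = g \<otimes> x [^] (2::nat))"
proof -
  let ?PP = "{V. subgroup V G \<and> (\<exists>i. card V = p ^ i) \<and> \<not> V \<subseteq> N}"
  have finPP: "finite ?PP" by (rule finite_subgroups)
  have p1: "p > 1" using p by (rule prime_gt_1_nat)
  have Ps: "P \<subseteq> carrier G" using P(1) by (rule subgroup.subset)
  have finP: "finite P" using P(1) by (rule finite_subgroup)
  obtain g where g: "g \<in> carrier G" "\<not> conjugate g P \<subseteq> P" using nn P(1) unfolding normal_iff_conjugate by blast
  define P1 where "P1 = conjugate g P"
  have cPP: "conjugate h V \<in> ?PP" if "V \<in> ?PP" "h \<in> carrier G" for V h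
  proof -
    have V: "subgroup V G" "\<exists>i. card V = p ^ i" "\<not> V \<subseteq> N" using that(1) by simp_all
    have "V \<subseteq> carrier G" using V(1) by (rule subgroup.subset)
    then show ?thesis using conjugate_subgroup[OF V(1) that(2)] card_conjugate[of V h] V conjugate_not_subset[OF N(1) _ V(3) that(2)] that(2) by simp
  qed
  have PPP: "P \<in> ?PP" using P PN by blast
  have P1: "P1 \<in> ?PP" "P1 \<noteq> P" using cPP[OF PPP g(1)] g by (simp_all add: P1_def)
  have sP1: "subgroup P1 G" "P1 \<subseteq> carrier G" "card P1 = p ^ a"
    unfolding P1_def using conjugate_subgroup[OF P(1) g(1)] conjugate_subset[OF Ps g(1)] card_conjugate[OF Ps g(1)] P(2) by simp_all
  \<comment> \<open>If \<open>P\<close> normalized another Sylow subgroup, their product would be a larger p-subgroup.\<close>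
  have "\<exists>x\<in>P. conjugate x P1 \<noteq> P1"
  proof (rule ccontr)
    assume "\<not> (\<exists>x\<in>P. conjugate x P1 \<noteq> P1)"
    then have S: "subgroup (P1 <#> P) G" using set_mult_subgroup_if_normalises[OF sP1(1) P(1)] by blast
    have I: "subgroup (P1 \<inter> P) G" using sP1(1) P(1) by (rule subgroups_Inter_pair)
    have "card (P1 \<inter> P) dvd p ^ a" using card_subgroup_dvd_subgroup[OF I P(1)] P(2) by simp
    then obtain i where i: "card (P1 \<inter> P) = p ^ i" "i \<le> a" using divides_primepow_nat[OF p] by blast
    have "i \<noteq> a"
    proof
      assume "i = a"
      then have "P1 \<inter> P = P" using i P finP by (intro card_subset_eq) simp_all
      then have "P \<subseteq> P1" by blast
      then have "P = P1" using sP1 P finite_subgroup[OF sP1(1)] by (intro card_subset_eq) simp_all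
      then show False using P1 by simp
    qed
    then obtain d where d: "a = i + Suc d" using i(2) by (metis le_neq_implies_less less_imp_Suc_add add_Suc_right)
    have "card (P1 <#> P) * p ^ i = p ^ a * p ^ a" using card_set_mult[OF sP1(1) P(1)] i sP1 P by simp
    also have "\<dots> = (p ^ a * p ^ Suc d) * p ^ i" by (simp add: d power_add)
    finally have "card (P1 <#> P) = p ^ a * p ^ Suc d" using p1 by simp
    then have "p ^ a * p dvd p ^ a * m" using card_subgroup_dvd[OF S] G(1) by (metis dvd_mult_left mult.assoc power_Suc)
    then show False using G(2) p1 by simp
  qed
  then obtain x where x: "x \<in> P" "conjugate x P1 \<noteq> P1" by blast
  have xc: "x \<in> carrier G" using x Ps by blast
  define P2 where "P2 = conjugate x P1"
  have P2: "P2 \<in> ?PP" "P2 \<noteq> P1" unfolding P2_def using cPP[OF P1(1) xc] x(2) by blast+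
  have xP: "conjugate x P = P" using conjugate_by_member[OF P(1) x(1)] .
  have P2P: "P2 \<noteq> P"
  proof
    assume "P2 = P"
    then have "conjugate x P1 = conjugate x P" using xP by (simp add: P2_def)
    then show False using conjugate_inj[OF sP1(2) Ps xc] P1(2) by simp
  qed
  have sP2: "subgroup P2 G" "P2 \<subseteq> carrier G" "card P2 = p ^ a"
    unfolding P2_def using conjugate_subgroup[OF sP1(1) xc] conjugate_subset[OF sP1(2) xc] card_conjugate[OF sP1(2) xc] sP1(3) by simp_all
  have PPeq: "{P, P1, P2} = ?PP"
  proof (rule card_seteq[OF finPP])
    show "{P, P1, P2} \<subseteq> ?PP" unfolding insert_subset using PPP P1(1) P2(1) by (intro conjI empty_subsetI)
    have "card {P, P1, P2} = 3" using P1(2) P2(2) P2P by (simp add: card_insert_if not_sym)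
    then show "card ?PP \<le> card {P, P1, P2}" using few_psubgroups by simp
  qed
  have PPcard: "subgroup V G \<and> card V = p ^ a" if "V \<in> {P, P1, P2}" for V
    using that P sP1 sP2 by auto
  obtain x0 where x0: "x0 \<in> P" "x0 \<notin> N" using PN by blast
  have x0c: "x0 \<in> carrier G" using x0 Ps by blast
  have "cyc x0 \<in> ?PP"
  proof -
    have "ord x0 dvd p ^ a" using ord_dvd_card[OF P(1) x0(1)] P(2) by simp
    then have "\<exists>i. card (cyc x0) = p ^ i" using divides_primepow_nat[OF p] card_cyc[OF x0c] by auto
    then show ?thesis using cyc_subgroup[OF x0c] x0(2) mem_cyc[of x0] by blast
  qed
  then have ox0: "ord x0 = p ^ a" using PPcard[of "cyc x0"] card_cyc[OF x0c] unfolding PPeq[symmetric] by simp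
  then have Pcyc: "P = cyc x0" using cyc_eqI[OF P(1) x0(1)] P(2) by simp
  \<comment> \<open>Conjugation by \<open>x\<close> exchanges the two other conjugates, so \<open>x\<close> has even order.\<close>
  have p2: "p = 2"
  proof (rule ccontr)
    assume "p \<noteq> 2"
    then have "odd p" using prime_odd_nat[OF p] p1 by simp
    have xP2: "conjugate x P2 = P1"
    proof -
      have "conjugate x P2 \<in> {P, P1, P2}" unfolding PPeq by (rule cPP[OF P2(1) xc])
      moreover have "conjugate x P2 \<noteq> P" using conjugate_inj[OF sP2(2) Ps xc] xP P2P by auto
      moreover have "conjugate x P2 \<noteq> P2"
        using conjugate_inj[OF sP2(2) sP1(2) xc] P2(2) unfolding P2_def by blast
      ultimately show ?thesis by simp
    qed
    then have "conjugate (x \<otimes> x) P1 = P1" using conjugate_conjugate[OF sP1(2) xc xc] by (simp add: P2_def)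
    then have xx: "x \<otimes> x \<in> normaliser P1" using xc by (simp add: normaliser_def)
    have "ord x dvd p ^ a" using ord_dvd_card[OF P(1) x(1)] P(2) by simp
    then obtain c where "ord x = p ^ c" using divides_primepow_nat[OF p] by blast
    then have "odd (ord x)" using \<open>odd p\<close> by simp
    then obtain h where h: "ord x = 2 * h + 1" by (elim oddE)
    have "(x \<otimes> x) [^] Suc h = x [^] (2 * Suc h)" using xc by (metis mult_2 nat_pow_mult nat_pow_pow nat_pow_eone One_nat_def numeral_2_eq_2 nat_pow_Suc nat_pow_0 l_one)
    also have "\<dots> = x [^] ord x \<otimes> x" unfolding h using xc by simp
    also have "\<dots> = x" using xc by simp
    finally have "x \<in> normaliser P1" using pow_mem_subgroup[OF normaliser_subgroup[OF sP1(2)] xx, of "Suc h"] by simp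
    then show False using x(2) by (simp add: normaliser_def)
  qed
  let ?H = "normaliser P"
  have H: "subgroup ?H G" "P \<subseteq> ?H" using normaliser_subgroup[OF Ps] subset_normaliser[OF P(1)] by simp_all
  have "(\<lambda>g. conjugate g P) ` carrier G = ?PP"
  proof
    show "(\<lambda>g. conjugate g P) ` carrier G \<subseteq> ?PP" using cPP[OF PPP] by blast
    have "conjugate (x \<otimes> g) P = P2" using conjugate_conjugate[OF Ps xc g(1)] by (simp add: P2_def P1_def)
    then have "P2 \<in> (\<lambda>g. conjugate g P) ` carrier G" using xc g(1) by (metis image_eqI m_closed)
    moreover have "P \<in> (\<lambda>g. conjugate g P) ` carrier G" using conjugate_one[OF Ps] by (metis image_eqI one_closed)
    moreover have "P1 \<in> (\<lambda>g. conjugate g P) ` carrier G" unfolding P1_def using g(1) by (rule imageI)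
    ultimately show "?PP \<subseteq> (\<lambda>g. conjugate g P) ` carrier G" unfolding PPeq[symmetric] insert_subset by (intro conjI empty_subsetI)
  qed
  moreover have c3: "card {P, P1, P2} = 3" using P1(2) P2(2) P2P by (simp add: card_insert_if not_sym)
  ultimately have oH: "order G = 3 * card ?H" using order_eq_conjugates_mult_normaliser[OF Ps] PPeq by simp
  have pH: "proper_subgroup ?H G" using H(1) oH card_subgroup_pos[OF H(1)] by (intro proper_subgroupI) simp_all
  have "?H \<in> {P, P1, P2}"
  proof (rule ccontr)
    assume nH: "?H \<notin> {P, P1, P2}"
    have n3: "\<not> (3::nat) dvd 2 ^ i" for i
    proof
      assume "(3::nat) dvd 2 ^ i"
      then have "(3::nat) dvd 2" by (rule prime_dvd_power[rotated]) simp
      then show False by simp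
    qed
    have HV: "\<not> order G dvd card ?H * p ^ a" unfolding oH p2 using n3[of a] card_subgroup_pos[OF H(1)] by simp
    have "card (insert ?H {P, P1, P2}) \<le> 3"
    proof (rule star_freeD[OF sf])
      show "proper_subgroup N G"
        using prime_index_is_maximal[OF p normal_imp_subgroup[OF N(1)] N(2)] by (simp add: maximal_subgroup_def)
      show "independent_family G (insert ?H {P, P1, P2})"
        unfolding independent_family_def
      proof (intro conjI ballI)
        fix V assume V: "V \<in> insert ?H {P, P1, P2}"
        have "proper_subgroup V G" if "V \<in> {P, P1, P2}"
          using PPcard[OF that] not_power[of a] by (intro proper_subgroupI) simp_all
        then show "proper_subgroup V G" using V pH by blast
        fix W assume W: "W \<in> insert ?H {P, P1, P2}"
        from V show "V <#> W \<noteq> carrier G"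
        proof
          assume VH: "V = ?H"
          from W show ?thesis
          proof
            assume "W = ?H" then show ?thesis using VH not_carrier_if_in_proper[OF pH] by blast
          next
            assume "W \<in> {P, P1, P2}"
            then show ?thesis using HV product_order_dvd[of V W] PPcard[of W] H(1) VH by auto
          qed
        next
          assume V3: "V \<in> {P, P1, P2}"
          from W show ?thesis
          proof
            assume "W = ?H"
            then show ?thesis using HV product_order_dvd[of V W] PPcard[OF V3] H(1) by (auto simp: mult.commute)
          next
            assume "W \<in> {P, P1, P2}"
            then show ?thesis using prime_power_order_if_product[OF p, of V a W a] PPcard[OF V3] PPcard[of W] not_power by blast
          qed
        qed
      qed
      fix V assume "V \<in> insert ?H {P, P1, P2}"
      then have "subgroup V G \<and> \<not> V \<subseteq> N" using H PN unfolding PPeq by blast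
      then show "N <#> V = carrier G" using prime_index_supplement(1)[OF p N] by simp
    qed
    moreover have "card (insert ?H {P, P1, P2}) = Suc (card {P, P1, P2})" using nH by (intro card_insert_disjoint) simp_all
    ultimately show False using c3 by simp
  qed
  then have "card ?H = p ^ a" using PPcard by blast
  then have HP: "?H = P" using H P(2) finite_subgroup[OF H(1)] by (metis card_subset_eq)
  have oG: "order G = 3 * 2 ^ a" "order G = 3 * card P" using oH HP P(2) p2 by simp_all
  have three: "Factorial_Ring.prime (3::nat)" by simp
  let ?K = "P \<inter> P1" and ?z = "x0 [^] (2::nat)"
  have cK: "card P = 2 * card ?K" unfolding P1_def by (rule index_three_core[OF P(1) oG(2) g(1)]) (use g in blast)
  have sK: "subgroup ?K G" using P(1) sP1(1) by (rule subgroups_Inter_pair)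
  have Kz: "?K = cyc ?z"
    using cyclic_pgroup_maximal[OF p x0c ox0 sK] Pcyc cK P(2) ox0 p2 by auto
  have Kcentral: "z \<otimes> w = w \<otimes> z" if z: "z \<in> ?K" and w: "w \<in> carrier G" for z w
  proof -
    have zc: "z \<in> carrier G" using z Ps by blast
    let ?C = "{w \<in> carrier G. z \<otimes> w = w \<otimes> z}"
    have C: "subgroup ?C G"
    proof (rule subgroupI)
      show "?C \<noteq> {}" using zc by blast
      fix u assume u: "u \<in> ?C"
      then have "z \<otimes> inv u = inv u \<otimes> z" using zc by (metis (mono_tags, lifting) inv_solve_left inv_solve_right m_assoc m_closed inv_closed mem_Collect_eq)
      then show "inv u \<in> ?C" using u by simp
      fix v assume v: "v \<in> ?C"
      have zu: "z \<otimes> u = u \<otimes> z" and zv: "z \<otimes> v = v \<otimes> z" and uv: "u \<in> carrier G" "v \<in> carrier G"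
        using u v by simp_all
      have "z \<otimes> (u \<otimes> v) = (z \<otimes> u) \<otimes> v" using uv zc by (simp add: m_assoc)
      also have "\<dots> = u \<otimes> (z \<otimes> v)" unfolding zu using uv zc by (simp add: m_assoc)
      also have "\<dots> = (u \<otimes> v) \<otimes> z" unfolding zv using uv zc by (simp add: m_assoc)
      finally show "u \<otimes> v \<in> ?C" using u v by simp
    qed blast
    have "P \<subseteq> ?C" using cyc_commute[OF x0c] z Pcyc Ps by blast
    moreover have "P1 \<subseteq> ?C"
    proof
      fix u assume u: "u \<in> P1"
      obtain u' where u': "u' \<in> P" "u = g \<otimes> u' \<otimes> inv g" using u unfolding P1_def conjugate_def by blast
      obtain z' where z': "z' \<in> P" "z = g \<otimes> z' \<otimes> inv g" using z unfolding P1_def conjugate_def by blast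
      have c: "u' \<in> carrier G" "z' \<in> carrier G" using u' z' Ps by blast+
      have uz: "z' \<otimes> u' = u' \<otimes> z'" using cyc_commute[OF x0c] u' z' Pcyc by blast
      have "z \<otimes> u = g \<otimes> (z' \<otimes> u') \<otimes> inv g" using u'(2) z'(2) c g(1) by (simp add: word_simps)
      also have "\<dots> = u \<otimes> z" unfolding uz using u'(2) z'(2) c g(1) by (simp add: word_simps)
      finally show "u \<in> ?C" using u sP1(2) by blast
    qed
    moreover have "\<not> P1 \<subseteq> P" using P1(2) sP1(3) P(2) finP by (metis card_subset_eq)
    ultimately have "?C = carrier G" using prime_index_maximal[OF three P(1) oG(2) C] by blast
    then show ?thesis using w by blast
  qed
  have "3 ^ 1 dvd order G" using oG(1) by simp
  then obtain R where R: "subgroup R G" "card R = 3 ^ 1" by (rule sylow_exists[OF three])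
  have "R \<noteq> {\<one>}" using R(2) by auto
  then obtain y where y: "y \<in> R" "y \<noteq> \<one>" using subgroup.one_closed[OF R(1)] by blast
  have yc: "y \<in> carrier G" using y R by (simp add: subgroup.mem_carrier)
  have "ord y dvd 3" using ord_dvd_card[OF R(1) y(1)] R(2) by simp
  moreover have "ord y \<noteq> 1" using ord_eq_1[OF yc] y(2) by simp
  ultimately have oy: "ord y = 3" using three prime_nat_iff by metis
  have sy: "subgroup (cyc y) G" "card (cyc y) = 3" using cyc_subgroup[OF yc] card_cyc[OF yc] oy by simp_all
  have cop: "coprime ((2::nat) ^ a) 3" by simp
  have triv: "card (V \<inter> cyc y) = 1" if V: "subgroup V G" "V \<subseteq> P" for V
  proof -
    have I: "subgroup (V \<inter> cyc y) G" using V(1) sy(1) by (rule subgroups_Inter_pair)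
    have "card (V \<inter> cyc y) dvd 2 ^ a" using card_subgroup_dvd_subgroup[OF I P(1)] V P(2) p2 by auto
    moreover have "card (V \<inter> cyc y) dvd 3" using card_subgroup_dvd_subgroup[OF I sy(1)] sy(2) by simp
    ultimately show ?thesis using cop by (metis coprime_common_divisor_nat)
  qed
  have Gxy: "cyc x0 <#> cyc y = carrier G"
  proof -
    have "card (P <#> cyc y) = order G" using card_set_mult[OF P(1) sy(1)] triv[OF P(1)] P(2) p2 sy(2) oG(1) by simp
    then show ?thesis using set_mult_eq_carrier_iff[OF P(1) sy(1)] Pcyc by simp
  qed
  have nK: "?K \<lhd> G"
    unfolding normal_iff_conjugate using sK conjugate_central[OF Kcentral subgroup.subset[OF sK]] by simp
  \<comment> \<open>In the central product of \<open>K\<close> and \<open>\<langle>y\<rangle>\<close>, normal as it has index \<open>2\<close>, the elements of order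
  dividing \<open>3\<close> are those of \<open>\<langle>y\<rangle>\<close>.  So conjugation by \<open>x\<^sub>0\<close> maps \<open>y\<close> to a power of \<open>y\<close>.\<close>
  let ?L = "?K <#> cyc y"
  have L: "subgroup ?L G" using nK sy(1) by (rule normal_set_mult_subgroup)
  have "card ?L = card ?K * 3" using card_set_mult[OF sK sy(1)] triv[OF sK Int_lower1] sy(2) by simp
  then have "order G = 2 * card ?L" using oG(2) cK by simp
  then have nL: "?L \<lhd> G" by (rule index_two_normal[OF L])
  have "y \<in> ?L" using set_mult_upper(2)[OF sK sy(1)] mem_cyc[of y] by blast
  then have "inv x0 \<otimes> y \<otimes> x0 \<in> ?L" using normal.inv_op_closed1[OF nL x0c] by simp
  then obtain z r where zr: "z \<in> ?K" "r \<in> cyc y" "inv x0 \<otimes> y \<otimes> x0 = z \<otimes> r" by (rule set_multE)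
  have zrc: "z \<in> carrier G" "r \<in> carrier G" using zr(1,2) Ps sy(1) by (auto simp: subgroup.mem_carrier)
  have y3: "y [^] (3::nat) = \<one>" using pow_ord_eq_1[OF yc] oy by simp
  have "(inv x0 \<otimes> y \<otimes> x0) [^] (3::nat) = inv x0 \<otimes> y [^] (3::nat) \<otimes> x0"
    using x0c yc by (simp add: numeral_3_eq_3 word_simps)
  then have "(z \<otimes> r) [^] (3::nat) = \<one>" using zr(3) y3 x0c by simp
  moreover have "(z \<otimes> r) [^] (3::nat) = z [^] (3::nat) \<otimes> r [^] (3::nat)"
    using Kcentral[OF zr(1) zrc(2)] zrc by (intro pow_mult_distrib)
  moreover have "r [^] (3::nat) = \<one>" using ord_dvd_card[OF sy(1) zr(2)] sy(2) zrc(2) by (simp add: pow_eq_id)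
  ultimately have "z [^] (3::nat) = \<one>" using zrc by simp
  then have "ord z dvd 3" using zrc(1) by (simp add: pow_eq_id)
  moreover have "ord z dvd 2 ^ a" using ord_dvd_card[OF P(1), of z] zr(1) P(2) p2 by simp
  ultimately have "ord z = 1" using cop by (metis coprime_common_divisor_nat)
  then have "z = \<one>" using ord_eq_1[OF zrc(1)] by simp
  then have wr: "inv x0 \<otimes> y \<otimes> x0 = r" using zr(3) zrc(2) by simp
  then have yx: "y \<otimes> x0 = x0 \<otimes> r" using x0c yc by (metis inv_solve_left m_assoc m_closed inv_closed)
  obtain i :: nat where i: "r = y [^] i" using zr(2) cyc_eq[OF yc] by auto
  have "y [^] i = y [^] (i mod 3)"
  proof -
    have "y [^] i = (y [^] (3::nat)) [^] (i div 3) \<otimes> y [^] (i mod 3)" using yc by (simp only: nat_pow_pow nat_pow_mult mult_div_mod_eq)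
    then show ?thesis using y3 yc by simp
  qed
  then have ri: "r = y [^] (i mod 3)" using i by simp
  have "i mod 3 = 2"
  proof (rule ccontr)
    assume "i mod 3 \<noteq> 2"
    then consider "i mod 3 = 0" | "i mod 3 = 1" by linarith
    then show False
    proof cases
      case 1
      then have "y \<otimes> x0 = \<one> \<otimes> x0" using yx ri x0c by simp
      then show False using y(2) yc x0c by (metis one_closed right_cancel)
    next
      case 2
      then have "y \<otimes> x0 = x0 \<otimes> y" using yx ri yc by simp
      then have "y \<otimes> x0 [^] j = x0 [^] j \<otimes> y" for j :: nat
        using group_commutes_pow[of x0 y j] x0c yc by simp
      then have "y \<otimes> x0 [^] j \<otimes> inv y = x0 [^] j" for j :: nat using x0c yc by (simp add: m_assoc)
      then have "conjugate y P \<subseteq> P" unfolding Pcyc cyc_eq[OF x0c] conjugate_def by auto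
      then have "conjugate y P = P" using card_conjugate[OF Ps yc] finP by (intro card_subset_eq) simp_all
      then have "y \<in> P" using HP yc by (auto simp: normaliser_def)
      then have "3 dvd (2::nat) ^ a" using ord_dvd_card[OF P(1)] oy P(2) p2 by metis
      then show False using cop by (metis coprime_common_divisor_nat dvd_refl numeral_eq_one_iff semiring_norm(86))
    qed
  qed
  then have "y \<otimes> x0 = x0 \<otimes> y [^] (2::nat)" using yx ri by simp
  moreover have "\<forall>g\<in>carrier G. ?z \<otimes> g = g \<otimes> ?z" using Kcentral mem_cyc[of ?z] unfolding Kz by blast
  ultimately show ?thesis using p2 oG(1) x0c yc ox0 oy Gxy by blast
qed

text \<open>The products of \<open>\<langle>y\<rangle>\<close> with the \<open>a\<close> subgroups of \<open>\<langle>x\<^sup>2\<rangle>\<close> supplement \<open>\<langle>x\<rangle>\<close> and lie in one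
  proper subgroup.\<close>

lemma nonnormal_sylow_bound:
  assumes G: "order G = 3 * 2 ^ a" and x: "x \<in> carrier G" "ord x = 2 ^ a" and y: "y \<in> carrier G" "ord y = 3"
    and xy: "cyc x <#> cyc y = carrier G" and central: "\<And>g. g \<in> carrier G \<Longrightarrow> x [^] (2::nat) \<otimes> g = g \<otimes> x [^] (2::nat)"
  shows "a \<le> 3"
proof -
  let ?k = "\<lambda>j. cyc (x [^] (2 ^ Suc j :: nat))"
  let ?V = "\<lambda>j. ?k j <#> cyc y"
  have sy: "subgroup (cyc y) G" "card (cyc y) = 3" using cyc_subgroup[OF y(1)] card_cyc[OF y(1)] y(2) by simp_all
  have sx: "subgroup (cyc x) G" using cyc_subgroup[OF x(1)] .
  have sk: "subgroup (?k j) G" for j using x(1) by (intro cyc_subgroup) simp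
  have kx: "?k j \<subseteq> cyc x" for j using cyc_subset[OF sx pow_mem_cyc[OF x(1)]] .
  have zc: "x [^] (2::nat) \<in> carrier G" using x by simp
  have cent: "z \<otimes> g = g \<otimes> z" if "z \<in> ?k j" "g \<in> carrier G" for z g j
  proof -
    have "z \<in> cyc (x [^] (2::nat))"
    proof -
      have "x [^] (2 ^ Suc j :: nat) = (x [^] (2::nat)) [^] (2 ^ j :: nat)" using x(1) by (simp add: nat_pow_pow)
      then have "?k j \<subseteq> cyc (x [^] (2::nat))"
        using cyc_subset[OF cyc_subgroup[OF zc] pow_mem_cyc[OF zc, of "2 ^ j"]] by simp
      then show ?thesis using that(1) by blast
    qed
    then obtain i :: nat where "z = (x [^] (2::nat)) [^] i" using cyc_eq[OF zc] by auto
    then show ?thesis using group_commutes_pow[OF central[OF that(2)] zc that(2), of i] by simp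
  qed
  have V: "subgroup (?V j) G" for j
    by (rule set_mult_subgroup_if_normalises[OF sk sy(1)])
      (use conjugate_central[OF cent subgroup.subset[OF sk]] sy(1) in \<open>simp add: subgroup.mem_carrier\<close>)
  have cV: "card (?V j) = 3 * 2 ^ (a - Suc j)" if "j < a" for j
  proof -
    have "a = Suc j + (a - Suc j)" using that by simp
    then have e: "(2::nat) ^ a = 2 ^ Suc j * 2 ^ (a - Suc j)" by (metis power_add)
    have "(2::nat) ^ Suc j dvd ord x" unfolding x(2) e by simp
    then have "ord (x [^] (2 ^ Suc j :: nat)) = 2 ^ (a - Suc j)" using ord_pow[OF x(1)] x(2) e by simp
    then have ck: "card (?k j) = 2 ^ (a - Suc j)" using card_cyc[of "x [^] (2 ^ Suc j :: nat)"] x(1) by simp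
    have I: "subgroup (?k j \<inter> cyc y) G" using sk sy(1) by (rule subgroups_Inter_pair)
    have "card (?k j \<inter> cyc y) dvd 2 ^ (a - Suc j)" using card_subgroup_dvd_subgroup[OF I sk Int_lower1] ck by simp
    moreover have "card (?k j \<inter> cyc y) dvd 3" using card_subgroup_dvd_subgroup[OF I sy(1)] sy(2) by simp
    moreover have "coprime ((2::nat) ^ (a - Suc j)) 3" by simp
    ultimately have "card (?k j \<inter> cyc y) = 1" by (metis coprime_common_divisor_nat)
    then show ?thesis using card_set_mult[OF sk sy(1), of j] ck sy(2) by simp
  qed
  have inj: "inj_on ?V {..<a}"
  proof (rule inj_onI)
    fix i j assume ij: "i \<in> {..<a}" "j \<in> {..<a}" "?V i = ?V j"
    then have "3 * (2::nat) ^ (a - Suc i) = 3 * 2 ^ (a - Suc j)" using cV[of i] cV[of j] by simp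
    then show "i = j" using ij by simp
  qed
  show ?thesis
  proof (cases "a = 0")
    case False
    have prx: "proper_subgroup (cyc x) G" using sx G x card_cyc[OF x(1)] by (intro proper_subgroupI) simp_all
    have prV: "proper_subgroup (?V 0) G"
    proof (rule proper_subgroupI[OF V])
      obtain b where "a = Suc b" using False by (cases a) simp_all
      then show "card (?V 0) \<noteq> order G" using cV[of 0] G by simp
    qed
    have sub: "?V j \<subseteq> ?V 0" for j
    proof -
      have "x [^] (2 ^ Suc j :: nat) = (x [^] (2 ^ Suc 0 :: nat)) [^] (2 ^ j :: nat)" using x(1) by (simp add: nat_pow_pow)
      then have "?k j \<subseteq> ?k 0"
        using cyc_subset[OF sk[of 0] pow_mem_cyc[of "x [^] (2 ^ Suc 0 :: nat)" "2 ^ j"]] x(1) by simp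
      then show ?thesis by (rule mono_set_mult) simp
    qed
    have "card (?V ` {..<a}) \<le> 3"
    proof (rule star_freeD[OF sf prx])
      show "independent_family G (?V ` {..<a})"
        by (rule independent_family_in_proper[OF prV]) (use V sub in blast)+
      fix W assume "W \<in> ?V ` {..<a}"
      then obtain j where W: "W = ?V j" by blast
      have "cyc y \<subseteq> W" unfolding W using set_mult_upper(2)[OF sk sy(1)] .
      then show "cyc x <#> W = carrier G"
        by (rule set_mult_mono_carrier[OF xy subset_refl])
          (use V[of j] W subgroup.subset[OF sx] in \<open>simp_all add: subgroup.subset\<close>)
    qed
    then show ?thesis using inj by (simp add: card_image)
  qed simp
qed

lemma sylow_normal_or_C3_extension:
  "(\<exists>a x y. 1 \<le> a \<and> a \<le> 3 \<and> metacyclic G 3 (2 ^ a) 0 2 y x) \<or>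
   (\<exists>P a m. P \<lhd> G \<and> card P = p ^ a \<and> order G = p ^ a * m \<and> \<not> p dvd m \<and> 1 \<le> a \<and> \<not> P \<subseteq> N \<and> m \<noteq> 1)"
proof -
  obtain P a m where P: "subgroup P G" "card P = p ^ a" and G: "order G = p ^ a * m" "\<not> p dvd m" and a: "1 \<le> a"
    and PN: "\<not> P \<subseteq> N" and m: "m \<noteq> 1"
    by (rule sylow_outside)
  show ?thesis
  proof (cases "P \<lhd> G")
    case True
    then show ?thesis using P(2) G a PN m by blast
  next
    case False
    obtain x y where xy: "order G = 3 * 2 ^ a" "x \<in> carrier G" "y \<in> carrier G" "ord x = 2 ^ a" "ord y = 3"
      "y \<otimes> x = x \<otimes> y [^] (2::nat)" "cyc x <#> cyc y = carrier G" "\<forall>g\<in>carrier G. x [^] (2::nat) \<otimes> g = g \<otimes> x [^] (2::nat)"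
      using nonnormal_sylow[OF P G PN False] by (elim exE conjE)
    have "a \<le> 3" using nonnormal_sylow_bound[OF xy(1,2,4,3,5,7)] xy(8) by blast
    moreover have "metacyclic G 3 (2 ^ a) 0 2 y x"
      using xy pow_ord_eq_1[OF xy(2)] pow_ord_eq_1[OF xy(3)] by (intro metacyclicI) simp_all
    ultimately show ?thesis using a by blast
  qed
qed

end

section \<open>All Sylow subgroups normal\<close>

lemma metacyclic_integer_mod_group:
  assumes "0 < n" shows "metacyclic (integer_mod_group n) n 1 0 1 (1 mod int n) 0"
  unfolding metacyclic_def
proof (intro conjI ballI)
  fix x assume "x \<in> carrier (integer_mod_group n)"
  then have x: "0 \<le> x" "x < int n" using assms by (auto simp: carrier_integer_mod_group)
  then show "\<exists>(j::nat) (i::nat). x = 0 [^]\<^bsub>integer_mod_group n\<^esub> j \<otimes>\<^bsub>integer_mod_group n\<^esub> (1 mod int n) [^]\<^bsub>integer_mod_group n\<^esub> i"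
    by (intro exI[of _ 0] exI[of _ "nat x"]) (simp add: mod_mult_right_eq)
qed (use assms in \<open>simp_all add: carrier_integer_mod_group order_def mod_mult_right_eq\<close>)

context fin_group begin

text \<open>A cyclic group is metacyclic with trivial second generator.\<close>

lemma cyclic_iso:
  assumes "z \<in> carrier G" "cyc z = carrier G"
  shows "G \<cong> integer_mod_group (order G)"
proof -
  have o: "ord z = order G" using card_cyc[OF assms(1)] assms(2) by (simp add: order_def)
  have "metacyclic G (order G) 1 0 1 z \<one>"
  proof (rule metacyclicI)
    show "cyc \<one> <#> cyc z = carrier G"
      using set_mult_upper(2)[OF cyc_subgroup[OF one_closed] cyc_subgroup[OF assms(1)]] assms(2)
        set_mult_closed[OF subgroup.subset[OF cyc_subgroup[OF one_closed]] subgroup.subset[OF cyc_subgroup[OF assms(1)]]]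
      by blast
    show "z [^] order G = \<one>" using o pow_ord_eq_1[OF assms(1)] by simp
  qed (use assms order_pos in simp_all)
  then show ?thesis
    using metacyclic_iso[OF is_group group_integer_mod_group _ metacyclic_integer_mod_group] order_pos by blast
qed

text \<open>The commutator of \<open>x\<close> and \<open>y\<close> lies in both normal subgroups.\<close>

lemma disjoint_normal_commute:
  assumes A: "A \<lhd> G" and B: "B \<lhd> G" and AB: "A \<inter> B = {\<one>}" and x: "x \<in> A" and y: "y \<in> B"
  shows "x \<otimes> y = y \<otimes> x"
proof -
  have s: "subgroup A G" "subgroup B G" using A B by (simp_all add: normal_imp_subgroup)
  have c: "x \<in> carrier G" "y \<in> carrier G" using x y s by (simp_all add: subgroup.mem_carrier)
  let ?c = "x \<otimes> y \<otimes> inv x \<otimes> inv y"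
  have "y \<otimes> inv x \<otimes> inv y \<in> A" using normal.inv_op_closed2[OF A c(2), of "inv x"] x s by (simp add: subgroup.m_inv_closed)
  then have "x \<otimes> (y \<otimes> inv x \<otimes> inv y) \<in> A" using x s by (simp add: subgroup.m_closed)
  moreover have "x \<otimes> y \<otimes> inv x \<in> B" using normal.inv_op_closed2[OF B c(1) y] .
  then have "x \<otimes> y \<otimes> inv x \<otimes> inv y \<in> B" using y s by (simp add: subgroup.m_closed subgroup.m_inv_closed)
  ultimately have "?c \<in> A \<inter> B" using c by (simp add: m_assoc)
  then have "?c = \<one>" using AB by simp
  then have "?c \<otimes> (y \<otimes> x) = y \<otimes> x" using c by simp
  then show ?thesis using c by (simp add: word_simps)
qed

lemma coprime_subgroups_Int:
  assumes A: "subgroup A G" and B: "subgroup B G" and cop: "coprime (card A) (card B)"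
  shows "A \<inter> B = {\<one>}"
proof -
  have I: "subgroup (A \<inter> B) G" using A B by (rule subgroups_Inter_pair)
  have "card (A \<inter> B) dvd card A" "card (A \<inter> B) dvd card B"
    using card_subgroup_dvd_subgroup[OF I A Int_lower1] card_subgroup_dvd_subgroup[OF I B Int_lower2] .
  then have "card (A \<inter> B) = 1" using cop by (metis coprime_common_divisor_nat)
  then show ?thesis using subgroup.one_closed[OF I] by (metis card_1_singletonE singletonD)
qed

lemma cyclic_product:
  assumes x: "x \<in> carrier G" "cyc x \<lhd> G" and y: "y \<in> carrier G" "cyc y \<lhd> G" and cop: "coprime (ord x) (ord y)"
  shows "ord (x \<otimes> y) = ord x * ord y" "cyc (x \<otimes> y) \<lhd> G"
proof -
  have s: "subgroup (cyc x) G" "subgroup (cyc y) G" using x y by (simp_all add: cyc_subgroup)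
  have I: "cyc x \<inter> cyc y = {\<one>}" using coprime_subgroups_Int[OF s] cop card_cyc[OF x(1)] card_cyc[OF y(1)] by simp
  have xy: "x \<otimes> y = y \<otimes> x" using disjoint_normal_commute[OF x(2) y(2) I mem_cyc mem_cyc] .
  have c: "x \<otimes> y \<in> carrier G" using x y by simp
  let ?n = "ord (x \<otimes> y)"
  have "x [^] ?n \<otimes> y [^] ?n = \<one>" using pow_ord_eq_1[OF c] pow_mult_distrib[OF xy x(1) y(1)] by simp
  then have e: "x [^] ?n = inv (y [^] ?n)" using x y by (metis inv_equality nat_pow_closed)
  have "inv (y [^] ?n) \<in> cyc y" using pow_mem_cyc[OF y(1)] s by (simp add: subgroup.m_inv_closed)
  then have "x [^] ?n \<in> cyc x \<inter> cyc y" using pow_mem_cyc[OF x(1), of ?n] e by simp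
  then have x1: "x [^] ?n = \<one>" using I by simp
  then have "y [^] ?n = \<one>" using e y by (metis inv_eq_1_iff nat_pow_closed)
  then have "ord x * ord y dvd ?n" using x1 x y cop by (simp add: pow_eq_id divides_mult)
  moreover have "?n dvd ord x * ord y" using ord_mul_divides[OF xy x(1) y(1)] .
  ultimately show on: "?n = ord x * ord y" by (rule dvd_antisym[rotated])
  have P: "subgroup (cyc x <#> cyc y) G" using x(2) s(2) by (rule normal_set_mult_subgroup)
  have "card (cyc x <#> cyc y) = ord x * ord y" using card_set_mult[OF s] I card_cyc[OF x(1)] card_cyc[OF y(1)] by simp
  then have eq: "cyc (x \<otimes> y) = cyc x <#> cyc y"
    using on by (intro cyc_eqI[OF P] set_multI mem_cyc) simp
  show "cyc (x \<otimes> y) \<lhd> G"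
    unfolding eq normal_inv_iff
  proof (intro conjI ballI)
    fix g h assume g: "g \<in> carrier G" and "h \<in> cyc x <#> cyc y"
    then obtain u v where uv: "u \<in> cyc x" "v \<in> cyc y" "h = u \<otimes> v" by (elim set_multE)
    have c: "u \<in> carrier G" "v \<in> carrier G" using uv s by (simp_all add: subgroup.mem_carrier)
    have "g \<otimes> h \<otimes> inv g = (g \<otimes> u \<otimes> inv g) \<otimes> (g \<otimes> v \<otimes> inv g)" using uv c g by (simp add: word_simps)
    moreover have "g \<otimes> u \<otimes> inv g \<in> cyc x" using normal.inv_op_closed2[OF x(2) g uv(1)] .
    moreover have "g \<otimes> v \<otimes> inv g \<in> cyc y" using normal.inv_op_closed2[OF y(2) g uv(2)] .
    ultimately show "g \<otimes> h \<otimes> inv g \<in> cyc x <#> cyc y" using set_multI by metis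
  qed (rule P)
qed

lemma prime_order_cyclic:
  assumes p: "Factorial_Ring.prime (p::nat)" and P: "subgroup P G" "card P = p"
  obtains x where "x \<in> P" "cyc x = P"
proof -
  have "P \<noteq> {\<one>}" using P(2) prime_gt_1_nat[OF p] by auto
  then obtain x where x: "x \<in> P" "x \<noteq> \<one>" using subgroup.one_closed[OF P(1)] by blast
  have xc: "x \<in> carrier G" using x P(1) by (simp add: subgroup.mem_carrier)
  have "ord x dvd p" using ord_dvd_card[OF P(1) x(1)] P(2) by simp
  moreover have "ord x \<noteq> 1" using ord_eq_1[OF xc] x(2) by simp
  ultimately have "ord x = p" using p prime_nat_iff by metis
  then show thesis using that[OF x(1)] cyc_eqI[OF P(1) x(1)] P(2) by simp
qed

lemma internal_direct_product:
  assumes A: "A \<lhd> G" and B: "B \<lhd> G" and AB: "A \<inter> B = {\<one>}" "A <#> B = carrier G"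
  shows "G\<lparr>carrier := A\<rparr> \<times>\<times> G\<lparr>carrier := B\<rparr> \<cong> G"
proof -
  have s: "subgroup A G" "subgroup B G" using A B by (simp_all add: normal_imp_subgroup)
  have e: "subgroup_generated G C = G\<lparr>carrier := C\<rparr>" if "subgroup C G" for C
  proof -
    have "generate G (carrier G \<inter> C) = C"
      using subgroup.carrier_subgroup_generated_subgroup[OF that] by (simp add: carrier_subgroup_generated)
    then show ?thesis by (simp add: subgroup_generated_def)
  qed
  interpret group_disjoint_sum G A B
    using s by (simp add: group_disjoint_sum_def)
  have "(\<lambda>(x, y). x \<otimes> y) \<in> iso (subgroup_generated G A \<times>\<times> subgroup_generated G B) G"
    unfolding iso_group_mul_eq using A B AB by simp
  then show ?thesis unfolding e[OF s(1)] e[OF s(2)] by (rule is_isoI)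
qed

end

context fin_group begin

lemma subgroup_fin_group: "subgroup H G \<Longrightarrow> fin_group (G\<lparr>carrier := H\<rparr>)"
  unfolding fin_group_def fin_group_axioms_def using subgroup_imp_group finite_subgroup by simp

lemma cyc_in_subgroup:
  assumes "subgroup H G" "x \<in> H" shows "group.cyc (G\<lparr>carrier := H\<rparr>) x = cyc x"
  using generate_consistent[of "{x}" H] assms by simp

lemma ord_in_subgroup:
  assumes H: "subgroup H G" and x: "x \<in> H" shows "group.ord (G\<lparr>carrier := H\<rparr>) x = ord x"
proof -
  interpret S: fin_group "G\<lparr>carrier := H\<rparr>" using subgroup_fin_group[OF H] .
  have "S.ord x = card (S.cyc x)" using S.card_cyc[of x] x by simp
  also have "\<dots> = card (cyc x)" using cyc_in_subgroup[OF H x] by simp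
  finally show ?thesis using card_cyc x H by (simp add: subgroup.mem_carrier)
qed

text \<open>The Sylow 2-subgroup \<open>P\<close> may be compared with any of its subgroups of index \<open>2\<close>, since each
  of them is the intersection of \<open>P\<close> with a normal subgroup of index \<open>2\<close> of \<open>G\<close>.  Starting from \<open>N\<close>
  one finds two cyclic subgroups \<open>A\<close>, \<open>B\<close> of index \<open>2\<close>, and then sees that all elements outside
  \<open>A \<inter> B\<close> have order \<open>|P|/2\<close>; among the groups of \<open>two_cyclic_maximal\<close> this excludes
  \<open>C\<^sub>4 \<times> C\<^sub>2\<close>.  If \<open>R\<close> did not have prime order, it would have a proper nontrivial subgroup \<open>T\<close>,
  and \<open>B\<close>, \<open>N \<inter> P\<close>, \<open>P\<close> and \<open>PT\<close> would be four supplements of \<open>AR\<close> inside the proper subgroup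
  \<open>PT\<close>.\<close>

lemma noncyclic_sylow_two:
  assumes sf: "star_free G" and P: "P \<lhd> G" "card P = 2 ^ a" and R: "R \<lhd> G" "card R = r ^ c"
    and r: "Factorial_Ring.prime (r::nat)" "r \<noteq> 2" "1 \<le> c" and G: "order G = 2 ^ a * r ^ c"
    and N: "N \<lhd> G" "order G = 2 * card N" "\<not> P \<subseteq> N" and nc: "\<And>x. x \<in> P \<Longrightarrow> cyc x \<noteq> P"
  shows "c = 1" "G\<lparr>carrier := P\<rparr> \<cong> integer_mod_group 2 \<times>\<times> integer_mod_group 2 \<or> G\<lparr>carrier := P\<rparr> \<cong> quaternion_group"
proof -
  have two: "Factorial_Ring.prime (2::nat)" by simp
  have r1: "r > 1" using prime_gt_1_nat[OF r(1)] .
  have sP: "subgroup P G" and sR: "subgroup R G" and sN: "subgroup N G" using P R N by (simp_all add: normal_imp_subgroup)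
  have "odd r" using prime_odd_nat[OF r(1)] r(2) r1 by simp
  then have odd: "odd (r ^ c)" by simp
  have rc1: "r ^ c > 1" using one_less_power[OF r1, of c] r(3) by simp
  have np: "order G \<noteq> 2 ^ k" for k
  proof
    assume "order G = 2 ^ k"
    then have "r ^ c dvd 2 ^ k" using G by (metis dvd_triv_right)
    then obtain i where i: "r ^ c = 2 ^ i" using divides_primepow_nat[OF two] by blast
    then have "i \<noteq> 0" using rc1 by (metis power_0 less_irrefl)
    then have "even ((2::nat) ^ i)" by simp
    then show False using odd unfolding i by simp
  qed
  have cPR: "coprime (card P) (card R)" using P R odd by simp
  have altern: "\<forall>x\<in>P - L. 2 * ord x = card P" if L: "L \<lhd> G" "order G = 2 * card L" "\<not> P \<subseteq> L" for L
  proof -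
    interpret prime_index_normal G 2 L
      using fin_group_axioms sf two L np by (simp add: prime_index_normal_def prime_index_normal_axioms_def)
    show ?thesis using psubgroup_alternative[OF sP P(2) L(3)] nc by blast
  qed
  interpret N: prime_index_normal G 2 N
    using fin_group_axioms sf two N np by (simp add: prime_index_normal_def prime_index_normal_axioms_def)
  obtain A B where AB: "A \<noteq> B" "2 * card A = card P" "2 * card B = card P" "A \<in> cyc ` (P - N)" "B \<in> cyc ` (P - N)"
    using N.psubgroup_alternative[OF sP P(2) N(3)] nc by blast
  obtain x where x: "x \<in> P - N" "A = cyc x" using AB(4) by (elim imageE)
  obtain y where y: "y \<in> P - N" "B = cyc y" using AB(5) by (elim imageE)
  have c: "x \<in> carrier G" "y \<in> carrier G" using x y sP by (auto simp: subgroup.mem_carrier)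
  have lift: "subgroup (V <#> R) G" "V <#> R \<lhd> G" "order G = 2 * card (V <#> R)" "P \<inter> (V <#> R) = V"
    if V: "subgroup V G" "V \<subseteq> P" "2 * card V = card P" for V
  proof -
    show s: "subgroup (V <#> R) G"
    proof (rule set_mult_subgroup_if_normalises[OF V(1) sR])
      fix b assume b: "b \<in> R"
      have bc: "b \<in> carrier G" using b sR by (simp add: subgroup.mem_carrier)
      have "b \<otimes> v \<otimes> inv b = v" if "v \<in> V" for v
      proof -
        have "v \<in> P" using that V(2) by blast
        then have "v \<otimes> b = b \<otimes> v" "v \<in> carrier G"
          using disjoint_normal_commute[OF P(1) R(1) coprime_subgroups_Int[OF sP sR cPR] _ b] sP
          by (simp_all add: subgroup.mem_carrier)
        then show ?thesis using bc by (metis inv_solve_right m_closed)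
      qed
      then show "conjugate b V = V" by (simp add: conjugate_def)
    qed
    have "V \<inter> R \<subseteq> {\<one>}" using coprime_subgroups_Int[OF sP sR cPR] V(2) by blast
    then have "V \<inter> R = {\<one>}" using subgroup.one_closed[OF V(1)] subgroup.one_closed[OF sR] by blast
    then have "card (V <#> R) = card V * card R" using card_set_mult[OF V(1) sR] by simp
    then show o: "order G = 2 * card (V <#> R)" using V(3) P(2) R(2) G by simp
    show n: "V <#> R \<lhd> G" by (rule index_two_normal[OF s o])
    have I: "subgroup (P \<inter> (V <#> R)) G" using sP s by (rule subgroups_Inter_pair)
    have "\<not> P \<subseteq> V <#> R"
    proof
      assume "P \<subseteq> V <#> R"
      then have "2 ^ a dvd card (V <#> R)" using card_subgroup_dvd_subgroup[OF sP s] P(2) by simp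
      then obtain l where "card (V <#> R) = 2 ^ a * l" by (elim dvdE)
      then have "2 ^ a * r ^ c = 2 ^ a * (2 * l)" using o G by simp
      then have "r ^ c = 2 * l" by simp
      then show False using odd by simp
    qed
    then have "card P = 2 * card ((V <#> R) \<inter> P)" using prime_index_supplement(2)[OF two n o sP] by simp
    then have "card (P \<inter> (V <#> R)) = card V" using V(3) by (simp add: Int_commute)
    moreover have "V \<subseteq> P \<inter> (V <#> R)" using V(2) set_mult_upper(1)[OF V(1) sR] by blast
    ultimately show "P \<inter> (V <#> R) = V" using finite_subgroup[OF I] by (metis card_subset_eq)
  qed
  have sA: "subgroup A G" "A \<subseteq> P" and sB: "subgroup B G" "B \<subseteq> P"
    using x y c cyc_subgroup cyc_subset[OF sP] by simp_all
  note lA = lift[OF sA AB(2)] and lB = lift[OF sB AB(3)]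
  have Ppos: "card P > 0" using sP by (rule card_subgroup_pos)
  have nPA: "\<not> P \<subseteq> A <#> R" "\<not> P \<subseteq> B <#> R"
  proof -
    have lt: "card A < card P" "card B < card P" using AB(2,3) Ppos by linarith+
    show "\<not> P \<subseteq> A <#> R"
    proof
      assume "P \<subseteq> A <#> R"
      then have "P \<inter> (A <#> R) = P" by (rule Int_absorb2)
      then show False using lt(1) unfolding lA(4) by simp
    qed
    show "\<not> P \<subseteq> B <#> R"
    proof
      assume "P \<subseteq> B <#> R"
      then have "P \<inter> (B <#> R) = P" by (rule Int_absorb2)
      then show False using lt(2) unfolding lB(4) by simp
    qed
  qed
  have big: "2 * ord u = card P" if u: "u \<in> P" "u \<notin> A \<or> u \<notin> B" for u
    using u(2)
  proof
    assume "u \<notin> A"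
    then have "u \<notin> P \<inter> (A <#> R)" unfolding lA(4) .
    then show ?thesis using altern[OF lA(2,3) nPA(1)] u(1) by simp
  next
    assume "u \<notin> B"
    then have "u \<notin> P \<inter> (B <#> R)" unfolding lB(4) .
    then show ?thesis using altern[OF lB(2,3) nPA(2)] u(1) by simp
  qed
  let ?S = "G\<lparr>carrier := P\<rparr>"
  interpret S: fin_group ?S using subgroup_fin_group[OF sP] .
  have xP: "x \<in> P" "y \<in> P" using x y by simp_all
  have oS: "order ?S = card P" by (simp add: order_def)
  have ox: "2 * ord x = card P" "2 * ord y = card P" using AB(2,3) x(2) y(2) card_cyc c by simp_all
  have yA: "y \<notin> A"
  proof
    assume "y \<in> A"
    then have "B \<subseteq> A" using y(2) cyc_subset[OF sA(1)] by simp
    then show False using AB(1-3) finite_subgroup[OF sA(1)] card_subset_eq[of A B] by simp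
  qed
  have "?S \<cong> integer_mod_group 2 \<times>\<times> integer_mod_group 2 \<or> (2::nat) = 2 \<and> (?S \<cong> quaternion_group \<or>
      ?S \<cong> integer_mod_group 4 \<times>\<times> integer_mod_group 2 \<and> (\<exists>u\<in>carrier ?S - S.cyc x. 2 * S.ord u < order ?S))"
  proof (rule S.two_cyclic_maximal[OF two, of a x y])
    show "order ?S = 2 ^ a" using oS P(2) by simp
    show "x \<in> carrier ?S" "y \<in> carrier ?S" using xP by simp_all
    show "order ?S = 2 * S.ord x" "order ?S = 2 * S.ord y" using oS ox ord_in_subgroup[OF sP] xP by simp_all
    show "y \<notin> S.cyc x" using yA cyc_in_subgroup[OF sP xP(1)] x(2) by simp
    fix u assume u: "u \<in> carrier ?S" "u \<notin> S.cyc x"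
    then have "u \<in> P" "u \<notin> A" using cyc_in_subgroup[OF sP xP(1)] x(2) by simp_all
    then have "order ?S = 2 * S.ord u" using big[of u] oS ord_in_subgroup[OF sP, of u] by simp
    then show "order ?S \<le> 2 * S.ord u \<or> (2::nat) = 2 \<and> order ?S \<le> 4 * S.ord u" by simp
  qed
  moreover have "2 * S.ord u = order ?S" if "u \<in> carrier ?S - S.cyc x" for u
    using that big[of u] oS ord_in_subgroup[OF sP, of u] cyc_in_subgroup[OF sP xP(1)] x(2) by simp
  ultimately show "?S \<cong> integer_mod_group 2 \<times>\<times> integer_mod_group 2 \<or> ?S \<cong> quaternion_group"
    by (metis less_irrefl)
  show "c = 1"
  proof (rule ccontr)
    assume "c \<noteq> 1"
    then have c2: "2 \<le> c" using r(3) by simp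
    have "r ^ (c - 1) dvd card R" unfolding R(2) by (rule le_imp_power_dvd) simp
    then obtain T where T: "subgroup T G" "T \<subseteq> R" "card T = r ^ (c - 1)" by (rule sylow_within[OF r(1) sR])
    have PT: "P \<inter> T = {\<one>}"
    proof (rule coprime_subgroups_Int[OF sP T(1)])
      show "coprime (card P) (card T)" using P(2) T(3) \<open>odd r\<close> by simp
    qed
    have W: "subgroup (P <#> T) G" using P(1) T(1) by (rule normal_set_mult_subgroup)
    have cW: "card (P <#> T) = 2 ^ a * r ^ (c - 1)" using card_set_mult[OF sP T(1)] PT P(2) T(3) by simp
    have lt: "r ^ (c - 1) < r ^ c" "1 < r ^ (c - 1)"
      using power_strict_increasing[of "c - 1" c r] one_less_power[OF r1, of "c - 1"] r1 c2 by simp_all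
    have pW: "proper_subgroup (P <#> T) G" using W cW G lt by (intro proper_subgroupI) simp_all
    let ?Q = "N \<inter> P"
    have sQ: "subgroup ?Q G" using sN sP by (rule subgroups_Inter_pair)
    have cQ: "card P = 2 * card ?Q" using prime_index_supplement(2)[OF two N(1,2) sP N(3)] .
    have BQ: "B \<noteq> ?Q" using y mem_cyc[of y] by blast
    have AQ: "\<not> ?Q \<subseteq> A"
    proof
      assume "?Q \<subseteq> A"
      then have "?Q = A" using cQ AB(2) finite_subgroup[OF sA(1)] by (intro card_subset_eq) simp_all
      then show False using x mem_cyc[of x] by blast
    qed
    have up: "P \<subseteq> P <#> T" using set_mult_upper(1)[OF sP T(1)] .
    have out: "\<not> V \<subseteq> A <#> R" if V: "V \<subseteq> P" "\<not> V \<subseteq> A" for V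
    proof
      assume "V \<subseteq> A <#> R"
      then have "V \<subseteq> P \<inter> (A <#> R)" using V(1) by simp
      then show False using V(2) unfolding lA(4) by simp
    qed
    have "\<not> B \<subseteq> A" using yA y(2) mem_cyc[of y] by blast
    note outs = out[OF sB(2) this] out[OF Int_lower2 AQ]
    have outT: "\<not> P <#> T \<subseteq> A <#> R" using nPA(1) subset_trans[OF up] by (rule contrapos_nn)
    have fin4: "finite {V. subgroup V G \<and> V \<subseteq> P <#> T \<and> \<not> V \<subseteq> A <#> R}" by (rule finite_subgroups)
    have "{B, ?Q, P, P <#> T} \<subseteq> {V. subgroup V G \<and> V \<subseteq> P <#> T \<and> \<not> V \<subseteq> A <#> R}"
      unfolding insert_subset mem_Collect_eq
      by (intro conjI empty_subsetI sB(1) sQ sP W up outs outT nPA(1) subset_trans[OF sB(2) up] subset_trans[OF Int_lower2 up] subset_refl)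
    then have "card {B, ?Q, P, P <#> T} \<le> 3"
      by (rule le_trans[OF card_mono[OF fin4] card_supplements_le[OF sf two lA(2,3) pW]])
    moreover have "card {B, ?Q, P, P <#> T} = 4"
    proof -
      have "card B < card P" "card ?Q < card P" using AB(3) cQ Ppos by simp_all
      moreover have "card P < card (P <#> T)" using cW P(2) lt by simp
      ultimately have "B \<noteq> P" "?Q \<noteq> P" "P \<noteq> P <#> T" "B \<noteq> P <#> T" "?Q \<noteq> P <#> T" by auto
      then show ?thesis using BQ by (simp add: card_insert_if)
    qed
    ultimately show False by simp
  qed
qed

text \<open>What star-freeness yields at one prime.  The quotient by the normal Sylow subgroup \<open>P\<close> has only
  small independent families, and its normal subgroups of prime index pull back to \<open>G\<close>, so that the
  lemma can be applied again at the other primes.\<close>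

lemma sylow_data:
  assumes sf: "star_free G" and np: "\<And>(q::nat) k. Factorial_Ring.prime q \<Longrightarrow> order G \<noteq> q ^ k"
    and nC: "\<not> (\<exists>a x y. 1 \<le> a \<and> a \<le> 3 \<and> metacyclic G 3 (2 ^ a) 0 2 y x)"
    and p: "Factorial_Ring.prime (p::nat)" and N: "N \<lhd> G" "order G = p * card N"
  obtains P a m where "P \<lhd> G" "card P = p ^ a" "order G = p ^ a * m" "\<not> p dvd m" "1 \<le> a" "\<not> P \<subseteq> N"
    "(\<exists>(r::nat) c. Factorial_Ring.prime r \<and> 1 \<le> c \<and> c \<le> 3 \<and> m = r ^ c) \<or>
      (\<exists>(r::nat) (s::nat). Factorial_Ring.prime r \<and> Factorial_Ring.prime s \<and> r \<noteq> s \<and> m = r * s)"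
    "\<forall>q::nat. Factorial_Ring.prime q \<longrightarrow> q dvd m \<longrightarrow> (\<exists>L. L \<lhd> G \<and> order G = q * card L)"
    "(\<exists>x\<in>P. cyc x = P) \<or> p = 2"
proof -
  interpret prime_index_normal G p N
    using fin_group_axioms sf p N np by (simp add: prime_index_normal_def prime_index_normal_axioms_def)
  obtain P a m where P: "P \<lhd> G" "card P = p ^ a" "order G = p ^ a * m" "\<not> p dvd m" "1 \<le> a" "\<not> P \<subseteq> N" "m \<noteq> 1"
    using sylow_normal_or_C3_extension nC by (elim disjE exE conjE) blast+
  have sP: "subgroup P G" using P(1) by (rule normal_imp_subgroup)
  have NP: "N <#> P = carrier G" using prime_index_supplement(1)[OF p N sP P(6)] .
  have pN: "proper_subgroup N G"
    using prime_index_is_maximal[OF p normal_imp_subgroup[OF N(1)] N(2)] by (simp add: maximal_subgroup_def)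
  interpret Q: strongly_free_group "G Mod P" by (rule quotient_strongly_free_group[OF sf pN P(1) NP])
  have "order (G Mod P) * p ^ a = m * p ^ a" using quotient_hom(4)[OF P(1)] unfolding P(2,3) by (simp only: mult.commute)
  moreover have "0 < p ^ a" using prime_gt_0_nat[OF p] by simp
  ultimately have oQ: "order (G Mod P) = m" by (metis mult.commute nat_mult_eq_cancel1)
  have m1: "order (G Mod P) \<noteq> 1" using oQ P(7) by simp
  have "\<forall>q::nat. Factorial_Ring.prime q \<longrightarrow> q dvd m \<longrightarrow> (\<exists>L. L \<lhd> G \<and> order G = q * card L)"
  proof (intro allI impI)
    fix q :: nat assume q: "Factorial_Ring.prime q" "q dvd m"
    obtain W where W: "W \<lhd> (G Mod P)" "order (G Mod P) = q * card W" using Q.order_cases(2)[OF m1 q(1)] q(2) oQ by blast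
    show "\<exists>L. L \<lhd> G \<and> order G = q * card L" using preimage_normal_prime_index[OF P(1) W] by blast
  qed
  moreover have "(\<exists>x\<in>P. cyc x = P) \<or> p = 2" using psubgroup_alternative[OF sP P(2,6)] by blast
  ultimately show thesis using that[OF P(1-6) Q.order_cases(1)[OF m1, unfolded oQ]] by blast
qed

end

section \<open>The presented extension of a cyclic group of order 3\<close>

lemma word_class_nat_pow: "word_class R w [^]\<^bsub>presented_group R\<^esub> (k::nat) = word_class R (pow_word w k)"
proof (induction k)
  case 0 show ?case by (simp add: pow_word_def presented_group_def)
next
  case (Suc k)
  have "pow_word w (Suc k) = pow_word w k @ w"
    unfolding pow_word_def by (induction k) simp_all
  then show ?case using Suc by (simp add: mult_presented_group)
qed

lemma word_class_relation: "(l, r) \<in> R \<Longrightarrow> word_class R l = word_class R r"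
  unfolding word_class_eq_iff using word_cong.rel[of l r R "[]" "[]"] by simp

lemma word_class_inv: "inv\<^bsub>presented_group R\<^esub> (word_class R w) = word_class R (inv_word w)"
proof (rule group.inv_equality[OF group_presented_group])
  show "word_class R (inv_word w) \<otimes>\<^bsub>presented_group R\<^esub> word_class R w = \<one>\<^bsub>presented_group R\<^esub>"
    unfolding mult_presented_group by (simp add: presented_group_def word_class_eq_iff word_cong_inv_word_left)
qed (simp_all add: presented_group_def)

text \<open>The words act on pairs of integers, with \<open>x\<close> as \<open>(s, t) \<mapsto> (s + 1, -t)\<close> and \<open>y\<close> as
  \<open>(s, t) \<mapsto> (s, t + 1)\<close>.  Modulo \<open>2\<^sup>n\<close> in the first and \<open>3\<close> in the second coordinate this respects
  the relations, which shows for \<open>n \<ge> 1\<close> that the group is not smaller than expected.\<close>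

fun letter_action :: "gen_xy \<times> bool \<Rightarrow> int \<times> int \<Rightarrow> int \<times> int" where
  "letter_action (Gen_x, True) (s, t) = (s + 1, - t)"
| "letter_action (Gen_x, False) (s, t) = (s - 1, - t)"
| "letter_action (Gen_y, True) (s, t) = (s, t + 1)"
| "letter_action (Gen_y, False) (s, t) = (s, t - 1)"

definition word_action :: "gen_xy word \<Rightarrow> int \<times> int \<Rightarrow> int \<times> int" where
  "word_action w q = foldl (\<lambda>q l. letter_action l q) q w"

definition same_point :: "nat \<Rightarrow> int \<times> int \<Rightarrow> int \<times> int \<Rightarrow> bool" where
  "same_point n q q' \<longleftrightarrow> 2 ^ n dvd fst q - fst q' \<and> 3 dvd snd q - snd q'"

lemma word_action_append: "word_action (u @ v) q = word_action v (word_action u q)"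
  by (simp add: word_action_def)

lemma word_action_Nil [simp]: "word_action [] q = q"
  and word_action_Cons [simp]: "word_action (l # w) q = word_action w (letter_action l q)"
  by (simp_all add: word_action_def)

lemma same_point_refl: "same_point n q q"
  by (simp add: same_point_def)

lemma same_point_sym: "same_point n q q' \<Longrightarrow> same_point n q' q"
  by (simp add: same_point_def dvd_diff_commute)

lemma same_point_trans: "same_point n q q' \<Longrightarrow> same_point n q' q'' \<Longrightarrow> same_point n q q''"
  unfolding same_point_def using dvd_add[of _ "fst q - fst q'" "fst q' - fst q''"] dvd_add[of _ "snd q - snd q'" "snd q' - snd q''"] by simp

lemma same_point_letter:
  assumes "same_point n q q'" shows "same_point n (letter_action l q) (letter_action l q')"
proof -
  obtain s t s' t' where q: "q = (s, t)" "q' = (s', t')" by (metis surj_pair)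
  have d: "2 ^ n dvd s - s'" "3 dvd t - t'" using assms by (simp_all add: same_point_def q)
  then have "3 dvd t' - t" by (simp add: dvd_diff_commute)
  then show ?thesis
    using d unfolding q by (cases "(l, (s, t))" rule: letter_action.cases) (simp_all add: same_point_def)
qed

lemma same_point_word: "same_point n q q' \<Longrightarrow> same_point n (word_action w q) (word_action w q')"
  by (induction w arbitrary: q q') (simp_all add: same_point_letter)

lemma letter_action_cancel: "letter_action (g, \<not> b) (letter_action (g, b) q) = q"
  by (cases q; cases g; cases b) simp_all

lemma word_action_pow_x: "word_action (pow_word [(Gen_x, True)] k) (s, t) = (s + int k, (- 1) ^ k * t)"
proof (induction k arbitrary: s t)
  case (Suc k)
  have "pow_word [(Gen_x, True)] (Suc k) = (Gen_x, True) # pow_word [(Gen_x, True)] k" by (simp add: pow_word_def)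
  then show ?case using Suc by simp
qed (simp add: pow_word_def)

lemma word_action_pow_y: "word_action (pow_word [(Gen_y, True)] k) (s, t) = (s, t + int k)"
proof (induction k arbitrary: s t)
  case (Suc k)
  have "pow_word [(Gen_y, True)] (Suc k) = (Gen_y, True) # pow_word [(Gen_y, True)] k" by (simp add: pow_word_def)
  then show ?case using Suc by simp
qed (simp add: pow_word_def)

definition C3_relations :: "nat \<Rightarrow> (gen_xy word \<times> gen_xy word) set" where
  "C3_relations n = {(pow_word (gen_word Gen_x) (2 ^ n), []), (pow_word (gen_word Gen_y) 3, []),
     (conj_word (gen_word Gen_y) (gen_word Gen_x), inv_word (gen_word Gen_y)),
     (conj_word (pow_word (gen_word Gen_x) 2) (gen_word Gen_y), pow_word (gen_word Gen_x) 2)}"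

lemma group_C3_C2pow_eq: "group_C3_C2pow n = presented_group (C3_relations n)"
  by (simp add: group_C3_C2pow_def C3_relations_def Let_def)

lemma relation_action:
  assumes n: "1 \<le> n" and R: "(l, r) \<in> C3_relations n" shows "same_point n (word_action l q) (word_action r q)"
proof -
  obtain s t where q: "q = (s, t)" by (metis surj_pair)
  have "even ((2::nat) ^ n)" using n by simp
  then have 1: "(- 1 :: int) ^ (2 ^ n) = 1" by simp
  have "(l, r) = (pow_word (gen_word Gen_x) (2 ^ n), []) \<or> (l, r) = (pow_word (gen_word Gen_y) 3, []) \<or>
     (l, r) = (conj_word (gen_word Gen_y) (gen_word Gen_x), inv_word (gen_word Gen_y)) \<or>
     (l, r) = (conj_word (pow_word (gen_word Gen_x) 2) (gen_word Gen_y), pow_word (gen_word Gen_x) 2)"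
    using R by (simp add: C3_relations_def)
  then show ?thesis
  proof (elim disjE)
    assume "(l, r) = (pow_word (gen_word Gen_x) (2 ^ n), [])"
    then show ?thesis using 1 by (simp add: q gen_word_def word_action_pow_x same_point_def)
  next
    assume "(l, r) = (pow_word (gen_word Gen_y) 3, [])"
    then show ?thesis by (simp add: q gen_word_def word_action_pow_y same_point_def)
  next
    assume "(l, r) = (conj_word (gen_word Gen_y) (gen_word Gen_x), inv_word (gen_word Gen_y))"
    then show ?thesis by (simp add: q gen_word_def conj_word_def inv_word_def same_point_def)
  next
    assume "(l, r) = (conj_word (pow_word (gen_word Gen_x) 2) (gen_word Gen_y), pow_word (gen_word Gen_x) 2)"
    then show ?thesis
      by (simp add: q gen_word_def conj_word_def inv_word_def same_point_def word_action_append word_action_pow_x)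
  qed
qed

lemma word_cong_action:
  assumes n: "1 \<le> n" and "word_cong (C3_relations n) u v"
  shows "same_point n (word_action u q) (word_action v q)"
  using assms(2)
proof (induction arbitrary: q rule: word_cong.induct)
  case (refl w) show ?case by (rule same_point_refl)
next
  case (sym u v) show ?case by (rule same_point_sym) (rule sym.IH)
next
  case (trans u v w) show ?case by (rule same_point_trans[OF trans.IH])
next
  case (cancel u g b v) show ?case by (simp add: word_action_append letter_action_cancel same_point_refl)
next
  case (rel l r u v) show ?case
    unfolding word_action_append by (rule same_point_word) (rule relation_action[OF n rel])
qed

text \<open>The relations bring every word into the form \<open>x\<^sup>jy\<^sup>i\<close>; the action on the point \<open>(0, 0)\<close> tells
  the reduced ones apart.\<close>

lemma metacyclic_C3_C2pow:
  assumes n: "1 \<le> n"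
  shows "\<exists>a b. metacyclic (group_C3_C2pow n) 3 (2 ^ n) 0 2 a b"
proof -
  let ?R = "C3_relations n"
  let ?P = "presented_group ?R"
  interpret P: group ?P by (rule group_presented_group)
  let ?wx = "[(Gen_x, True)]" and ?wy = "[(Gen_y, True)]"
  define gx where "gx = word_class ?R ?wx"
  define gy where "gy = word_class ?R ?wy"
  have car: "carrier ?P = range (word_class ?R)" and one: "\<one>\<^bsub>?P\<^esub> = word_class ?R []" by (simp_all add: presented_group_def)
  have XY: "gx \<in> carrier ?P" "gy \<in> carrier ?P" unfolding car gx_def gy_def by simp_all
  have Xn: "gx [^]\<^bsub>?P\<^esub> (2 ^ n :: nat) = \<one>\<^bsub>?P\<^esub>"
    unfolding gx_def one word_class_nat_pow by (rule word_class_relation) (simp add: C3_relations_def gen_word_def)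
  have Y3: "gy [^]\<^bsub>?P\<^esub> (3 :: nat) = \<one>\<^bsub>?P\<^esub>"
    unfolding gy_def one word_class_nat_pow by (rule word_class_relation) (simp add: C3_relations_def gen_word_def)
  have "inv\<^bsub>?P\<^esub> gx \<otimes>\<^bsub>?P\<^esub> gy \<otimes>\<^bsub>?P\<^esub> gx = inv\<^bsub>?P\<^esub> gy"
  proof -
    have "word_class ?R (conj_word ?wy ?wx) = word_class ?R (inv_word ?wy)"
      by (rule word_class_relation) (simp add: C3_relations_def gen_word_def)
    then show ?thesis unfolding gx_def gy_def word_class_inv by (simp add: mult_presented_group conj_word_def)
  qed
  moreover have iY: "inv\<^bsub>?P\<^esub> gy = gy [^]\<^bsub>?P\<^esub> (2::nat)"
  proof (rule P.inv_equality)
    show "gy [^]\<^bsub>?P\<^esub> (2::nat) \<otimes>\<^bsub>?P\<^esub> gy = \<one>\<^bsub>?P\<^esub>" using Y3 XY by (simp add: numeral_3_eq_3 numeral_2_eq_2)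
  qed (use XY in simp_all)
  ultimately have "gx \<otimes>\<^bsub>?P\<^esub> (inv\<^bsub>?P\<^esub> gx \<otimes>\<^bsub>?P\<^esub> gy \<otimes>\<^bsub>?P\<^esub> gx) = gx \<otimes>\<^bsub>?P\<^esub> gy [^]\<^bsub>?P\<^esub> (2::nat)" by simp
  moreover have "gx \<otimes>\<^bsub>?P\<^esub> (inv\<^bsub>?P\<^esub> gx \<otimes>\<^bsub>?P\<^esub> gy \<otimes>\<^bsub>?P\<^esub> gx) = gy \<otimes>\<^bsub>?P\<^esub> gx" using XY by (simp flip: P.m_assoc)
  ultimately have YX: "gy \<otimes>\<^bsub>?P\<^esub> gx = gx \<otimes>\<^bsub>?P\<^esub> gy [^]\<^bsub>?P\<^esub> (2::nat)" by simp
  have iX: "inv\<^bsub>?P\<^esub> gx = gx [^]\<^bsub>?P\<^esub> (2 ^ n - 1 :: nat)"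
  proof (rule P.inv_equality)
    have "gx [^]\<^bsub>?P\<^esub> (2 ^ n - 1 :: nat) \<otimes>\<^bsub>?P\<^esub> gx = gx [^]\<^bsub>?P\<^esub> Suc (2 ^ n - 1)" by (simp only: nat_pow_Suc)
    also have "Suc (2 ^ n - 1) = 2 ^ n" by simp
    finally show "gx [^]\<^bsub>?P\<^esub> (2 ^ n - 1 :: nat) \<otimes>\<^bsub>?P\<^esub> gx = \<one>\<^bsub>?P\<^esub>" using Xn by simp
  qed (use XY in simp_all)
  note tw = P.pow_twist[OF XY(2) XY(1) YX]
  have Xl: "gx [^]\<^bsub>?P\<^esub> k \<otimes>\<^bsub>?P\<^esub> (gx [^]\<^bsub>?P\<^esub> j \<otimes>\<^bsub>?P\<^esub> gy [^]\<^bsub>?P\<^esub> i) = gx [^]\<^bsub>?P\<^esub> (k + j) \<otimes>\<^bsub>?P\<^esub> gy [^]\<^bsub>?P\<^esub> i" for k j i :: nat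
    using XY by (simp add: P.nat_pow_mult flip: P.m_assoc)
  have Yl: "gy [^]\<^bsub>?P\<^esub> k \<otimes>\<^bsub>?P\<^esub> (gx [^]\<^bsub>?P\<^esub> j \<otimes>\<^bsub>?P\<^esub> gy [^]\<^bsub>?P\<^esub> i) = gx [^]\<^bsub>?P\<^esub> j \<otimes>\<^bsub>?P\<^esub> gy [^]\<^bsub>?P\<^esub> (k * 2 ^ j + i)" for k j i :: nat
  proof -
    have "gy [^]\<^bsub>?P\<^esub> k \<otimes>\<^bsub>?P\<^esub> (gx [^]\<^bsub>?P\<^esub> j \<otimes>\<^bsub>?P\<^esub> gy [^]\<^bsub>?P\<^esub> i) = (gy [^]\<^bsub>?P\<^esub> k \<otimes>\<^bsub>?P\<^esub> gx [^]\<^bsub>?P\<^esub> j) \<otimes>\<^bsub>?P\<^esub> gy [^]\<^bsub>?P\<^esub> i"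
      using XY by (simp add: P.m_assoc)
    also have "\<dots> = gx [^]\<^bsub>?P\<^esub> j \<otimes>\<^bsub>?P\<^esub> (gy [^]\<^bsub>?P\<^esub> (k * 2 ^ j) \<otimes>\<^bsub>?P\<^esub> gy [^]\<^bsub>?P\<^esub> i)"
      unfolding tw using XY by (simp add: P.m_assoc)
    finally show ?thesis using XY by (simp add: P.nat_pow_mult)
  qed
  have all: "\<exists>(j::nat) (i::nat). word_class ?R w = gx [^]\<^bsub>?P\<^esub> j \<otimes>\<^bsub>?P\<^esub> gy [^]\<^bsub>?P\<^esub> i" for w
  proof (induction w)
    case Nil show ?case by (intro exI[of _ 0]) (simp flip: one)
  next
    case (Cons l w)
    then obtain j i :: nat where ji: "word_class ?R w = gx [^]\<^bsub>?P\<^esub> j \<otimes>\<^bsub>?P\<^esub> gy [^]\<^bsub>?P\<^esub> i" by blast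
    have step: "word_class ?R (l # w) = word_class ?R [l] \<otimes>\<^bsub>?P\<^esub> (gx [^]\<^bsub>?P\<^esub> j \<otimes>\<^bsub>?P\<^esub> gy [^]\<^bsub>?P\<^esub> i)"
      unfolding ji[symmetric] mult_presented_group by simp
    have cX: "word_class ?R [(Gen_x, True)] = gx [^]\<^bsub>?P\<^esub> (1::nat)" using XY by (simp add: gx_def)
    have cY: "word_class ?R [(Gen_y, True)] = gy [^]\<^bsub>?P\<^esub> (1::nat)" using XY by (simp add: gy_def)
    have cX': "word_class ?R [(Gen_x, False)] = gx [^]\<^bsub>?P\<^esub> (2 ^ n - 1 :: nat)"
      using iX unfolding gx_def word_class_inv by (simp add: inv_word_def)
    have cY': "word_class ?R [(Gen_y, False)] = gy [^]\<^bsub>?P\<^esub> (2 :: nat)"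
      using iY unfolding gy_def word_class_inv by (simp add: inv_word_def)
    have "\<exists>k::nat. word_class ?R [l] = gx [^]\<^bsub>?P\<^esub> k \<or> word_class ?R [l] = gy [^]\<^bsub>?P\<^esub> k"
    proof -
      obtain g b where l: "l = (g, b)" by (metis surj_pair)
      consider "l = (Gen_x, True)" | "l = (Gen_y, True)" | "l = (Gen_x, False)" | "l = (Gen_y, False)"
        unfolding l by (cases g; cases b) simp_all
      then show ?thesis
      proof cases
        case 1 show ?thesis unfolding 1 cX by (rule exI, rule disjI1, rule HOL.refl)
      next
        case 2 show ?thesis unfolding 2 cY by (rule exI, rule disjI2, rule HOL.refl)
      next
        case 3 show ?thesis unfolding 3 cX' by (rule exI, rule disjI1, rule HOL.refl)
      next
        case 4 show ?thesis unfolding 4 cY' by (rule exI, rule disjI2, rule HOL.refl)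
      qed
    qed
    then obtain k :: nat where "word_class ?R [l] = gx [^]\<^bsub>?P\<^esub> k \<or> word_class ?R [l] = gy [^]\<^bsub>?P\<^esub> k" by blast
    then show ?case
    proof
      assume "word_class ?R [l] = gx [^]\<^bsub>?P\<^esub> k" then show ?case unfolding step using Xl by metis
    next
      assume "word_class ?R [l] = gy [^]\<^bsub>?P\<^esub> k" then show ?case unfolding step using Yl by metis
    qed
  qed
  let ?f = "\<lambda>(j::nat, i::nat). gx [^]\<^bsub>?P\<^esub> j \<otimes>\<^bsub>?P\<^esub> gy [^]\<^bsub>?P\<^esub> i"
  have f: "?f (j, i) = word_class ?R (pow_word ?wx j @ pow_word ?wy i)" for j i
    unfolding prod.case gx_def gy_def word_class_nat_pow mult_presented_group by (rule HOL.refl)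
  have inj: "inj_on ?f ({..<2 ^ n} \<times> {..<3})"
  proof (rule inj_onI)
    fix q q' assume q: "q \<in> {..<2 ^ n} \<times> {..<3::nat}" "q' \<in> {..<2 ^ n} \<times> {..<3}" "?f q = ?f q'"
    obtain j i j' i' where e: "q = (j, i)" "q' = (j', i')" by (metis surj_pair)
    have "word_cong ?R (pow_word ?wx j @ pow_word ?wy i) (pow_word ?wx j' @ pow_word ?wy i')"
      using q(3) unfolding e f word_class_eq_iff .
    from word_cong_action[OF n this, of "(0, 0)"]
    have d: "2 ^ n dvd int j - int j'" "3 dvd int i - int i'"
      by (simp_all add: same_point_def word_action_append word_action_pow_x word_action_pow_y)
    have b: "j < 2 ^ n" "j' < 2 ^ n" "i < 3" "i' < 3" using q(1,2) e by simp_all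
    have "int j < 2 ^ n" "int j' < 2 ^ n" using b by (simp_all flip: of_nat_less_iff)
    then have "\<bar>int j - int j'\<bar> < \<bar>2 ^ n\<bar>" by linarith
    then have "int j - int j' = 0" using dvd_imp_le_int[OF _ d(1)] by linarith
    moreover have "int i - int i' = 0" using d(2) b(3,4) by presburger
    ultimately show "q = q'" using e by simp
  qed
  have red: "gx [^]\<^bsub>?P\<^esub> j = gx [^]\<^bsub>?P\<^esub> (j mod 2 ^ n)" "gy [^]\<^bsub>?P\<^esub> j = gy [^]\<^bsub>?P\<^esub> (j mod 3)" for j :: nat
  proof -
    have "gx [^]\<^bsub>?P\<^esub> j = (gx [^]\<^bsub>?P\<^esub> (2 ^ n :: nat)) [^]\<^bsub>?P\<^esub> (j div 2 ^ n) \<otimes>\<^bsub>?P\<^esub> gx [^]\<^bsub>?P\<^esub> (j mod 2 ^ n)"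
      using XY by (simp only: P.nat_pow_pow P.nat_pow_mult mult_div_mod_eq)
    then show "gx [^]\<^bsub>?P\<^esub> j = gx [^]\<^bsub>?P\<^esub> (j mod 2 ^ n)" using Xn XY by simp
    have "gy [^]\<^bsub>?P\<^esub> j = (gy [^]\<^bsub>?P\<^esub> (3 :: nat)) [^]\<^bsub>?P\<^esub> (j div 3) \<otimes>\<^bsub>?P\<^esub> gy [^]\<^bsub>?P\<^esub> (j mod 3)"
      using XY by (simp only: P.nat_pow_pow P.nat_pow_mult mult_div_mod_eq)
    then show "gy [^]\<^bsub>?P\<^esub> j = gy [^]\<^bsub>?P\<^esub> (j mod 3)" using Y3 XY by simp
  qed
  have "?f ` ({..<2 ^ n} \<times> {..<3}) = carrier ?P"
  proof (intro equalityI subsetI)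
    fix z assume "z \<in> ?f ` ({..<2 ^ n} \<times> {..<3})"
    then show "z \<in> carrier ?P" using XY by auto
  next
    fix z assume "z \<in> carrier ?P"
    then obtain w where "z = word_class ?R w" unfolding car by blast
    then obtain j i :: nat where "z = gx [^]\<^bsub>?P\<^esub> j \<otimes>\<^bsub>?P\<^esub> gy [^]\<^bsub>?P\<^esub> i" using all by blast
    then have "z = ?f (j mod 2 ^ n, i mod 3)" using red[of j] red[of i] by simp
    then show "z \<in> ?f ` ({..<2 ^ n} \<times> {..<3})" by (rule image_eqI) simp
  qed
  then have "order ?P = 3 * 2 ^ n" using card_image[OF inj] by (simp add: order_def card_cartesian_product)
  then have "metacyclic ?P 3 (2 ^ n) 0 2 gy gx"
    unfolding metacyclic_def using XY Xn Y3 YX all car by auto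
  then show ?thesis unfolding group_C3_C2pow_eq by blast
qed

section \<open>Star-free factorizable groups are on the list\<close>

lemma prime_power_cofactor_unique:
  fixes r u v :: nat
  assumes r: "Factorial_Ring.prime r" and eq: "r ^ c * u = r ^ b * v" and "\<not> r dvd u" "\<not> r dvd v"
  shows "b = c" "u = v"
proof -
  have le: "b \<le> c" if "r ^ c * u = r ^ b * v" "\<not> r dvd u" for b c and u v :: nat
  proof (rule ccontr)
    assume "\<not> b \<le> c"
    then obtain d where d: "b = c + Suc d" by (metis add_Suc_right less_imp_Suc_add not_le)
    have "r ^ c * u = r ^ c * (r * r ^ d * v)" using that(1) by (simp add: d power_add ac_simps)
    then have "u = r * r ^ d * v" using prime_gt_0_nat[OF r] by simp
    then show False using that(2) by simp
  qed
  show bc: "b = c" using le[OF eq assms(3)] le[OF eq[symmetric] assms(4)] by simp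
  then show "u = v" using eq prime_gt_0_nat[OF r] by simp
qed

context fin_group begin

text \<open>Normal Sylow subgroups for two primes make \<open>G\<close> their direct product.\<close>

lemma noncyclic_sylow_two_conclusion:
  assumes sf: "star_free G" and P: "P \<lhd> G" "card P = 2 ^ a" and R: "R \<lhd> G" "card R = r ^ c"
    and r: "Factorial_Ring.prime (r::nat)" "r \<noteq> 2" "1 \<le> c" and G: "order G = 2 ^ a * r ^ c"
    and N: "N \<lhd> G" "order G = 2 * card N" "\<not> P \<subseteq> N" and nc: "\<And>x. x \<in> P \<Longrightarrow> cyc x \<noteq> P"
  shows "r > 2 \<and> (G \<cong> integer_mod_group r \<times>\<times> quaternion_group \<or>
      G \<cong> integer_mod_group r \<times>\<times> integer_mod_group 2 \<times>\<times> integer_mod_group 2)"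
proof -
  note res = noncyclic_sylow_two[OF assms]
  have sP: "subgroup P G" and sR: "subgroup R G" using P R by (simp_all add: normal_imp_subgroup)
  have r2: "r > 2" using prime_gt_1_nat[OF r(1)] r(2) by simp
  then have "odd r" using prime_odd_nat[OF r(1)] by simp
  then have cop: "coprime (card R) (card P)" using P R by simp
  have I: "R \<inter> P = {\<one>}" using coprime_subgroups_Int[OF sR sP cop] .
  have "card (R <#> P) = order G" using card_set_mult[OF sR sP] I P R G by simp
  then have RP: "R <#> P = carrier G" using set_mult_eq_carrier_iff[OF sR sP] by simp
  have iso: "G\<lparr>carrier := R\<rparr> \<times>\<times> G\<lparr>carrier := P\<rparr> \<cong> G" by (rule internal_direct_product[OF R(1) P(1) I RP])
  interpret S: fin_group "G\<lparr>carrier := R\<rparr>" using subgroup_fin_group[OF sR] .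
  interpret T: fin_group "G\<lparr>carrier := P\<rparr>" using subgroup_fin_group[OF sP] .
  have cR: "card R = r" using R(2) res(1) by simp
  obtain x where x: "x \<in> R" "cyc x = R" by (rule prime_order_cyclic[OF r(1) sR cR])
  have "G\<lparr>carrier := R\<rparr> \<cong> integer_mod_group (order (G\<lparr>carrier := R\<rparr>))"
    by (rule S.cyclic_iso[of x]) (use x cyc_in_subgroup[OF sR x(1)] in simp_all)
  then have isoR: "G\<lparr>carrier := R\<rparr> \<cong> integer_mod_group r" using cR by (simp add: order_def)
  have grp: "group (G\<lparr>carrier := R\<rparr> \<times>\<times> G\<lparr>carrier := P\<rparr>)" by (rule DirProd_group[OF S.is_group T.is_group])
  have G1: "G \<cong> G\<lparr>carrier := R\<rparr> \<times>\<times> G\<lparr>carrier := P\<rparr>" by (rule group.iso_sym[OF grp iso])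
  have "G \<cong> integer_mod_group r \<times>\<times> L" if "G\<lparr>carrier := P\<rparr> \<cong> L" for L :: "'c monoid"
    by (rule iso_trans[OF G1 S.DirProd_iso_trans[OF isoR that]])
  moreover have "G \<cong> integer_mod_group r \<times>\<times> L" if "G\<lparr>carrier := P\<rparr> \<cong> L" for L :: "(int \<times> int) monoid"
    by (rule iso_trans[OF G1 S.DirProd_iso_trans[OF isoR that]])
  moreover have "G \<cong> integer_mod_group r \<times>\<times> L" if "G\<lparr>carrier := P\<rparr> \<cong> L" for L :: "(int \<times> int \<times> int \<times> int) monoid"
    by (rule iso_trans[OF G1 S.DirProd_iso_trans[OF isoR that]])
  ultimately show ?thesis using res(2) r2 by blast
qed

text \<open>The data at one prime \<open>p\<close> show which other primes occur, and then the data at these primes show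
  that their Sylow subgroups are normal too.  Generators of cyclic normal Sylow subgroups commute and
  their product generates \<open>G\<close>.\<close>

theorem star_free_nonpgroup_cases:
  assumes sf: "star_free G" and fac: "factorizable G" and np: "\<And>(q::nat) k. Factorial_Ring.prime q \<Longrightarrow> order G \<noteq> q ^ k"
  shows "(\<exists>p q r :: nat. Factorial_Ring.prime p \<and> Factorial_Ring.prime q \<and> Factorial_Ring.prime r \<and>
          p \<noteq> q \<and> p \<noteq> r \<and> q \<noteq> r \<and> G \<cong> integer_mod_group (p * q * r))
    \<or> (\<exists>p q m n :: nat. Factorial_Ring.prime p \<and> Factorial_Ring.prime q \<and> p \<noteq> q \<and>
          1 \<le> m \<and> m \<le> 3 \<and> 1 \<le> n \<and> n \<le> 3 \<and> G \<cong> integer_mod_group (p ^ m * q ^ n))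
    \<or> (\<exists>p :: nat. Factorial_Ring.prime p \<and> p > 2 \<and>
          (G \<cong> integer_mod_group p \<times>\<times> quaternion_group \<or>
           G \<cong> integer_mod_group p \<times>\<times> integer_mod_group 2 \<times>\<times> integer_mod_group 2))
    \<or> (\<exists>n :: nat. 1 \<le> n \<and> n \<le> 3 \<and> G \<cong> group_C3_C2pow n)"
proof (cases "\<exists>a x y. 1 \<le> a \<and> a \<le> 3 \<and> metacyclic G 3 (2 ^ a) 0 2 y x")
  case True
  then obtain a x y where a: "1 \<le> a" "a \<le> 3" "metacyclic G 3 (2 ^ a) 0 2 y x" by blast
  obtain u v where "metacyclic (group_C3_C2pow a) 3 (2 ^ a) 0 2 u v" using metacyclic_C3_C2pow[OF a(1)] by blast
  moreover have grp: "group (group_C3_C2pow a)" unfolding group_C3_C2pow_eq by (rule group_presented_group)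
  ultimately have "G \<cong> group_C3_C2pow a" by (intro metacyclic_iso[OF is_group grp a(3)])
  then show ?thesis using a by blast
next
  case nC: False
  obtain N p where N: "N \<lhd> G" "Factorial_Ring.prime (p::nat)" "order G = p * card N"
    by (rule factorizable_normal_prime_index[OF sf fac])
  obtain P a m where P: "P \<lhd> G" "card P = p ^ a" "order G = p ^ a * m" "\<not> p dvd m" "1 \<le> a" "\<not> P \<subseteq> N"
    and m: "(\<exists>(r::nat) c. Factorial_Ring.prime r \<and> 1 \<le> c \<and> c \<le> 3 \<and> m = r ^ c) \<or>
      (\<exists>(r::nat) (s::nat). Factorial_Ring.prime r \<and> Factorial_Ring.prime s \<and> r \<noteq> s \<and> m = r * s)"
    and nm: "\<forall>q::nat. Factorial_Ring.prime q \<longrightarrow> q dvd m \<longrightarrow> (\<exists>L. L \<lhd> G \<and> order G = q * card L)"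
    and Pc: "(\<exists>x\<in>P. cyc x = P) \<or> p = 2"
    by (rule sylow_data[OF sf np nC N(2,1,3)])
  have sP: "subgroup P G" using P(1) by (rule normal_imp_subgroup)
  from m show ?thesis
  proof
    assume "\<exists>(r::nat) c. Factorial_Ring.prime r \<and> 1 \<le> c \<and> c \<le> 3 \<and> m = r ^ c"
    then obtain r c where r: "Factorial_Ring.prime (r::nat)" "1 \<le> c" "c \<le> 3" "m = r ^ c" by blast
    have rm: "r dvd m" using r by (simp add: dvd_power)
    have pr: "p \<noteq> r" using P(4) rm by blast
    obtain L where L: "L \<lhd> G" "order G = r * card L" using nm r(1) rm by blast
    obtain R b m' where R: "R \<lhd> G" "card R = r ^ b" "order G = r ^ b * m'" "\<not> r dvd m'" "1 \<le> b" "\<not> R \<subseteq> L"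
      and m': "(\<exists>(r::nat) c. Factorial_Ring.prime r \<and> 1 \<le> c \<and> c \<le> 3 \<and> m' = r ^ c) \<or>
        (\<exists>(r::nat) (s::nat). Factorial_Ring.prime r \<and> Factorial_Ring.prime s \<and> r \<noteq> s \<and> m' = r * s)"
      and nm': "\<forall>q::nat. Factorial_Ring.prime q \<longrightarrow> q dvd m' \<longrightarrow> (\<exists>L. L \<lhd> G \<and> order G = q * card L)"
      and Rc: "(\<exists>x\<in>R. cyc x = R) \<or> r = 2"
      by (rule sylow_data[OF sf np nC r(1) L])
    have sR: "subgroup R G" using R(1) by (rule normal_imp_subgroup)
    have "\<not> r dvd p ^ a" using r(1) N(2) pr by (metis prime_dvd_power primes_dvd_imp_eq)
    moreover have "r ^ c * p ^ a = r ^ b * m'" using P(3) R(3) r(4) by (simp add: mult.commute)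
    ultimately have bc: "b = c" "p ^ a = m'" using prime_power_cofactor_unique[OF r(1)] R(4) by blast+
    have a3: "a \<le> 3"
    proof -
      have pa: "q = p" if "Factorial_Ring.prime q" "q dvd p ^ a" for q :: nat
        using that N(2) by (metis prime_dvd_power primes_dvd_imp_eq)
      from m' show ?thesis
      proof
        assume "\<exists>(r::nat) c. Factorial_Ring.prime r \<and> 1 \<le> c \<and> c \<le> 3 \<and> m' = r ^ c"
        then obtain q d where q: "Factorial_Ring.prime (q::nat)" "1 \<le> d" "d \<le> 3" "p ^ a = q ^ d" using bc(2) by blast
        then have "q = p" by (intro pa) (simp_all add: dvd_power)
        then have "a = d" using q(4) prime_gt_1_nat[OF N(2)] by simp
        then show ?thesis using q(3) by simp
      next
        assume "\<exists>(r::nat) (s::nat). Factorial_Ring.prime r \<and> Factorial_Ring.prime s \<and> r \<noteq> s \<and> m' = r * s"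
        then obtain q s where q: "Factorial_Ring.prime (q::nat)" "Factorial_Ring.prime (s::nat)" "q \<noteq> s" "p ^ a = q * s" using bc(2) by blast
        have "q = p" "s = p" using pa[OF q(1)] pa[OF q(2)] q(4) by simp_all
        then show ?thesis using q(3) by simp
      qed
    qed
    have o: "order G = p ^ a * r ^ c" using P(3) r(4) by simp
    have cR: "card R = r ^ c" using R(2) bc(1) by simp
    show ?thesis
    proof (cases "(\<exists>x\<in>P. cyc x = P) \<and> (\<exists>y\<in>R. cyc y = R)")
      case True
      then obtain x y where xy: "x \<in> P" "cyc x = P" "y \<in> R" "cyc y = R" by blast
      have c: "x \<in> carrier G" "y \<in> carrier G" using xy sP sR by (simp_all add: subgroup.mem_carrier)
      have oo: "ord x = p ^ a" "ord y = r ^ c" using card_cyc[OF c(1)] card_cyc[OF c(2)] xy P(2) cR by simp_all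
      have "coprime (ord x) (ord y)" unfolding oo using primes_coprime[OF N(2) r(1) pr] by simp
      then have "ord (x \<otimes> y) = order G" using cyclic_product(1)[OF c(1) _ c(2)] xy P(1) R(1) oo o by simp
      then have "cyc (x \<otimes> y) = carrier G" using c by (intro cyc_eqI subgroup_self) (simp_all add: order_def)
      then have "G \<cong> integer_mod_group (p ^ a * r ^ c)" using cyclic_iso[of "x \<otimes> y"] c o by simp
      then show ?thesis using N(2) r pr P(5) a3 by blast
    next
      case False
      then consider "\<not> (\<exists>x\<in>P. cyc x = P)" | "\<not> (\<exists>y\<in>R. cyc y = R)" by blast
      then show ?thesis
      proof cases
        case 1
        then have p2: "p = 2" using Pc by blast
        have "r > 2 \<and> (G \<cong> integer_mod_group r \<times>\<times> quaternion_group \<or>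
          G \<cong> integer_mod_group r \<times>\<times> integer_mod_group 2 \<times>\<times> integer_mod_group 2)"
          by (rule noncyclic_sylow_two_conclusion[OF sf P(1) _ R(1) cR r(1) _ r(2) _ N(1) _ P(6)])
            (use P(2) pr p2 o N(3) 1 in auto)
        then show ?thesis using r(1) by blast
      next
        case 2
        then have r2: "r = 2" using Rc by blast
        have "p > 2 \<and> (G \<cong> integer_mod_group p \<times>\<times> quaternion_group \<or>
          G \<cong> integer_mod_group p \<times>\<times> integer_mod_group 2 \<times>\<times> integer_mod_group 2)"
          by (rule noncyclic_sylow_two_conclusion[OF sf R(1) _ P(1,2) N(2) _ P(5) _ L(1) _ R(6), of c])
            (use cR pr r2 o L(2) 2 in auto)
        then show ?thesis using N(2) by blast
      qed
    qed
  next
    assume "\<exists>(r::nat) (s::nat). Factorial_Ring.prime r \<and> Factorial_Ring.prime s \<and> r \<noteq> s \<and> m = r * s"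
    then obtain r s where rs: "Factorial_Ring.prime (r::nat)" "Factorial_Ring.prime (s::nat)" "r \<noteq> s" "m = r * s" by blast
    have pr: "p \<noteq> r" "p \<noteq> s" using P(4) rs(4) by auto
    have sub: "\<exists>R. R \<lhd> G \<and> card R = q \<and> a = 1"
      if q: "Factorial_Ring.prime (q::nat)" and t: "Factorial_Ring.prime (t::nat)" and qt: "q \<noteq> t" "p \<noteq> q" "p \<noteq> t" and m: "m = q * t" for q t
    proof -
      obtain L where L: "L \<lhd> G" "order G = q * card L" using nm q m by (meson dvd_triv_left)
      obtain R b m' where R: "R \<lhd> G" "card R = q ^ b" "order G = q ^ b * m'" "\<not> q dvd m'" "1 \<le> b" "\<not> R \<subseteq> L"
        and m': "(\<exists>(r::nat) c. Factorial_Ring.prime r \<and> 1 \<le> c \<and> c \<le> 3 \<and> m' = r ^ c) \<or>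
          (\<exists>(r::nat) (s::nat). Factorial_Ring.prime r \<and> Factorial_Ring.prime s \<and> r \<noteq> s \<and> m' = r * s)"
        and "\<forall>q::nat. Factorial_Ring.prime q \<longrightarrow> q dvd m' \<longrightarrow> (\<exists>L. L \<lhd> G \<and> order G = q * card L)"
        and "(\<exists>x\<in>R. cyc x = R) \<or> q = 2"
        by (rule sylow_data[OF sf np nC q L])
      have "\<not> q dvd p ^ a * t"
      proof
        assume "q dvd p ^ a * t"
        then have "q dvd p ^ a \<or> q dvd t" using q by (simp add: prime_dvd_mult_iff)
        then show False using q t qt N(2) by (metis prime_dvd_power primes_dvd_imp_eq)
      qed
      moreover have "q ^ 1 * (p ^ a * t) = q ^ b * m'" using P(3) R(3) m by (simp add: ac_simps)
      ultimately have bc: "b = 1" "p ^ a * t = m'" using prime_power_cofactor_unique[OF q] R(4) by blast+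
      have pm: "p dvd m'" "t dvd m'" using bc(2) P(5) by (auto simp: dvd_power)
      have "a = 1"
        using m'
      proof
        assume "\<exists>(r::nat) c. Factorial_Ring.prime r \<and> 1 \<le> c \<and> c \<le> 3 \<and> m' = r ^ c"
        then obtain u d where u: "Factorial_Ring.prime (u::nat)" "m' = u ^ d" by blast
        have "p = u" "t = u" using pm u N(2) t by (metis prime_dvd_power primes_dvd_imp_eq)+
        then show ?thesis using qt by simp
      next
        assume "\<exists>(r::nat) (s::nat). Factorial_Ring.prime r \<and> Factorial_Ring.prime s \<and> r \<noteq> s \<and> m' = r * s"
        then obtain u w where u: "Factorial_Ring.prime (u::nat)" "Factorial_Ring.prime (w::nat)" "u \<noteq> w" "m' = u * w" by blast
        have "p = u \<or> p = w" "t = u \<or> t = w" using pm u N(2) t by (metis prime_dvd_mult_iff primes_dvd_imp_eq)+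
        then have "m' = p * t" using u(4) qt(3) by auto
        then have "p ^ a * t = p ^ 1 * t" using bc(2) by simp
        then have "p ^ a = p ^ 1" using prime_gt_0_nat[OF t] by simp
        then show ?thesis using prime_gt_1_nat[OF N(2)] power_inject_exp by blast
      qed
      then show ?thesis using R(1,2) bc(1) by auto
    qed
    obtain R where R: "R \<lhd> G" "card R = r" "a = 1" using sub[OF rs(1,2,3) pr rs(4)] by blast
    obtain S where S: "S \<lhd> G" "card S = s" using sub[OF rs(2,1) rs(3)[symmetric] pr(2,1)] rs(4) by (auto simp: mult.commute)
    have sub': "subgroup R G" "subgroup S G" using R S by (simp_all add: normal_imp_subgroup)
    have cP: "card P = p" using P(2) R(3) by simp
    obtain x where x: "x \<in> P" "cyc x = P" by (rule prime_order_cyclic[OF N(2) sP cP])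
    obtain y where y: "y \<in> R" "cyc y = R" by (rule prime_order_cyclic[OF rs(1) sub'(1) R(2)])
    obtain z where z: "z \<in> S" "cyc z = S" by (rule prime_order_cyclic[OF rs(2) sub'(2) S(2)])
    have c: "x \<in> carrier G" "y \<in> carrier G" "z \<in> carrier G"
      using x y z sP sub' by (simp_all add: subgroup.mem_carrier)
    have oo: "ord x = p" "ord y = r" "ord z = s"
      using card_cyc[OF c(1)] card_cyc[OF c(2)] card_cyc[OF c(3)] x y z cP R(2) S(2) by simp_all
    have cop: "coprime p r" "coprime p s" "coprime r s"
      using primes_coprime[OF N(2) rs(1) pr(1)] primes_coprime[OF N(2) rs(2) pr(2)] primes_coprime[OF rs(1,2,3)] .
    have xy: "ord (x \<otimes> y) = p * r" "cyc (x \<otimes> y) \<lhd> G"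
      using cyclic_product[OF c(1) _ c(2)] x y P(1) R(1) oo cop by simp_all
    have "ord (x \<otimes> y \<otimes> z) = p * r * s"
      using cyclic_product(1)[OF _ xy(2) c(3)] c z S(1) xy(1) oo cop by simp
    moreover have o: "order G = p * r * s" using P(3) R(3) rs(4) by simp
    ultimately have "cyc (x \<otimes> y \<otimes> z) = carrier G" using c by (intro cyc_eqI subgroup_self) (simp_all add: order_def)
    then have "G \<cong> integer_mod_group (p * r * s)" using cyclic_iso[of "x \<otimes> y \<otimes> z"] c o by simp
    then show ?thesis using N(2) rs pr by blast
  qed
qed

end

section \<open>The converse: cyclic groups\<close>

context fin_group begin

lemma star_freeI:
  assumes "\<And>U \<S>. proper_subgroup U G \<Longrightarrow> independent_family G \<S> \<Longrightarrow>
    (\<And>V. V \<in> \<S> \<Longrightarrow> proper_subgroup V G) \<Longrightarrow> (\<And>V. V \<in> \<S> \<Longrightarrow> U <#> V = carrier G) \<Longrightarrow> card \<S> \<le> 3"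
  shows "star_free G"
  unfolding star_free_def
proof (intro allI impI, elim conjE)
  fix U \<S> assume U: "proper_subgroup U G" and S: "independent_family G \<S>" and US: "\<forall>V\<in>\<S>. U <#> V = carrier G"
  show "card \<S> \<le> 3"
    using S US by (intro assms[OF U S]) (simp_all add: independent_family_def)
qed

lemma independent_familyD: "independent_family G \<S> \<Longrightarrow> V \<in> \<S> \<Longrightarrow> W \<in> \<S> \<Longrightarrow> V <#> W \<noteq> carrier G"
  by (simp add: independent_family_def)

text \<open>A subgroup of order \<open>d\<close> consists of solutions of \<open>x\<^sup>d = 1\<close>, and in a cyclic group these form the
  subgroup generated by the power with exponent \<open>ord z / d\<close>.\<close>

lemma cyc_subgroup_unique:
  assumes z: "z \<in> carrier G" and H: "subgroup H G" "H \<subseteq> cyc z" and K: "subgroup K G" "K \<subseteq> cyc z" and c: "card H = card K"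
  shows "H = K"
proof -
  have gen: "H = cyc (z [^] (ord z div card H))" if H: "subgroup H G" "H \<subseteq> cyc z" for H
  proof -
    let ?d = "card H" and ?c = "ord z div card H"
    have d0: "0 < ?d" using H(1) by (rule card_subgroup_pos)
    have "?d dvd ord z" using card_subgroup_dvd_subgroup[OF H(1) cyc_subgroup[OF z] H(2)] card_cyc[OF z] by simp
    then have n: "ord z = ?c * ?d" by simp
    have zc: "z [^] ?c \<in> carrier G" using z by simp
    show ?thesis
    proof (rule card_seteq)
      show "finite (cyc (z [^] ?c))" using cyc_subgroup[OF zc] by (rule finite_subgroup)
      show "H \<subseteq> cyc (z [^] ?c)"
      proof
        fix x assume x: "x \<in> H"
        then have "x \<in> range (\<lambda>k::nat. z [^] k)" using H(2) cyc_eq[OF z] by blast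
        then obtain k :: nat where k: "x = z [^] k" by blast
        have xc: "x \<in> carrier G" using k z by simp
        have "x [^] ?d = \<one>" using pow_eq_id[OF xc] ord_dvd_card[OF H(1) x] by simp
        then have "z [^] (k * ?d) = \<one>" using k z by (simp add: nat_pow_pow)
        then have "?c * ?d dvd k * ?d" using pow_eq_id[OF z] n by simp
        then have "?c dvd k" using d0 by simp
        then obtain l where "k = ?c * l" by (elim dvdE)
        then have "x = (z [^] ?c) [^] l" using k z by (simp add: nat_pow_pow)
        then show "x \<in> cyc (z [^] ?c)" using pow_mem_cyc[OF zc] by simp
      qed
      have "(z [^] ?c) [^] ?d = \<one>" using pow_ord_eq_1[OF z] n z by (simp add: nat_pow_pow)
      then have "ord (z [^] ?c) dvd ?d" using pow_eq_id[OF zc] by simp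
      then show "card (cyc (z [^] ?c)) \<le> ?d" using card_cyc[OF zc] d0 by (simp add: dvd_imp_le)
    qed
  qed
  have "H = cyc (z [^] (ord z div card H))" using H by (rule gen)
  also have "\<dots> = K" unfolding c using gen[OF K] by (rule HOL.sym)
  finally show ?thesis .
qed

text \<open>If \<open>z\<^sup>k\<close> is an element of a subgroup \<open>H\<close>, then \<open>|G|\<close> divides \<open>k|H|\<close>.  So if \<open>t\<^sup>e\<close> does not divide
  \<open>|H|\<close>, then \<open>t\<close> divides \<open>k\<close>, and \<open>H\<close> lies in the subgroup of index \<open>t\<close>.  Two factors of \<open>G\<close> cannot
  both do so.\<close>

lemma cyclic_supplement_dvd:
  assumes z: "z \<in> carrier G" "cyc z = carrier G" and t: "Factorial_Ring.prime (t::nat)" "t ^ e dvd order G" "e \<noteq> 0"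
    and U: "subgroup U G" "\<not> t ^ e dvd card U" and V: "subgroup V G" "U <#> V = carrier G"
  shows "t ^ e dvd card V"
proof (rule ccontr)
  assume nV: "\<not> t ^ e dvd card V"
  have oz: "ord z = order G" using card_cyc[OF z(1)] z(2) by (simp add: order_def)
  have zt: "z [^] t \<in> carrier G" using z by simp
  have sub: "H \<subseteq> cyc (z [^] t)" if H: "subgroup H G" "\<not> t ^ e dvd card H" for H
  proof
    fix x assume x: "x \<in> H"
    then have xc: "x \<in> carrier G" using H(1) by (rule subgroup.mem_carrier[rotated])
    then have "x \<in> range (\<lambda>k::nat. z [^] k)" using z cyc_eq[OF z(1)] by simp
    then obtain k :: nat where k: "x = z [^] k" by blast
    have "x [^] card H = \<one>" using pow_eq_id[OF xc] ord_dvd_card[OF H(1) x] by simp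
    then have "z [^] (k * card H) = \<one>" using k z by (simp add: nat_pow_pow)
    then have "order G dvd k * card H" using pow_eq_id[OF z(1)] oz by simp
    then have d: "t ^ e dvd k * card H" using t(2) by (rule dvd_trans[rotated])
    have "t dvd k"
    proof (rule ccontr)
      assume "\<not> t dvd k"
      then have "coprime (t ^ e) k" using t(1) by (simp add: prime_imp_coprime)
      then show False using d H(2) by (simp add: coprime_dvd_mult_right_iff)
    qed
    then obtain l where "k = t * l" by (elim dvdE)
    then have "x = (z [^] t) [^] l" using k z by (simp add: nat_pow_pow)
    then show "x \<in> cyc (z [^] t)" using pow_mem_cyc[OF zt] by simp
  qed
  have td: "t dvd order G" using t(2,3) by (metis dvd_power dvd_trans neq0_conv)
  then obtain c where c: "order G = t * c" by (elim dvdE)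
  have "(z [^] t) [^] c = \<one>" using c oz pow_ord_eq_1[OF z(1)] z by (simp add: nat_pow_pow)
  then have "ord (z [^] t) dvd c" using pow_eq_id[OF zt] by simp
  moreover have c0: "0 < c" using c order_pos by (cases c) simp_all
  ultimately have "ord (z [^] t) \<le> c" by (rule dvd_imp_le)
  moreover have "c < order G" unfolding c using c0 prime_gt_1_nat[OF t(1)] by simp
  ultimately have "card (cyc (z [^] t)) < order G" unfolding card_cyc[OF zt] by (rule le_less_trans)
  then have "proper_subgroup (cyc (z [^] t)) G" using cyc_subgroup[OF zt] by (intro proper_subgroupI) simp_all
  then show False using not_carrier_if_in_proper[OF _ sub[OF U] sub[OF V(1) nV]] V(2) by simp
qed

text \<open>Some prime \<open>t\<close> has its full power \<open>t\<^sup>e\<close> in \<open>|G|\<close> but not in \<open>|U|\<close>.  Then the order of a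
  supplement of \<open>U\<close> is \<open>t\<^sup>ed\<close> for a proper divisor \<open>d\<close> of the cofactor \<open>w\<close>, and it determines the
  supplement.\<close>

lemma star_free_cyclic:
  assumes z: "z \<in> carrier G" "cyc z = carrier G"
    and few: "\<And>t e w. Factorial_Ring.prime (t::nat) \<Longrightarrow> order G = t ^ e * w \<Longrightarrow> \<not> t dvd w \<Longrightarrow> e \<noteq> 0 \<Longrightarrow>
      card {d. d dvd w \<and> d \<noteq> w} \<le> 3"
  shows "star_free G"
proof (rule star_freeI)
  fix U \<S> assume U: "proper_subgroup U G" and S: "\<And>V. V \<in> \<S> \<Longrightarrow> proper_subgroup V G" "\<And>V. V \<in> \<S> \<Longrightarrow> U <#> V = carrier G"
  note U' = proper_subgroupD[OF U]
  have "card U dvd order G" using U'(1) by (rule card_subgroup_dvd)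
  then obtain c where c: "order G = card U * c" by (elim dvdE)
  have "c \<noteq> 1" using c U'(3) by simp
  then obtain t where t: "Factorial_Ring.prime (t::nat)" "t dvd c" using prime_factor_nat by blast
  have o0: "order G \<noteq> 0" using order_pos by simp
  moreover have "\<not> is_unit t" using prime_gt_1_nat[OF t(1)] by simp
  ultimately obtain w where w: "order G = t ^ multiplicity t (order G) * w" "\<not> t dvd w"
    by (rule multiplicity_decompose')
  define e where "e = multiplicity t (order G)"
  have w': "order G = t ^ e * w" using w(1) unfolding e_def .
  have nU: "\<not> t ^ e dvd card U"
  proof
    assume "t ^ e dvd card U"
    then have "t ^ e * t dvd card U * c" using t(2) by (rule mult_dvd_mono)
    then have "t ^ e * t dvd t ^ e * w" using w' c by simp
    then show False using w(2) prime_gt_0_nat[OF t(1)] by simp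
  qed
  then have e0: "e \<noteq> 0" by (metis one_dvd power_0)
  have w0: "w \<noteq> 0" using o0 w' by (metis mult_0_right)
  have te: "t ^ e dvd order G" unfolding w' by simp
  have fin: "finite {d. d dvd w \<and> d \<noteq> w}" using w0 by (intro finite_subset[OF _ finite_divisors_nat[of w]]) auto
  have "card \<S> \<le> card ((\<lambda>d. t ^ e * d) ` {d. d dvd w \<and> d \<noteq> w})"
  proof (rule card_inj_on_le[of card])
    show "inj_on card \<S>"
    proof (rule inj_onI)
      fix V W assume V: "V \<in> \<S>" and W: "W \<in> \<S>" and eq: "card V = card W"
      note V' = proper_subgroupD[OF S(1)[OF V]] and W' = proper_subgroupD[OF S(1)[OF W]]
      show "V = W" using V'(2) W'(2) unfolding z(2)[symmetric] by (intro cyc_subgroup_unique[OF z(1) V'(1) _ W'(1) _ eq])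
    qed
    show "card ` \<S> \<subseteq> (\<lambda>d. t ^ e * d) ` {d. d dvd w \<and> d \<noteq> w}"
    proof
      fix k assume "k \<in> card ` \<S>"
      then obtain V where V: "V \<in> \<S>" "k = card V" by blast
      note V' = proper_subgroupD[OF S(1)[OF V(1)]]
      have "t ^ e dvd card V" by (rule cyclic_supplement_dvd[OF z t(1) te e0 U'(1) nU V'(1) S(2)[OF V(1)]])
      then obtain d where d: "card V = t ^ e * d" by (elim dvdE)
      have "t ^ e * d dvd t ^ e * w" using card_subgroup_dvd[OF V'(1)] unfolding d w' .
      then have "d dvd w" using prime_gt_0_nat[OF t(1)] by simp
      moreover have "d \<noteq> w" using V'(3) d w' by auto
      ultimately have "d \<in> {d. d dvd w \<and> d \<noteq> w}" by simp
      then show "k \<in> (\<lambda>d. t ^ e * d) ` {d. d dvd w \<and> d \<noteq> w}" by (rule image_eqI[rotated]) (simp add: V(2) d)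
    qed
    show "finite ((\<lambda>d. t ^ e * d) ` {d. d dvd w \<and> d \<noteq> w})" using fin by simp
  qed
  also have "\<dots> \<le> card {d. d dvd w \<and> d \<noteq> w}" using fin by (rule card_image_le)
  also have "\<dots> \<le> 3" by (rule few[OF t(1) w' w(2) e0])
  finally show "card \<S> \<le> 3" .
qed

end

lemma fin_groupI: "group G \<Longrightarrow> finite (carrier G) \<Longrightarrow> fin_group G"
  by (simp add: fin_group_def fin_group_axioms_def)

lemma star_free_integer_mod_group:
  assumes n: "0 < n"
    and few: "\<And>t e w. Factorial_Ring.prime (t::nat) \<Longrightarrow> n = t ^ e * w \<Longrightarrow> \<not> t dvd w \<Longrightarrow> e \<noteq> 0 \<Longrightarrow>
      card {d. d dvd w \<and> d \<noteq> w} \<le> 3"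
  shows "star_free (integer_mod_group n)"
proof -
  interpret fin_group "integer_mod_group n" using n by (intro fin_groupI) (simp_all add: carrier_integer_mod_group)
  let ?z = "1 mod int n"
  have z: "?z \<in> carrier (integer_mod_group n)" using n by (simp add: carrier_integer_mod_group)
  have "carrier (integer_mod_group n) \<subseteq> cyc ?z"
  proof
    fix x assume "x \<in> carrier (integer_mod_group n)"
    then have x: "0 \<le> x" "x < int n" using n by (auto simp: carrier_integer_mod_group)
    then have "x = ?z [^]\<^bsub>integer_mod_group n\<^esub> nat x" by (simp add: mod_mult_right_eq)
    then show "x \<in> cyc ?z" using pow_mem_cyc[OF z, of "nat x"] by simp
  qed
  moreover have "cyc ?z \<subseteq> carrier (integer_mod_group n)" using cyc_subgroup[OF z] by (rule subgroup.subset)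
  ultimately have gen: "cyc ?z = carrier (integer_mod_group n)" by simp
  have o: "order (integer_mod_group n) = n" using n by (simp add: order_def carrier_integer_mod_group)
  show ?thesis
  proof (rule star_free_cyclic[OF z gen])
    fix t e w :: nat
    assume "Factorial_Ring.prime t" "order (integer_mod_group n) = t ^ e * w" "\<not> t dvd w" "e \<noteq> 0"
    then show "card {d. d dvd w \<and> d \<noteq> w} \<le> 3" unfolding o by (rule few)
  qed
qed

lemma prime_product_divisors:
  fixes q r d :: nat
  assumes q: "Factorial_Ring.prime q" and r: "Factorial_Ring.prime r" and d: "d dvd q * r"
  shows "d = 1 \<or> d = q \<or> d = r \<or> d = q * r"
proof -
  obtain a b where ab: "d = a * b" "a dvd q" "b dvd r" using d by (rule dvd_productE)
  have "a = 1 \<or> a = q" using q ab(2) by (simp add: prime_nat_iff)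
  moreover have "b = 1 \<or> b = r" using r ab(3) by (simp add: prime_nat_iff)
  ultimately show ?thesis using ab(1) by (elim disjE) simp_all
qed

lemma star_free_cyclic_pqr:
  fixes p q r :: nat
  assumes "Factorial_Ring.prime p" "Factorial_Ring.prime q" "Factorial_Ring.prime r" "p \<noteq> q" "p \<noteq> r" "q \<noteq> r"
  shows "star_free (integer_mod_group (p * q * r))"
proof (rule star_free_integer_mod_group)
  show "0 < p * q * r" using assms by (simp add: prime_gt_0_nat)
  have main: "card {d. d dvd w \<and> d \<noteq> w} \<le> 3"
    if pr: "Factorial_Ring.prime t" "Factorial_Ring.prime a" "Factorial_Ring.prime b" "t \<noteq> a" "t \<noteq> b"
      and eq: "t * (a * b) = t ^ e * w" and w: "\<not> t dvd w" for t a b e w :: nat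
  proof -
    have "\<not> t dvd a * b" using pr by (simp add: prime_dvd_mult_iff primes_dvd_imp_eq) (metis primes_dvd_imp_eq)
    moreover have "t ^ 1 * (a * b) = t ^ e * w" using eq by simp
    ultimately have "w = a * b" using prime_power_cofactor_unique(2)[OF pr(1) _ _ w] by metis
    then have "{d. d dvd w \<and> d \<noteq> w} \<subseteq> {1, a, b}" using prime_product_divisors[OF pr(2,3)] by auto
    then have "card {d. d dvd w \<and> d \<noteq> w} \<le> card {1, a, b}" by (intro card_mono) simp_all
    also have "\<dots> \<le> 3" by (simp add: card_insert_if)
    finally show ?thesis .
  qed
  fix t e w :: nat assume t: "Factorial_Ring.prime t" and eq: "p * q * r = t ^ e * w" and w: "\<not> t dvd w" and e: "e \<noteq> 0"
  have "t dvd t ^ e * w" using e by (simp add: dvd_power)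
  then have "t dvd p \<or> t dvd q \<or> t dvd r" using t eq[symmetric] by (simp add: prime_dvd_mult_iff)
  then consider "t = p" | "t = q" | "t = r" using t assms(1-3) primes_dvd_imp_eq by blast
  then show "card {d. d dvd w \<and> d \<noteq> w} \<le> 3"
  proof cases
    case 1 show ?thesis using assms eq w t unfolding 1 by (intro main[of p q r e w]) (simp_all add: ac_simps)
  next
    case 2 show ?thesis using assms eq w t unfolding 2 by (intro main[of q p r e w]) (simp_all add: ac_simps)
  next
    case 3 show ?thesis using assms eq w t unfolding 3 by (intro main[of r p q e w]) (simp_all add: ac_simps)
  qed
qed

lemma star_free_cyclic_two_primes:
  fixes p q m n :: nat
  assumes "Factorial_Ring.prime p" "Factorial_Ring.prime q" "p \<noteq> q" "m \<le> 3" "n \<le> 3"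
  shows "star_free (integer_mod_group (p ^ m * q ^ n))"
proof (rule star_free_integer_mod_group)
  show "0 < p ^ m * q ^ n" using assms by (simp add: prime_gt_0_nat)
  have main: "card {d. d dvd w \<and> d \<noteq> w} \<le> 3"
    if pr: "Factorial_Ring.prime t" "Factorial_Ring.prime a" "t \<noteq> a" and k: "k \<le> 3"
      and eq: "t ^ l * a ^ k = t ^ e * w" and w: "\<not> t dvd w" for t a k l e w :: nat
  proof -
    have "\<not> t dvd a ^ k" using pr by (metis prime_dvd_power primes_dvd_imp_eq)
    then have w': "w = a ^ k" using prime_power_cofactor_unique(2)[OF pr(1) eq _ w] by simp
    have "{d. d dvd w \<and> d \<noteq> w} \<subseteq> (\<lambda>i. a ^ i) ` {..<k}"
    proof
      fix d assume "d \<in> {d. d dvd w \<and> d \<noteq> w}"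
      then have d: "d dvd a ^ k" "d \<noteq> a ^ k" using w' by simp_all
      then obtain i where "i \<le> k" "d = a ^ i" using divides_primepow_nat[OF pr(2)] by blast
      then have "d = a ^ i" "i < k" using d(2) by (simp_all add: less_le) (metis)
      then show "d \<in> (\<lambda>i. a ^ i) ` {..<k}" by blast
    qed
    then have "card {d. d dvd w \<and> d \<noteq> w} \<le> card {..<k}" by (rule surj_card_le[rotated]) simp
    then show ?thesis using k by simp
  qed
  fix t e w :: nat assume t: "Factorial_Ring.prime t" and eq: "p ^ m * q ^ n = t ^ e * w" and w: "\<not> t dvd w" and e: "e \<noteq> 0"
  have "t dvd t ^ e * w" using e by (simp add: dvd_power)
  then have "t dvd p ^ m \<or> t dvd q ^ n" using t eq[symmetric] by (simp add: prime_dvd_mult_iff)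
  then have "t dvd p \<or> t dvd q" using t prime_dvd_power by blast
  then consider "t = p" | "t = q" using t assms(1,2) primes_dvd_imp_eq by blast
  then show "card {d. d dvd w \<and> d \<noteq> w} \<le> 3"
  proof cases
    case 1 show ?thesis using assms eq w t unfolding 1 by (intro main[of p q n m e w]) simp_all
  next
    case 2 show ?thesis using assms eq w t unfolding 2 by (intro main[of q p m n e w]) (simp_all add: mult.commute)
  qed
qed

section \<open>The converse: the 2-groups and the elementary abelian groups of rank 2\<close>

context fin_group begin

text \<open>Supplements have order \<open>p\<close>, and two distinct subgroups of order \<open>p\<close> have product \<open>G\<close>.\<close>

lemma star_free_order_prime_square:
  assumes p: "Factorial_Ring.prime (p::nat)" and o: "order G = p * p"
  shows "star_free G"
proof (rule star_freeI)
  fix U \<S> assume U: "proper_subgroup U G" and ind: "independent_family G \<S>"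
    and S: "\<And>V. V \<in> \<S> \<Longrightarrow> proper_subgroup V G" "\<And>V. V \<in> \<S> \<Longrightarrow> U <#> V = carrier G"
  have c: "card V = 1 \<or> card V = p" if "proper_subgroup V G" for V
    using prime_product_divisors[OF p p, of "card V"] card_subgroup_dvd[OF proper_subgroupD(1)[OF that]] proper_subgroupD(3)[OF that] o by auto
  have cp: "card V = p" if V: "V \<in> \<S>" for V
  proof (rule ccontr)
    assume "card V \<noteq> p"
    then have "card V = 1" using c[OF S(1)[OF V]] by simp
    moreover have "order G dvd card U * card V"
      using product_order_dvd[OF proper_subgroupD(1)[OF U] proper_subgroupD(1)[OF S(1)[OF V]] S(2)[OF V]] .
    ultimately have "order G dvd card U" by simp
    then show False using proper_subgroupD(3)[OF U] card_subgroup_pos[OF proper_subgroupD(1)[OF U]] dvd_imp_le by fastforce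
  qed
  have "V = W" if V: "V \<in> \<S>" and W: "W \<in> \<S>" for V W
  proof (rule ccontr)
    assume ne: "V \<noteq> W"
    note sV = proper_subgroupD(1)[OF S(1)[OF V]] and sW = proper_subgroupD(1)[OF S(1)[OF W]]
    have I: "subgroup (V \<inter> W) G" using sV sW by (rule subgroups_Inter_pair)
    have "card (V \<inter> W) dvd p" using card_subgroup_dvd_subgroup[OF I sV Int_lower1] cp[OF V] by simp
    moreover have "card (V \<inter> W) \<noteq> p"
    proof
      assume e: "card (V \<inter> W) = p"
      have "V \<inter> W = V" using e cp[OF V] finite_subgroup[OF sV] by (intro card_subset_eq) simp_all
      moreover have "V \<inter> W = W" using e cp[OF W] finite_subgroup[OF sW] by (intro card_subset_eq) simp_all
      ultimately show False using ne by simp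
    qed
    ultimately have "card (V \<inter> W) = 1" using p prime_nat_iff by metis
    then have "card (V <#> W) = order G" using card_set_mult[OF sV sW] cp[OF V] cp[OF W] o by simp
    then show False using set_mult_eq_carrier_iff[OF sV sW] independent_familyD[OF ind V W] by simp
  qed
  then have "card \<S> \<le> 1" using card_le_Suc0_iff_eq[of \<S>] by (cases "finite \<S>") simp_all
  then show "card \<S> \<le> 3" by simp
qed

text \<open>Apart from \<open>M\<close>, a subgroup outside \<open>D\<close> is generated by each of its elements outside \<open>D\<close>.  So these
  subgroups are disjoint outside \<open>D\<close>, where each of them has at least \<open>|D|/2\<close> elements, while \<open>M - D\<close>
  has only \<open>|D|\<close> elements.\<close>

lemma few_outside_half:
  assumes M: "subgroup M G" and D: "subgroup D G" "D \<subseteq> M" "card M = 2 * card D"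
    and big: "\<And>x. x \<in> M \<Longrightarrow> x \<notin> D \<Longrightarrow> card D \<le> ord x"
    and fV: "\<And>V. V \<in> \<S> \<Longrightarrow> subgroup V G" "\<And>V. V \<in> \<S> \<Longrightarrow> V \<subseteq> M" "\<And>V. V \<in> \<S> \<Longrightarrow> \<not> V \<subseteq> D"
  shows "card \<S> \<le> 3"
proof -
  let ?T = "\<S> - {M}"
  have finS: "finite \<S>"
    by (rule finite_subset[OF _ finite_subgroups[of "\<lambda>_. True"]]) (simp add: fV(1) subset_iff)
  have gen: "cyc x = V" if V: "V \<in> ?T" and x: "x \<in> V" "x \<notin> D" for V x
  proof (rule cyc_eqI)
    show sV: "subgroup V G" using V fV(1) by simp
    have "card V dvd card M" using V fV(2) card_subgroup_dvd_subgroup[OF sV M] by simp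
    then obtain k where k: "card M = card V * k" by (elim dvdE)
    have "k \<noteq> 1"
    proof
      assume "k = 1"
      then have "V = M" using k V fV(2) finite_subgroup[OF M] by (intro card_subset_eq) simp_all
      then show False using V by simp
    qed
    moreover have "k \<noteq> 0" using k card_subgroup_pos[OF M] by (cases k) simp_all
    ultimately have "card V * 2 \<le> card V * k" by (intro mult_le_mono2) simp
    then have "card V \<le> card D" using k D(3) by linarith
    then show "card V \<le> ord x" using big[of x] x V fV(2) by fastforce
  qed (rule x(1))
  have half: "card D \<le> 2 * card (V - D)" if V: "V \<in> ?T" for V
  proof -
    have sV: "subgroup V G" using V fV(1) by simp
    obtain x where x: "x \<in> V" "x \<notin> D" using fV(3) V by blast
    have xc: "x \<in> carrier G" using x sV by (simp add: subgroup.mem_carrier)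
    have xM: "x \<in> M" using x V fV(2) by blast
    have finV: "finite V" using sV by (rule finite_subgroup)
    have "card (V \<inter> D) \<le> card (V - D)"
    proof (rule card_inj_on_le)
      show "inj_on (\<lambda>y. x \<otimes> y) (V \<inter> D)"
        using xc subgroup.mem_carrier[OF sV] by (intro inj_onI) simp
      show "(\<lambda>y. x \<otimes> y) ` (V \<inter> D) \<subseteq> V - D"
      proof
        fix z assume "z \<in> (\<lambda>y. x \<otimes> y) ` (V \<inter> D)"
        then obtain y where y: "y \<in> V" "y \<in> D" "z = x \<otimes> y" by blast
        have yc: "y \<in> carrier G" using y sV by (simp add: subgroup.mem_carrier)
        have "z \<notin> D"
        proof
          assume "z \<in> D"
          then have "x \<otimes> y \<otimes> inv y \<in> D" using y D(1) by (simp add: subgroup.m_closed subgroup.m_inv_closed)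
          then show False using x(2) xc yc by (simp add: m_assoc)
        qed
        then show "z \<in> V - D" using y x sV by (simp add: subgroup.m_closed)
      qed
      show "finite (V - D)" using finV by simp
    qed
    moreover have "card V = card (V \<inter> D) + card (V - D)" using finV by (metis card_Diff_subset_Int card_mono finite_Int inf_le1 le_add_diff_inverse)
    moreover have "card D \<le> card V" using big[OF xM x(2)] gen[OF V x] card_cyc[OF xc] by simp
    ultimately show ?thesis by simp
  qed
  have disj: "(V - D) \<inter> (W - D) = {}" if "V \<in> ?T" "W \<in> ?T" "V \<noteq> W" for V W
  proof (rule equals0I)
    fix x assume "x \<in> (V - D) \<inter> (W - D)"
    then have x: "x \<in> V" "x \<in> W" "x \<notin> D" by simp_all
    then have "V = W" using gen[OF that(1) x(1,3)] gen[OF that(2) x(2,3)] by simp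
    then show False using that(3) by simp
  qed
  have "card ?T * card D = (\<Sum>V\<in>?T. card D)" by simp
  also have "\<dots> \<le> (\<Sum>V\<in>?T. 2 * card (V - D))" using half by (rule sum_mono)
  also have "\<dots> = 2 * (\<Sum>V\<in>?T. card (V - D))" by (rule sum_distrib_left[symmetric])
  also have "(\<Sum>V\<in>?T. card (V - D)) = card (\<Union>V\<in>?T. V - D)"
    using finS disj finite_subgroup fV(1) by (intro card_UN_disjoint[symmetric]) simp_all
  also have "\<dots> \<le> card (M - D)" using finite_subgroup[OF M] fV(2) by (intro card_mono) auto
  also have "card (M - D) = card D" using D(2,3) finite_subgroup[OF D(1)] by (simp add: card_Diff_subset)
  finally have "card ?T \<le> 2" using card_subgroup_pos[OF D(1)] by simp
  then show "card \<S> \<le> 3" using card_Diff1_le[of \<S> M] finS by (cases "M \<in> \<S>") simp_all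
qed

text \<open>For an abelian group of exponent \<open>4\<close> the squares form the Frattini subgroup \<open>D\<close>.  Supplements \<open>V\<close>,
  \<open>W\<close> of a proper subgroup are not inside \<open>D\<close>; if \<open>VW\<close> is proper, so is \<open>VWD\<close>, and comparing orders
  gives \<open>VD = VWD = WD\<close>.  Hence an independent family of supplements lies in one maximal subgroup.\<close>

lemma star_free_exponent_four:
  assumes comm: "\<And>x y. x \<in> carrier G \<Longrightarrow> y \<in> carrier G \<Longrightarrow> x \<otimes> y = y \<otimes> x"
    and D: "subgroup D G" "\<And>x. x \<in> D \<longleftrightarrow> (\<exists>y\<in>carrier G. x = y \<otimes> y)" and sq: "\<And>x. x \<in> D \<Longrightarrow> x \<otimes> x = \<one>"
    and o: "order G = 4 * card D" and big: "\<And>x. x \<in> carrier G \<Longrightarrow> x \<notin> D \<Longrightarrow> card D \<le> ord x"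
  shows "star_free G"
proof (rule star_freeI)
  fix U \<S> assume U: "proper_subgroup U G" and ind: "independent_family G \<S>"
    and S: "\<And>V. V \<in> \<S> \<Longrightarrow> proper_subgroup V G" "\<And>V. V \<in> \<S> \<Longrightarrow> U <#> V = carrier G"
  have norm: "H \<lhd> G" if H: "subgroup H G" for H
  proof -
    have "conjugate g H \<subseteq> H" if g: "g \<in> carrier G" for g
    proof
      fix z assume "z \<in> conjugate g H"
      then obtain h where h: "h \<in> H" "z = g \<otimes> h \<otimes> inv g" unfolding conjugate_def by blast
      have hc: "h \<in> carrier G" using h H by (simp add: subgroup.mem_carrier)
      have "z = h" unfolding h(2) comm[OF g hc] using g hc by (simp add: m_assoc)
      then show "z \<in> H" using h by simp
    qed
    then show ?thesis using H by (simp add: normal_iff_conjugate)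
  qed
  \<comment> \<open>If \<open>HD = G\<close>, every square is a square of an element of \<open>H\<close>, as \<open>D\<close> is killed by squaring.\<close>
  have frat: "proper_subgroup (H <#> D) G" if H: "proper_subgroup H G" for H
  proof -
    note H' = proper_subgroupD[OF H]
    have sub: "subgroup (H <#> D) G" using norm[OF H'(1)] D(1) by (rule normal_set_mult_subgroup)
    have "H <#> D \<noteq> carrier G"
    proof
      assume eq: "H <#> D = carrier G"
      have "D \<subseteq> H"
      proof
        fix x assume "x \<in> D"
        then obtain y where y: "y \<in> carrier G" "x = y \<otimes> y" using D(2) by blast
        then have "y \<in> H <#> D" using eq by simp
        then obtain h d where hd: "h \<in> H" "d \<in> D" "y = h \<otimes> d" by (elim set_multE)
        have c: "h \<in> carrier G" "d \<in> carrier G" using hd H'(1) D(1) by (simp_all add: subgroup.mem_carrier)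
        have "x = h \<otimes> (d \<otimes> h) \<otimes> d" unfolding y(2) hd(3) using c by (simp add: m_assoc)
        also have "\<dots> = (h \<otimes> h) \<otimes> (d \<otimes> d)" unfolding comm[OF c(2,1)] using c by (simp add: m_assoc)
        finally have "x = h \<otimes> h" using sq[OF hd(2)] c by simp
        then show "x \<in> H" using hd(1) H'(1) by (simp add: subgroup.m_closed)
      qed
      then have "H <#> D \<noteq> carrier G" by (intro not_carrier_if_in_proper[OF H]) simp_all
      then show False using eq by simp
    qed
    then show ?thesis using sub by (simp add: proper_subgroup_def)
  qed
  note sU = proper_subgroupD(1)[OF U]
  have nD: "\<not> V \<subseteq> D" if V: "V \<in> \<S>" for V
  proof
    assume VD: "V \<subseteq> D"
    have "U \<subseteq> U <#> D" "V \<subseteq> U <#> D" using set_mult_upper[OF sU D(1)] VD by simp_all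
    then show False using not_carrier_if_in_proper[OF frat[OF U]] S(2)[OF V] by simp
  qed
  have cD: "card D < card (V <#> D)" if V: "V \<in> \<S>" for V
  proof (rule psubset_card_mono)
    note sV = proper_subgroupD(1)[OF S(1)[OF V]]
    show "finite (V <#> D)" using frat[OF S(1)[OF V]] by (intro finite_subgroup proper_subgroupD(1))
    show "D \<subset> V <#> D" using set_mult_upper[OF sV D(1)] nD[OF V] by auto
  qed
  have cM: "card H = 2 * card D" if H: "proper_subgroup H G" "D \<subseteq> H" "card D < card H" for H
  proof -
    note H' = proper_subgroupD[OF H(1)]
    obtain k where k: "card H = card D * k" using card_subgroup_dvd_subgroup[OF D(1) H'(1) H(2)] by (elim dvdE)
    have "card D * k dvd card D * 4" using card_subgroup_dvd[OF H'(1)] unfolding k o by (simp only: mult.commute)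
    then have "k dvd 4" using card_subgroup_pos[OF D(1)] by simp
    then have "k \<le> 4" by (rule dvd_imp_le) simp
    moreover have "k \<noteq> 1" "k \<noteq> 4" using H(3) H'(3) k o by auto
    moreover have "k \<noteq> 0" "k \<noteq> 3" using \<open>k dvd 4\<close> by (cases "k = 0"; cases "k = 3"; simp)+
    ultimately have "k = 2" by simp
    then show ?thesis using k by simp
  qed
  show "card \<S> \<le> 3"
  proof (cases "\<S> = {}")
    case True then show ?thesis by simp
  next
    case False
    then obtain V where V: "V \<in> \<S>" by blast
    note sV = proper_subgroupD(1)[OF S(1)[OF V]]
    let ?M = "V <#> D"
    have pM: "proper_subgroup ?M G" using frat[OF S(1)[OF V]] .
    note M' = proper_subgroupD[OF pM]
    have c2: "card ?M = 2 * card D" using cM[OF pM set_mult_upper(2)[OF sV D(1)] cD[OF V]] .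
    show ?thesis
    proof (rule few_outside_half[OF M'(1) D(1) set_mult_upper(2)[OF sV D(1)] c2])
      fix W assume W: "W \<in> \<S>"
      show sW: "subgroup W G" using proper_subgroupD(1)[OF S(1)[OF W]] .
      show "\<not> W \<subseteq> D" using nD[OF W] .
      let ?H = "V <#> W"
      have sH: "subgroup ?H G" using norm[OF sV] sW by (rule normal_set_mult_subgroup)
      have pH: "proper_subgroup ?H G" using sH independent_familyD[OF ind V W] by (simp add: proper_subgroup_def)
      have pHD: "proper_subgroup (?H <#> D) G" using frat[OF pH] .
      have up: "V \<subseteq> ?H <#> D" "W \<subseteq> ?H <#> D" "D \<subseteq> ?H <#> D"
        using set_mult_upper[OF sV sW] set_mult_upper[OF sH D(1)] by (metis subset_trans)+
      have MH: "?M \<subseteq> ?H <#> D" using proper_subgroupD(1)[OF pHD] up by (intro set_mult_subset_subgroup)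
      have finH: "finite (?H <#> D)" using proper_subgroupD(1)[OF pHD] by (rule finite_subgroup)
      have "card D < card (?H <#> D)" using cD[OF V] card_mono[OF finH MH] by simp
      then have "card (?H <#> D) = 2 * card D" using cM[OF pHD up(3)] by simp
      then have "?M = ?H <#> D" using c2 finH MH by (intro card_subset_eq) simp_all
      then show "W \<subseteq> ?M" using up(2) by simp
    qed (use big M'(2) in blast)
  qed
qed

end

lemma star_free_Z4_DirProd:
  assumes n: "n = 2 \<or> n = 4"
  shows "star_free (integer_mod_group 4 \<times>\<times> integer_mod_group n)"
proof -
  let ?G = "integer_mod_group 4 \<times>\<times> integer_mod_group n"
  have n0: "0 < n" using n by auto
  have grp: "group ?G" by (intro DirProd_group) simp_all
  have car: "carrier ?G = {0..<4} \<times> {0..<int n}" using n0 by (simp add: carrier_integer_mod_group)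
  interpret fin_group ?G using grp by (intro fin_groupI) (simp_all only: car finite_cartesian_product finite_atLeastLessThan_int)
  define D where "D = {0, 2::int} \<times> (if n = 2 then {0::int} else {0, 2})"
  have cD: "4 * card D = order ?G" using n unfolding order_def car D_def by (elim disjE) simp_all
  have sq: "x \<in> D \<longleftrightarrow> (\<exists>y\<in>carrier ?G. x = y \<otimes>\<^bsub>?G\<^esub> y)" for x
  proof
    assume x: "x \<in> D"
    obtain a b where ab: "x = (a, b)" by (metis surj_pair)
    have h: "a = 0 \<or> a = 2" "b = 0 \<or> b = 2 \<and> n = 4" using x n unfolding ab D_def by (auto split: if_splits)
    then have "(a div 2, b div 2) \<in> carrier ?G" "x = (a div 2, b div 2) \<otimes>\<^bsub>?G\<^esub> (a div 2, b div 2)"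
      using n unfolding ab car by auto
    then show "\<exists>y\<in>carrier ?G. x = y \<otimes>\<^bsub>?G\<^esub> y" by (rule bexI[rotated])
  next
    assume "\<exists>y\<in>carrier ?G. x = y \<otimes>\<^bsub>?G\<^esub> y"
    then obtain a b where ab: "(a, b) \<in> carrier ?G" "x = (a, b) \<otimes>\<^bsub>?G\<^esub> (a, b)" by (metis surj_pair)
    then have x: "x = ((a + a) mod 4, (b + b) mod int n)" by simp
    have "(a + a) mod 4 = 0 \<or> (a + a) mod 4 = 2" by presburger
    moreover have "(b + b) mod 2 = 0" "(b + b) mod 4 = 0 \<or> (b + b) mod 4 = 2" by presburger+
    ultimately show "x \<in> D" using n unfolding x D_def by (elim disjE) simp_all
  qed
  have sD: "subgroup D ?G"
  proof (rule subgroupI)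
    show DG: "D \<subseteq> carrier ?G" using n unfolding car D_def by auto
    show "D \<noteq> {}" unfolding D_def by simp
    have closed: "x \<otimes>\<^bsub>?G\<^esub> y \<in> D" "x \<otimes>\<^bsub>?G\<^esub> x = \<one>\<^bsub>?G\<^esub>" if "x \<in> D" "y \<in> D" for x y
      using that n unfolding D_def by (auto split: if_splits)
    fix x y assume x: "x \<in> D" and y: "y \<in> D"
    show "x \<otimes>\<^bsub>?G\<^esub> y \<in> D" using closed(1)[OF x y] .
    have xc: "x \<in> carrier ?G" using x DG by (rule subsetD[rotated])
    have "inv\<^bsub>?G\<^esub> x = x" using inv_equality[OF closed(2)[OF x x] xc xc] .
    then show "inv\<^bsub>?G\<^esub> x \<in> D" using x by simp
  qed
  show ?thesis
  proof (rule star_free_exponent_four[OF _ sD sq])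
    show "x \<otimes>\<^bsub>?G\<^esub> y = y \<otimes>\<^bsub>?G\<^esub> x" for x y by (cases x; cases y) (simp add: add.commute)
    show "x \<otimes>\<^bsub>?G\<^esub> x = \<one>\<^bsub>?G\<^esub>" if "x \<in> D" for x using that n unfolding D_def by (auto split: if_splits)
    show "order ?G = 4 * card D" using cD by simp
    fix x assume x: "x \<in> carrier ?G" "x \<notin> D"
    obtain a b where ab: "x = (a, b)" by (metis surj_pair)
    have "\<one>\<^bsub>?G\<^esub> \<in> D" using sD by (rule subgroup.one_closed)
    then have o1: "ord x \<noteq> 1" using x ord_eq_1[OF x(1)] by metis
    moreover have "ord x \<noteq> 0" using ord_gt_0[OF x(1)] by simp
    ultimately have o2: "2 \<le> ord x" by simp
    show "card D \<le> ord x"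
    proof (cases "n = 2")
      case True then show ?thesis using o2 by (simp add: D_def)
    next
      case False
      then have n4: "n = 4" using n by simp
      have ran: "0 \<le> a" "a < 4" "0 \<le> b" "b < 4" using x(1) n4 unfolding ab car by simp_all
      have p2: "x [^]\<^bsub>?G\<^esub> (2::nat) = ((2 * a) mod 4, (2 * b) mod 4)" unfolding ab using n4 by (simp add: DirProd_nat_pow)
      have "x [^]\<^bsub>?G\<^esub> (4::nat) = \<one>\<^bsub>?G\<^esub>" unfolding ab using n4 by (simp add: DirProd_nat_pow)
      then have "ord x dvd 4" using pow_eq_id[OF x(1)] by simp
      moreover have "ord x \<noteq> 2"
      proof
        assume "ord x = 2"
        then have "x [^]\<^bsub>?G\<^esub> (2::nat) = \<one>\<^bsub>?G\<^esub>" using pow_ord_eq_1[OF x(1)] by simp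
        then have "(2 * a) mod 4 = 0" "(2 * b) mod 4 = 0" unfolding p2 by simp_all
        then have "a = 0 \<or> a = 2" "b = 0 \<or> b = 2" using ran by presburger+
        then show False using x(2) n4 unfolding ab D_def by auto
      qed
      moreover have "ord x \<noteq> 3" using \<open>ord x dvd 4\<close> by auto
      ultimately have "4 \<le> ord x" using o2 by simp
      then show ?thesis using n4 by (simp add: D_def)
    qed
  qed
qed

section \<open>The converse: the quaternion group and direct products with a group of prime order\<close>

text \<open>The common features of \<open>C\<^sub>2 \<times> C\<^sub>2\<close> and \<open>Q\<^sub>8\<close>: the subgroup \<open>D\<close> is the Frattini subgroup, and the
  subgroups strictly between \<open>D\<close> and \<open>G\<close> are three cyclic ones.\<close>

locale small_core = fin_group +
  fixes D :: "'a set"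
  assumes D: "subgroup D G" "card D \<le> 2" and o: "order G = 4 * card D"
    and outside: "\<And>x. x \<in> carrier G \<Longrightarrow> x \<notin> D \<Longrightarrow> D \<subseteq> cyc x \<and> 2 * card D \<le> ord x"
begin

lemma proper_outside:
  assumes V: "proper_subgroup V G" "\<not> V \<subseteq> D"
  shows "D \<subseteq> V" "card V = 2 * card D"
proof -
  note V' = proper_subgroupD[OF V(1)]
  obtain x where x: "x \<in> V" "x \<notin> D" using V(2) by blast
  have xc: "x \<in> carrier G" using x V' by blast
  have sub: "cyc x \<subseteq> V" using V'(1) x(1) by (rule cyc_subset)
  show "D \<subseteq> V" using outside[OF xc x(2)] sub by (meson subset_trans)
  have "2 * card D \<le> ord x" using outside[OF xc x(2)] by simp
  also have "ord x \<le> card V" using card_mono[OF finite_subgroup[OF V'(1)] sub] card_cyc[OF xc] by simp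
  finally have ge: "2 * card D \<le> card V" .
  obtain k where k: "order G = card V * k" using card_subgroup_dvd[OF V'(1)] by (elim dvdE)
  have "k \<noteq> 1" "k \<noteq> 0" using k V'(3) order_pos by auto
  then have "card V * 2 \<le> card V * k" by (intro mult_le_mono2) simp
  then have "card V \<le> 2 * card D" using k o by linarith
  then show "card V = 2 * card D" using ge by simp
qed

lemma proper_outside_product:
  assumes V: "proper_subgroup V G" "\<not> V \<subseteq> D" and W: "proper_subgroup W G" "\<not> W \<subseteq> D" and ne: "V \<noteq> W"
  shows "V <#> W = carrier G"
proof -
  note sV = proper_subgroupD(1)[OF V(1)] and sW = proper_subgroupD(1)[OF W(1)]
  have pI: "proper_subgroup (V \<inter> W) G"
    using V(1) proper_subgroupD(2)[OF V(1)] subgroups_Inter_pair[OF sV sW] unfolding proper_subgroup_def by blast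
  have "V \<inter> W \<subseteq> D"
  proof (rule ccontr)
    assume "\<not> V \<inter> W \<subseteq> D"
    then have c: "card (V \<inter> W) = 2 * card D" by (rule proper_outside(2)[OF pI])
    have "V \<inter> W = V" using c proper_outside(2)[OF V] finite_subgroup[OF sV] by (intro card_subset_eq) simp_all
    moreover have "V \<inter> W = W" using c proper_outside(2)[OF W] finite_subgroup[OF sW] by (intro card_subset_eq) simp_all
    ultimately show False using ne by simp
  qed
  moreover have "D \<subseteq> V \<inter> W" using proper_outside(1)[OF V] proper_outside(1)[OF W] by simp
  ultimately have "V \<inter> W = D" by simp
  then have "card (V <#> W) = order G"
    using card_set_mult[OF sV sW] proper_outside(2)[OF V] proper_outside(2)[OF W] card_subgroup_pos[OF D(1)] o by simp
  then show ?thesis using set_mult_eq_carrier_iff[OF sV sW] by simp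
qed

lemma neighbour_outside:
  assumes U: "proper_subgroup U G" and V: "proper_subgroup V G" and UV: "U <#> V = carrier G"
  shows "\<not> U \<subseteq> D" "\<not> V \<subseteq> D"
proof -
  have c: "card D < order G" using o card_subgroup_pos[OF D(1)] by simp
  have pD: "proper_subgroup D G" using D(1) c by (intro proper_subgroupI) simp_all
  have cov: "\<exists>M. proper_subgroup M G \<and> W \<subseteq> M \<and> D \<subseteq> M" if "proper_subgroup W G" for W
    using that pD proper_outside(1)[OF that] by (cases "W \<subseteq> D") blast+
  show "\<not> U \<subseteq> D"
  proof
    assume "U \<subseteq> D"
    moreover obtain M where "proper_subgroup M G" "V \<subseteq> M" "D \<subseteq> M" using cov[OF V] by blast
    ultimately show False using not_carrier_if_in_proper[of M U V] UV by blast
  qed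
  show "\<not> V \<subseteq> D"
  proof
    assume "V \<subseteq> D"
    moreover obtain M where "proper_subgroup M G" "U \<subseteq> M" "D \<subseteq> M" using cov[OF U] by blast
    ultimately show False using not_carrier_if_in_proper[of M U V] UV by blast
  qed
qed

lemma distinct_neighbours_adjacent:
  assumes U: "proper_subgroup U G" and V: "proper_subgroup V G" "U <#> V = carrier G"
    and W: "proper_subgroup W G" "U <#> W = carrier G" and ne: "V \<noteq> W"
  shows "V <#> W = carrier G"
  using proper_outside_product[OF V(1) neighbour_outside(2)[OF U V] W(1) neighbour_outside(2)[OF U W] ne] .

lemma star_free_small_core: "star_free G"
proof (rule star_freeI)
  fix U \<S> assume U: "proper_subgroup U G" and ind: "independent_family G \<S>"
    and S: "\<And>V. V \<in> \<S> \<Longrightarrow> proper_subgroup V G" "\<And>V. V \<in> \<S> \<Longrightarrow> U <#> V = carrier G"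
  have "V = W" if V: "V \<in> \<S>" and W: "W \<in> \<S>" for V W
    using distinct_neighbours_adjacent[OF U S(1,2)[OF V] S(1,2)[OF W]] independent_familyD[OF ind V W] by blast
  then have "card \<S> \<le> 1" using card_le_Suc0_iff_eq[of \<S>] by (cases "finite \<S>") simp_all
  then show "card \<S> \<le> 3" by simp
qed

text \<open>The family has at most one member outside \<open>D\<close>, and \<open>D\<close> has at most two subgroups.\<close>

lemma independent_card_le:
  assumes ind: "independent_family G \<S>" shows "card \<S> \<le> 3"
proof -
  have pr: "proper_subgroup V G" if "V \<in> \<S>" for V using ind that by (simp add: independent_family_def)
  have fin: "finite \<S>"
    by (rule finite_subset[OF _ finite_subgroups[of "\<lambda>_. True"]]) (use pr in \<open>auto simp: proper_subgroup_def\<close>)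
  have one: "V = W" if "V \<in> \<S>" "W \<in> \<S>" "\<not> V \<subseteq> D" "\<not> W \<subseteq> D" for V W
    using proper_outside_product[OF pr[OF that(1)] that(3) pr[OF that(2)] that(4)] independent_familyD[OF ind that(1,2)] by blast
  have "V = {\<one>} \<or> V = D" if V: "V \<in> \<S>" "V \<subseteq> D" for V
  proof -
    have sV: "subgroup V G" using pr[OF V(1)] by (rule proper_subgroupD(1))
    have "card V \<le> card D" using V(2) finite_subgroup[OF D(1)] by (rule card_mono[rotated])
    moreover have "0 < card V" using sV by (rule card_subgroup_pos)
    ultimately consider "card V = 1" | "card V = card D" using D(2) by linarith
    then show ?thesis
    proof cases
      case 1
      then show ?thesis using subgroup.one_closed[OF sV] by (metis card_1_singletonE singletonD)
    next
      case 2
      then have "V = D" using V(2) finite_subgroup[OF D(1)] by (intro card_subset_eq)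
      then show ?thesis by simp
    qed
  qed
  then have "{V \<in> \<S>. V \<subseteq> D} \<subseteq> {{\<one>}, D}" by blast
  then have "card {V \<in> \<S>. V \<subseteq> D} \<le> card {{\<one>}, D}" by (intro card_mono) simp_all
  also have "\<dots> \<le> 2" by (simp add: card_insert_if)
  finally have 2: "card {V \<in> \<S>. V \<subseteq> D} \<le> 2" .
  have "card {V \<in> \<S>. \<not> V \<subseteq> D} \<le> Suc 0"
    using card_le_Suc0_iff_eq[of "{V \<in> \<S>. \<not> V \<subseteq> D}"] fin one by simp
  moreover have "card ({V \<in> \<S>. V \<subseteq> D} \<union> {V \<in> \<S>. \<not> V \<subseteq> D}) \<le> card {V \<in> \<S>. V \<subseteq> D} + card {V \<in> \<S>. \<not> V \<subseteq> D}"
    by (rule card_Un_le)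
  moreover have "{V \<in> \<S>. V \<subseteq> D} \<union> {V \<in> \<S>. \<not> V \<subseteq> D} = \<S>" by (intro Set.set_eqI) auto
  ultimately show ?thesis using 2 by simp
qed

text \<open>The proper subgroups not inside \<open>D\<close> are disjoint outside \<open>D\<close>, where each has \<open>|D|\<close> of the \<open>3|D|\<close>
  elements.  So there are at most three of them, and \<open>U\<close> is one.\<close>

lemma few_neighbours:
  assumes U: "proper_subgroup U G"
  shows "card {V. proper_subgroup V G \<and> U <#> V = carrier G} \<le> 2"
proof (cases "U \<subseteq> D")
  case True
  then have e: "{V. proper_subgroup V G \<and> U <#> V = carrier G} = {}" using neighbour_outside(1)[OF U] by blast
  show ?thesis unfolding e by simp
next
  case False
  let ?T = "{V. subgroup V G \<and> V \<noteq> carrier G \<and> \<not> V \<subseteq> D}"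
  have fin: "finite ?T" using finite_subgroups[of "\<lambda>V. V \<noteq> carrier G \<and> \<not> V \<subseteq> D"] .
  have T: "proper_subgroup V G" "\<not> V \<subseteq> D" if "V \<in> ?T" for V using that by (simp_all add: proper_subgroup_def)
  have sT: "subgroup V G" if "V \<in> ?T" for V using that by simp
  have UT: "U \<in> ?T" using U False by (simp add: proper_subgroup_def)
  have size: "card (V - D) = card D" if V: "V \<in> ?T" for V
    using proper_outside[OF T[OF V]] finite_subgroup[OF D(1)] by (simp add: card_Diff_subset)
  have disj: "(V - D) \<inter> (W - D) = {}" if V: "V \<in> ?T" and W: "W \<in> ?T" and ne: "V \<noteq> W" for V W
  proof -
    note sV = sT[OF V] and sW = sT[OF W]
    have "order G * card (V \<inter> W) = (2 * card D) * (2 * card D)"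
      using card_set_mult[OF sV sW] proper_outside_product[OF T[OF V] T[OF W] ne]
        proper_outside(2)[OF T[OF V]] proper_outside(2)[OF T[OF W]] by (simp add: order_def)
    then have c: "card (V \<inter> W) = card D" using o card_subgroup_pos[OF D(1)] by simp
    have "D = V \<inter> W"
      using proper_outside(1)[OF T[OF V]] proper_outside(1)[OF T[OF W]] finite_subgroup[OF sV] c
      by (intro card_subset_eq) simp_all
    then show ?thesis by blast
  qed
  have "card ?T * card D = (\<Sum>V\<in>?T. card (V - D))" using size by simp
  also have "\<dots> = card (\<Union>V\<in>?T. V - D)"
    using fin disj finite_subgroup[OF sT] by (intro card_UN_disjoint[symmetric]) simp_all
  also have "\<dots> \<le> card (carrier G - D)"
    by (rule card_mono) (use subgroup.subset[OF sT] in auto)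
  also have "\<dots> = 3 * card D"
    using subgroup.subset[OF D(1)] finite_subgroup[OF D(1)] o by (simp add: card_Diff_subset order_def)
  finally have 3: "card ?T \<le> 3" using card_subgroup_pos[OF D(1)] by simp
  have "{V. proper_subgroup V G \<and> U <#> V = carrier G} \<subseteq> ?T - {U}"
  proof
    fix V assume "V \<in> {V. proper_subgroup V G \<and> U <#> V = carrier G}"
    then have V: "proper_subgroup V G" "U <#> V = carrier G" by simp_all
    have "V \<noteq> U" using not_carrier_if_in_proper[OF U, of U V] V(2) by auto
    then show "V \<in> ?T - {U}" using V(1) neighbour_outside(2)[OF U V] by (simp add: proper_subgroup_def)
  qed
  then have "card {V. proper_subgroup V G \<and> U <#> V = carrier G} \<le> card (?T - {U})" using fin by (intro card_mono) simp_all
  also have "\<dots> = card ?T - 1" using UT by simp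
  finally show ?thesis using 3 by simp
qed

end

lemma (in fin_group) pow_mod_order:
  assumes "a \<in> carrier G" shows "a [^] (k::nat) = a [^] (k mod order G)"
proof -
  have "a [^] k = (a [^] order G) [^] (k div order G) \<otimes> a [^] (k mod order G)"
    using assms by (simp only: nat_pow_pow nat_pow_mult mult_div_mod_eq)
  then show ?thesis using assms pow_order_eq_1[OF assms] by simp
qed

lemma coprime_mult_inverse:
  fixes m n :: nat
  assumes "coprime m n" shows "\<exists>x. m * x mod n = 1 mod n"
proof (cases "n = 1")
  case True then show ?thesis by simp
next
  case False
  then obtain x y where "m * x = n * y + 1" using coprime_bezout_strong[OF assms] by blast
  then have "m * x mod n = 1 mod n" by (simp only: add.commute[of _ 1] mod_mult_self2)
  then show ?thesis by blast
qed

text \<open>A suitable power is the identity on one factor and trivial on the other.\<close>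

lemma coprime_DirProd_subgroup:
  assumes A: "fin_group A" and B: "fin_group B" and cop: "coprime (order A) (order B)"
    and V: "subgroup V (A \<times>\<times> B)" and ab: "(a, b) \<in> V"
  shows "(a, \<one>\<^bsub>B\<^esub>) \<in> V" "(\<one>\<^bsub>A\<^esub>, b) \<in> V"
proof -
  interpret A: fin_group A by fact
  interpret B: fin_group B by fact
  interpret fin_group "A \<times>\<times> B"
    using DirProd_group[OF A.is_group B.is_group] A.fin B.fin by (intro fin_groupI) simp_all
  have c: "a \<in> carrier A" "b \<in> carrier B" using subgroup.mem_carrier[OF V ab] by simp_all
  have cop': "coprime (order B) (order A)" using cop by (simp add: coprime_commute)
  obtain x where x: "order B * x mod order A = 1 mod order A" using coprime_mult_inverse[OF cop'] by blast
  obtain y where y: "order A * y mod order B = 1 mod order B" using coprime_mult_inverse[OF cop] by blast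
  have "a [^]\<^bsub>A\<^esub> (order B * x) = a [^]\<^bsub>A\<^esub> (1 mod order A)"
    using A.pow_mod_order[OF c(1), of "order B * x"] unfolding x .
  then have a: "a [^]\<^bsub>A\<^esub> (order B * x) = a" using A.pow_mod_order[OF c(1), of 1] c(1) by simp
  have "b [^]\<^bsub>B\<^esub> (order A * y) = b [^]\<^bsub>B\<^esub> (1 mod order B)"
    using B.pow_mod_order[OF c(2), of "order A * y"] unfolding y .
  then have b: "b [^]\<^bsub>B\<^esub> (order A * y) = b" using B.pow_mod_order[OF c(2), of 1] c(2) by simp
  have a1: "a [^]\<^bsub>A\<^esub> (order A * y) = \<one>\<^bsub>A\<^esub>" using A.pow_mod_order[OF c(1), of "order A * y"] by simp
  have b1: "b [^]\<^bsub>B\<^esub> (order B * x) = \<one>\<^bsub>B\<^esub>" using B.pow_mod_order[OF c(2), of "order B * x"] by simp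
  show "(a, \<one>\<^bsub>B\<^esub>) \<in> V" using pow_mem_subgroup[OF V ab, of "order B * x"] unfolding DirProd_nat_pow a b1 .
  show "(\<one>\<^bsub>A\<^esub>, b) \<in> V" using pow_mem_subgroup[OF V ab, of "order A * y"] unfolding DirProd_nat_pow a1 b .
qed

text \<open>The orders are coprime, so a subgroup is \<open>V\<^sub>1 \<times> V\<^sub>2\<close>, where \<open>V\<^sub>1\<close> is trivial or full.  If \<open>U\<^sub>1\<close> is
  trivial, then \<open>V\<^sub>1\<close> is full for all supplements, and the \<open>V\<^sub>2\<close> form an independent family of \<open>T\<close>.
  If \<open>U\<^sub>1\<close> is full, then \<open>V\<^sub>2\<close> is \<open>T\<close> or one of the at most two neighbours of \<open>U\<^sub>2\<close>.  Either all \<open>V\<^sub>1\<close>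
  are trivial and \<open>V\<^sub>2\<close> determines the supplement, or one of them is full and, by adjacency of distinct
  neighbours of \<open>U\<^sub>2\<close>, all the \<open>V\<^sub>2\<close> are equal.\<close>

lemma star_free_prime_DirProd_small_core:
  fixes T :: "('b, 'c) monoid_scheme"
  assumes p: "Factorial_Ring.prime (p::nat)" and T: "small_core T D" and cop: "coprime p (order T)"
  shows "star_free (integer_mod_group p \<times>\<times> T)"
proof -
  interpret T: small_core T D by fact
  let ?Z = "integer_mod_group p"
  have p0: "0 < p" using p by (rule prime_gt_0_nat)
  have Z: "fin_group ?Z" using p0 by (intro fin_groupI) (simp_all add: carrier_integer_mod_group)
  interpret Z: fin_group ?Z by fact
  have oZ: "order ?Z = p" using p0 by (simp add: order_def carrier_integer_mod_group)
  let ?G = "?Z \<times>\<times> T"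
  interpret fin_group ?G
    using DirProd_group[OF Z.is_group T.is_group] Z.fin T.fin by (intro fin_groupI) simp_all
  interpret pr: group_hom ?G T snd
    by (auto simp: group_hom_def group_hom_axioms_def is_group T.is_group hom_def)
  have one: "\<one>\<^bsub>?G\<^esub> = (\<one>\<^bsub>?Z\<^esub>, \<one>\<^bsub>T\<^esub>)" by simp
  let ?N = "{\<one>\<^bsub>?Z\<^esub>}"
  have split: "(a, \<one>\<^bsub>T\<^esub>) \<in> V" "(\<one>\<^bsub>?Z\<^esub>, b) \<in> V" if "subgroup V ?G" "(a, b) \<in> V" for V a b
    using coprime_DirProd_subgroup[OF Z T.fin_group_axioms _ that] cop oZ by simp_all
  have fst_cases: "V = {\<one>\<^bsub>?Z\<^esub>} \<times> snd ` V \<or> V = carrier ?Z \<times> snd ` V" if V: "subgroup V ?G" for V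
  proof -
    let ?A = "{a. (a, \<one>\<^bsub>T\<^esub>) \<in> V}"
    have VA: "(a, b) \<in> V \<longleftrightarrow> a \<in> ?A \<and> b \<in> snd ` V" for a b
    proof
      assume "(a, b) \<in> V"
      then show "a \<in> ?A \<and> b \<in> snd ` V" using split(1)[OF V] by force
    next
      assume h: "a \<in> ?A \<and> b \<in> snd ` V"
      then obtain a' where "(a', b) \<in> V" by force
      then have "(\<one>\<^bsub>?Z\<^esub>, b) \<in> V" by (rule split(2)[OF V])
      moreover have "(a, \<one>\<^bsub>T\<^esub>) \<in> V" using h by simp
      ultimately have "(a, \<one>\<^bsub>T\<^esub>) \<otimes>\<^bsub>?G\<^esub> (\<one>\<^bsub>?Z\<^esub>, b) \<in> V" using subgroup.m_closed[OF V] by blast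
      moreover have "a \<in> carrier ?Z" "b \<in> carrier T" using subgroup.mem_carrier[OF V] h \<open>(a', b) \<in> V\<close> by auto
      ultimately show "(a, b) \<in> V" using Z.r_one T.l_one by (simp del: mult_integer_mod_group one_integer_mod_group)
    qed
    have A: "subgroup ?A ?Z"
    proof (rule Z.subgroupI)
      show "?A \<subseteq> carrier ?Z" using subgroup.mem_carrier[OF V] by auto
      show "?A \<noteq> {}" using subgroup.one_closed[OF V] by auto
      fix a assume a: "a \<in> ?A"
      then have "inv\<^bsub>?G\<^esub> (a, \<one>\<^bsub>T\<^esub>) \<in> V" using V by (simp add: subgroup.m_inv_closed)
      moreover have "a \<in> carrier ?Z" using a subgroup.mem_carrier[OF V] by auto
      ultimately show "inv\<^bsub>?Z\<^esub> a \<in> ?A" using inv_DirProd[OF Z.is_group T.is_group, of a "\<one>\<^bsub>T\<^esub>"] by simp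
      fix b assume "b \<in> ?A"
      then have "(a, \<one>\<^bsub>T\<^esub>) \<otimes>\<^bsub>?G\<^esub> (b, \<one>\<^bsub>T\<^esub>) \<in> V" using a subgroup.m_closed[OF V] by blast
      then show "a \<otimes>\<^bsub>?Z\<^esub> b \<in> ?A" by simp
    qed
    have "card ?A dvd p" using Z.card_subgroup_dvd[OF A] oZ by simp
    then have "card ?A = 1 \<or> card ?A = p" using p by (simp add: prime_nat_iff)
    then have "?A = {\<one>\<^bsub>?Z\<^esub>} \<or> ?A = carrier ?Z"
    proof
      assume "card ?A = 1"
      then have "?A = {\<one>\<^bsub>?Z\<^esub>}" using subgroup.one_closed[OF A] by (metis card_1_singletonE singletonD)
      then show ?thesis by simp
    next
      assume "card ?A = p"
      then have "?A = carrier ?Z" using oZ subgroup.subset[OF A] Z.fin unfolding order_def by (intro card_subset_eq) simp_all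
      then show ?thesis by simp
    qed
    moreover have "V = ?A \<times> snd ` V"
    proof (rule Set.set_eqI)
      fix v :: "int \<times> 'b"
      obtain a b where v: "v = (a, b)" by (metis surj_pair)
      show "v \<in> V \<longleftrightarrow> v \<in> ?A \<times> snd ` V" using VA[of a b] unfolding v mem_Times_iff fst_conv snd_conv .
    qed
    ultimately show ?thesis
    proof (elim disjE)
      assume e: "?A = {\<one>\<^bsub>?Z\<^esub>}" and V': "V = ?A \<times> snd ` V"
      from V' show ?thesis unfolding e by (rule disjI1)
    next
      assume e: "?A = carrier ?Z" and V': "V = ?A \<times> snd ` V"
      from V' show ?thesis unfolding e by (rule disjI2)
    qed
  qed
  define full where "full V \<longleftrightarrow> V = carrier ?Z \<times> snd ` V" for V :: "(int \<times> 'b) set"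
  have Z1: "carrier ?Z \<noteq> {\<one>\<^bsub>?Z\<^esub>}"
  proof
    assume "carrier ?Z = {\<one>\<^bsub>?Z\<^esub>}"
    then have "order ?Z = 1" unfolding order_def by simp
    then show False using oZ prime_gt_1_nat[OF p] by simp
  qed
  have img: "subgroup (snd ` V) T" if "subgroup V ?G" for V using pr.subgroup_img_is_subgroup[OF that] .
  have prodT: "snd ` V <#>\<^bsub>T\<^esub> snd ` W = carrier T" if V: "subgroup V ?G" "subgroup W ?G" and eq: "V <#>\<^bsub>?G\<^esub> W = carrier ?G" for V W
  proof (intro equalityI subsetI)
    fix t assume "t \<in> snd ` V <#>\<^bsub>T\<^esub> snd ` W"
    then show "t \<in> carrier T"
      using T.setmult_subset_G[OF subgroup.subset[OF img[OF V(1)]] subgroup.subset[OF img[OF V(2)]]] by blast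
  next
    fix t assume "t \<in> carrier T"
    then have "(\<one>\<^bsub>?Z\<^esub>, t) \<in> V <#>\<^bsub>?G\<^esub> W" unfolding eq using Z.one_closed by (simp del: one_integer_mod_group)
    then obtain v w where vw: "v \<in> V" "w \<in> W" "(\<one>\<^bsub>?Z\<^esub>, t) = v \<otimes>\<^bsub>?G\<^esub> w" by (elim set_multE)
    have "v \<in> carrier ?G" "w \<in> carrier ?G" using vw V by (simp_all add: subgroup.mem_carrier del: carrier_DirProd)
    then have "t = snd v \<otimes>\<^bsub>T\<^esub> snd w" using pr.hom_mult[of v w] vw(3) by (metis snd_conv)
    then show "t \<in> snd ` V <#>\<^bsub>T\<^esub> snd ` W" using vw(1,2) by (simp add: T.set_multI)
  qed
  have prodG: "V <#>\<^bsub>?G\<^esub> W = carrier ?G"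
    if V: "subgroup V ?G" "subgroup W ?G" and f: "full V" and eq: "snd ` V <#>\<^bsub>T\<^esub> snd ` W = carrier T" for V W
  proof (intro equalityI subsetI)
    fix g assume "g \<in> V <#>\<^bsub>?G\<^esub> W"
    then show "g \<in> carrier ?G" using setmult_subset_G[OF subgroup.subset[OF V(1)] subgroup.subset[OF V(2)]] by blast
  next
    fix g assume g: "g \<in> carrier ?G"
    obtain z t where zt: "g = (z, t)" by (metis surj_pair)
    have c: "z \<in> carrier ?Z" "t \<in> carrier T" using g zt by simp_all
    then have "t \<in> snd ` V <#>\<^bsub>T\<^esub> snd ` W" using eq by simp
    then obtain v w where vw: "v \<in> snd ` V" "w \<in> snd ` W" "t = v \<otimes>\<^bsub>T\<^esub> w" by (elim T.set_multE)
    have "(z, v) \<in> V" using f[unfolded full_def] c(1) vw(1) by blast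
    moreover obtain a where "(a, w) \<in> W" using vw(2) by force
    then have "(\<one>\<^bsub>?Z\<^esub>, w) \<in> W" by (rule split(2)[OF V(2)])
    moreover have "g = (z, v) \<otimes>\<^bsub>?G\<^esub> (\<one>\<^bsub>?Z\<^esub>, w)" unfolding zt vw(3) using Z.r_one[OF c(1)] by (simp del: mult_integer_mod_group one_integer_mod_group)
    ultimately show "g \<in> V <#>\<^bsub>?G\<^esub> W" using set_multI by metis
  qed
  have full_or: "full V \<or> full W" if V: "subgroup V ?G" "subgroup W ?G" and eq: "V <#>\<^bsub>?G\<^esub> W = carrier ?G" for V W
  proof (rule ccontr)
    assume "\<not> (full V \<or> full W)"
    then have VW: "V = {\<one>\<^bsub>?Z\<^esub>} \<times> snd ` V" "W = {\<one>\<^bsub>?Z\<^esub>} \<times> snd ` W" using fst_cases V unfolding full_def by metis+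
    have "z = \<one>\<^bsub>?Z\<^esub>" if z: "z \<in> carrier ?Z" for z
    proof -
      have "(z, \<one>\<^bsub>T\<^esub>) \<in> V <#>\<^bsub>?G\<^esub> W" unfolding eq using z by simp
      then obtain v w where vw: "v \<in> V" "w \<in> W" "(z, \<one>\<^bsub>T\<^esub>) = v \<otimes>\<^bsub>?G\<^esub> w" by (elim set_multE)
      have "fst v = \<one>\<^bsub>?Z\<^esub>" "fst w = \<one>\<^bsub>?Z\<^esub>" using vw(1,2) VW by (metis mem_Times_iff singletonD)+
      moreover have "z = fst v \<otimes>\<^bsub>?Z\<^esub> fst w" using vw(3) by (cases v; cases w) (simp del: mult_integer_mod_group)
      ultimately show ?thesis using Z.r_one[OF Z.one_closed] by metis
    qed
    then show False using Z1 Z.one_closed by blast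
  qed
  show ?thesis
  proof (rule star_freeI)
    fix U \<S> assume U: "proper_subgroup U ?G" and ind: "independent_family ?G \<S>"
      and S: "\<And>V. V \<in> \<S> \<Longrightarrow> proper_subgroup V ?G" "\<And>V. V \<in> \<S> \<Longrightarrow> U <#>\<^bsub>?G\<^esub> V = carrier ?G"
    have sS: "subgroup V ?G" if "V \<in> \<S>" for V using S(1)[OF that] by (rule proper_subgroupD(1))
    have sU: "subgroup U ?G" using U by (rule proper_subgroupD(1))
    have imgP: "proper_subgroup (snd ` V) T" if V: "proper_subgroup V ?G" "full V" for V
    proof -
      have "snd ` V \<noteq> carrier T"
      proof
        assume "snd ` V = carrier T"
        then have "V = carrier ?G" using V(2) unfolding full_def by simp
        then show False using V(1) by (simp add: proper_subgroup_def)
      qed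
      then show ?thesis using img[OF proper_subgroupD(1)[OF V(1)]] by (simp add: proper_subgroup_def)
    qed
    show "card \<S> \<le> 3"
    proof (cases "full U")
      case False
      then have fS: "full V" if "V \<in> \<S>" for V using full_or[OF sU sS[OF that] S(2)[OF that]] by simp
      have "inj_on ((`) snd) \<S>"
        by (rule inj_onI) (metis fS full_def)
      then have "card \<S> = card ((`) snd ` \<S>)" by (rule card_image[symmetric])
      also have "\<dots> \<le> 3"
      proof (rule T.independent_card_le)
        show "independent_family T ((`) snd ` \<S>)"
          unfolding independent_family_def
        proof (intro conjI ballI)
          fix V' assume "V' \<in> (`) snd ` \<S>"
          then obtain V where V: "V \<in> \<S>" "V' = snd ` V" by blast
          show "proper_subgroup V' T" unfolding V(2) by (rule imgP[OF S(1)[OF V(1)] fS[OF V(1)]])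
          fix W' assume "W' \<in> (`) snd ` \<S>"
          then obtain W where W: "W \<in> \<S>" "W' = snd ` W" by blast
          show "V' <#>\<^bsub>T\<^esub> W' \<noteq> carrier T"
          proof
            assume "V' <#>\<^bsub>T\<^esub> W' = carrier T"
            then have "V <#>\<^bsub>?G\<^esub> W = carrier ?G" unfolding V(2) W(2) by (rule prodG[OF sS[OF V(1)] sS[OF W(1)] fS[OF V(1)]])
            then show False using independent_familyD[OF ind V(1) W(1)] by simp
          qed
        qed
      qed
      finally show ?thesis .
    next
      case fU: True
      have pU: "proper_subgroup (snd ` U) T" using U fU by (rule imgP)
      have nb: "snd ` U <#>\<^bsub>T\<^esub> snd ` V = carrier T" if "V \<in> \<S>" for V using prodT[OF sU sS[OF that] S(2)[OF that]] .
      show ?thesis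
      proof (cases "\<exists>V\<in>\<S>. full V")
        case True
        then obtain V where V: "V \<in> \<S>" "full V" by blast
        have pV: "proper_subgroup (snd ` V) T" using imgP[OF S(1)[OF V(1)] V(2)] .
        have eqVW: "snd ` W = snd ` V" if W: "W \<in> \<S>" for W
        proof (rule ccontr)
          assume ne: "snd ` W \<noteq> snd ` V"
          have "snd ` V <#>\<^bsub>T\<^esub> snd ` W = carrier T"
          proof (cases "snd ` W = carrier T")
            case True
            have "snd ` V \<subseteq> carrier T" using T.proper_subgroupD(2)[OF pV] .
            then show ?thesis using T.set_mult_upper(2)[OF T.proper_subgroupD(1)[OF pV] T.subgroup_self]
                T.setmult_subset_G[of "snd ` V" "carrier T"] unfolding True by simp
          next
            case False
            then have "proper_subgroup (snd ` W) T" using img[OF sS[OF W]] by (simp add: proper_subgroup_def)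
            then show ?thesis using T.distinct_neighbours_adjacent[OF pU pV nb[OF V(1)] _ nb[OF W]] ne by metis
          qed
          then have "V <#>\<^bsub>?G\<^esub> W = carrier ?G" by (rule prodG[OF sS[OF V(1)] sS[OF W] V(2)])
          then show False using independent_familyD[OF ind V(1) W] by simp
        qed
        have "\<S> \<subseteq> {{\<one>\<^bsub>?Z\<^esub>} \<times> snd ` V, carrier ?Z \<times> snd ` V}"
        proof
          fix W assume W: "W \<in> \<S>"
          show "W \<in> {{\<one>\<^bsub>?Z\<^esub>} \<times> snd ` V, carrier ?Z \<times> snd ` V}"
            using fst_cases[OF sS[OF W]] unfolding eqVW[OF W] insert_iff by (elim disjE) simp_all
        qed
        then have "card \<S> \<le> card {{\<one>\<^bsub>?Z\<^esub>} \<times> snd ` V, carrier ?Z \<times> snd ` V}" by (intro card_mono) simp_all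
        also have "\<dots> \<le> 2" by (simp add: card_insert_if)
        finally show ?thesis by simp
      next
        case False
        then have nf: "V = {\<one>\<^bsub>?Z\<^esub>} \<times> snd ` V" if "V \<in> \<S>" for V
          using fst_cases[OF sS[OF that]] that unfolding full_def by blast
        let ?B = "{V. proper_subgroup V T \<and> snd ` U <#>\<^bsub>T\<^esub> V = carrier T}"
        have finB: "finite ?B"
          by (rule finite_subset[OF _ T.finite_subgroups[of "\<lambda>_. True"]]) (auto simp: proper_subgroup_def)
        have "card \<S> \<le> card (insert (carrier T) ?B)"
        proof (rule card_inj_on_le)
          show "inj_on ((`) snd) \<S>" by (rule inj_onI) (metis nf)
          show "(`) snd ` \<S> \<subseteq> insert (carrier T) ?B"
          proof
            fix V' assume "V' \<in> (`) snd ` \<S>"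
            then obtain V where V: "V \<in> \<S>" "V' = snd ` V" by blast
            show "V' \<in> insert (carrier T) ?B"
              unfolding V(2) using nb[OF V(1)] img[OF sS[OF V(1)]] by (simp add: proper_subgroup_def)
          qed
          show "finite (insert (carrier T) ?B)" using finB by simp
        qed
        also have "\<dots> \<le> 3" using T.few_neighbours[OF pU] card_insert_le_m1[of 3 ?B] by simp
        finally show ?thesis .
      qed
    qed
  qed
qed

lemma small_core_Z2_Z2: "small_core (integer_mod_group 2 \<times>\<times> integer_mod_group 2) {(0, 0)}"
proof -
  let ?G = "integer_mod_group 2 \<times>\<times> integer_mod_group 2"
  have car: "carrier ?G = {0..<2} \<times> {0..<2}" by (simp add: carrier_integer_mod_group)
  have grp: "group ?G" by (intro DirProd_group) simp_all
  interpret fin_group ?G using grp by (intro fin_groupI) (simp_all only: car finite_cartesian_product finite_atLeastLessThan_int)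
  have one: "\<one>\<^bsub>?G\<^esub> = (0, 0)" by simp
  show ?thesis
  proof (rule small_core.intro[OF fin_group_axioms], rule small_core_axioms.intro)
    show "subgroup {(0, 0)} ?G" using triv_subgroup unfolding one .
    show "order ?G = 4 * card {(0::int, 0::int)}" unfolding order_def car by simp
    fix x assume x: "x \<in> carrier ?G" "x \<notin> {(0, 0)}"
    have "ord x \<noteq> 1" using x ord_eq_1[OF x(1)] one by simp
    moreover have "ord x \<noteq> 0" using ord_gt_0[OF x(1)] by simp
    moreover have "(0, 0) \<in> cyc x" using subgroup.one_closed[OF cyc_subgroup[OF x(1)]] one by simp
    ultimately show "{(0, 0)} \<subseteq> cyc x \<and> 2 * card {(0::int, 0::int)} \<le> ord x" by simp
  qed simp
qed

lemma small_core_quaternion: "small_core quaternion_group {(1, 0, 0, 0), (-1, 0, 0, 0)}"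
proof -
  let ?G = quaternion_group and ?D = "{(1, 0, 0, 0), (-1, 0, 0, 0)} :: (int \<times> int \<times> int \<times> int) set"
  interpret fin_group ?G using group_quaternion_group by (rule fin_groupI) (simp add: quaternion_group_def)
  have m: "monoid.mult ?G = quat_mult" "\<one>\<^bsub>?G\<^esub> = (1, 0, 0, 0)" by (simp_all add: quaternion_group_def)
  have sq: "x \<otimes>\<^bsub>?G\<^esub> x = (-1, 0, 0, 0)" if "x \<in> carrier ?G" "x \<notin> ?D" for x
    using that unfolding quaternion_group_def by auto
  have D: "?D \<subseteq> carrier ?G" by (simp add: quaternion_group_def)
  have sD: "subgroup ?D ?G"
  proof (rule subgroupI[OF D])
    fix x assume x: "x \<in> ?D"
    then have "x \<otimes>\<^bsub>?G\<^esub> x = \<one>\<^bsub>?G\<^esub>" unfolding m by auto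
    moreover have "x \<in> carrier ?G" using x D by blast
    ultimately have "inv\<^bsub>?G\<^esub> x = x" by (intro inv_equality)
    then show "inv\<^bsub>?G\<^esub> x \<in> ?D" using x by simp
    show "x \<otimes>\<^bsub>?G\<^esub> y \<in> ?D" if "y \<in> ?D" for y using x that unfolding m by auto
  qed simp
  have cD: "card ?D = 2" by simp
  have o8: "order ?G = 8" by (simp add: order_def quaternion_group_def)
  show ?thesis
  proof (rule small_core.intro[OF fin_group_axioms], rule small_core_axioms.intro)
    show "order ?G = 4 * card ?D" unfolding cD o8 by simp
    fix x assume x: "x \<in> carrier ?G" "x \<notin> ?D"
    have p2: "x [^]\<^bsub>?G\<^esub> (2::nat) = (-1, 0, 0, 0)" using sq[OF x] x(1) by (simp add: numeral_2_eq_2)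
    then have mem: "(-1, 0, 0, 0) \<in> cyc x" using pow_mem_cyc[OF x(1), of 2] by simp
    have mem1: "(1, 0, 0, 0) \<in> cyc x" using subgroup.one_closed[OF cyc_subgroup[OF x(1)]] unfolding m(2) .
    have xx: "x \<in> cyc x" by (rule mem_cyc)
    have sub: "insert x ?D \<subseteq> cyc x" using mem mem1 xx by simp
    have "card (insert x ?D) \<le> ord x" using card_mono[OF finite_subgroup[OF cyc_subgroup[OF x(1)]] sub] card_cyc[OF x(1)] by simp
    then have 3: "3 \<le> ord x" using x(2) cD by simp
    have "ord x dvd 8" using ord_dvd_card[OF subgroup_self x(1)] unfolding order_def[symmetric] o8 .
    then have "ord x \<noteq> 3" by auto
    then have "4 \<le> ord x" using 3 by simp
    then show "?D \<subseteq> cyc x \<and> 2 * card ?D \<le> ord x" using mem mem1 cD by simp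
  qed (use sD cD in simp_all)
qed

section \<open>The converse: the extension of a cyclic group of order 3\<close>

lemma (in group) metacyclic_pow:
  assumes M: "metacyclic G m n k e a b"
  shows "\<exists>s::nat. (b [^] (j::nat) \<otimes> a [^] (i::nat)) [^] (l::nat) = b [^] (j * l) \<otimes> a [^] s"
proof (induction l)
  case 0
  have "a \<in> carrier G" using M by (simp add: metacyclic_def)
  then show ?case by (intro exI[of _ 0]) simp
next
  case (Suc l)
  then obtain s :: nat where s: "(b [^] j \<otimes> a [^] i) [^] l = b [^] (j * l) \<otimes> a [^] s" by blast
  have "(b [^] j \<otimes> a [^] i) [^] Suc l = b [^] (j * l + j) \<otimes> a [^] (s * e ^ j + i)"
    unfolding nat_pow_Suc s by (rule metacyclic_mult[OF M])
  moreover have "j * l + j = j * Suc l" by simp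
  ultimately show ?case by metis
qed

text \<open>The subgroup \<open>\<langle>b\<^sup>2a\<rangle>\<close> of index 2 is cyclic, so a subgroup of it is determined by its order.
  The proper subgroups outside of it are the three complements \<open>\<langle>ba\<^sup>i\<rangle>\<close> of \<open>\<langle>a\<rangle>\<close>.  A supplement
  of a subgroup inside is outside; a supplement of a subgroup outside has order \<open>3 \<sdot> 2\<^sup>i\<close> with
  \<open>i < n\<close> and is inside.\<close>

lemma (in fin_group) star_free_C3_C2pow:
  assumes M: "metacyclic G 3 (2 ^ n) 0 2 a b" and n: "1 \<le> n" "n \<le> 3"
  shows "star_free G"
proof -
  have ab: "a \<in> carrier G" "b \<in> carrier G" and o: "order G = 3 * 2 ^ n" using M by (simp_all add: metacyclic_def)
  note eq = metacyclic_eq_iff[OF M, unfolded mult_0 add_0]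
  have form: "\<exists>(j::nat) (i::nat). x = b [^] j \<otimes> a [^] i" if "x \<in> carrier G" for x
    using M that unfolding metacyclic_def by blast
  have p3: "Factorial_Ring.prime (3::nat)" by simp
  obtain n' where n': "n = Suc n'" using n(1) by (cases n) simp_all
  define c where "c = b [^] (2::nat) \<otimes> a [^] (1::nat)"
  have c: "c \<in> carrier G" using ab by (simp add: c_def)
  have pc: "c [^] k = b [^] (2 * k) \<otimes> a [^] k" for k :: nat
  proof (induction k)
    case 0 show ?case using ab by simp
  next
    case (Suc k)
    have "c [^] Suc k = b [^] (2 * k + 2) \<otimes> a [^] (k * 2 ^ 2 + 1)"
      unfolding nat_pow_Suc Suc.IH unfolding c_def by (rule metacyclic_mult[OF M])
    also have "\<dots> = b [^] (2 * Suc k) \<otimes> a [^] Suc k"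
    proof -
      have "(k * 2 ^ 2 + 1) mod 3 = Suc k mod 3" by simp presburger
      then show ?thesis unfolding eq by simp
    qed
    finally show ?case .
  qed
  let ?L = "cyc c"
  have even_L: "b [^] (2 * j) \<otimes> a [^] i \<in> ?L" for j i :: nat
  proof -
    have "coprime (2 ^ n') (3::nat)" by simp
    then have "\<exists>k u v. k = j + u * 2 ^ n' \<and> k = i + v * 3" by (rule chinese_remainder) simp_all
    then obtain k u v where "k = j + u * 2 ^ n'" "k = i + v * 3" by blast
    then have k: "k mod 2 ^ n' = j mod 2 ^ n'" "k mod 3 = i mod 3" by (metis mod_mult_self1)+
    have "2 * k mod 2 ^ n = 2 * j mod 2 ^ n" unfolding n' power_Suc using k(1) by (simp only: mult_mod_right[symmetric])
    then have "c [^] k = b [^] (2 * j) \<otimes> a [^] i" unfolding pc eq using k(2) by simp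
    then show ?thesis using pow_mem_cyc[OF c, of k] by simp
  qed
  have bL: "b \<notin> ?L"
  proof
    assume "b \<in> ?L"
    then have "b \<in> range (\<lambda>k::nat. c [^] k)" using cyc_eq[OF c] by simp
    then obtain k :: nat where "b = c [^] k" by blast
    then have "b [^] (2 * k) \<otimes> a [^] k = b [^] (1::nat) \<otimes> a [^] (0::nat)" unfolding pc using ab by simp
    then have "2 * k mod 2 ^ n = 1 mod 2 ^ n" unfolding eq by simp
    then have "2 * k mod 2 ^ n mod 2 = 1 mod 2 ^ n mod 2" by simp
    moreover have "(2::nat) dvd 2 ^ n" using n' by simp
    ultimately have "2 * k mod 2 = 1 mod 2" by (simp only: mod_mod_cancel)
    then show False by simp
  qed
  have sL: "subgroup ?L G" using c by (rule cyc_subgroup)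
  have pL: "proper_subgroup ?L G" using sL bL ab(2) unfolding proper_subgroup_def by blast
  have outside: "\<exists>i<3. V = cyc (b \<otimes> a [^] (i::nat))" "card V = 2 ^ n"
    if V: "proper_subgroup V G" "\<not> V \<subseteq> ?L" for V
  proof -
    note V' = proper_subgroupD[OF V(1)]
    obtain g where g: "g \<in> V" "g \<notin> ?L" using V(2) by blast
    obtain j i :: nat where ji: "g = b [^] j \<otimes> a [^] i" using form g(1) V'(2) by blast
    have "odd j"
    proof
      assume "even j"
      then obtain l where "j = 2 * l" by (elim evenE)
      then show False using g(2) even_L ji by simp
    qed
    then have "coprime j (2 ^ n)" by simp
    then obtain l where l: "j * l mod 2 ^ n = 1 mod 2 ^ n" using coprime_mult_inverse by blast
    obtain s :: nat where s: "g [^] l = b [^] (j * l) \<otimes> a [^] s" unfolding ji using metacyclic_pow[OF M] by blast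
    have "b [^] (j * l) \<otimes> a [^] s = b [^] (1::nat) \<otimes> a [^] (s mod 3)" unfolding eq using l by simp
    then have gl: "g [^] l = b \<otimes> a [^] (s mod 3)" using s ab by simp
    let ?h = "b \<otimes> a [^] (s mod 3)"
    have hV: "?h \<in> V" using pow_mem_subgroup[OF V'(1) g(1), of l] unfolding gl .
    have hc: "?h \<in> carrier G" using ab by simp
    obtain u :: nat where u: "?h [^] ord ?h = b [^] (1 * ord ?h) \<otimes> a [^] u"
      using metacyclic_pow[OF M, of 1 "s mod 3" "ord ?h"] ab by auto
    have "b [^] (1 * ord ?h) \<otimes> a [^] u = b [^] (0::nat) \<otimes> a [^] (0::nat)"
      unfolding u[symmetric] using pow_ord_eq_1[OF hc] ab by simp
    then have "2 ^ n dvd ord ?h" unfolding eq by (simp add: mod_eq_0_iff_dvd)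
    moreover have "ord ?h dvd card V" using V'(1) hV by (rule ord_dvd_card)
    ultimately have "2 ^ n dvd card V" by (rule dvd_trans)
    then obtain k where k: "card V = 2 ^ n * k" by (elim dvdE)
    have "2 ^ n * k dvd 2 ^ n * 3" using card_subgroup_dvd[OF V'(1)] unfolding k o by (simp only: mult.commute)
    then have "k dvd 3" by simp
    then have "k = 1 \<or> k = 3" using p3 prime_nat_iff by blast
    moreover have "k \<noteq> 3" using V'(3) k o by auto
    ultimately show cV: "card V = 2 ^ n" using k by simp
    have "2 ^ n \<le> ord ?h" using \<open>2 ^ n dvd ord ?h\<close> ord_gt_0[OF hc] by (rule dvd_imp_le)
    then have "cyc ?h = V" using cV by (intro cyc_eqI[OF V'(1) hV]) simp
    then show "\<exists>i<3. V = cyc (b \<otimes> a [^] (i::nat))" by (intro exI[of _ "s mod 3"]) simp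
  qed
  show ?thesis
  proof (rule star_freeI)
    fix U \<S> assume U: "proper_subgroup U G"
      and S: "\<And>V. V \<in> \<S> \<Longrightarrow> proper_subgroup V G" "\<And>V. V \<in> \<S> \<Longrightarrow> U <#> V = carrier G"
    note sU = proper_subgroupD(1)[OF U]
    show "card \<S> \<le> 3"
    proof (cases "U \<subseteq> ?L")
      case True
      have "\<S> \<subseteq> (\<lambda>i. cyc (b \<otimes> a [^] i)) ` {..<3::nat}"
      proof
        fix V assume V: "V \<in> \<S>"
        have "\<not> V \<subseteq> ?L" using not_carrier_if_in_proper[OF pL True] S(2)[OF V] by blast
        then obtain i :: nat where "i < 3" "V = cyc (b \<otimes> a [^] i)" using outside(1)[OF S(1)[OF V]] by blast
        then show "V \<in> (\<lambda>i. cyc (b \<otimes> a [^] i)) ` {..<3::nat}" by (intro image_eqI[of _ _ i]) simp_all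
      qed
      then have "card \<S> \<le> card {..<3::nat}" by (intro surj_card_le) simp_all
      then show ?thesis by simp
    next
      case False
      then have cU: "card U = 2 ^ n" by (rule outside(2)[OF U])
      have three: "3 dvd card V" if V: "V \<in> \<S>" for V
      proof -
        have "order G dvd card U * card V" using product_order_dvd[OF sU proper_subgroupD(1)[OF S(1)[OF V]] S(2)[OF V]] .
        then have "2 ^ n * 3 dvd 2 ^ n * card V" unfolding o cU by (simp only: mult.commute)
        then show ?thesis by simp
      qed
      have inL: "V \<subseteq> ?L" if V: "V \<in> \<S>" for V
      proof (rule ccontr)
        assume "\<not> V \<subseteq> ?L"
        then have "3 dvd (2::nat) ^ n" using outside(2)[OF S(1)[OF V]] three[OF V] by simp
        then have "3 dvd (2::nat)" using prime_dvd_power[OF p3] by blast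
        then show False by simp
      qed
      have "card \<S> \<le> card ((\<lambda>i. 3 * 2 ^ i :: nat) ` {..<n})"
      proof (rule card_inj_on_le[of card])
        show "inj_on card \<S>"
        proof (rule inj_onI)
          fix V W assume V: "V \<in> \<S>" and W: "W \<in> \<S>" and e: "card V = card W"
          show "V = W" by (rule cyc_subgroup_unique[OF c proper_subgroupD(1)[OF S(1)[OF V]] inL[OF V]
              proper_subgroupD(1)[OF S(1)[OF W]] inL[OF W] e])
        qed
        show "card ` \<S> \<subseteq> (\<lambda>i. 3 * 2 ^ i) ` {..<n}"
        proof
          fix k assume "k \<in> card ` \<S>"
          then obtain V where V: "V \<in> \<S>" "k = card V" by blast
          note V' = proper_subgroupD[OF S(1)[OF V(1)]]
          obtain l where l: "card V = 3 * l" using three[OF V(1)] by (elim dvdE)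
          have "3 * l dvd 3 * 2 ^ n" using card_subgroup_dvd[OF V'(1)] unfolding l o .
          then have "l dvd 2 ^ n" by simp
          then obtain i where i: "i \<le> n" "l = 2 ^ i" using divides_primepow_nat[OF two_is_prime_nat] by blast
          have "i \<noteq> n" using V'(3) l i(2) o by auto
          then show "k \<in> (\<lambda>i. 3 * 2 ^ i) ` {..<n}" using V(2) l i by (intro image_eqI[of _ _ i]) simp_all
        qed
      qed simp
      also have "\<dots> \<le> card {..<n}" by (rule card_image_le) simp
      finally show ?thesis using n by simp
    qed
  qed
qed

section \<open>The classification\<close>

text \<open>The proper subgroups of a cyclic p-group lie in a common proper subgroup.\<close>

lemma (in fin_group) factorizable_pgroup_not_cyclic:
  assumes fac: "factorizable G" and q: "Factorial_Ring.prime (q::nat)" "order G = q ^ k" and x: "x \<in> carrier G"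
  shows "cyc x \<noteq> carrier G"
proof
  assume e: "cyc x = carrier G"
  then have ox: "ord x = q ^ k" using card_cyc[OF x] q(2) by (simp add: order_def)
  obtain A B where A: "proper_subgroup A G" and B: "proper_subgroup B G" and AB: "carrier G = A <#> B"
    using fac unfolding factorizable_def by blast
  have xq: "x [^] q \<in> carrier G" using x by simp
  have sub: "H \<subseteq> cyc (x [^] q)" if H: "proper_subgroup H G" for H
    using H proper_subgroupD(2)[OF H] unfolding proper_subgroup_def e[symmetric]
    by (intro cyclic_pgroup_proper[OF q(1) x ox]) simp_all
  have "cyc (x [^] q) \<noteq> carrier G"
  proof
    assume f: "cyc (x [^] q) = carrier G"
    have "k \<noteq> 0"
proof
      assume "k = 0"
      then have "order G = 1" using q(2) by simp
      then show False using proper_subgroupD(3)[OF A] card_subgroup_pos[OF proper_subgroupD(1)[OF A]] by simp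
    qed
    then obtain l where l: "k = Suc l" by (cases k) simp_all
    have "(x [^] q) [^] (q ^ l) = \<one>" using pow_ord_eq_1[OF x] ox l x by (simp add: nat_pow_pow)
    then have "ord (x [^] q) dvd q ^ l" using pow_eq_id[OF xq] by simp
    then have "q ^ k \<le> q ^ l" using f card_cyc[OF xq] q by (simp add: order_def dvd_imp_le prime_gt_0_nat)
    then show False using l prime_gt_1_nat[OF q(1)] by simp
  qed
  then have "proper_subgroup (cyc (x [^] q)) G" using cyc_subgroup[OF xq] by (simp add: proper_subgroup_def)
  then show False using not_carrier_if_in_proper[OF _ sub[OF A] sub[OF B]] AB by simp
qed

theorem theorem3p1:
  fixes G :: "('a, 'b) monoid_scheme"
  assumes "group G" and "finite (carrier G)" and "factorizable G"
  shows "induced_free (with_proj (star_graph 4)) (with_proj (factorization_graph G)) \<longleftrightarrow>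
      (\<exists>p q r :: nat. Factorial_Ring.prime p \<and> Factorial_Ring.prime q \<and> Factorial_Ring.prime r \<and>
          p \<noteq> q \<and> p \<noteq> r \<and> q \<noteq> r \<and> G \<cong> integer_mod_group (p * q * r))
    \<or> (\<exists>p :: nat. Factorial_Ring.prime p \<and> G \<cong> integer_mod_group p \<times>\<times> integer_mod_group p)
    \<or> G \<cong> quaternion_group
    \<or> G \<cong> integer_mod_group 4 \<times>\<times> integer_mod_group 2
    \<or> G \<cong> integer_mod_group 4 \<times>\<times> integer_mod_group 4
    \<or> (\<exists>p q m n :: nat. Factorial_Ring.prime p \<and> Factorial_Ring.prime q \<and> p \<noteq> q \<and>
          1 \<le> m \<and> m \<le> 3 \<and> 1 \<le> n \<and> n \<le> 3 \<and> G \<cong> integer_mod_group (p ^ m * q ^ n))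
    \<or> (\<exists>p :: nat. Factorial_Ring.prime p \<and> p > 2 \<and>
          (G \<cong> integer_mod_group p \<times>\<times> quaternion_group \<or>
           G \<cong> integer_mod_group p \<times>\<times> integer_mod_group 2 \<times>\<times> integer_mod_group 2))
    \<or> (\<exists>n :: nat. 1 \<le> n \<and> n \<le> 3 \<and> G \<cong> group_C3_C2pow n)"
    (is "?free \<longleftrightarrow> ?pqr \<or> ?pp \<or> ?q8 \<or> ?z42 \<or> ?z44 \<or> ?pq \<or> ?pT \<or> ?c3")
proof -
  interpret fin_group G using assms by (intro fin_groupI)
  have iff: "?free \<longleftrightarrow> star_free G" using star_free_if_induced_free induced_free_if_star_free by blast
  have forward: "?pqr \<or> ?pp \<or> ?q8 \<or> ?z42 \<or> ?z44 \<or> ?pq \<or> ?pT \<or> ?c3" if sf: "star_free G"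
  proof (cases "\<exists>(q::nat) k. Factorial_Ring.prime q \<and> order G = q ^ k")
    case True
    then obtain q k where q: "Factorial_Ring.prime (q::nat)" "order G = q ^ k" by blast
    show ?thesis using star_free_pgroup_cases[OF sf q factorizable_pgroup_not_cyclic[OF assms(3) q]] q(1) by blast
  next
    case False
    have "?pqr \<or> ?pq \<or> ?pT \<or> ?c3"
      by (rule star_free_nonpgroup_cases[OF sf assms(3)]) (use False in blast)
    then show ?thesis by blast
  qed
  have gZ: "group (integer_mod_group p \<times>\<times> integer_mod_group q)" for p q
    by (intro DirProd_group) simp_all
  have Zpp: "star_free (integer_mod_group p \<times>\<times> integer_mod_group p)" if p: "Factorial_Ring.prime (p::nat)" for p
  proof -
    have car: "carrier (integer_mod_group p \<times>\<times> integer_mod_group p) = {0..<int p} \<times> {0..<int p}"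
      using prime_gt_0_nat[OF p] by (simp add: carrier_integer_mod_group)
    interpret Z: fin_group "integer_mod_group p \<times>\<times> integer_mod_group p"
      using gZ by (rule fin_groupI) (simp only: car finite_cartesian_product finite_atLeastLessThan_int)
    show ?thesis by (rule Z.star_free_order_prime_square[OF p]) (unfold order_def car, simp)
  qed
  have pT: "star_free (integer_mod_group p \<times>\<times> quaternion_group)"
      "star_free (integer_mod_group p \<times>\<times> integer_mod_group 2 \<times>\<times> integer_mod_group 2)"
    if p: "Factorial_Ring.prime p" "p > 2" for p :: nat
  proof -
    have "odd p" using prime_odd_nat[OF p] .
    then have "coprime p (2 ^ l)" for l by simp
    from this[of 3] this[of 2] have cop: "coprime p 8" "coprime p 4" by simp_all
    have o: "order quaternion_group = 8" "order (integer_mod_group 2 \<times>\<times> integer_mod_group 2) = 4"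
      by (simp_all add: order_def quaternion_group_def carrier_integer_mod_group card_cartesian_product)
    show "star_free (integer_mod_group p \<times>\<times> quaternion_group)"
      by (rule star_free_prime_DirProd_small_core[OF p(1) small_core_quaternion]) (simp only: o cop)
    show "star_free (integer_mod_group p \<times>\<times> integer_mod_group 2 \<times>\<times> integer_mod_group 2)"
      by (rule star_free_prime_DirProd_small_core[OF p(1) small_core_Z2_Z2]) (simp only: o cop)
  qed
  have c3: "star_free (group_C3_C2pow n)" if n: "1 \<le> n" "n \<le> 3" for n
  proof -
    obtain a b where M: "metacyclic (group_C3_C2pow n) 3 (2 ^ n) 0 2 a b" using metacyclic_C3_C2pow[OF n(1)] by blast
    then have "order (group_C3_C2pow n) = 3 * 2 ^ n" by (simp add: metacyclic_def)
    then have "finite (carrier (group_C3_C2pow n))" unfolding order_def by (intro card_ge_0_finite) simp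
    moreover have "group (group_C3_C2pow n)" unfolding group_C3_C2pow_eq by (rule group_presented_group)
    ultimately interpret C: fin_group "group_C3_C2pow n" by (intro fin_groupI)
    show ?thesis by (rule C.star_free_C3_C2pow[OF M n])
  qed
  note transfer_back = star_free_iso[OF _ is_group iso_sym]
  have backward: "star_free G" if "?pqr \<or> ?pp \<or> ?q8 \<or> ?z42 \<or> ?z44 \<or> ?pq \<or> ?pT \<or> ?c3"
    using that
  proof (elim disjE exE conjE)
    fix p q r :: nat
    assume h: "Factorial_Ring.prime p" "Factorial_Ring.prime q" "Factorial_Ring.prime r" "p \<noteq> q" "p \<noteq> r" "q \<noteq> r"
      and i: "G \<cong> integer_mod_group (p * q * r)"
    show ?thesis by (rule transfer_back[OF _ i star_free_cyclic_pqr[OF h]]) simp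
  next
    fix p :: nat assume h: "Factorial_Ring.prime p" and i: "G \<cong> integer_mod_group p \<times>\<times> integer_mod_group p"
    show ?thesis by (rule transfer_back[OF gZ i Zpp[OF h]])
  next
    assume i: "G \<cong> quaternion_group"
    show ?thesis by (rule transfer_back[OF group_quaternion_group i small_core.star_free_small_core[OF small_core_quaternion]])
  next
    assume i: "G \<cong> integer_mod_group 4 \<times>\<times> integer_mod_group 2"
    show ?thesis by (rule transfer_back[OF gZ i star_free_Z4_DirProd]) simp
  next
    assume i: "G \<cong> integer_mod_group 4 \<times>\<times> integer_mod_group 4"
    show ?thesis by (rule transfer_back[OF gZ i star_free_Z4_DirProd]) simp
  next
    fix p q m n :: nat
    assume h: "Factorial_Ring.prime p" "Factorial_Ring.prime q" "p \<noteq> q" "m \<le> 3" "n \<le> 3"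
      and i: "G \<cong> integer_mod_group (p ^ m * q ^ n)"
    show ?thesis by (rule transfer_back[OF _ i star_free_cyclic_two_primes[OF h]]) simp
  next
    fix p :: nat assume h: "Factorial_Ring.prime p" "p > 2" and i: "G \<cong> integer_mod_group p \<times>\<times> quaternion_group"
    show ?thesis by (rule transfer_back[OF DirProd_group[OF group_integer_mod_group group_quaternion_group] i pT(1)[OF h]])
  next
    fix p :: nat assume h: "Factorial_Ring.prime p" "p > 2"
      and i: "G \<cong> integer_mod_group p \<times>\<times> integer_mod_group 2 \<times>\<times> integer_mod_group 2"
    show ?thesis by (rule transfer_back[OF DirProd_group[OF group_integer_mod_group gZ] i pT(2)[OF h]])
  next
    fix n :: nat assume h: "1 \<le> n" "n \<le> 3" and i: "G \<cong> group_C3_C2pow n"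
    show ?thesis by (rule transfer_back[OF _ i c3[OF h]]) (unfold group_C3_C2pow_eq, rule group_presented_group)
  qed
  show ?thesis unfolding iff using forward backward by (rule iffI)
qed

end
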